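(* Let $\mathbb{K}$ be a commutative ring with unit. There exists a unique isomorphism of graded operads $$\Lambda^{-1}\mathrm{MetabLie} \stackrel{\sim}{\longrightarrow} h^\bullet(\mathrm{NS})$$ that sends the Lie bracket to the generator $[12<1|2]$ of $h^1(\mathrm{NS}(2))$.
   Context: All finite sets are non-empty. A Lie algebra $\mathfrak{g}$ is metabelian if $[[a,b],[c,d]]=0$ for all $a,b,c,d\in\mathfrak{g}$. $\mathrm{MetabLie}$ is the $\mathbb{K}$-linear operad encoding metabelian Lie algebras: the quotient of the operad $\mathrm{Lie}$ by the operadic ideal generated by $[[x_1,x_2],[x_3,x_4]]$. The operadic desuspension is $(\Lambda^{-1}\mathcal{P})(n)=s^{n-1}\mathrm{sgn}_n\otimes\mathcal{P}(n)$ with $(sV)^\bullet=V^{\bullet-1}$, i.e. the arity-wise tensor product with the endomorphism operad of $\mathbb{K}$ placed in cohomological degree $-1$. Graded modules carry the Koszul sign symmetry. $\Pi(S)$ is the poset of partitions of $S$ with $\alpha\le\beta$ iff $\alpha$ is obtained by merging blocks of $\beta$. The non-singleton boolean poset $\mathrm{NS}(S)\subset\Pi(S)$ is the subposet of those partitions with at most one block of cardinality $\ge2$. $\mathrm{NS}(2)=\mathrm{NS}(\{1,2\})$ consists of the two partitions $12$ (one block) and $1|2$ (two blocks). For a finite poset $P$, $c^n(P)$ is the free $\mathbb{K}$-module on symbols $[x_0<\cdots<x_n]$ for chains with $x_0$ minimal and $x_n$ maximal in $P$, with $d[x_0<\cdots<x_n]=\sum_{i=1}^n(-1)^i\sum_{x_{i-1}<y<x_i}[\cdots<x_{i-1}<y<x_i<\cdots]$,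 and $h^\bullet(P)$ is its cohomology. Operad structure on $h^\bullet(\mathrm{NS}):S\mapsto h^\bullet(\mathrm{NS}(S))$. It is determined by the following partial compositions. For disjoint finite sets $A$, $B$, let $\pi\in\mathrm{NS}(A\sqcup B)$ be the partition with blocks $B$ and the singletons $\{a\}$, $a\in A$, and identify its set of blocks with $A\sqcup\{*\}$. Let $\varphi_\pi:\mathrm{NS}_{\le\pi}(A\sqcup B)\to\mathrm{NS}(A\sqcup\{*\})$ send a partition $\alpha\le\pi$ to the partition that it induces on the set of blocks of $\pi$, and let $\psi_\pi:\mathrm{NS}_{\ge\pi}(A\sqcup B)\to\mathrm{NS}(B)$ send $\beta$ to its restriction to $B$. Then $\circ_*:h^\bullet(\mathrm{NS}(A\sqcup\{*\}))\otimes h^\bullet(\mathrm{NS}(B))\to h^\bullet(\mathrm{NS}(A\sqcup B))$ is $\mu_\pi\circ(\varphi_\pi^*\otimes\psi_\pi^* )$, where $f^*[y_0<\cdots<y_n]=\sum_{f(x_i)=y_i}[x_0<\cdots<x_n]$ and $\mu_\pi([x_0<\cdots<x_m=\pi]\otimes[\pi=x_m<\cdots<x_{m+n}])=[x_0<\cdots<x_{m+n}]$. The unit is the generator of $h^0(\mathrm{NS}(\{s\}))=\mathbb{K}$. *)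

theory Defs
  imports
    "HOL-Algebra.Module"
    "HOL-Algebra.AbelCoset"
    "HOL-Algebra.Order"
    "HOL-Library.Poly_Mapping"
    "HOL-Library.Disjoint_Sets"
begin

section \<open>Modules over the ground ring\<close>

text \<open>
  The ground ring is a type of sort \<open>{comm_ring, comm_monoid_mult}\<close>: commutative with unit, and,
  unlike \<open>comm_ring_1\<close>, possibly zero.  Every type of class \<open>comm_ring_1\<close> has this sort.
\<close>

definition base_ring :: "'k::{comm_ring,comm_monoid_mult} ring" where
  "base_ring = \<lparr>carrier = UNIV, monoid.mult = (*), one = 1, ring.zero = 0, add = (+)\<rparr>"

text \<open>
  The fields \<open>mult\<close> and \<open>one\<close> of the record \<open>module\<close> are not used by the locale \<open>module\<close>;
  they are left undefined throughout.
\<close>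

definition linear_maps :: "('k,'a) module \<Rightarrow> ('k,'b) module \<Rightarrow> ('a \<Rightarrow> 'b) set" where
  "linear_maps M N = {f \<in> carrier M \<rightarrow> carrier N.
     (\<forall>x\<in>carrier M. \<forall>y\<in>carrier M. f (x \<oplus>\<^bsub>M\<^esub> y) = f x \<oplus>\<^bsub>N\<^esub> f y) \<and>
     (\<forall>k. \<forall>x\<in>carrier M. f (k \<odot>\<^bsub>M\<^esub> x) = k \<odot>\<^bsub>N\<^esub> f x)}"

definition quot_module :: "('k,'a) module \<Rightarrow> 'a set \<Rightarrow> ('k,'a set) module" where
  "quot_module M H =
     \<lparr>carrier = a_rcosets\<^bsub>M\<^esub> H, monoid.mult = undefined, one = undefined,
      ring.zero = H, add = set_add M,
      smult = (\<lambda>k C. \<Union>x\<in>C. H +>\<^bsub>M\<^esub> (k \<odot>\<^bsub>M\<^esub> x))\<rparr>"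

definition scale :: "'k::{comm_ring,comm_monoid_mult} \<Rightarrow> ('x \<Rightarrow>\<^sub>0 'k) \<Rightarrow> 'x \<Rightarrow>\<^sub>0 'k" where
  "scale k p = Poly_Mapping.map ((*) k) p"

definition free_module :: "'x set \<Rightarrow> ('k::{comm_ring,comm_monoid_mult}, 'x \<Rightarrow>\<^sub>0 'k) module" where
  "free_module X =
     \<lparr>carrier = {p. Poly_Mapping.keys p \<subseteq> X}, monoid.mult = undefined, one = undefined,
      ring.zero = 0, add = (+), smult = scale\<rparr>"

definition basis :: "'x \<Rightarrow> 'x \<Rightarrow>\<^sub>0 'k::{comm_ring,comm_monoid_mult}" where
  "basis x = Poly_Mapping.single x 1"

definition lin_ext ::
  "('x \<Rightarrow> 'y \<Rightarrow>\<^sub>0 'k) \<Rightarrow> ('x \<Rightarrow>\<^sub>0 'k::{comm_ring,comm_monoid_mult}) \<Rightarrow> 'y \<Rightarrow>\<^sub>0 'k" where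
  "lin_ext g p = (\<Sum>x\<in>Poly_Mapping.keys p. scale (Poly_Mapping.lookup p x) (g x))"

definition bilin_ext ::
  "('x \<Rightarrow> 'y \<Rightarrow> 'z \<Rightarrow>\<^sub>0 'k) \<Rightarrow>
   ('x \<Rightarrow>\<^sub>0 'k::{comm_ring,comm_monoid_mult}) \<Rightarrow> ('y \<Rightarrow>\<^sub>0 'k) \<Rightarrow> 'z \<Rightarrow>\<^sub>0 'k" where
  "bilin_ext g p q =
     (\<Sum>x\<in>Poly_Mapping.keys p. \<Sum>y\<in>Poly_Mapping.keys q.
        scale (Poly_Mapping.lookup p x * Poly_Mapping.lookup q y) (g x y))"

definition ksign :: "int \<Rightarrow> 'k::{comm_ring,comm_monoid_mult}" where
  "ksign n = (if even n then 1 else -1)"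


section \<open>Graded operads\<close>

text \<open>
  The finite sets indexing an operad are the finite non-empty sets of natural numbers.
  In a composition \<open>\<circ>\<^sub>s : P(S) \<otimes> P(T) \<rightarrow> P((S - {s}) \<union> T)\<close> the sets \<open>A = S - {s}\<close> and \<open>B = T\<close> have
  to be disjoint; \<open>s\<close> itself may belong to \<open>T\<close>, and \<open>A\<close> may be empty (as in the unit law).
\<close>

definition label_set :: "nat set \<Rightarrow> bool" where
  "label_set S \<longleftrightarrow> finite S \<and> S \<noteq> {}"

definition composable :: "nat set \<Rightarrow> nat \<Rightarrow> nat set \<Rightarrow> bool" where
  "composable S s T \<longleftrightarrow> label_set S \<and> label_set T \<and> s \<in> S \<and> (S - {s}) \<inter> T = {}"

definition plug :: "nat set \<Rightarrow> nat \<Rightarrow> nat set \<Rightarrow> nat set" where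
  "plug S s T = (S - {s}) \<union> T"

text \<open>
  \<open>comp_module P S d\<close> is the homogeneous part \<open>P(S)\<^sup>d\<close>.  \<open>relabel P \<sigma> S d\<close> is the map
  \<open>P(S)\<^sup>d \<rightarrow> P(\<sigma> ` S)\<^sup>d\<close> induced by a function \<open>\<sigma>\<close> that is injective on \<open>S\<close>, and
  \<open>pcomp P S s T d e\<close> is \<open>\<circ>\<^sub>s : P(S)\<^sup>d \<times> P(T)\<^sup>e \<rightarrow> P(plug S s T)\<^sup>d\<^sup>+\<^sup>e\<close>.
\<close>

record ('k,'a) gr_operad =
  comp_module :: "nat set \<Rightarrow> int \<Rightarrow> ('k,'a) module"
  relabel :: "(nat \<Rightarrow> nat) \<Rightarrow> nat set \<Rightarrow> int \<Rightarrow> 'a \<Rightarrow> 'a"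
  pcomp :: "nat set \<Rightarrow> nat \<Rightarrow> nat set \<Rightarrow> int \<Rightarrow> int \<Rightarrow> 'a \<Rightarrow> 'a \<Rightarrow> 'a"
  op_unit :: "nat \<Rightarrow> 'a"

locale graded_operad =
  fixes P :: "('k::{comm_ring,comm_monoid_mult},'a) gr_operad"
  assumes comp_module_module: "label_set S \<Longrightarrow> module base_ring (comp_module P S d)"
    and relabel_linear:
      "\<lbrakk>label_set S; inj_on \<sigma> S\<rbrakk> \<Longrightarrow>
       relabel P \<sigma> S d \<in> linear_maps (comp_module P S d) (comp_module P (\<sigma> ` S) d)"
    and relabel_cong:
      "\<lbrakk>label_set S; inj_on \<sigma> S; \<And>s. s \<in> S \<Longrightarrow> \<sigma> s = \<tau> s; x \<in> carrier (comp_module P S d)\<rbrakk> \<Longrightarrow>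
       relabel P \<sigma> S d x = relabel P \<tau> S d x"
    and relabel_id:
      "\<lbrakk>label_set S; x \<in> carrier (comp_module P S d)\<rbrakk> \<Longrightarrow> relabel P id S d x = x"
    and relabel_comp:
      "\<lbrakk>label_set S; inj_on \<sigma> S; inj_on \<tau> (\<sigma> ` S); x \<in> carrier (comp_module P S d)\<rbrakk> \<Longrightarrow>
       relabel P (\<tau> \<circ> \<sigma>) S d x = relabel P \<tau> (\<sigma> ` S) d (relabel P \<sigma> S d x)"
    and pcomp_linear_left:
      "\<lbrakk>composable S s T; y \<in> carrier (comp_module P T e)\<rbrakk> \<Longrightarrow>
       (\<lambda>x. pcomp P S s T d e x y)
         \<in> linear_maps (comp_module P S d) (comp_module P (plug S s T) (d + e))"
    and pcomp_linear_right:
      "\<lbrakk>composable S s T; x \<in> carrier (comp_module P S d)\<rbrakk> \<Longrightarrow>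
       (\<lambda>y. pcomp P S s T d e x y)
         \<in> linear_maps (comp_module P T e) (comp_module P (plug S s T) (d + e))"
    and pcomp_relabel:
      "\<lbrakk>composable S s T; inj_on \<sigma> S; inj_on \<tau> T; composable (\<sigma> ` S) (\<sigma> s) (\<tau> ` T);
        x \<in> carrier (comp_module P S d); y \<in> carrier (comp_module P T e)\<rbrakk> \<Longrightarrow>
       relabel P (\<lambda>a. if a \<in> T then \<tau> a else \<sigma> a) (plug S s T) (d + e) (pcomp P S s T d e x y) =
       pcomp P (\<sigma> ` S) (\<sigma> s) (\<tau> ` T) d e (relabel P \<sigma> S d x) (relabel P \<tau> T e y)"
    and op_unit_closed: "op_unit P s \<in> carrier (comp_module P {s} 0)"
    and relabel_op_unit: "relabel P \<sigma> {s} 0 (op_unit P s) = op_unit P (\<sigma> s)"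
    and op_unit_left:
      "\<lbrakk>label_set T; y \<in> carrier (comp_module P T e)\<rbrakk> \<Longrightarrow>
       pcomp P {s} s T 0 e (op_unit P s) y = y"
    and op_unit_right:
      "\<lbrakk>composable S s {t}; x \<in> carrier (comp_module P S d)\<rbrakk> \<Longrightarrow>
       pcomp P S s {t} d 0 x (op_unit P t) = relabel P (id(s := t)) S d x"
    and sequential_assoc:
      "\<lbrakk>composable S s T; composable T t R; (S - {s}) \<inter> R = {};
        x \<in> carrier (comp_module P S d); y \<in> carrier (comp_module P T e);
        z \<in> carrier (comp_module P R f)\<rbrakk> \<Longrightarrow>
       pcomp P (plug S s T) t R (d + e) f (pcomp P S s T d e x y) z =
       pcomp P S s (plug T t R) d (e + f) x (pcomp P T t R e f y z)"
    and parallel_assoc: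
      "\<lbrakk>composable S s T; composable S r R; s \<noteq> r; T \<inter> R = {};
        x \<in> carrier (comp_module P S d); y \<in> carrier (comp_module P T e);
        z \<in> carrier (comp_module P R f)\<rbrakk> \<Longrightarrow>
       pcomp P (plug S s T) r R (d + e) f (pcomp P S s T d e x y) z =
       ksign (e * f) \<odot>\<^bsub>comp_module P (plug (plug S s T) r R) (d + e + f)\<^esub>
       pcomp P (plug S r R) s T (d + f) e (pcomp P S r R d f x z) y"

definition operad_iso ::
  "('k::{comm_ring,comm_monoid_mult},'a) gr_operad \<Rightarrow> ('k,'b) gr_operad \<Rightarrow>
   (nat set \<Rightarrow> int \<Rightarrow> 'a \<Rightarrow> 'b) \<Rightarrow> bool" where
  "operad_iso P Q F \<longleftrightarrow>
     graded_operad P \<and> graded_operad Q \<and>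
     (\<forall>S d. label_set S \<longrightarrow>
        F S d \<in> linear_maps (comp_module P S d) (comp_module Q S d) \<and>
        bij_betw (F S d) (carrier (comp_module P S d)) (carrier (comp_module Q S d))) \<and>
     (\<forall>\<sigma> S d. \<forall>x\<in>carrier (comp_module P S d). label_set S \<longrightarrow> inj_on \<sigma> S \<longrightarrow>
        F (\<sigma> ` S) d (relabel P \<sigma> S d x) = relabel Q \<sigma> S d (F S d x)) \<and>
     (\<forall>S s T d e. \<forall>x\<in>carrier (comp_module P S d). \<forall>y\<in>carrier (comp_module P T e).
        composable S s T \<longrightarrow>
        F (plug S s T) (d + e) (pcomp P S s T d e x y) = pcomp Q S s T d e (F S d x) (F T e y)) \<and>
     (\<forall>s. F {s} 0 (op_unit P s) = op_unit Q s)"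


section \<open>Operadic ideals and quotients\<close>

definition operad_ideal ::
  "('k::{comm_ring,comm_monoid_mult},'a) gr_operad \<Rightarrow> (nat set \<Rightarrow> int \<Rightarrow> 'a set) \<Rightarrow> bool" where
  "operad_ideal P I \<longleftrightarrow>
     (\<forall>S d. label_set S \<longrightarrow> submodule (I S d) base_ring (comp_module P S d)) \<and>
     (\<forall>\<sigma> S d. \<forall>x\<in>I S d. label_set S \<longrightarrow> inj_on \<sigma> S \<longrightarrow> relabel P \<sigma> S d x \<in> I (\<sigma> ` S) d) \<and>
     (\<forall>S s T d e. \<forall>x\<in>I S d. \<forall>y\<in>carrier (comp_module P T e).
        composable S s T \<longrightarrow> pcomp P S s T d e x y \<in> I (plug S s T) (d + e)) \<and>
     (\<forall>S s T d e. \<forall>x\<in>carrier (comp_module P S d). \<forall>y\<in>I T e.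
        composable S s T \<longrightarrow> pcomp P S s T d e x y \<in> I (plug S s T) (d + e))"

text \<open>A generator \<open>(S, d, x)\<close> stands for the element \<open>x\<close> of \<open>P(S)\<^sup>d\<close>.\<close>

definition ideal_gen ::
  "('k::{comm_ring,comm_monoid_mult},'a) gr_operad \<Rightarrow> (nat set \<times> int \<times> 'a) set \<Rightarrow>
   nat set \<Rightarrow> int \<Rightarrow> 'a set" where
  "ideal_gen P G S d = \<Inter>{I S d | I. operad_ideal P I \<and> (\<forall>(T,e,x)\<in>G. x \<in> I T e)}"

definition quot_class ::
  "('k::{comm_ring,comm_monoid_mult},'a) gr_operad \<Rightarrow> (nat set \<times> int \<times> 'a) set \<Rightarrow>
   nat set \<Rightarrow> int \<Rightarrow> 'a \<Rightarrow> 'a set" where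
  "quot_class P G S d x = ideal_gen P G S d +>\<^bsub>comp_module P S d\<^esub> x"

definition operad_quot ::
  "('k::{comm_ring,comm_monoid_mult},'a) gr_operad \<Rightarrow> (nat set \<times> int \<times> 'a) set \<Rightarrow>
   ('k,'a set) gr_operad" where
  "operad_quot P G =
     \<lparr>comp_module = (\<lambda>S d. quot_module (comp_module P S d) (ideal_gen P G S d)),
      relabel = (\<lambda>\<sigma> S d C. \<Union>x\<in>C. quot_class P G (\<sigma> ` S) d (relabel P \<sigma> S d x)),
      pcomp = (\<lambda>S s T d e C D. \<Union>x\<in>C. \<Union>y\<in>D.
        quot_class P G (plug S s T) (d + e) (pcomp P S s T d e x y)),
      op_unit = (\<lambda>s. quot_class P G {s} 0 (op_unit P s))\<rparr>"


section \<open>The operads Lie and MetabLie\<close>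

datatype 'l ltree = Leaf 'l | Br "'l ltree" "'l ltree"

primrec leaves :: "'l ltree \<Rightarrow> 'l list" where
  "leaves (Leaf a) = [a]"
| "leaves (Br t u) = leaves t @ leaves u"

definition ltrees :: "'l set \<Rightarrow> 'l ltree set" where
  "ltrees S = {t. distinct (leaves t) \<and> set (leaves t) = S}"

primrec graft :: "'l \<Rightarrow> 'l ltree \<Rightarrow> 'l ltree \<Rightarrow> 'l ltree" where
  "graft s (Leaf a) u = (if a = s then u else Leaf a)"
| "graft s (Br t t') u = Br (graft s t u) (graft s t' u)"

text \<open>
  The free operad on one binary operation of degree 0 without symmetry, written \<open>Br\<close>.
  The operad \<open>Lie\<close> is its quotient by antisymmetry and the Jacobi identity.
\<close>

definition Mag :: "('k::{comm_ring,comm_monoid_mult}, nat ltree \<Rightarrow>\<^sub>0 'k) gr_operad" where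
  "Mag =
     \<lparr>comp_module = (\<lambda>S d. free_module (if d = 0 then ltrees S else {})),
      relabel = (\<lambda>\<sigma> S d. lin_ext (\<lambda>t. basis (map_ltree \<sigma> t))),
      pcomp = (\<lambda>S s T d e. bilin_ext (\<lambda>t u. basis (graft s t u))),
      op_unit = (\<lambda>s. basis (Leaf s))\<rparr>"

definition lie_relations ::
  "(nat set \<times> int \<times> (nat ltree \<Rightarrow>\<^sub>0 'k::{comm_ring,comm_monoid_mult})) set" where
  "lie_relations =
     {({1,2}, 0, basis (Br (Leaf 1) (Leaf 2)) + basis (Br (Leaf 2) (Leaf 1))),
      ({1,2,3}, 0, basis (Br (Leaf 1) (Br (Leaf 2) (Leaf 3)))
                 + basis (Br (Leaf 2) (Br (Leaf 3) (Leaf 1)))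
                 + basis (Br (Leaf 3) (Br (Leaf 1) (Leaf 2))))}"

definition Lie :: "('k::{comm_ring,comm_monoid_mult}, (nat ltree \<Rightarrow>\<^sub>0 'k) set) gr_operad" where
  "Lie = operad_quot Mag lie_relations"

definition lie_monomial ::
  "nat ltree \<Rightarrow> (nat ltree \<Rightarrow>\<^sub>0 'k::{comm_ring,comm_monoid_mult}) set" where
  "lie_monomial t = quot_class Mag lie_relations (set (leaves t)) 0 (basis t)"

definition metab_relations ::
  "(nat set \<times> int \<times> (nat ltree \<Rightarrow>\<^sub>0 'k::{comm_ring,comm_monoid_mult}) set) set" where
  "metab_relations =
     {({1,2,3,4}, 0, lie_monomial (Br (Br (Leaf 1) (Leaf 2)) (Br (Leaf 3) (Leaf 4))))}"

definition MetabLie ::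
  "('k::{comm_ring,comm_monoid_mult}, (nat ltree \<Rightarrow>\<^sub>0 'k) set set) gr_operad" where
  "MetabLie = operad_quot Lie metab_relations"

definition metab_bracket ::
  "(nat ltree \<Rightarrow>\<^sub>0 'k::{comm_ring,comm_monoid_mult}) set set" where
  "metab_bracket = quot_class Lie metab_relations {1,2} 0 (lie_monomial (Br (Leaf 1) (Leaf 2)))"


section \<open>Operadic desuspension\<close>

text \<open>
  Let \<open>V = K e\<close> with \<open>e\<close> of degree -1.  For a finite set \<open>S = {s\<^sub>1 < \<dots> < s\<^sub>m}\<close> of naturals,
  \<open>End\<^sub>V(S) = Hom(\<Otimes>\<^sub>S V, V)\<close> is free on \<open>\<epsilon>\<^sub>S\<close>, of degree \<open>m - 1\<close>, which sends \<open>e \<otimes> \<dots> \<otimes> e\<close>, with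
  factors in the order \<open>s\<^sub>1, \<dots>, s\<^sub>m\<close>, to \<open>e\<close>.  An element \<open>\<epsilon>\<^sub>S \<otimes> p\<close> of
  \<open>End\<^sub>V(S) \<otimes> P(S)\<close> is represented by \<open>p\<close>.

  Since \<open>e\<close> is odd, reordering factors gives the sign of the permutation: \<open>\<sigma> : S \<rightarrow> \<sigma> ` S\<close> acts by
  \<open>\<epsilon>\<^sub>S \<mapsto> \<plusminus>\<epsilon>\<^bsub>\<sigma> ` S\<^esub>\<close> with the sign given by the inversions of \<open>\<sigma>\<close>.  In \<open>\<epsilon>\<^sub>S \<circ>\<^sub>s \<epsilon>\<^sub>T\<close>, moving \<open>\<epsilon>\<^sub>T\<close> (of
  degree \<open>|T| - 1\<close>) past the factors \<open>e\<close> labelled by elements of \<open>S\<close> below \<open>s\<close> gives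
  \<open>(-1)\<close> to the power \<open>|{a \<in> S. a < s}| (|T| - 1)\<close>, and the word obtained from
  \<open>s\<^sub>1 \<dots> s\<^sub>m\<close> by replacing \<open>s\<close> with the increasing word of \<open>T\<close> must be sorted, which contributes
  its inversions.
\<close>

definition relabel_exponent :: "(nat \<Rightarrow> nat) \<Rightarrow> nat set \<Rightarrow> int" where
  "relabel_exponent \<sigma> S = int (card {(a,b). a \<in> S \<and> b \<in> S \<and> a < b \<and> \<sigma> b < \<sigma> a})"

definition pcomp_exponent :: "nat set \<Rightarrow> nat \<Rightarrow> nat set \<Rightarrow> int" where
  "pcomp_exponent S s T =
     int (card {a\<in>S. a < s}) * (int (card T) - 1) +
     int (card {(a,t). a \<in> S - {s} \<and> t \<in> T \<and> (a < s \<and> t < a \<or> s < a \<and> a < t)})"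

text \<open>
  The last summand in the exponent for \<open>pcomp\<close> below is the Koszul sign of
  \<open>(\<epsilon>\<^sub>S \<otimes> x) \<circ>\<^sub>s (\<epsilon>\<^sub>T \<otimes> y) = (-1)\<^bsup>|x||\<epsilon>\<^sub>T|\<^esup> (\<epsilon>\<^sub>S \<circ>\<^sub>s \<epsilon>\<^sub>T) \<otimes> (x \<circ>\<^sub>s y)\<close>.
\<close>

definition desuspension ::
  "('k::{comm_ring,comm_monoid_mult},'a) gr_operad \<Rightarrow> ('k,'a) gr_operad" where
  "desuspension P =
     (let sh = (\<lambda>S d. d - (int (card S) - 1)) in
     \<lparr>comp_module = (\<lambda>S d. comp_module P S (sh S d)),
      relabel = (\<lambda>\<sigma> S d x.
        ksign (relabel_exponent \<sigma> S) \<odot>\<^bsub>comp_module P (\<sigma> ` S) (sh S d)\<^esub>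
        relabel P \<sigma> S (sh S d) x),
      pcomp = (\<lambda>S s T d e x y.
        ksign (pcomp_exponent S s T + sh S d * (int (card T) - 1))
          \<odot>\<^bsub>comp_module P (plug S s T) (sh S d + sh T e)\<^esub>
        pcomp P S s T (sh S d) (sh T e) x y),
      op_unit = op_unit P\<rparr>)"


section \<open>Cohomology of finite posets\<close>

definition chains :: "'x gorder \<Rightarrow> int \<Rightarrow> 'x list set" where
  "chains L n = {xs. xs \<noteq> [] \<and> int (length xs) = n + 1 \<and> set xs \<subseteq> carrier L \<and>
     sorted_wrt (lless L) xs \<and>
     (\<forall>y\<in>carrier L. \<not> y \<sqsubset>\<^bsub>L\<^esub> hd xs) \<and> (\<forall>y\<in>carrier L. \<not> last xs \<sqsubset>\<^bsub>L\<^esub> y)}"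

definition cochains ::
  "'x gorder \<Rightarrow> int \<Rightarrow> ('k::{comm_ring,comm_monoid_mult}, 'x list \<Rightarrow>\<^sub>0 'k) module" where
  "cochains L n = free_module (chains L n)"

definition coboundary ::
  "'x gorder \<Rightarrow> ('x list \<Rightarrow>\<^sub>0 'k) \<Rightarrow> 'x list \<Rightarrow>\<^sub>0 'k::{comm_ring,comm_monoid_mult}" where
  "coboundary L = lin_ext (\<lambda>xs. \<Sum>i = 1..<length xs. scale (ksign (int i))
     (\<Sum>y | y \<in> carrier L \<and> xs ! (i - 1) \<sqsubset>\<^bsub>L\<^esub> y \<and> y \<sqsubset>\<^bsub>L\<^esub> xs ! i.
        basis (take i xs @ y # drop i xs)))"

definition cocycles ::
  "'x gorder \<Rightarrow> int \<Rightarrow> ('k::{comm_ring,comm_monoid_mult}, 'x list \<Rightarrow>\<^sub>0 'k) module" where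
  "cocycles L n =
     (cochains L n)\<lparr>carrier := {p \<in> carrier (cochains L n). coboundary L p = 0}\<rparr>"

definition coboundaries ::
  "'x gorder \<Rightarrow> int \<Rightarrow> ('x list \<Rightarrow>\<^sub>0 'k::{comm_ring,comm_monoid_mult}) set" where
  "coboundaries L n = coboundary L ` carrier (cochains L (n - 1))"

definition cohomology ::
  "'x gorder \<Rightarrow> int \<Rightarrow> ('k::{comm_ring,comm_monoid_mult}, ('x list \<Rightarrow>\<^sub>0 'k) set) module" where
  "cohomology L n = quot_module (cocycles L n) (coboundaries L n)"

definition coh_class ::
  "'x gorder \<Rightarrow> int \<Rightarrow> ('x list \<Rightarrow>\<^sub>0 'k) \<Rightarrow> ('x list \<Rightarrow>\<^sub>0 'k::{comm_ring,comm_monoid_mult}) set" where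
  "coh_class L n z = coboundaries L n +>\<^bsub>cocycles L n\<^esub> z"

text \<open>\<open>pullback L f\<close> is \<open>f\<^sup>*\<close> for a map \<open>f\<close> with domain the poset \<open>L\<close>.\<close>

definition pullback ::
  "'x gorder \<Rightarrow> ('x \<Rightarrow> 'y) \<Rightarrow> ('y list \<Rightarrow>\<^sub>0 'k) \<Rightarrow> 'x list \<Rightarrow>\<^sub>0 'k::{comm_ring,comm_monoid_mult}" where
  "pullback L f = lin_ext (\<lambda>ys.
     \<Sum>xs | xs \<in> chains L (int (length ys) - 1) \<and> map f xs = ys. basis xs)"


section \<open>The operad of the non-singleton boolean posets\<close>

text \<open>
  The smaller partition is the coarser one, so \<open>\<alpha> \<le> \<beta>\<close> iff \<open>\<beta>\<close> refines \<open>\<alpha>\<close>; in particular the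
  one-block partition is the least element.
\<close>

definition NS :: "nat set \<Rightarrow> nat set set gorder" where
  "NS S = \<lparr>carrier = {\<alpha>. partition_on S \<alpha> \<and> card {B\<in>\<alpha>. 2 \<le> card B} \<le> 1},
           eq = (=), le = (\<lambda>\<alpha> \<beta>. refines S \<beta> \<alpha>)\<rparr>"

text \<open>
  For \<open>A = S - {s}\<close> and \<open>B = T\<close>, \<open>plug_part S s T\<close> is the partition \<open>\<pi>\<close>.  Its set of blocks is
  identified with \<open>S\<close> (the set \<open>A \<squnion> {*}\<close> with \<open>* = s\<close>) by \<open>plug_block s T\<close>, and \<open>\<phi>\<^sub>\<pi>\<close>, \<open>\<psi>\<^sub>\<pi>\<close> are
  \<open>induced_part\<close> and \<open>restrict_part\<close>.
\<close>

definition plug_block :: "nat \<Rightarrow> nat set \<Rightarrow> nat \<Rightarrow> nat set" where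
  "plug_block s T a = (if a = s then T else {a})"

definition plug_part :: "nat set \<Rightarrow> nat \<Rightarrow> nat set \<Rightarrow> nat set set" where
  "plug_part S s T = plug_block s T ` S"

definition induced_part :: "nat set \<Rightarrow> nat \<Rightarrow> nat set \<Rightarrow> nat set set \<Rightarrow> nat set set" where
  "induced_part S s T \<alpha> = (\<lambda>X. {a\<in>S. plug_block s T a \<subseteq> X}) ` \<alpha>"

definition restrict_part :: "nat set \<Rightarrow> nat set set \<Rightarrow> nat set set" where
  "restrict_part T \<beta> = (\<lambda>X. X \<inter> T) ` \<beta> - {{}}"

definition NS_below :: "nat set \<Rightarrow> nat \<Rightarrow> nat set \<Rightarrow> nat set set gorder" where
  "NS_below S s T = (NS (plug S s T))
     \<lparr>carrier := {\<alpha> \<in> carrier (NS (plug S s T)). \<alpha> \<sqsubseteq>\<^bsub>NS (plug S s T)\<^esub> plug_part S s T}\<rparr>"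

definition NS_above :: "nat set \<Rightarrow> nat \<Rightarrow> nat set \<Rightarrow> nat set set gorder" where
  "NS_above S s T = (NS (plug S s T))
     \<lparr>carrier := {\<beta> \<in> carrier (NS (plug S s T)). plug_part S s T \<sqsubseteq>\<^bsub>NS (plug S s T)\<^esub> \<beta>}\<rparr>"

definition concat_chains ::
  "('x list \<Rightarrow>\<^sub>0 'k) \<Rightarrow> ('x list \<Rightarrow>\<^sub>0 'k) \<Rightarrow> 'x list \<Rightarrow>\<^sub>0 'k::{comm_ring,comm_monoid_mult}" where
  "concat_chains = bilin_ext (\<lambda>xs ys. basis (xs @ tl ys))"

definition NS_pcomp ::
  "nat set \<Rightarrow> nat \<Rightarrow> nat set \<Rightarrow> (nat set set list \<Rightarrow>\<^sub>0 'k) \<Rightarrow> (nat set set list \<Rightarrow>\<^sub>0 'k) \<Rightarrow>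
   nat set set list \<Rightarrow>\<^sub>0 'k::{comm_ring,comm_monoid_mult}" where
  "NS_pcomp S s T x y =
     concat_chains (pullback (NS_below S s T) (induced_part S s T) x)
                   (pullback (NS_above S s T) (restrict_part T) y)"

definition hNS ::
  "('k::{comm_ring,comm_monoid_mult}, (nat set set list \<Rightarrow>\<^sub>0 'k) set) gr_operad" where
  "hNS =
     \<lparr>comp_module = (\<lambda>S d. cohomology (NS S) d),
      relabel = (\<lambda>\<sigma> S d C. \<Union>z\<in>C.
        coh_class (NS (\<sigma> ` S)) d (lin_ext (\<lambda>xs. basis (map ((`) ((`) \<sigma>)) xs)) z)),
      pcomp = (\<lambda>S s T d e C D. \<Union>x\<in>C. \<Union>y\<in>D.
        coh_class (NS (plug S s T)) (d + e) (NS_pcomp S s T x y)),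
      op_unit = (\<lambda>s. coh_class (NS {s}) 0 (basis [{{s}}]))\<rparr>"

definition hNS_generator ::
  "(nat set set list \<Rightarrow>\<^sub>0 'k::{comm_ring,comm_monoid_mult}) set" where
  "hNS_generator = coh_class (NS {1,2}) 1 (basis [{{1,2}}, {{1},{2}}])"

end

(*
  Both operads are identified with the desuspension of an explicit operad whose component at S is
  the module of vectors in K^S with coordinate sum 0 (all of K for a singleton), in degree 0.

  In a metabelian Lie algebra the left-normed brackets [a1, [a2, ... [b, c]]] are symmetric in
  a1, a2, ..., so the Jacobi identity makes them depend only on c - b: this identifies MetabLie.

  A partition in NS(S) is given by its big block, so chains in NS(S) are chains of subsets of S
  without singletons, from S down to the empty set.  An acyclic matching shows that a cocycle is
  cohomologous to a combination of critical chains, all of which are maximal and indexed by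
  S - {min S}.  A maximal chain comes from two words in the letters of S, which differ by the order
  of the last two letters.  The signed sum of the values of a cocycle over the words that end in v
  gives the coordinate at v; swapping adjacent letters shows that the coordinate sum vanishes and
  that coboundaries are mapped to 0, and the signs are those of the desuspension.

  Uniqueness holds because both operads are generated by the bracket.
*)
theory Submission
  imports Defs
begin

section \<open>Modules and their quotients\<close>

text \<open>Checking the operad axioms of \<open>MetabLie\<close> and \<open>hNS\<close> on
  representatives would be laborious. So quotients are formed of structures of which only the
  operations and their linearity are known (\<open>pre_operad\<close>), and the axioms are pulled
  back along the injective maps to the explicit operad. In the same spirit, the coboundaries form an
  operadic ideal because they are the kernel of a homomorphism.

  Every identity between signs of the desuspension becomes a comparison of inversion numbers of a
  few words. One discrepancy remains: a word of the composite lists \<open>S - {s}\<close> before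
  \<open>T\<close>, as if \<open>s\<close> stood last, which costs a sign of exponent
  \<open>(|S| - 1)(|T| - 1)\<close>. Since
  \<open>(m + n choose 2) = (m choose 2) + (n choose 2) + m n\<close>, rescaling arity
  \<open>m + 1\<close> by the sign of exponent \<open>m choose 2\<close> removes it.

  The ground ring is arbitrary, and 2 may be a zero divisor. Hence sums that vanish are split into
  explicit cancelling pairs, and independence is read off from coordinates: the normal forms based
  at a letter \<open>m\<close> evaluate to \<open>e_b - e_m\<close>.\<close>

lemma base_ring_simps [simp]:
  "carrier base_ring = UNIV" "x \<otimes>\<^bsub>base_ring\<^esub> y = x * y" "\<one>\<^bsub>base_ring\<^esub> = 1"
  "\<zero>\<^bsub>base_ring\<^esub> = 0" "x \<oplus>\<^bsub>base_ring\<^esub> y = x + y"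
  by (auto simp: base_ring_def)

lemma cring_base_ring: "cring (base_ring :: 'k::{comm_ring,comm_monoid_mult} ring)"
proof (rule cringI)
  show "abelian_group (base_ring :: 'k ring)"
    by (rule abelian_groupI) (auto simp: algebra_simps intro: exI[of _ "- _"])
  show "comm_monoid (base_ring :: 'k ring)"
    by (rule comm_monoidI) (auto simp: algebra_simps)
qed (auto simp: algebra_simps)

lemma ksign_mult: "ksign m * ksign n = (ksign (m + n) :: 'k::{comm_ring,comm_monoid_mult})"
  by (auto simp: ksign_def)

lemma ksign_0 [simp]: "ksign 0 = 1"
  by (simp add: ksign_def)

lemma ksign_cong: "even (m + n) \<Longrightarrow> ksign m = ksign n"
  by (auto simp: ksign_def)

lemma ksign_square [simp]: "ksign n * ksign n = (1 :: 'k::{comm_ring,comm_monoid_mult})"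
  by (simp add: ksign_def)

lemma ksign_cancel [simp]: "ksign n * (ksign n * x) = (x :: 'k::{comm_ring,comm_monoid_mult})"
  by (simp add: ksign_def)

lemma ksign_eq_0_iff: "ksign n * x = 0 \<longleftrightarrow> (x :: 'k::{comm_ring,comm_monoid_mult}) = 0"
  by (simp add: ksign_def)

lemma linear_mapsD:
  assumes "f \<in> linear_maps M N"
  shows "x \<in> carrier M \<Longrightarrow> f x \<in> carrier N"
    and "x \<in> carrier M \<Longrightarrow> y \<in> carrier M \<Longrightarrow> f (x \<oplus>\<^bsub>M\<^esub> y) = f x \<oplus>\<^bsub>N\<^esub> f y"
    and "x \<in> carrier M \<Longrightarrow> f (k \<odot>\<^bsub>M\<^esub> x) = k \<odot>\<^bsub>N\<^esub> f x"
  using assms by (auto simp: linear_maps_def)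

lemma linear_mapsI:
  assumes "\<And>x. x \<in> carrier M \<Longrightarrow> f x \<in> carrier N"
    and "\<And>x y. x \<in> carrier M \<Longrightarrow> y \<in> carrier M \<Longrightarrow> f (x \<oplus>\<^bsub>M\<^esub> y) = f x \<oplus>\<^bsub>N\<^esub> f y"
    and "\<And>k x. x \<in> carrier M \<Longrightarrow> f (k \<odot>\<^bsub>M\<^esub> x) = k \<odot>\<^bsub>N\<^esub> f x"
  shows "f \<in> linear_maps M N"
  using assms by (auto simp: linear_maps_def)

lemma linear_maps_compose:
  assumes "f \<in> linear_maps L M" "g \<in> linear_maps M N"
  shows "(\<lambda>x. g (f x)) \<in> linear_maps L N"
  using assms by (auto simp: linear_maps_def Pi_iff)

lemma linear_maps_cong:
  assumes "f \<in> linear_maps M N" "\<And>x. x \<in> carrier M \<Longrightarrow> g x = f x"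
    and "module base_ring M"
  shows "g \<in> linear_maps M N"
proof -
  interpret module base_ring M by fact
  show ?thesis using assms(1,2) by (auto simp: linear_maps_def Pi_iff)
qed

lemma linear_maps_zero:
  assumes "f \<in> linear_maps M N" "module base_ring M" "module base_ring N"
  shows "f \<zero>\<^bsub>M\<^esub> = \<zero>\<^bsub>N\<^esub>"
proof -
  interpret M: module base_ring M by fact
  interpret N: module base_ring N by fact
  have "f (0 \<odot>\<^bsub>M\<^esub> \<zero>\<^bsub>M\<^esub>) = 0 \<odot>\<^bsub>N\<^esub> f \<zero>\<^bsub>M\<^esub>"
    by (rule linear_mapsD(3)[OF assms(1)]) simp
  then show ?thesis
    using M.smult_l_null[of "\<zero>\<^bsub>M\<^esub>"] N.smult_l_null[of "f \<zero>\<^bsub>M\<^esub>"]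
      linear_mapsD(1)[OF assms(1), of "\<zero>\<^bsub>M\<^esub>"] by simp
qed

lemma linear_maps_uminus:
  assumes "f \<in> linear_maps M N" "module base_ring M" "module base_ring N" "x \<in> carrier M"
  shows "f (\<ominus>\<^bsub>M\<^esub> x) = \<ominus>\<^bsub>N\<^esub> f x"
proof -
  interpret M: module base_ring M by fact
  interpret N: module base_ring N by fact
  note f = linear_mapsD[OF assms(1)]
  have "f (\<ominus>\<^bsub>M\<^esub> x) \<oplus>\<^bsub>N\<^esub> f x = f (\<ominus>\<^bsub>M\<^esub> x \<oplus>\<^bsub>M\<^esub> x)"
    by (simp add: f assms(4))
  also have "\<dots> = \<zero>\<^bsub>N\<^esub>"
    using linear_maps_zero[OF assms(1-3)] by (simp add: M.l_neg assms(4))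
  finally show ?thesis
    using N.minus_equality[of "f (\<ominus>\<^bsub>M\<^esub> x)" "f x"] f(1) assms(4) by simp
qed

lemma linear_maps_minus:
  assumes "f \<in> linear_maps M N" "module base_ring M" "module base_ring N"
    "x \<in> carrier M" "y \<in> carrier M"
  shows "f (x \<ominus>\<^bsub>M\<^esub> y) = f x \<ominus>\<^bsub>N\<^esub> f y"
proof -
  interpret M: module base_ring M by fact
  show ?thesis
    using linear_mapsD(2)[OF assms(1), of x "\<ominus>\<^bsub>M\<^esub> y"] linear_maps_uminus[OF assms(1-3,5)] assms(4,5)
    by (simp add: a_minus_def)
qed

lemma (in abelian_group) minus_eq_zero_iff:
  assumes "x \<in> carrier G" "y \<in> carrier G"
  shows "x \<ominus> y = \<zero> \<longleftrightarrow> x = y"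
proof
  assume "x \<ominus> y = \<zero>"
  then have "(x \<ominus> y) \<oplus> y = y" using assms by simp
  then show "x = y" using assms by (simp add: a_minus_def a_assoc l_neg)
qed (use assms in \<open>simp add: a_minus_def r_neg\<close>)

text \<open>The module axioms pass to the image of a surjection that respects the operations;
  negatives are images of negatives. \<open>linear_maps\<close> says nothing about zero, so its
  image is assumed: this ties the field \<open>\<zero>\<close> of \<open>N\<close> to the rest of
  the structure.\<close>

lemma module_surj_image:
  assumes M: "module base_ring M" and f: "f \<in> linear_maps M N"
    and surj: "carrier N = f ` carrier M" and zero: "f \<zero>\<^bsub>M\<^esub> = \<zero>\<^bsub>N\<^esub>"
  shows "module base_ring N"
proof -
  interpret M: module base_ring M by fact
  note fs = linear_mapsD(2,3)[OF f, symmetric]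
  show ?thesis
  proof (rule moduleI)
    show "abelian_group N"
    proof (rule abelian_groupI)
      show "\<zero>\<^bsub>N\<^esub> \<in> carrier N" using zero surj by (metis M.zero_closed image_eqI)
      fix x assume "x \<in> carrier N"
      then obtain a where a: "a \<in> carrier M" "x = f a" using surj by auto
      have "f (\<ominus>\<^bsub>M\<^esub> a) \<oplus>\<^bsub>N\<^esub> f a = \<zero>\<^bsub>N\<^esub>"
        using a zero by (simp add: fs M.l_neg)
      then show "\<exists>y\<in>carrier N. y \<oplus>\<^bsub>N\<^esub> x = \<zero>\<^bsub>N\<^esub>" using a surj by auto
    qed (auto simp: surj fs zero[symmetric] M.a_ac)
  qed (auto simp: surj fs cring_base_ring M.smult_assoc1 M.smult_l_distr M.smult_r_distr
      M.smult_closed[simplified] simp flip: base_ring_simps)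
qed

lemma submodule_abelian_subgroup:
  assumes "module base_ring M" "submodule H base_ring M"
  shows "abelian_subgroup H M"
  using assms unfolding module_def submodule_def
  by (intro abelian_subgroupI3 additive_subgroup.intro) auto

locale module_quotient =
  M: module base_ring M + H: submodule H base_ring M
  for M :: "('k::{comm_ring,comm_monoid_mult},'a) module" and H
begin

sublocale Q: abelian_subgroup H M
  using submodule_abelian_subgroup M.module_axioms H.submodule_axioms by blast

lemma class_eq_iff:
  assumes "x \<in> carrier M" "y \<in> carrier M"
  shows "H +>\<^bsub>M\<^esub> x = H +>\<^bsub>M\<^esub> y \<longleftrightarrow> x \<ominus>\<^bsub>M\<^esub> y \<in> H"
  using Q.a_rcos_module[OF assms(2,1)] Q.a_repr_independence'[OF _ assms(2), of x]
    Q.a_repr_independenceD[OF assms(1), of y]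
  by (auto simp: a_minus_def)

lemma class_eq_self_iff:
  assumes "x \<in> carrier M"
  shows "H +>\<^bsub>M\<^esub> x = H \<longleftrightarrow> x \<in> H"
  using Q.a_rcos_self[OF assms] Q.a_rcos_const[of x] by auto

lemma mem_classD:
  assumes "x \<in> carrier M" "y \<in> H +>\<^bsub>M\<^esub> x"
  shows "y \<in> carrier M" "H +>\<^bsub>M\<^esub> y = H +>\<^bsub>M\<^esub> x"
  using assms Q.a_repr_independence' Q.a_elemrcos_carrier by auto

lemma self_mem_class: "x \<in> carrier M \<Longrightarrow> x \<in> H +>\<^bsub>M\<^esub> x"
  by (rule Q.a_rcos_self)

text \<open>The operations of a quotient are defined as unions over all representatives. A coset is
  non-empty, so the union collapses as soon as all representatives give the same set. The hypothesis
  speaks of differences in \<open>H\<close> because this is the form in which an ideal delivers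
  it.\<close>

lemma UN_class:
  assumes "x \<in> carrier M" "\<And>y. y \<in> carrier M \<Longrightarrow> y \<ominus>\<^bsub>M\<^esub> x \<in> H \<Longrightarrow> G y = G x"
  shows "(\<Union>y\<in>H +>\<^bsub>M\<^esub> x. G y) = G x"
proof -
  have "G y = G x" if "y \<in> H +>\<^bsub>M\<^esub> x" for y
    using mem_classD[OF assms(1) that] class_eq_iff[of y x] assms by auto
  then show ?thesis using self_mem_class[OF assms(1)] by blast
qed

lemma quot_carrier: "carrier (quot_module M H) = (\<lambda>x. H +>\<^bsub>M\<^esub> x) ` carrier M"
  by (auto simp: quot_module_def A_RCOSETS_def')

lemma quot_zero: "\<zero>\<^bsub>quot_module M H\<^esub> = H"
  by (simp add: quot_module_def)

lemma quot_add:
  "x \<in> carrier M \<Longrightarrow> y \<in> carrier M \<Longrightarrow>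
   (H +>\<^bsub>M\<^esub> x) \<oplus>\<^bsub>quot_module M H\<^esub> (H +>\<^bsub>M\<^esub> y) = H +>\<^bsub>M\<^esub> (x \<oplus>\<^bsub>M\<^esub> y)"
  by (simp add: quot_module_def Q.a_rcos_sum)

lemma smult_minus:
  assumes "x \<in> carrier M" "y \<in> carrier M"
  shows "k \<odot>\<^bsub>M\<^esub> x \<ominus>\<^bsub>M\<^esub> k \<odot>\<^bsub>M\<^esub> y = k \<odot>\<^bsub>M\<^esub> (x \<ominus>\<^bsub>M\<^esub> y)"
  using assms M.smult_r_distr[of k x "\<ominus>\<^bsub>M\<^esub> y"] M.smult_r_minus[of k y] by (simp add: a_minus_def)

lemma quot_smult:
  assumes "x \<in> carrier M"
  shows "k \<odot>\<^bsub>quot_module M H\<^esub> (H +>\<^bsub>M\<^esub> x) = H +>\<^bsub>M\<^esub> (k \<odot>\<^bsub>M\<^esub> x)"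
proof -
  have "(\<Union>y\<in>H +>\<^bsub>M\<^esub> x. H +>\<^bsub>M\<^esub> (k \<odot>\<^bsub>M\<^esub> y)) = H +>\<^bsub>M\<^esub> (k \<odot>\<^bsub>M\<^esub> x)"
    by (rule UN_class) (use assms in \<open>auto simp: class_eq_iff smult_minus intro!: H.smult_closed\<close>)
  then show ?thesis by (simp add: quot_module_def)
qed

lemma class_linear: "(\<lambda>x. H +>\<^bsub>M\<^esub> x) \<in> linear_maps M (quot_module M H)"
  by (rule linear_mapsI) (auto simp: quot_carrier quot_add quot_smult)

lemma quot_module_module: "module base_ring (quot_module M H)"
  using M.module_axioms class_linear
  by (rule module_surj_image) (auto simp: quot_carrier quot_zero class_eq_self_iff)

end


section \<open>Quotients of operads\<close>

text \<open>The part of the structure of a graded operad that suffices to form quotients by ideals.\<close>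

locale pre_operad =
  fixes P :: "('k::{comm_ring,comm_monoid_mult},'a) gr_operad"
  assumes comp_module_module: "label_set S \<Longrightarrow> module base_ring (comp_module P S d)"
    and relabel_linear:
      "\<lbrakk>label_set S; inj_on \<sigma> S\<rbrakk> \<Longrightarrow>
       relabel P \<sigma> S d \<in> linear_maps (comp_module P S d) (comp_module P (\<sigma> ` S) d)"
    and pcomp_linear_left:
      "\<lbrakk>composable S s T; y \<in> carrier (comp_module P T e)\<rbrakk> \<Longrightarrow>
       (\<lambda>x. pcomp P S s T d e x y)
         \<in> linear_maps (comp_module P S d) (comp_module P (plug S s T) (d + e))"
    and pcomp_linear_right:
      "\<lbrakk>composable S s T; x \<in> carrier (comp_module P S d)\<rbrakk> \<Longrightarrow>
       (\<lambda>y. pcomp P S s T d e x y)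
         \<in> linear_maps (comp_module P T e) (comp_module P (plug S s T) (d + e))"
    and op_unit_closed: "op_unit P s \<in> carrier (comp_module P {s} 0)"

lemma graded_operad_pre_operad: "graded_operad P \<Longrightarrow> pre_operad P"
  by (simp add: graded_operad_def pre_operad_def)

lemma label_set_image: "label_set S \<Longrightarrow> label_set (\<sigma> ` S)"
  by (simp add: label_set_def)

lemma label_set_singleton [simp]: "label_set {s}"
  by (simp add: label_set_def)

lemma label_set_plug: "composable S s T \<Longrightarrow> label_set (plug S s T)"
  by (auto simp: label_set_def composable_def plug_def)

lemma composableD:
  assumes "composable S s T"
  shows "label_set S" "label_set T" "finite S" "finite T" "s \<in> S" "T \<noteq> {}" "(S - {s}) \<inter> T = {}"
  using assms by (auto simp: composable_def label_set_def)

context pre_operad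
begin

lemmas comp_module_plug_module = comp_module_module[OF label_set_plug]

lemma relabel_closed:
  "label_set S \<Longrightarrow> inj_on \<sigma> S \<Longrightarrow> x \<in> carrier (comp_module P S d) \<Longrightarrow>
   relabel P \<sigma> S d x \<in> carrier (comp_module P (\<sigma> ` S) d)"
  by (rule linear_mapsD(1)[OF relabel_linear])

lemma pcomp_closed:
  "composable S s T \<Longrightarrow> x \<in> carrier (comp_module P S d) \<Longrightarrow> y \<in> carrier (comp_module P T e) \<Longrightarrow>
   pcomp P S s T d e x y \<in> carrier (comp_module P (plug S s T) (d + e))"
  by (rule linear_mapsD(1)[OF pcomp_linear_left])

end

section \<open>Homomorphisms of operads and quotients by ideals\<close>

definition operad_hom ::
  "('k::{comm_ring,comm_monoid_mult},'a) gr_operad \<Rightarrow> ('k,'b) gr_operad \<Rightarrow>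
   (nat set \<Rightarrow> int \<Rightarrow> 'a \<Rightarrow> 'b) \<Rightarrow> bool" where
  "operad_hom P Q F \<longleftrightarrow>
     (\<forall>S d. label_set S \<longrightarrow> F S d \<in> linear_maps (comp_module P S d) (comp_module Q S d)) \<and>
     (\<forall>\<sigma> S d. \<forall>x\<in>carrier (comp_module P S d). label_set S \<longrightarrow> inj_on \<sigma> S \<longrightarrow>
        F (\<sigma> ` S) d (relabel P \<sigma> S d x) = relabel Q \<sigma> S d (F S d x)) \<and>
     (\<forall>S s T d e. \<forall>x\<in>carrier (comp_module P S d). \<forall>y\<in>carrier (comp_module P T e).
        composable S s T \<longrightarrow>
        F (plug S s T) (d + e) (pcomp P S s T d e x y) = pcomp Q S s T d e (F S d x) (F T e y)) \<and>
     (\<forall>s. F {s} 0 (op_unit P s) = op_unit Q s)"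

lemma operad_homI:
  assumes "\<And>S d. label_set S \<Longrightarrow> F S d \<in> linear_maps (comp_module P S d) (comp_module Q S d)"
    and "\<And>\<sigma> S d x. x \<in> carrier (comp_module P S d) \<Longrightarrow> label_set S \<Longrightarrow> inj_on \<sigma> S \<Longrightarrow>
        F (\<sigma> ` S) d (relabel P \<sigma> S d x) = relabel Q \<sigma> S d (F S d x)"
    and "\<And>S s T d e x y. x \<in> carrier (comp_module P S d) \<Longrightarrow> y \<in> carrier (comp_module P T e) \<Longrightarrow>
        composable S s T \<Longrightarrow>
        F (plug S s T) (d + e) (pcomp P S s T d e x y) = pcomp Q S s T d e (F S d x) (F T e y)"
    and "\<And>s. F {s} 0 (op_unit P s) = op_unit Q s"
  shows "operad_hom P Q F"
  using assms by (simp add: operad_hom_def)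

lemma operad_homD:
  assumes "operad_hom P Q F"
  shows "label_set S \<Longrightarrow> F S d \<in> linear_maps (comp_module P S d) (comp_module Q S d)"
    and "x \<in> carrier (comp_module P S d) \<Longrightarrow> label_set S \<Longrightarrow> inj_on \<sigma> S \<Longrightarrow>
        F (\<sigma> ` S) d (relabel P \<sigma> S d x) = relabel Q \<sigma> S d (F S d x)"
    and "x \<in> carrier (comp_module P S d) \<Longrightarrow> y \<in> carrier (comp_module P T e) \<Longrightarrow>
        composable S s T \<Longrightarrow>
        F (plug S s T) (d + e) (pcomp P S s T d e x y) = pcomp Q S s T d e (F S d x) (F T e y)"
    and "F {s} 0 (op_unit P s) = op_unit Q s"
    and "label_set S \<Longrightarrow> x \<in> carrier (comp_module P S d) \<Longrightarrow> F S d x \<in> carrier (comp_module Q S d)"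
  using assms by (simp_all add: operad_hom_def linear_maps_def Pi_iff)

lemma operad_iso_iff:
  "operad_iso P Q F \<longleftrightarrow> graded_operad P \<and> graded_operad Q \<and> operad_hom P Q F \<and>
     (\<forall>S d. label_set S \<longrightarrow>
        bij_betw (F S d) (carrier (comp_module P S d)) (carrier (comp_module Q S d)))"
  unfolding operad_iso_def operad_hom_def by (intro iffI; elim conjE; intro conjI; simp)

text \<open>The formulas of \<open>operad_quot\<close> for an arbitrary family instead of a
  generated ideal: then \<open>hNS\<close>, whose components are cocycles modulo coboundaries, is an
  instance too.\<close>

definition quot_by ::
  "('k::{comm_ring,comm_monoid_mult},'a) gr_operad \<Rightarrow> (nat set \<Rightarrow> int \<Rightarrow> 'a set) \<Rightarrow>
   ('k,'a set) gr_operad" where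
  "quot_by P I =
     \<lparr>comp_module = (\<lambda>S d. quot_module (comp_module P S d) (I S d)),
      relabel = (\<lambda>\<sigma> S d C. \<Union>x\<in>C. I (\<sigma> ` S) d +>\<^bsub>comp_module P (\<sigma> ` S) d\<^esub> relabel P \<sigma> S d x),
      pcomp = (\<lambda>S s T d e C D. \<Union>x\<in>C. \<Union>y\<in>D.
        I (plug S s T) (d + e) +>\<^bsub>comp_module P (plug S s T) (d + e)\<^esub> pcomp P S s T d e x y),
      op_unit = (\<lambda>s. I {s} 0 +>\<^bsub>comp_module P {s} 0\<^esub> op_unit P s)\<rparr>"

lemma operad_quot_eq_quot_by: "operad_quot P G = quot_by P (ideal_gen P G)"
  by (simp add: operad_quot_def quot_by_def quot_class_def)

lemma operad_idealD:
  assumes "operad_ideal P I"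
  shows "label_set S \<Longrightarrow> submodule (I S d) base_ring (comp_module P S d)"
    and "label_set S \<Longrightarrow> inj_on \<sigma> S \<Longrightarrow> x \<in> I S d \<Longrightarrow> relabel P \<sigma> S d x \<in> I (\<sigma> ` S) d"
    and "composable S s T \<Longrightarrow> x \<in> I S d \<Longrightarrow> y \<in> carrier (comp_module P T e) \<Longrightarrow>
        pcomp P S s T d e x y \<in> I (plug S s T) (d + e)"
    and "composable S s T \<Longrightarrow> x \<in> carrier (comp_module P S d) \<Longrightarrow> y \<in> I T e \<Longrightarrow>
        pcomp P S s T d e x y \<in> I (plug S s T) (d + e)"
  using assms unfolding operad_ideal_def by simp_all

locale operad_with_ideal = pre_operad P
  for P :: "('k::{comm_ring,comm_monoid_mult},'a) gr_operad" +
  fixes I :: "nat set \<Rightarrow> int \<Rightarrow> 'a set"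
  assumes ideal: "operad_ideal P I"
begin

lemma module_quotient: "label_set S \<Longrightarrow> module_quotient (comp_module P S d) (I S d)"
  using comp_module_module operad_idealD(1)[OF ideal] by (simp add: module_quotient_def)

abbreviation cls :: "nat set \<Rightarrow> int \<Rightarrow> 'a \<Rightarrow> 'a set" where
  "cls S d x \<equiv> I S d +>\<^bsub>comp_module P S d\<^esub> x"

lemma relabel_class:
  assumes "label_set S" "inj_on \<sigma> S" "x \<in> carrier (comp_module P S d)"
  shows "relabel (quot_by P I) \<sigma> S d (cls S d x) = cls (\<sigma> ` S) d (relabel P \<sigma> S d x)"
proof -
  interpret A: module_quotient "comp_module P S d" "I S d" using assms(1) by (rule module_quotient)
  interpret B: module_quotient "comp_module P (\<sigma> ` S) d" "I (\<sigma> ` S) d"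
    by (rule module_quotient[OF label_set_image[OF assms(1)]])
  have "(\<Union>y\<in>cls S d x. cls (\<sigma> ` S) d (relabel P \<sigma> S d y)) = cls (\<sigma> ` S) d (relabel P \<sigma> S d x)"
  proof (rule A.UN_class)
    fix y assume y: "y \<in> carrier (comp_module P S d)" "y \<ominus>\<^bsub>comp_module P S d\<^esub> x \<in> I S d"
    then show "cls (\<sigma> ` S) d (relabel P \<sigma> S d y) = cls (\<sigma> ` S) d (relabel P \<sigma> S d x)"
      using operad_idealD(2)[OF ideal assms(1,2) y(2)] assms relabel_closed[OF assms(1,2)]
        linear_maps_minus[OF relabel_linear[OF assms(1,2)] A.M.module_axioms B.M.module_axioms y(1) assms(3)]
      by (simp add: B.class_eq_iff)
  qed fact
  then show ?thesis by (simp add: quot_by_def)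
qed

lemma pcomp_class:
  assumes "composable S s T" "x \<in> carrier (comp_module P S d)" "y \<in> carrier (comp_module P T e)"
  shows "pcomp (quot_by P I) S s T d e (cls S d x) (cls T e y)
       = cls (plug S s T) (d + e) (pcomp P S s T d e x y)"
proof -
  interpret A: module_quotient "comp_module P S d" "I S d"
    by (rule module_quotient[OF composableD(1)[OF assms(1)]])
  interpret B: module_quotient "comp_module P T e" "I T e"
    by (rule module_quotient[OF composableD(2)[OF assms(1)]])
  interpret C: module_quotient "comp_module P (plug S s T) (d + e)" "I (plug S s T) (d + e)"
    by (rule module_quotient[OF label_set_plug[OF assms(1)]])
  \<comment> \<open>The inner union is collapsed for every representative \<open>x'\<close> of the
    left argument; only then can the outer union be collapsed, with \<open>y\<close> fixed.\<close>
  have right: "(\<Union>y'\<in>cls T e y. cls (plug S s T) (d + e) (pcomp P S s T d e x' y')) =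
     cls (plug S s T) (d + e) (pcomp P S s T d e x' y)"
    if x': "x' \<in> carrier (comp_module P S d)" for x'
  proof (rule B.UN_class)
    fix y' assume y: "y' \<in> carrier (comp_module P T e)" "y' \<ominus>\<^bsub>comp_module P T e\<^esub> y \<in> I T e"
    then show "cls (plug S s T) (d + e) (pcomp P S s T d e x' y')
      = cls (plug S s T) (d + e) (pcomp P S s T d e x' y)"
      using operad_idealD(4)[OF ideal assms(1) x' y(2)] assms pcomp_closed[OF assms(1) x']
        linear_maps_minus[OF pcomp_linear_right[OF assms(1) x'] B.M.module_axioms C.M.module_axioms y(1) assms(3)]
      by (simp add: C.class_eq_iff)
  qed fact
  have "(\<Union>x'\<in>cls S d x. cls (plug S s T) (d + e) (pcomp P S s T d e x' y)) =
     cls (plug S s T) (d + e) (pcomp P S s T d e x y)"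
  proof (rule A.UN_class)
    fix x' assume y: "x' \<in> carrier (comp_module P S d)" "x' \<ominus>\<^bsub>comp_module P S d\<^esub> x \<in> I S d"
    then show "cls (plug S s T) (d + e) (pcomp P S s T d e x' y)
      = cls (plug S s T) (d + e) (pcomp P S s T d e x y)"
      using operad_idealD(3)[OF ideal assms(1) y(2) assms(3)] assms pcomp_closed[OF assms(1) _ assms(3)]
        linear_maps_minus[OF pcomp_linear_left[OF assms(1) assms(3)] A.M.module_axioms C.M.module_axioms y(1) assms(2)]
      by (simp add: C.class_eq_iff)
  qed fact
  moreover have "(\<Union>x'\<in>cls S d x. \<Union>y'\<in>cls T e y. cls (plug S s T) (d + e) (pcomp P S s T d e x' y'))
    = (\<Union>x'\<in>cls S d x. cls (plug S s T) (d + e) (pcomp P S s T d e x' y))"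
    using right A.mem_classD(1)[OF assms(2)] by (intro SUP_cong) auto
  ultimately show ?thesis by (simp add: quot_by_def)
qed

lemma quot_comp_module: "comp_module (quot_by P I) S d = quot_module (comp_module P S d) (I S d)"
  and quot_op_unit: "op_unit (quot_by P I) s = cls {s} 0 (op_unit P s)"
  by (simp_all add: quot_by_def)

lemma quot_carrier:
  "label_set S \<Longrightarrow> carrier (comp_module (quot_by P I) S d) = cls S d ` carrier (comp_module P S d)"
  using module_quotient.quot_carrier[OF module_quotient] by (simp add: quot_comp_module)

lemma class_linear:
  "label_set S \<Longrightarrow> cls S d \<in> linear_maps (comp_module P S d) (comp_module (quot_by P I) S d)"
  using module_quotient.class_linear[OF module_quotient] by (simp add: quot_comp_module)

lemma class_hom: "operad_hom P (quot_by P I) cls"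
  by (rule operad_homI) (simp_all add: class_linear relabel_class pcomp_class quot_op_unit)

text \<open>Every element of the quotient is a class and the class map is linear, so linearity can
  be tested after composing with it.\<close>

lemma linear_via_class:
  assumes "label_set S" "(\<lambda>x. f (cls S d x)) \<in> linear_maps (comp_module P S d) N"
  shows "f \<in> linear_maps (comp_module (quot_by P I) S d) N"
proof -
  note * = linear_mapsD(2,3)[OF class_linear[OF assms(1)], symmetric]
  interpret A: module_quotient "comp_module P S d" "I S d" using assms(1) by (rule module_quotient)
  show ?thesis
    using linear_mapsD[OF assms(2)]
    by (intro linear_mapsI; clarsimp simp: quot_carrier assms(1); simp add: * A.M.smult_closed[simplified])
qed

lemma pre_operad_quot: "pre_operad (quot_by P I)"
proof (rule pre_operad.intro)
  show "module base_ring (comp_module (quot_by P I) S d)" if "label_set S" for S d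
    using module_quotient.quot_module_module[OF module_quotient[OF that]]
    by (simp add: quot_comp_module)
  fix S s T d e and \<sigma> :: "nat \<Rightarrow> nat"
  show "relabel (quot_by P I) \<sigma> S d \<in>
      linear_maps (comp_module (quot_by P I) S d) (comp_module (quot_by P I) (\<sigma> ` S) d)"
    if "label_set S" "inj_on \<sigma> S"
    by (rule linear_via_class[OF that(1)],
        rule linear_maps_cong[OF linear_maps_compose[OF relabel_linear class_linear]])
      (use that in \<open>simp_all add: relabel_class comp_module_module label_set_image\<close>)
  show "(\<lambda>x. pcomp (quot_by P I) S s T d e x y)
       \<in> linear_maps (comp_module (quot_by P I) S d) (comp_module (quot_by P I) (plug S s T) (d + e))"
    if S: "composable S s T" and y: "y \<in> carrier (comp_module (quot_by P I) T e)" for y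
  proof -
    obtain b where b: "b \<in> carrier (comp_module P T e)" "y = cls T e b"
      using y quot_carrier composableD(2)[OF S] by auto
    show ?thesis
      by (rule linear_via_class[OF composableD(1)[OF S]], unfold b(2),
        rule linear_maps_cong[OF linear_maps_compose[OF pcomp_linear_left[OF S b(1)] class_linear]])
        (use S b(1) composableD[OF S] in \<open>simp_all add: pcomp_class comp_module_module label_set_plug\<close>)
  qed
  show "(\<lambda>y. pcomp (quot_by P I) S s T d e x y)
       \<in> linear_maps (comp_module (quot_by P I) T e) (comp_module (quot_by P I) (plug S s T) (d + e))"
    if S: "composable S s T" and x: "x \<in> carrier (comp_module (quot_by P I) S d)" for x
  proof -
    obtain b where b: "b \<in> carrier (comp_module P S d)" "x = cls S d b"
      using x quot_carrier composableD(1)[OF S] by auto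
    show ?thesis
      by (rule linear_via_class[OF composableD(2)[OF S]], unfold b(2),
        rule linear_maps_cong[OF linear_maps_compose[OF pcomp_linear_right[OF S b(1)] class_linear]])
        (use S b(1) composableD[OF S] in \<open>simp_all add: pcomp_class comp_module_module label_set_plug\<close>)
  qed
  show "op_unit (quot_by P I) s \<in> carrier (comp_module (quot_by P I) {s} 0)" for s
    by (simp add: quot_op_unit quot_carrier op_unit_closed)
qed

text \<open>A homomorphism that vanishes on \<open>I\<close> takes the same value on all
  representatives of a class, so \<open>h\<close> may evaluate an arbitrary one, chosen by
  \<open>SOME\<close>.\<close>

lemma induced_hom:
  assumes g: "operad_hom P N g" and N: "pre_operad N"
    and ker: "\<And>S d x. label_set S \<Longrightarrow> x \<in> I S d \<Longrightarrow> g S d x = \<zero>\<^bsub>comp_module N S d\<^esub>"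
  obtains h where "operad_hom (quot_by P I) N h"
    "\<And>S d x. label_set S \<Longrightarrow> x \<in> carrier (comp_module P S d) \<Longrightarrow> h S d (cls S d x) = g S d x"
proof -
  interpret N: pre_operad N by fact
  define h where "h S d C = g S d (SOME x. x \<in> C)" for S d C
  have h: "h S d (cls S d x) = g S d x"
    if S: "label_set S" and x: "x \<in> carrier (comp_module P S d)" for S d x
  proof -
    interpret A: module_quotient "comp_module P S d" "I S d" using S by (rule module_quotient)
    interpret B: module base_ring "comp_module N S d" using S by (rule N.comp_module_module)
    define y where "y = (SOME y. y \<in> cls S d x)"
    have "y \<in> cls S d x" unfolding y_def using A.self_mem_class[OF x] by (rule someI)
    then have y: "y \<in> carrier (comp_module P S d)" "y \<ominus>\<^bsub>comp_module P S d\<^esub> x \<in> I S d"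
      using A.mem_classD[OF x] A.class_eq_iff[of y x] x by auto
    have "g S d y \<ominus>\<^bsub>comp_module N S d\<^esub> g S d x = \<zero>\<^bsub>comp_module N S d\<^esub>"
      using ker[OF S y(2)] linear_maps_minus[OF operad_homD(1)[OF g S] A.M.module_axioms B.module_axioms y(1) x]
      by simp
    then show ?thesis
      using operad_homD(5)[OF g S x] operad_homD(5)[OF g S y(1)]
      by (simp add: h_def y_def[symmetric] B.minus_eq_zero_iff)
  qed
  show ?thesis
  proof
    show "operad_hom (quot_by P I) N h"
    proof (rule operad_homI)
      show "h S d \<in> linear_maps (comp_module (quot_by P I) S d) (comp_module N S d)" if "label_set S" for S d
        by (rule linear_via_class[OF that], rule linear_maps_cong[OF operad_homD(1)[OF g that]])
          (simp_all add: h that comp_module_module)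
    qed (auto simp: quot_carrier composableD(1,2) relabel_class pcomp_class h label_set_image label_set_plug
        relabel_closed pcomp_closed quot_op_unit op_unit_closed operad_homD[OF g])
  qed (fact h)
qed

end

section \<open>Transport of the operad axioms along injective homomorphisms\<close>

text \<open>Injectivity on the union requires the images of \<open>S - {s}\<close> and
  \<open>T\<close> to be disjoint, which is composability of the images. The test
  \<open>a \<in> T\<close> comes first because \<open>s\<close> itself may belong to
  \<open>T\<close>.\<close>

lemma plug_relabel:
  assumes "composable S s T" "inj_on \<sigma> S" "inj_on \<tau> T" "composable (\<sigma> ` S) (\<sigma> s) (\<tau> ` T)"
  shows "inj_on (\<lambda>a. if a \<in> T then \<tau> a else \<sigma> a) (plug S s T)"
    and "(\<lambda>a. if a \<in> T then \<tau> a else \<sigma> a) ` plug S s T = plug (\<sigma> ` S) (\<sigma> s) (\<tau> ` T)"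
proof -
  let ?f = "\<lambda>a. if a \<in> T then \<tau> a else \<sigma> a"
  have 1: "\<sigma> ` (S - {s}) = \<sigma> ` S - {\<sigma> s}"
    using inj_on_image_set_diff[OF assms(2), of S "{s}"] assms(1) by (simp add: composable_def)
  have 2: "?f ` (S - {s}) = \<sigma> ` (S - {s})" "?f ` T = \<tau> ` T"
    using assms(1) by (auto simp: composable_def intro!: image_cong)
  show "?f ` plug S s T = plug (\<sigma> ` S) (\<sigma> s) (\<tau> ` T)"
    unfolding plug_def image_Un 1 2 ..
  have "inj_on ?f (S - {s})"
    using inj_on_subset[OF assms(2), of "S - {s}"] assms(1)
    by (subst inj_on_cong[of _ _ \<sigma>]) (auto simp: composable_def)
  moreover have "inj_on ?f T" using assms(3) by (subst inj_on_cong[of _ _ \<tau>]) auto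
  moreover have "?f ` (S - {s}) \<inter> ?f ` T = {}"
    unfolding 1 2 using assms(4) by (simp add: composable_def)
  ultimately show "inj_on ?f (plug S s T)"
    unfolding plug_def inj_on_Un by blast
qed

text \<open>Each axiom is an equation between values of the operations. Both sides have the same
  image under \<open>h\<close>, because \<open>h\<close> commutes with the operations and the axiom
  holds in \<open>N\<close>; injectivity of \<open>h\<close> on the component gives the equation in
  \<open>P\<close>. The operad axioms of both quotients are obtained in this way.\<close>

lemma graded_operad_transport:
  assumes "pre_operad P" "graded_operad N" "operad_hom P N h"
    and inj: "\<And>S d. label_set S \<Longrightarrow> inj_on (h S d) (carrier (comp_module P S d))"
  shows "graded_operad P"
proof -
  interpret P: pre_operad P by fact
  interpret N: graded_operad N by fact
  note h = operad_homD[OF assms(3)]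
  have eqI: "x = y" if "h S d x = h S d y" "label_set S" "x \<in> carrier (comp_module P S d)"
    "y \<in> carrier (comp_module P S d)" for S d x y
    using inj that by (auto dest: inj_onD)
  note cl = P.relabel_closed P.pcomp_closed P.op_unit_closed label_set_image label_set_plug
  have op: "\<sigma> ` S = \<tau> ` S \<and> inj_on \<tau> S" if "inj_on \<sigma> S" "\<And>s. s \<in> S \<Longrightarrow> \<sigma> s = \<tau> s"
    for \<sigma> \<tau> :: "nat \<Rightarrow> nat" and S
    using that by (auto simp: inj_on_def)
  show ?thesis
  proof (rule graded_operad.intro)
    fix S T R :: "nat set" and s t r :: nat and d e f :: int and \<sigma> \<tau> :: "nat \<Rightarrow> nat" and x y z
    {
      assume "label_set S" "inj_on \<sigma> S" "\<And>s. s \<in> S \<Longrightarrow> \<sigma> s = \<tau> s" "x \<in> carrier (comp_module P S d)"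
      with op[of \<sigma> S \<tau>] show "relabel P \<sigma> S d x = relabel P \<tau> S d x"
        using cl(1)[of S \<sigma> x d] cl(1)[of S \<tau> x d] h(2)[of x S d \<sigma>] h(2)[of x S d \<tau>]
          N.relabel_cong[of S \<sigma> \<tau> "h S d x" d] h(5)[of S x d] cl(4)[of S \<sigma>]
        by (intro eqI[of "\<sigma> ` S" d]) auto
    }
    show "relabel P id S d x = x" if "label_set S" "x \<in> carrier (comp_module P S d)"
      using that cl(1)[of S id x d] h(2)[of x S d id] h(5)[of S x d] N.relabel_id
      by (intro eqI[of S d]) auto
    show "relabel P (\<tau> \<circ> \<sigma>) S d x = relabel P \<tau> (\<sigma> ` S) d (relabel P \<sigma> S d x)"
      if "label_set S" "inj_on \<sigma> S" "inj_on \<tau> (\<sigma> ` S)" "x \<in> carrier (comp_module P S d)"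
    proof -
      have "inj_on (\<tau> \<circ> \<sigma>) S" using that by (simp add: comp_inj_on)
      note i = this and x = that(4) and xs = cl(1)[OF that(1,2,4)] and ls = cl(4)[OF that(1), of \<sigma>]
      show ?thesis
        using h(2)[OF x that(1) i, folded image_comp] h(2)[OF xs ls that(3)] h(2)[OF x that(1,2)]
          N.relabel_comp[OF that(1-3) h(5)[OF that(1) x]]
        by (intro eqI[OF _ _ cl(1)[OF that(1) i x, folded image_comp] cl(1)[OF ls that(3) xs]])
          (simp_all add: cl(4) that(1))
    qed
    show "relabel P (\<lambda>a. if a \<in> T then \<tau> a else \<sigma> a) (plug S s T) (d + e) (pcomp P S s T d e x y) =
       pcomp P (\<sigma> ` S) (\<sigma> s) (\<tau> ` T) d e (relabel P \<sigma> S d x) (relabel P \<tau> T e y)"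
      if A: "composable S s T" "inj_on \<sigma> S" "inj_on \<tau> T" "composable (\<sigma> ` S) (\<sigma> s) (\<tau> ` T)"
        "x \<in> carrier (comp_module P S d)" "y \<in> carrier (comp_module P T e)"
    proof -
      note 1 = plug_relabel(1)[OF A(1-4)] and 2 = plug_relabel(2)[OF A(1-4)]
      note c = composableD(1,2)[OF A(1)]
      note xy = cl(1)[OF c(1) A(2,5)] cl(1)[OF c(2) A(3,6)] cl(2)[OF A(1,5,6)]
      note hh = h(2)[OF xy(3) label_set_plug[OF A(1)] 1, unfolded 2] h(3)[OF A(5,6,1)]
        h(3)[OF xy(1,2) A(4)] h(2)[OF A(5) c(1) A(2)] h(2)[OF A(6) c(2) A(3)]
        N.pcomp_relabel[OF A(1-4) h(5)[OF c(1) A(5)] h(5)[OF c(2) A(6)]]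
      show ?thesis
        using cl(1)[OF label_set_plug[OF A(1)] 1 xy(3), unfolded 2] cl(2)[OF A(4) xy(1,2)]
          label_set_plug[OF A(4)]
        by (intro eqI[of "plug (\<sigma> ` S) (\<sigma> s) (\<tau> ` T)" "d + e"]) (simp_all add: hh)
    qed
    show "relabel P \<sigma> {s} 0 (op_unit P s) = op_unit P (\<sigma> s)"
      using cl(1)[of "{s}" \<sigma> "op_unit P s" 0] cl(3)
        h(2)[of "op_unit P s" "{s}" 0 \<sigma>] N.relabel_op_unit
      by (intro eqI[of "{\<sigma> s}" 0]) (auto simp: h)
    show "pcomp P {s} s T 0 e (op_unit P s) y = y"
      if "label_set T" "y \<in> carrier (comp_module P T e)"
    proof -
      have c: "composable {s} s T" "plug {s} s T = T" using that by (auto simp: composable_def plug_def)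
      then show ?thesis
        using that cl(2)[OF c(1) cl(3) that(2)] h(3)[OF cl(3) that(2) c(1)] N.op_unit_left
        by (intro eqI[of T e]) (auto simp: h)
    qed
    show "pcomp P S s {t} d 0 x (op_unit P t) = relabel P (id(s := t)) S d x"
      if A: "composable S s {t}" "x \<in> carrier (comp_module P S d)"
    proof -
      have 1: "inj_on (id(s := t)) S" "id(s := t) ` S = plug S s {t}"
        using A(1) by (auto simp: composable_def inj_on_def plug_def)
      note c = composableD(1)[OF A(1)]
      show ?thesis
        using A cl(2)[OF A cl(3)] h(3)[OF A(2) cl(3) A(1)] N.op_unit_right[OF A(1) h(5)[OF c A(2)]]
          h(2)[OF A(2) c 1(1), unfolded 1(2)] cl(1)[OF c 1(1) A(2), unfolded 1(2)] label_set_plug[OF A(1)]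
        by (intro eqI[of "plug S s {t}" d]) (simp_all add: h(4))
    qed
    show "pcomp P (plug S s T) t R (d + e) f (pcomp P S s T d e x y) z =
       pcomp P S s (plug T t R) d (e + f) x (pcomp P T t R e f y z)"
      if A: "composable S s T" "composable T t R" "(S - {s}) \<inter> R = {}"
        "x \<in> carrier (comp_module P S d)" "y \<in> carrier (comp_module P T e)"
        "z \<in> carrier (comp_module P R f)"
    proof -
      have B: "composable (plug S s T) t R" "composable S s (plug T t R)"
        "plug (plug S s T) t R = plug S s (plug T t R)"
        using A(1-3) by (auto simp: composable_def plug_def label_set_def)
      note c = composableD(1,2)[OF A(1)] composableD(2)[OF A(2)]
      note xy = cl(2)[OF A(1,4,5)] and yz = cl(2)[OF A(2,5,6)]
      show ?thesis
        using cl(2)[OF B(1) xy A(6)] cl(2)[OF B(2) A(4) yz] label_set_plug[OF B(2)]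
          h(3)[OF xy A(6) B(1)] h(3)[OF A(4) yz B(2)] h(3)[OF A(4,5,1)] h(3)[OF A(5,6,2)]
          N.sequential_assoc[OF A(1-3) h(5)[OF c(1) A(4)] h(5)[OF c(2) A(5)] h(5)[OF c(3) A(6)]]
        by (intro eqI[of "plug S s (plug T t R)" "d + e + f"]) (simp_all add: B(3) add.assoc)
    qed
    show "pcomp P (plug S s T) r R (d + e) f (pcomp P S s T d e x y) z =
       ksign (e * f) \<odot>\<^bsub>comp_module P (plug (plug S s T) r R) (d + e + f)\<^esub>
       pcomp P (plug S r R) s T (d + f) e (pcomp P S r R d f x z) y"
      if A: "composable S s T" "composable S r R" "s \<noteq> r" "T \<inter> R = {}"
        "x \<in> carrier (comp_module P S d)" "y \<in> carrier (comp_module P T e)"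
        "z \<in> carrier (comp_module P R f)"
    proof -
      have B: "composable (plug S s T) r R" "composable (plug S r R) s T"
        "plug (plug S r R) s T = plug (plug S s T) r R"
        using A(1-4) by (auto simp: composable_def plug_def label_set_def)
      note c = composableD(1,2)[OF A(1)] composableD(2)[OF A(2)]
      note xy = cl(2)[OF A(1,5,6)] and xz = cl(2)[OF A(2,5,7)]
      \<comment> \<open>Composition in the other order lands in degree \<open>d + f + e\<close> over
        the same set; rewriting this to \<open>d + e + f\<close> lets the scalar of the axiom act on
        it.\<close>
      have p: "pcomp P (plug S r R) s T (d + f) e (pcomp P S r R d f x z) y
          \<in> carrier (comp_module P (plug (plug S s T) r R) (d + e + f))"
        using cl(2)[OF B(2) xz A(6)] B(3) by (simp add: add.commute add.left_commute add.assoc)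
      note lp = label_set_plug[OF B(1)]
      interpret C: module base_ring "comp_module P (plug (plug S s T) r R) (d + e + f)"
        by (rule P.comp_module_module[OF lp])
      have "h (plug (plug S s T) r R) (d + e + f)
           (pcomp P (plug S r R) s T (d + f) e (pcomp P S r R d f x z) y)
        = pcomp N (plug S r R) s T (d + f) e (pcomp N S r R d f (h S d x) (h R f z)) (h T e y)"
        using h(3)[OF xz A(6) B(2)] h(3)[OF A(5,7,2)] B(3) by (simp add: add.commute add.left_commute add.assoc)
      moreover have "h (plug (plug S s T) r R) (d + e + f)
           (pcomp P (plug S s T) r R (d + e) f (pcomp P S s T d e x y) z)
        = pcomp N (plug S s T) r R (d + e) f (pcomp N S s T d e (h S d x) (h T e y)) (h R f z)"
        using h(3)[OF xy A(7) B(1)] h(3)[OF A(5,6,1)] by simp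
      ultimately show ?thesis
        using cl(2)[OF B(1) xy A(7)] p lp linear_mapsD(3)[OF h(1)[OF lp] p, of "ksign (e * f)"]
          N.parallel_assoc[OF A(1-4) h(5)[OF c(1) A(5)] h(5)[OF c(2) A(6)] h(5)[OF c(3) A(7)]]
        by (intro eqI[of "plug (plug S s T) r R" "d + e + f"]) (auto simp: C.smult_closed)
    qed
  qed (fact P.comp_module_module P.relabel_linear P.pcomp_linear_left P.pcomp_linear_right
      P.op_unit_closed)+
qed

lemma operad_iso_transport:
  assumes "pre_operad P" "graded_operad N" "operad_hom P N h"
    and "\<And>S d. label_set S \<Longrightarrow> bij_betw (h S d) (carrier (comp_module P S d)) (carrier (comp_module N S d))"
  shows "operad_iso P N h"
  using graded_operad_transport[OF assms(1-3)] assms by (auto simp: operad_iso_iff bij_betw_def)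

text \<open>The first isomorphism theorem. Besides the bijection it yields that the quotient is a
  graded operad at all, since its axioms are transported from \<open>N\<close>.\<close>

lemma (in operad_with_ideal) quot_by_iso:
  assumes g: "operad_hom P N g" and N: "graded_operad N"
    and ker: "\<And>S d x. label_set S \<Longrightarrow> x \<in> carrier (comp_module P S d) \<Longrightarrow>
      g S d x = \<zero>\<^bsub>comp_module N S d\<^esub> \<longleftrightarrow> x \<in> I S d"
    and surj: "\<And>S d. label_set S \<Longrightarrow> carrier (comp_module N S d) \<subseteq> g S d ` carrier (comp_module P S d)"
  obtains h where "operad_iso (quot_by P I) N h"
    "\<And>S d x. label_set S \<Longrightarrow> x \<in> carrier (comp_module P S d) \<Longrightarrow> h S d (cls S d x) = g S d x"
proof -
  interpret N: pre_operad N using N by (rule graded_operad_pre_operad)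
  have I: "x \<in> carrier (comp_module P S d)" if "label_set S" "x \<in> I S d" for S d x
  proof -
    interpret A: module_quotient "comp_module P S d" "I S d" using that(1) by (rule module_quotient)
    show ?thesis using that(2) by (rule A.H.mem_carrier[simplified])
  qed
  obtain h where h: "operad_hom (quot_by P I) N h"
    "\<And>S d x. label_set S \<Longrightarrow> x \<in> carrier (comp_module P S d) \<Longrightarrow> h S d (cls S d x) = g S d x"
    using induced_hom[OF g N.pre_operad_axioms] ker I by blast
  have "bij_betw (h S d) (carrier (comp_module (quot_by P I) S d)) (carrier (comp_module N S d))"
    if S: "label_set S" for S d
  proof -
    interpret A: module_quotient "comp_module P S d" "I S d" using S by (rule module_quotient)
    interpret B: module base_ring "comp_module N S d" using S by (rule N.comp_module_module)
    have "inj_on (h S d) (carrier (comp_module (quot_by P I) S d))"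
    proof (rule inj_onI, unfold quot_carrier[OF S], elim imageE, hypsubst)
      fix x y assume xy: "x \<in> carrier (comp_module P S d)" "y \<in> carrier (comp_module P S d)"
        and eq: "h S d (cls S d x) = h S d (cls S d y)"
      then have "g S d (x \<ominus>\<^bsub>comp_module P S d\<^esub> y) = \<zero>\<^bsub>comp_module N S d\<^esub>"
        using linear_maps_minus[OF operad_homD(1)[OF g S] A.M.module_axioms B.module_axioms xy]
          operad_homD(5)[OF g S] h(2)[OF S] by (simp add: B.minus_eq_zero_iff)
      then show "cls S d x = cls S d y"
        using xy ker[OF S, of "x \<ominus>\<^bsub>comp_module P S d\<^esub> y"] by (simp add: A.class_eq_iff)
    qed
    moreover have "h S d ` carrier (comp_module (quot_by P I) S d) = carrier (comp_module N S d)"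
      using surj[OF S, of d] operad_homD(5)[OF g S, of _ d] h(2)[OF S, of _ d]
      by (force simp: quot_carrier[OF S] image_image)
    ultimately show ?thesis by (simp add: bij_betw_def)
  qed
  then show ?thesis using that[of h] operad_iso_transport[OF pre_operad_quot N h(1)] h(2) by blast
qed

section \<open>Composites and inverses of isomorphisms\<close>

lemma operad_iso_trans:
  assumes "operad_iso P Q F" "operad_iso Q R G"
  shows "operad_iso P R (\<lambda>S d x. G S d (F S d x))"
proof -
  note iso = assms[unfolded operad_iso_iff]
  have F: "operad_hom P Q F" and G: "operad_hom Q R G" using iso by simp_all
  have "operad_hom P R (\<lambda>S d x. G S d (F S d x))"
  proof (rule operad_homI)
    show "(\<lambda>x. G S d (F S d x)) \<in> linear_maps (comp_module P S d) (comp_module R S d)"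
      if "label_set S" for S d
      by (rule linear_maps_compose[OF operad_homD(1)[OF F that] operad_homD(1)[OF G that]])
  qed (simp_all add: operad_homD[OF F] operad_homD[OF G] composableD(1,2))
  moreover have "bij_betw (\<lambda>x. G S d (F S d x)) (carrier (comp_module P S d)) (carrier (comp_module R S d))"
    if "label_set S" for S d
    using iso that bij_betw_trans[of "F S d" "carrier (comp_module P S d)"
        "carrier (comp_module Q S d)" "G S d" "carrier (comp_module R S d)"] by (simp add: o_def)
  ultimately show ?thesis using iso by (simp add: operad_iso_iff)
qed

lemma operad_iso_sym:
  assumes "operad_iso P Q F"
  shows "operad_iso Q P (\<lambda>S d. the_inv_into (carrier (comp_module P S d)) (F S d))"
proof -
  let ?G = "\<lambda>S d. the_inv_into (carrier (comp_module P S d)) (F S d)"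
  note iso = assms[unfolded operad_iso_iff]
  then interpret P: pre_operad P by (simp add: graded_operad_pre_operad)
  have bij: "bij_betw (F S d) (carrier (comp_module P S d)) (carrier (comp_module Q S d))"
    if "label_set S" for S d using that iso by blast
  note F = operad_homD[of P Q F]
  have hom: "operad_hom P Q F" using iso by blast
  have GI: "?G S d y = x" if "label_set S" "x \<in> carrier (comp_module P S d)" "F S d x = y" for S d x y
    using that bij[OF that(1)] by (auto simp: bij_betw_def the_inv_into_f_f)
  have E: "\<exists>x\<in>carrier (comp_module P S d). y = F S d x"
    if "label_set S" "y \<in> carrier (comp_module Q S d)" for S d y
    using that bij[OF that(1), of d] unfolding bij_betw_def by (metis imageE)
  have "operad_hom Q P ?G"
  proof (rule operad_homI)
    fix S d assume S: "label_set S"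
    interpret A: module base_ring "comp_module P S d" using S by (rule P.comp_module_module)
    show "?G S d \<in> linear_maps (comp_module Q S d) (comp_module P S d)"
    proof (rule linear_mapsI)
      fix x y k assume x: "x \<in> carrier (comp_module Q S d)"
      then obtain a where a: "a \<in> carrier (comp_module P S d)" "x = F S d a" using E S by blast
      then show "?G S d x \<in> carrier (comp_module P S d)" using GI S by auto
      show "?G S d (k \<odot>\<^bsub>comp_module Q S d\<^esub> x) = k \<odot>\<^bsub>comp_module P S d\<^esub> ?G S d x"
        using a linear_mapsD(3)[OF F(1)[OF hom S]] GI[OF S] by (intro GI[OF S]) auto
      assume "y \<in> carrier (comp_module Q S d)"
      then obtain b where b: "b \<in> carrier (comp_module P S d)" "y = F S d b" using E S by blast
      show "?G S d (x \<oplus>\<^bsub>comp_module Q S d\<^esub> y) = ?G S d x \<oplus>\<^bsub>comp_module P S d\<^esub> ?G S d y"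
        using a b linear_mapsD(2)[OF F(1)[OF hom S]] GI[OF S] by (intro GI[OF S]) auto
    qed
  next
    fix \<sigma> :: "nat \<Rightarrow> nat" and S d x assume "x \<in> carrier (comp_module Q S d)" and S: "label_set S" "inj_on \<sigma> S"
    then obtain a where a: "a \<in> carrier (comp_module P S d)" "x = F S d a" using E by blast
    then show "?G (\<sigma> ` S) d (relabel Q \<sigma> S d x) = relabel P \<sigma> S d (?G S d x)"
      using F(2)[OF hom a(1) S] GI[OF S(1) a(1)]
      by (intro GI) (auto simp: label_set_image S P.relabel_closed)
  next
    fix S s T d e x y assume "x \<in> carrier (comp_module Q S d)" "y \<in> carrier (comp_module Q T e)"
      and S: "composable S s T"
    then obtain a b where a: "a \<in> carrier (comp_module P S d)" "x = F S d a"
      and b: "b \<in> carrier (comp_module P T e)" "y = F T e b" using E composableD(1,2)[OF S] by metis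
    then show "?G (plug S s T) (d + e) (pcomp Q S s T d e x y) = pcomp P S s T d e (?G S d x) (?G T e y)"
      using F(3)[OF hom a(1) b(1) S] GI[OF _ a(1)] GI[OF _ b(1)] composableD[OF S]
      by (intro GI) (auto simp: label_set_plug[OF S] P.pcomp_closed[OF S])
  next
    show "?G {s} 0 (op_unit Q s) = op_unit P s" for s
      using F(4)[OF hom] by (intro GI) (auto simp: P.op_unit_closed)
  qed
  then show ?thesis
    using iso by (auto simp: operad_iso_iff intro: bij_betw_the_inv_into)
qed

section \<open>Inversions\<close>

text \<open>Counts are kept as sums of \<open>of_bool\<close>, so that parities can be compared term
  by term; the simplifier would turn them back into cardinalities.\<close>

declare sum_of_bool_eq [simp del]

lemma card_eq_sum_of_bool: "finite A \<Longrightarrow> int (card {b\<in>A. P b}) = (\<Sum>b\<in>A. of_bool (P b))"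
  by (simp add: sum_of_bool_eq Int_def)

text \<open>The inversion number of a word. Since the sum runs over \<open>set xs\<close> and not
  over positions, it is correct for words without repeated letters, the only ones
  considered.\<close>

fun invs :: "nat list \<Rightarrow> int" where
  "invs [] = 0"
| "invs (x # xs) = (\<Sum>y\<in>set xs. of_bool (y < x)) + invs xs"

definition crossings :: "nat set \<Rightarrow> nat set \<Rightarrow> int" where
  "crossings A B = (\<Sum>a\<in>A. \<Sum>b\<in>B. of_bool (b < a))"

lemma invs_append:
  "distinct (xs @ ys) \<Longrightarrow> invs (xs @ ys) = invs xs + invs ys + crossings (set xs) (set ys)"
  by (induction xs) (auto simp: crossings_def sum.union_disjoint)

lemma crossings_Un_right:
  "finite B \<Longrightarrow> finite B' \<Longrightarrow> B \<inter> B' = {} \<Longrightarrow>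
   crossings A (B \<union> B') = crossings A B + crossings A B'"
  by (simp add: crossings_def sum.union_disjoint sum.distrib)

lemma crossings_swap:
  assumes "finite A" "finite B" "A \<inter> B = {}"
  shows "crossings A B + crossings B A = int (card A) * int (card B)"
proof -
  have "crossings A B + crossings B A = (\<Sum>a\<in>A. \<Sum>b\<in>B. of_bool (b < a) + of_bool (a < b))"
    unfolding crossings_def by (subst (2) sum.swap) (simp add: sum.distrib)
  also have "\<dots> = (\<Sum>a\<in>A. \<Sum>b\<in>B. 1)"
    using assms(3) by (intro sum.cong refl) (auto simp: of_bool_def)
  finally show ?thesis by simp
qed

text \<open>Each pair of a letter of \<open>as\<close> and a letter of \<open>bs\<close> is inverted
  in exactly one of the two orders, and all other pairs keep their order. So the two inversion
  numbers add up to the product of the lengths modulo 2.\<close>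

lemma invs_swap:
  assumes "distinct (xs @ as @ bs @ ys)"
  shows "even (invs (xs @ as @ bs @ ys) + invs (xs @ bs @ as @ ys) + int (length as) * int (length bs))"
proof -
  have d: "distinct xs" "distinct as" "distinct bs" "distinct ys"
    "set as \<inter> set bs = {}" "set as \<inter> set ys = {}" "set bs \<inter> set ys = {}"
    "set xs \<inter> (set as \<union> (set bs \<union> set ys)) = {}"
    "set xs \<inter> (set bs \<union> (set as \<union> set ys)) = {}"
    using assms by auto
  have "int (length as) * int (length bs) = crossings (set as) (set bs) + crossings (set bs) (set as)"
    using d by (simp add: crossings_swap distinct_card)
  then show ?thesis
    using d by (simp add: invs_append crossings_Un_right Int_Un_distrib Int_commute Un_ac)
qed

lemma relabel_exponent_insert:
  assumes "finite X" "x \<notin> X"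
  shows "relabel_exponent \<sigma> (insert x X) = relabel_exponent \<sigma> X +
    (\<Sum>b\<in>X. of_bool (x < b \<and> \<sigma> b < \<sigma> x \<or> b < x \<and> \<sigma> x < \<sigma> b))"
proof -
  let ?D = "{b\<in>X. x < b \<and> \<sigma> b < \<sigma> x \<or> b < x \<and> \<sigma> x < \<sigma> b}"
  let ?f = "\<lambda>b. if x < b then (x, b) else (b, x)"
  let ?R = "\<lambda>X. {(a,b). a \<in> X \<and> b \<in> X \<and> a < b \<and> \<sigma> b < \<sigma> a}"
  have "?R (insert x X) = ?R X \<union> ?f ` ?D"
    by (auto simp: image_iff split: if_splits)
  moreover have "?R X \<inter> ?f ` ?D = {}" using assms(2) by auto
  moreover have "finite (?R X)" by (rule finite_subset[of _ "X \<times> X"]) (use assms in auto)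
  moreover have "card (?f ` ?D) = card ?D"
    by (intro card_image) (auto simp: inj_on_def split: if_splits)
  ultimately have "card (?R (insert x X)) = card (?R X) + card ?D"
    using assms(1) by (simp add: card_Un_disjoint)
  moreover have "int (card ?D) = (\<Sum>b\<in>X. of_bool (x < b \<and> \<sigma> b < \<sigma> x \<or> b < x \<and> \<sigma> x < \<sigma> b))"
    using assms(1) by (rule card_eq_sum_of_bool)
  ultimately show ?thesis by (simp add: relabel_exponent_def)
qed

text \<open>For each pair of letters consider whether it is inverted before relabelling, whether it
  is inverted afterwards, and whether \<open>\<sigma>\<close> reverses the order of the two. Any two
  of these facts determine the third, and the number of those that hold is even.\<close>

lemma invs_map:
  assumes "distinct l" "inj_on \<sigma> (set l)"
  shows "even (invs (map \<sigma> l) + invs l + relabel_exponent \<sigma> (set l))"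
  using assms
proof (induction l)
  case (Cons x l)
  have "(\<Sum>y\<in>\<sigma> ` set l. of_bool (y < \<sigma> x)) = (\<Sum>b\<in>set l. of_bool (\<sigma> b < \<sigma> x) :: int)"
    using Cons.prems by (subst sum.reindex) auto
  moreover have "even (\<Sum>b\<in>set l. of_bool (\<sigma> b < \<sigma> x) + of_bool (b < x) +
     (of_bool (x < b \<and> \<sigma> b < \<sigma> x \<or> b < x \<and> \<sigma> x < \<sigma> b) :: int))"
  proof (rule dvd_sum)
    fix b assume "b \<in> set l"
    then have "b \<noteq> x" "\<sigma> b \<noteq> \<sigma> x" using Cons.prems by (auto simp: image_iff dest: sym)
    then consider "b < x" "\<sigma> b < \<sigma> x" | "b < x" "\<sigma> x < \<sigma> b" | "x < b" "\<sigma> b < \<sigma> x" | "x < b" "\<sigma> x < \<sigma> b"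
      by linarith
    then show "even (of_bool (\<sigma> b < \<sigma> x) + of_bool (b < x) +
       (of_bool (x < b \<and> \<sigma> b < \<sigma> x \<or> b < x \<and> \<sigma> x < \<sigma> b) :: int))"
      by cases auto
  qed
  moreover have "even (invs (map \<sigma> l) + invs l + relabel_exponent \<sigma> (set l))"
    using Cons by auto
  ultimately show ?case
    using Cons.prems by (simp add: relabel_exponent_insert sum.distrib) presburger
qed (simp add: relabel_exponent_def)

text \<open>The sign of \<open>\<epsilon>\<^sub>S \<circ>\<^sub>s \<epsilon>\<^sub>T\<close> in terms of words: if \<open>s\<close> is the last letter of the word of \<open>S\<close>, then
  \<open>\<epsilon>\<^sub>T\<close> moves past \<open>|S| - 1\<close> factors.\<close>

lemma pcomp_exponent_invs:
  assumes "distinct l" "set l = S - {s}" "s \<in> S" "distinct l'" "set l' = T" "(S - {s}) \<inter> T = {}"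
  shows "even (pcomp_exponent S s T + invs (l @ l') + invs (l @ [s]) + invs l' +
    (int (card S) - 1) * (int (card T) - 1))"
proof -
  define A where "A = S - {s}"
  have fin: "finite A" "finite T" using assms(2,5) by (auto simp: A_def simp flip: assms(2))
  then have "finite S" by (simp add: A_def)
  have cS: "int (card S) - 1 = int (card A)"
    using card_Suc_Diff1[OF \<open>finite S\<close> assms(3)] by (simp add: A_def del: card_Diff_insert)
  have "{a\<in>S. a < s} = {a\<in>A. a < s}" by (auto simp: A_def)
  then have 1: "int (card {a\<in>S. a < s}) = (\<Sum>a\<in>A. of_bool (a < s))"
    using fin by (simp add: card_eq_sum_of_bool)
  have "{(a,t). a \<in> S - {s} \<and> t \<in> T \<and> (a < s \<and> t < a \<or> s < a \<and> a < t)} =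
    Sigma A (\<lambda>a. {t\<in>T. a < s \<and> t < a \<or> s < a \<and> a < t})" by (auto simp: A_def)
  then have 2: "int (card {(a,t). a \<in> S - {s} \<and> t \<in> T \<and> (a < s \<and> t < a \<or> s < a \<and> a < t)}) =
     (\<Sum>a\<in>A. \<Sum>t\<in>T. of_bool (a < s \<and> t < a \<or> s < a \<and> a < t))"
    using fin by (simp add: card_eq_sum_of_bool del: of_bool_or_iff)
  \<comment> \<open>The contribution of each single letter \<open>a\<close> is even already. If
    \<open>a < s\<close>, every term occurs twice; if \<open>s < a\<close>, the letters of
    \<open>T\<close> above and below \<open>a\<close> together number \<open>card T\<close>, and
    what is left is \<open>1 + (card T - 1)\<close>.\<close>
  have "even (\<Sum>a\<in>A. of_bool (a < s) * (int (card T) - 1)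
     + (\<Sum>t\<in>T. of_bool (a < s \<and> t < a \<or> s < a \<and> a < t)) + (\<Sum>t\<in>T. of_bool (t < a)) + of_bool (s < a)
     + (int (card T) - 1))"
  proof (rule dvd_sum)
    fix a assume a: "a \<in> A"
    have "a \<noteq> t" if "t \<in> T" for t using that a assms(6) by (auto simp: A_def)
    then have "(\<Sum>t\<in>T. of_bool (a < t)) + (\<Sum>t\<in>T. of_bool (t < a)) = (\<Sum>t\<in>T. 1 :: int)"
      unfolding sum.distrib[symmetric] by (intro sum.cong refl) (auto simp: of_bool_def)
    then have *: "(\<Sum>t\<in>T. of_bool (a < t)) + (\<Sum>t\<in>T. of_bool (t < a)) = int (card T)" by simp
    show "even (of_bool (a < s) * (int (card T) - 1)
     + (\<Sum>t\<in>T. of_bool (a < s \<and> t < a \<or> s < a \<and> a < t)) + (\<Sum>t\<in>T. of_bool (t < a)) + of_bool (s < a)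
     + (int (card T) - 1))"
    proof (cases "a < s")
      case False
      then have "s < a" using a by (auto simp: A_def)
      then show ?thesis using * by simp
    qed simp
  qed
  moreover have "invs (l @ l') = invs l + invs l' + (\<Sum>a\<in>A. \<Sum>t\<in>T. of_bool (t < a))"
    using assms by (subst invs_append) (auto simp: crossings_def A_def)
  moreover have "invs (l @ [s]) = invs l + (\<Sum>a\<in>A. of_bool (s < a))"
    using assms by (subst invs_append) (auto simp: crossings_def A_def)
  ultimately show ?thesis
    unfolding pcomp_exponent_def 1 2 cS by (simp add: sum.distrib flip: sum_distrib_right) presburger
qed

section \<open>Parity identities for the signs of the desuspension\<close>

lemma obtain_word:
  assumes "finite S"
  obtains l where "distinct l" "set l = S"
  using assms finite_distinct_list by blast

text \<open>Arity minus one is additive under composition. This makes the degree shift of the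
  desuspension compatible with composition.\<close>

lemma card_plug:
  assumes "composable S s T"
  shows "int (card (plug S s T)) - 1 = (int (card S) - 1) + (int (card T) - 1)"
proof -
  have "card (plug S s T) = card (S - {s}) + card T"
    unfolding plug_def using assms by (intro card_Un_disjoint) (auto simp: composable_def label_set_def)
  moreover have "card S = Suc (card (S - {s}))"
    using composableD[OF assms] by (simp only: card_Suc_Diff1)
  ultimately show ?thesis by simp
qed

text \<open>Take any word of \<open>S\<close>: relabelling it by \<open>\<sigma>\<close> and then by
  \<open>\<tau>\<close> gives the same word as relabelling it at once, so the inversion numbers
  telescope.\<close>

lemma relabel_exponent_comp:
  assumes "finite S" "inj_on \<sigma> S" "inj_on \<tau> (\<sigma> ` S)"
  shows "even (relabel_exponent (\<tau> \<circ> \<sigma>) S + relabel_exponent \<sigma> S + relabel_exponent \<tau> (\<sigma> ` S))"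
proof -
  obtain l where l: "distinct l" "set l = S" using obtain_word assms(1) by blast
  show ?thesis
    using invs_map[of l \<sigma>] invs_map[of "map \<sigma> l" \<tau>] invs_map[of l "\<tau> \<circ> \<sigma>"] l assms
    by (simp add: distinct_map comp_inj_on) presburger
qed

lemma pcomp_exponent_relabel:
  assumes "composable S s T" "inj_on \<sigma> S" "inj_on \<tau> T" "composable (\<sigma> ` S) (\<sigma> s) (\<tau> ` T)"
    and f: "inj_on f (plug S s T)" "\<And>a. a \<in> T \<Longrightarrow> f a = \<tau> a" "\<And>a. a \<in> S - {s} \<Longrightarrow> f a = \<sigma> a"
  shows "even (relabel_exponent f (plug S s T) + pcomp_exponent S s T +
    relabel_exponent \<sigma> S + relabel_exponent \<tau> T + pcomp_exponent (\<sigma> ` S) (\<sigma> s) (\<tau> ` T))"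
proof -
  note c = composableD[OF assms(1)]
  obtain l where l: "distinct l" "set l = S - {s}"
    using obtain_word[OF finite_Diff[OF c(3)]] by metis
  obtain l' where l': "distinct l'" "set l' = T" using obtain_word[OF c(4)] by metis
  have m: "map f (l @ l') = map \<sigma> l @ map \<tau> l'" using f l l' by auto
  have S: "set (l @ [s]) = S" "set (l @ l') = plug S s T" using l l' c(5) by (auto simp: plug_def)
  have d: "distinct (l @ [s])" "distinct (l @ l')" using l l' c(7) by auto
  have "inj_on \<sigma> (set l)" using l inj_on_subset[OF assms(2)] by auto
  then have "distinct (map \<sigma> l)" "distinct (map \<tau> l')" using l l' assms(3) by (simp_all add: distinct_map)
  moreover have "set (map \<sigma> l) = \<sigma> ` S - {\<sigma> s}"
    using l c(5) inj_on_image_set_diff[OF assms(2), of S "{s}"] by simp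
  ultimately have "even (pcomp_exponent (\<sigma> ` S) (\<sigma> s) (\<tau> ` T) + invs (map f (l @ l'))
      + invs (map \<sigma> (l @ [s])) + invs (map \<tau> l') + (int (card S) - 1) * (int (card T) - 1))"
    using pcomp_exponent_invs[of "map \<sigma> l" "\<sigma> ` S" "\<sigma> s" "map \<tau> l'" "\<tau> ` T"] l' c(5)
      composableD(7)[OF assms(4)] card_image[OF assms(2)] card_image[OF assms(3)]
    unfolding m by simp
  moreover have "even (invs (map \<sigma> (l @ [s])) + invs (l @ [s]) + relabel_exponent \<sigma> S)"
    using invs_map[OF d(1), of \<sigma>] assms(2) unfolding S by blast
  moreover have "even (invs (map f (l @ l')) + invs (l @ l') + relabel_exponent f (plug S s T))"
    using invs_map[OF d(2), of f] f(1) unfolding S by blast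
  moreover have "even (invs (map \<tau> l') + invs l' + relabel_exponent \<tau> T)"
    using invs_map[OF l'(1), of \<tau>] assms(3) unfolding l'(2) by blast
  ultimately show ?thesis
    using pcomp_exponent_invs[OF l c(5) l' c(7)] unfolding even_add by argo
qed

lemma pcomp_exponent_unit_left: "even (pcomp_exponent {s} s T)"
proof -
  have "{(a, t). a \<in> {s} - {s} \<and> t \<in> T \<and> (a < s \<and> t < a \<or> s < a \<and> a < t)} = {}" by auto
  moreover have "{a \<in> {s}. a < s} = {}" by auto
  ultimately show ?thesis unfolding pcomp_exponent_def by (simp only: card.empty) simp
qed

lemma pcomp_exponent_unit_right:
  assumes "composable S s {t}"
  shows "even (pcomp_exponent S s {t} + relabel_exponent (id(s := t)) S)"
proof -
  note c = composableD[OF assms]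
  obtain l where l: "distinct l" "set l = S - {s}"
    using obtain_word[OF finite_Diff[OF c(3)]] by metis
  have "map (id(s := t)) (l @ [s]) = l @ [t]" using l by (auto intro: map_idI)
  moreover have "inj_on (id(s := t)) (set (l @ [s]))" using l c(7) by (auto simp: inj_on_def)
  moreover have "set (l @ [s]) = S" using l c(5) by auto
  ultimately show ?thesis
    using pcomp_exponent_invs[OF l c(5), of "[t]" "{t}"] invs_map[of "l @ [s]" "id(s := t)"] l c(7)
    by simp presburger
qed

text \<open>With the words \<open>l @ [s]\<close>, \<open>l' @ [t]\<close> and \<open>r\<close> of
  \<open>S\<close>, \<open>T\<close> and \<open>R\<close>, both bracketings lead to the word
  \<open>l @ l' @ r\<close>. In the total every inversion number occurs twice, and the products of
  degrees cancel because arity minus one is additive.\<close>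

lemma pcomp_exponent_sequential:
  assumes "composable S s T" "composable T t R" "(S - {s}) \<inter> R = {}"
  shows "even (pcomp_exponent S s T + pcomp_exponent (plug S s T) t R +
    pcomp_exponent T t R + pcomp_exponent S s (plug T t R))"
proof -
  note c = composableD[OF assms(1)] and c' = composableD[OF assms(2)]
  obtain l where l: "distinct l" "set l = S - {s}"
    using obtain_word[OF finite_Diff[OF c(3)]] by metis
  obtain l' where l': "distinct l'" "set l' = T - {t}"
    using obtain_word[OF finite_Diff[OF c(4)]] by metis
  obtain r where r: "distinct r" "set r = R" using obtain_word[OF c'(4)] by metis
  have 1: "even (pcomp_exponent S s T + invs (l @ l' @ [t]) + invs (l @ [s]) + invs (l' @ [t]) +
      (int (card S) - 1) * (int (card T) - 1))"
    using l l' c c' by (intro pcomp_exponent_invs) auto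
  have 2: "even (pcomp_exponent (plug S s T) t R + invs ((l @ l') @ r) + invs ((l @ l') @ [t]) + invs r +
      (int (card (plug S s T)) - 1) * (int (card R) - 1))"
    using l l' r c c' assms(3) by (intro pcomp_exponent_invs) (auto simp: plug_def)
  have 3: "even (pcomp_exponent T t R + invs (l' @ r) + invs (l' @ [t]) + invs r +
      (int (card T) - 1) * (int (card R) - 1))"
    using l l' r c c' by (intro pcomp_exponent_invs) auto
  have 4: "even (pcomp_exponent S s (plug T t R) + invs (l @ l' @ r) + invs (l @ [s]) + invs (l' @ r) +
      (int (card S) - 1) * (int (card (plug T t R)) - 1))"
    using l l' r c c' assms(3) by (intro pcomp_exponent_invs) (auto simp: plug_def)
  show ?thesis
    using 1 2 3 4 unfolding card_plug[OF assms(1)] card_plug[OF assms(2)] distrib_left distrib_right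
    by (simp only: even_add append_assoc) argo
qed

text \<open>\<open>pcomp_exponent_invs\<close> reads the sign off words in which the replaced letter
  stands last, which is impossible for \<open>s\<close> and \<open>r\<close> at once. So the words
  of the two orders of composition differ by exchanges of adjacent blocks, whose signs are
  known.\<close>

lemma pcomp_exponent_parallel:
  assumes "composable S s T" "composable S r R" "s \<noteq> r" "T \<inter> R = {}"
  shows "even (pcomp_exponent S s T + pcomp_exponent (plug S s T) r R +
    pcomp_exponent S r R + pcomp_exponent (plug S r R) s T + (int (card T) - 1) * (int (card R) - 1))"
proof -
  note c = composableD[OF assms(1)] and c' = composableD[OF assms(2)]
  obtain l where l: "distinct l" "set l = S - {s, r}"
    using obtain_word[OF finite_Diff[OF c(3)]] by metis
  obtain l' where l': "distinct l'" "set l' = T" using obtain_word[OF c(4)] by metis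
  obtain k where k: "distinct k" "set k = R" using obtain_word[OF c'(4)] by metis
  have 1: "even (pcomp_exponent S s T + invs ((l @ [r]) @ l') + invs ((l @ [r]) @ [s]) + invs l' +
      (int (card S) - 1) * (int (card T) - 1))"
    using l l' c c' assms(3) by (intro pcomp_exponent_invs) auto
  have 2: "even (pcomp_exponent (plug S s T) r R + invs ((l @ l') @ k) + invs ((l @ l') @ [r]) + invs k +
      (int (card (plug S s T)) - 1) * (int (card R) - 1))"
    using l l' k c c' assms(3,4) by (intro pcomp_exponent_invs) (auto simp: plug_def)
  have 3: "even (pcomp_exponent S r R + invs ((l @ [s]) @ k) + invs ((l @ [s]) @ [r]) + invs k +
      (int (card S) - 1) * (int (card R) - 1))"
    using l k c c' assms(3) by (intro pcomp_exponent_invs) auto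
  have 4: "even (pcomp_exponent (plug S r R) s T + invs ((l @ k) @ l') + invs ((l @ k) @ [s]) + invs l' +
      (int (card (plug S r R)) - 1) * (int (card T) - 1))"
    using l l' k c c' assms(3,4) by (intro pcomp_exponent_invs) (auto simp: plug_def)
  have sT: "r \<notin> T" "s \<notin> R" using c c' assms(3) by auto
  have lk: "length l' = card T" "length k = card R" using l' k distinct_card by fastforce+
  \<comment> \<open>The four exchanges: \<open>T\<close> with \<open>R\<close>, \<open>r\<close>
    with \<open>T\<close>, \<open>s\<close> with \<open>R\<close>, and \<open>r\<close> with
    \<open>s\<close>.\<close>
  have 5: "even (invs (l @ l' @ k @ []) + invs (l @ k @ l' @ []) + int (card T) * int (card R))"
    using invs_swap[of l l' k "[]"] l l' k c c' assms(3,4) unfolding lk by auto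
  have 6: "even (invs (l @ [r] @ l' @ []) + invs (l @ l' @ [r] @ []) + int 1 * int (card T))"
    using invs_swap[of l "[r]" l' "[]"] l l' sT c unfolding lk by auto
  have 7: "even (invs (l @ [s] @ k @ []) + invs (l @ k @ [s] @ []) + int 1 * int (card R))"
    using invs_swap[of l "[s]" k "[]"] l k sT c' unfolding lk by auto
  have 8: "even (invs (l @ [r] @ [s] @ []) + invs (l @ [s] @ [r] @ []) + int 1 * int 1)"
    using invs_swap[of l "[r]" "[s]" "[]"] l assms(3) by auto
  show ?thesis
    using 1 2 3 4 5 6 7 8 unfolding card_plug[OF assms(1)] card_plug[OF assms(2)]
    by (cases "even (int (card S))"; cases "even (int (card T))"; cases "even (int (card R))";
      simp only: even_add even_mult_iff even_diff append_assoc append_Nil2 odd_one of_nat_1; argo)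
qed

section \<open>Desuspension of graded operads\<close>

abbreviation (input) desusp_degree :: "nat set \<Rightarrow> int \<Rightarrow> int" where
  "desusp_degree S d \<equiv> d - (int (card S) - 1)"

lemma desuspension_simps:
  "comp_module (desuspension P) S d = comp_module P S (desusp_degree S d)"
  "relabel (desuspension P) \<sigma> S d x = ksign (relabel_exponent \<sigma> S)
     \<odot>\<^bsub>comp_module P (\<sigma> ` S) (desusp_degree S d)\<^esub> relabel P \<sigma> S (desusp_degree S d) x"
  "pcomp (desuspension P) S s T d e x y =
     ksign (pcomp_exponent S s T + desusp_degree S d * (int (card T) - 1))
       \<odot>\<^bsub>comp_module P (plug S s T) (desusp_degree S d + desusp_degree T e)\<^esub>
     pcomp P S s T (desusp_degree S d) (desusp_degree T e) x y"
  "op_unit (desuspension P) = op_unit P"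
  by (simp_all add: desuspension_def Let_def)

lemma smult_linear:
  assumes M: "module base_ring M" and f: "f \<in> linear_maps L M"
  shows "(\<lambda>x. k \<odot>\<^bsub>M\<^esub> f x) \<in> linear_maps L M"
proof (rule linear_mapsI)
  interpret module base_ring M by fact
  note f = linear_mapsD[OF f]
  show "k \<odot>\<^bsub>M\<^esub> f x \<in> carrier M" if "x \<in> carrier L" for x using f that by simp
  show "k \<odot>\<^bsub>M\<^esub> f (x \<oplus>\<^bsub>L\<^esub> y) = k \<odot>\<^bsub>M\<^esub> f x \<oplus>\<^bsub>M\<^esub> k \<odot>\<^bsub>M\<^esub> f y"
    if "x \<in> carrier L" "y \<in> carrier L" for x y using f that by (simp add: smult_r_distr)
  show "k \<odot>\<^bsub>M\<^esub> f (l \<odot>\<^bsub>L\<^esub> x) = l \<odot>\<^bsub>M\<^esub> (k \<odot>\<^bsub>M\<^esub> f x)" if "x \<in> carrier L" for l x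
    using f[OF that] smult_assoc1[of k l "f x"] smult_assoc1[of l k "f x"] by (simp add: mult.commute)
qed

context pre_operad
begin

lemma ksign_smult:
  assumes "label_set S" "x \<in> carrier (comp_module P S d)"
  shows "ksign m \<odot>\<^bsub>comp_module P S d\<^esub> (ksign n \<odot>\<^bsub>comp_module P S d\<^esub> x) =
    ksign (m + n) \<odot>\<^bsub>comp_module P S d\<^esub> x"
proof -
  interpret module base_ring "comp_module P S d" using assms(1) by (rule comp_module_module)
  show ?thesis using smult_assoc1[of "ksign m" "ksign n" x] assms(2) by (simp add: ksign_mult)
qed

lemma smult_closed:
  assumes "label_set S" "x \<in> carrier (comp_module P S d)"
  shows "k \<odot>\<^bsub>comp_module P S d\<^esub> x \<in> carrier (comp_module P S d)"
proof -
  interpret module base_ring "comp_module P S d" using assms(1) by (rule comp_module_module)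
  show ?thesis using assms(2) by simp
qed

lemma ksign_even_smult:
  assumes "label_set S" "x \<in> carrier (comp_module P S d)" "even n"
  shows "ksign n \<odot>\<^bsub>comp_module P S d\<^esub> x = x"
proof -
  interpret module base_ring "comp_module P S d" using assms(1) by (rule comp_module_module)
  show ?thesis using smult_one[OF assms(2)] assms(3) by (simp add: ksign_def)
qed

lemma relabel_smult:
  "label_set S \<Longrightarrow> inj_on \<sigma> S \<Longrightarrow> x \<in> carrier (comp_module P S d) \<Longrightarrow>
   relabel P \<sigma> S d (k \<odot>\<^bsub>comp_module P S d\<^esub> x)
   = k \<odot>\<^bsub>comp_module P (\<sigma> ` S) d\<^esub> relabel P \<sigma> S d x"
  by (rule linear_mapsD(3)[OF relabel_linear])

lemma pcomp_smult_left:
  "composable S s T \<Longrightarrow> x \<in> carrier (comp_module P S d) \<Longrightarrow> y \<in> carrier (comp_module P T e) \<Longrightarrow>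
   pcomp P S s T d e (k \<odot>\<^bsub>comp_module P S d\<^esub> x) y
   = k \<odot>\<^bsub>comp_module P (plug S s T) (d + e)\<^esub> pcomp P S s T d e x y"
  by (rule linear_mapsD(3)[OF pcomp_linear_left])

lemma pcomp_smult_right:
  "composable S s T \<Longrightarrow> x \<in> carrier (comp_module P S d) \<Longrightarrow> y \<in> carrier (comp_module P T e) \<Longrightarrow>
   pcomp P S s T d e x (k \<odot>\<^bsub>comp_module P T e\<^esub> y)
   = k \<odot>\<^bsub>comp_module P (plug S s T) (d + e)\<^esub> pcomp P S s T d e x y"
  by (rule linear_mapsD(3)[OF pcomp_linear_right])

end

lemma composable_sequential:
  assumes "composable S s T" "composable T t R" "(S - {s}) \<inter> R = {}"
  shows "composable (plug S s T) t R" "composable S s (plug T t R)"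
    "plug (plug S s T) t R = plug S s (plug T t R)"
  using assms by (auto simp: composable_def plug_def label_set_def)

lemma composable_parallel:
  assumes "composable S s T" "composable S r R" "s \<noteq> r" "T \<inter> R = {}"
  shows "composable (plug S s T) r R" "composable (plug S r R) s T"
    "plug (plug S r R) s T = plug (plug S s T) r R"
  using assms by (auto simp: composable_def plug_def label_set_def)

lemma composable_unit_left: "label_set T \<Longrightarrow> composable {s} s T" "plug {s} s T = T"
  by (auto simp: composable_def plug_def)

lemma composable_unit_right:
  assumes "composable S s {t}"
  shows "inj_on (id(s := t)) S" "id(s := t) ` S = plug S s {t}"
  using assms by (auto simp: composable_def inj_on_def plug_def)

lemma desusp_degree_plug:
  "composable S s T \<Longrightarrow> desusp_degree (plug S s T) (d + e) = desusp_degree S d + desusp_degree T e"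
  using card_plug by (simp add: algebra_simps)

text \<open>Every axiom is the one of \<open>P\<close> with the signs pulled out of the operations
  by linearity. It remains to see that the total exponents of both sides have the same parity, which
  the identities for \<open>relabel_exponent\<close> and \<open>pcomp_exponent\<close>
  provide.\<close>

lemma graded_operad_desuspension:
  assumes "graded_operad P"
  shows "graded_operad (desuspension P)"
proof -
  interpret graded_operad P by fact
  interpret P: pre_operad P using assms by (rule graded_operad_pre_operad)
  show ?thesis
  proof (rule graded_operad.intro, unfold desuspension_simps)
    fix S T R :: "nat set" and s t r :: nat and d e f :: int and \<sigma> \<tau> :: "nat \<Rightarrow> nat" and x y z
    let ?d = "desusp_degree S d" and ?e = "desusp_degree T e" and ?f = "desusp_degree R f"
    show "module base_ring (comp_module P S ?d)" if "label_set S"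
      using that by (rule comp_module_module)
    show "(\<lambda>x. ksign (relabel_exponent \<sigma> S) \<odot>\<^bsub>comp_module P (\<sigma> ` S) ?d\<^esub> relabel P \<sigma> S ?d x)
      \<in> linear_maps (comp_module P S ?d) (comp_module P (\<sigma> ` S) (desusp_degree (\<sigma> ` S) d))"
      if "label_set S" "inj_on \<sigma> S"
      unfolding card_image[OF that(2)]
      by (rule smult_linear[OF comp_module_module[OF label_set_image[OF that(1)]] relabel_linear[OF that]])
    show "ksign (relabel_exponent \<sigma> S) \<odot>\<^bsub>comp_module P (\<sigma> ` S) ?d\<^esub> relabel P \<sigma> S ?d x =
        ksign (relabel_exponent \<tau> S) \<odot>\<^bsub>comp_module P (\<tau> ` S) ?d\<^esub> relabel P \<tau> S ?d x"
      if A: "label_set S" "inj_on \<sigma> S" "\<And>s. s \<in> S \<Longrightarrow> \<sigma> s = \<tau> s" "x \<in> carrier (comp_module P S ?d)"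
    proof -
      have "\<sigma> ` S = \<tau> ` S" using A(3) by (rule image_cong[OF refl])
      moreover have "relabel_exponent \<sigma> S = relabel_exponent \<tau> S"
        using A(3) unfolding relabel_exponent_def by (intro arg_cong[of _ _ "\<lambda>A. int (card A)"]) auto
      ultimately show ?thesis using relabel_cong[OF A] by simp
    qed
    show "ksign (relabel_exponent id S) \<odot>\<^bsub>comp_module P (id ` S) ?d\<^esub> relabel P id S ?d x = x"
      if A: "label_set S" "x \<in> carrier (comp_module P S ?d)"
    proof -
      have "{(a, b). a \<in> S \<and> b \<in> S \<and> a < b \<and> id b < id a} = {}" by auto
      then have "relabel_exponent id S = 0" unfolding relabel_exponent_def by (simp only: card.empty of_nat_0)
      then show ?thesis using P.ksign_even_smult[OF A, of 0] relabel_id[OF A] by simp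
    qed
    show "ksign (relabel_exponent (\<tau> \<circ> \<sigma>) S) \<odot>\<^bsub>comp_module P ((\<tau> \<circ> \<sigma>) ` S) ?d\<^esub> relabel P (\<tau> \<circ> \<sigma>) S ?d x =
      ksign (relabel_exponent \<tau> (\<sigma> ` S)) \<odot>\<^bsub>comp_module P (\<tau> ` \<sigma> ` S) (desusp_degree (\<sigma> ` S) d)\<^esub>
      relabel P \<tau> (\<sigma> ` S) (desusp_degree (\<sigma> ` S) d)
       (ksign (relabel_exponent \<sigma> S) \<odot>\<^bsub>comp_module P (\<sigma> ` S) ?d\<^esub> relabel P \<sigma> S ?d x)"
      if A: "label_set S" "inj_on \<sigma> S" "inj_on \<tau> (\<sigma> ` S)" "x \<in> carrier (comp_module P S ?d)"
    proof -
      note x = P.relabel_closed[OF A(1,2,4)] and L = label_set_image[OF A(1), of \<sigma>]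
      have "finite S" using A(1) by (simp add: label_set_def)
      then have "ksign (relabel_exponent (\<tau> \<circ> \<sigma>) S)
          = (ksign (relabel_exponent \<tau> (\<sigma> ` S) + relabel_exponent \<sigma> S) :: 'a)"
        using relabel_exponent_comp[OF _ A(2,3)] by (intro ksign_cong) (simp add: ac_simps)
      then show ?thesis
        unfolding card_image[OF A(2)] image_comp[symmetric]
        by (simp add: relabel_comp[OF A] P.relabel_smult[OF L A(3) x] P.relabel_closed[OF L A(3) x]
            P.ksign_smult label_set_image A(1))
    qed
    show "(\<lambda>x. ksign (pcomp_exponent S s T + ?d * (int (card T) - 1))
        \<odot>\<^bsub>comp_module P (plug S s T) (?d + ?e)\<^esub> pcomp P S s T ?d ?e x y)
      \<in> linear_maps (comp_module P S ?d) (comp_module P (plug S s T) (desusp_degree (plug S s T) (d + e)))"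
      if "composable S s T" "y \<in> carrier (comp_module P T ?e)"
      unfolding desusp_degree_plug[OF that(1)]
      by (rule smult_linear[OF P.comp_module_plug_module[OF that(1)] pcomp_linear_left[OF that]])
    show "(\<lambda>y. ksign (pcomp_exponent S s T + ?d * (int (card T) - 1))
        \<odot>\<^bsub>comp_module P (plug S s T) (?d + ?e)\<^esub> pcomp P S s T ?d ?e x y)
      \<in> linear_maps (comp_module P T ?e) (comp_module P (plug S s T) (desusp_degree (plug S s T) (d + e)))"
      if "composable S s T" "x \<in> carrier (comp_module P S ?d)"
      unfolding desusp_degree_plug[OF that(1)]
      by (rule smult_linear[OF P.comp_module_plug_module[OF that(1)] pcomp_linear_right[OF that]])
    show "ksign (relabel_exponent (\<lambda>a. if a \<in> T then \<tau> a else \<sigma> a) (plug S s T))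
         \<odot>\<^bsub>comp_module P ((\<lambda>a. if a \<in> T then \<tau> a else \<sigma> a) ` plug S s T) (desusp_degree (plug S s T) (d + e))\<^esub>
        relabel P (\<lambda>a. if a \<in> T then \<tau> a else \<sigma> a) (plug S s T) (desusp_degree (plug S s T) (d + e))
         (ksign (pcomp_exponent S s T + ?d * (int (card T) - 1))
           \<odot>\<^bsub>comp_module P (plug S s T) (?d + ?e)\<^esub> pcomp P S s T ?d ?e x y) =
        ksign (pcomp_exponent (\<sigma> ` S) (\<sigma> s) (\<tau> ` T) +
            desusp_degree (\<sigma> ` S) d * (int (card (\<tau> ` T)) - 1))
         \<odot>\<^bsub>comp_module P (plug (\<sigma> ` S) (\<sigma> s) (\<tau> ` T)) (desusp_degree (\<sigma> ` S) d + desusp_degree (\<tau> ` T) e)\<^esub>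
        pcomp P (\<sigma> ` S) (\<sigma> s) (\<tau> ` T) (desusp_degree (\<sigma> ` S) d) (desusp_degree (\<tau> ` T) e)
         (ksign (relabel_exponent \<sigma> S) \<odot>\<^bsub>comp_module P (\<sigma> ` S) ?d\<^esub> relabel P \<sigma> S ?d x)
         (ksign (relabel_exponent \<tau> T) \<odot>\<^bsub>comp_module P (\<tau> ` T) ?e\<^esub> relabel P \<tau> T ?e y)"
      if A: "composable S s T" "inj_on \<sigma> S" "inj_on \<tau> T" "composable (\<sigma> ` S) (\<sigma> s) (\<tau> ` T)"
        "x \<in> carrier (comp_module P S ?d)" "y \<in> carrier (comp_module P T ?e)"
    proof -
      let ?g = "\<lambda>a. if a \<in> T then \<tau> a else \<sigma> a"
      note c = composableD(1,2)[OF A(1)]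
      note x = P.relabel_closed[OF c(1) A(2,5)] and y = P.relabel_closed[OF c(2) A(3,6)]
      note xy = P.pcomp_closed[OF A(1,5,6)] and g = plug_relabel[OF A(1-4)]
      note lp = label_set_plug[OF A(1)] and lp' = label_set_plug[OF A(4)]
      have "even (relabel_exponent ?g (plug S s T) + pcomp_exponent S s T +
        relabel_exponent \<sigma> S + relabel_exponent \<tau> T + pcomp_exponent (\<sigma> ` S) (\<sigma> s) (\<tau> ` T))"
        using composableD(7)[OF A(1)] by (intro pcomp_exponent_relabel[OF A(1-4) g(1)]) auto
      then have "ksign (relabel_exponent ?g (plug S s T) + (pcomp_exponent S s T + ?d * (int (card T) - 1))) =
          (ksign (pcomp_exponent (\<sigma> ` S) (\<sigma> s) (\<tau> ` T) + ?d * (int (card T) - 1)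
            + (relabel_exponent \<sigma> S + relabel_exponent \<tau> T)) :: 'a)"
        by (intro ksign_cong) (simp only: even_add; argo)
      then show ?thesis
        unfolding desusp_degree_plug[OF A(1)] card_image[OF A(2)] card_image[OF A(3)] g(2)
        by (simp only: P.relabel_smult[OF lp g(1) xy, unfolded g(2)] pcomp_relabel[OF A]
            P.pcomp_smult_left[OF A(4) x P.smult_closed[OF label_set_image[OF c(2)] y]]
            P.pcomp_smult_right[OF A(4) x y] P.ksign_smult[OF lp' P.pcomp_closed[OF A(4) x y]])
    qed
    show "op_unit P s \<in> carrier (comp_module P {s} (desusp_degree {s} 0))"
      using op_unit_closed by simp
    show "ksign (relabel_exponent \<sigma> {s}) \<odot>\<^bsub>comp_module P (\<sigma> ` {s}) (desusp_degree {s} 0)\<^esub>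
        relabel P \<sigma> {s} (desusp_degree {s} 0) (op_unit P s) = op_unit P (\<sigma> s)"
    proof -
      have "{(a, b). a \<in> {s} \<and> b \<in> {s} \<and> a < b \<and> \<sigma> b < \<sigma> a} = {}" by auto
      then have "relabel_exponent \<sigma> {s} = 0" unfolding relabel_exponent_def by (simp only: card.empty of_nat_0)
      then show ?thesis using relabel_op_unit[of \<sigma> s] P.ksign_even_smult[of "{\<sigma> s}" _ 0 0] op_unit_closed by simp
    qed
    show "ksign (pcomp_exponent {s} s T + desusp_degree {s} 0 * (int (card T) - 1))
         \<odot>\<^bsub>comp_module P (plug {s} s T) (desusp_degree {s} 0 + ?e)\<^esub>
        pcomp P {s} s T (desusp_degree {s} 0) ?e (op_unit P s) y = y"
      if A: "label_set T" "y \<in> carrier (comp_module P T ?e)"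
      using P.ksign_even_smult[OF A pcomp_exponent_unit_left] op_unit_left[OF A]
      by (simp add: composable_unit_left)
    show "ksign (pcomp_exponent S s {t} + ?d * (int (card {t}) - 1))
         \<odot>\<^bsub>comp_module P (plug S s {t}) (?d + desusp_degree {t} 0)\<^esub>
        pcomp P S s {t} ?d (desusp_degree {t} 0) x (op_unit P t) =
        ksign (relabel_exponent (id(s := t)) S) \<odot>\<^bsub>comp_module P (id(s := t) ` S) ?d\<^esub>
        relabel P (id(s := t)) S ?d x"
      if A: "composable S s {t}" "x \<in> carrier (comp_module P S ?d)"
      using ksign_cong[OF pcomp_exponent_unit_right[OF A(1)], where ?'a = 'a] op_unit_right[OF A]
      unfolding composable_unit_right(2)[OF A(1)] by simp
    show "ksign (pcomp_exponent (plug S s T) t R + desusp_degree (plug S s T) (d + e) * (int (card R) - 1))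
         \<odot>\<^bsub>comp_module P (plug (plug S s T) t R) (desusp_degree (plug S s T) (d + e) + ?f)\<^esub>
        pcomp P (plug S s T) t R (desusp_degree (plug S s T) (d + e)) ?f
         (ksign (pcomp_exponent S s T + ?d * (int (card T) - 1))
           \<odot>\<^bsub>comp_module P (plug S s T) (?d + ?e)\<^esub> pcomp P S s T ?d ?e x y) z =
        ksign (pcomp_exponent S s (plug T t R) + ?d * (int (card (plug T t R)) - 1))
         \<odot>\<^bsub>comp_module P (plug S s (plug T t R)) (?d + desusp_degree (plug T t R) (e + f))\<^esub>
        pcomp P S s (plug T t R) ?d (desusp_degree (plug T t R) (e + f)) x
         (ksign (pcomp_exponent T t R + ?e * (int (card R) - 1))
           \<odot>\<^bsub>comp_module P (plug T t R) (?e + ?f)\<^esub> pcomp P T t R ?e ?f y z)"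
      if A: "composable S s T" "composable T t R" "(S - {s}) \<inter> R = {}"
        "x \<in> carrier (comp_module P S ?d)" "y \<in> carrier (comp_module P T ?e)"
        "z \<in> carrier (comp_module P R ?f)"
    proof -
      note B = composable_sequential[OF A(1-3)]
      note xy = P.pcomp_closed[OF A(1,4,5)] and yz = P.pcomp_closed[OF A(2,5,6)]
      note u = P.pcomp_closed[OF B(1) xy A(6)] and v = P.pcomp_closed[OF B(2) A(4) yz]
      note lp = label_set_plug[OF B(2)]
      have "ksign (pcomp_exponent (plug S s T) t R + (?d + ?e) * (int (card R) - 1) +
           (pcomp_exponent S s T + ?d * (int (card T) - 1))) =
          (ksign (pcomp_exponent S s (plug T t R) + ?d * (int (card (plug T t R)) - 1) +
           (pcomp_exponent T t R + ?e * (int (card R) - 1))) :: 'a)"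
        using pcomp_exponent_sequential[OF A(1-3)] unfolding card_plug[OF A(2)] distrib_left distrib_right
        by (intro ksign_cong) (simp only: even_add; argo)
      then show ?thesis
        unfolding desusp_degree_plug[OF A(1)] desusp_degree_plug[OF A(2)]
        by (simp only: P.pcomp_smult_left[OF B(1) xy A(6)] P.pcomp_smult_right[OF B(2) A(4) yz]
            P.ksign_smult[OF lp v] B(3) sequential_assoc[OF A] add.assoc)
    qed
    show "ksign (pcomp_exponent (plug S s T) r R + desusp_degree (plug S s T) (d + e) * (int (card R) - 1))
         \<odot>\<^bsub>comp_module P (plug (plug S s T) r R) (desusp_degree (plug S s T) (d + e) + ?f)\<^esub>
        pcomp P (plug S s T) r R (desusp_degree (plug S s T) (d + e)) ?f
         (ksign (pcomp_exponent S s T + ?d * (int (card T) - 1))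
           \<odot>\<^bsub>comp_module P (plug S s T) (?d + ?e)\<^esub> pcomp P S s T ?d ?e x y) z =
        ksign (e * f) \<odot>\<^bsub>comp_module P (plug (plug S s T) r R) (desusp_degree (plug (plug S s T) r R) (d + e + f))\<^esub>
        (ksign (pcomp_exponent (plug S r R) s T + desusp_degree (plug S r R) (d + f) * (int (card T) - 1))
         \<odot>\<^bsub>comp_module P (plug (plug S r R) s T) (desusp_degree (plug S r R) (d + f) + ?e)\<^esub>
        pcomp P (plug S r R) s T (desusp_degree (plug S r R) (d + f)) ?e
         (ksign (pcomp_exponent S r R + ?d * (int (card R) - 1))
           \<odot>\<^bsub>comp_module P (plug S r R) (?d + ?f)\<^esub> pcomp P S r R ?d ?f x z) y)"
      if A: "composable S s T" "composable S r R" "s \<noteq> r" "T \<inter> R = {}"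
        "x \<in> carrier (comp_module P S ?d)" "y \<in> carrier (comp_module P T ?e)"
        "z \<in> carrier (comp_module P R ?f)"
    proof -
      note B = composable_parallel[OF A(1-4)]
      note xy = P.pcomp_closed[OF A(1,5,6)] and xz = P.pcomp_closed[OF A(2,5,7)]
      note u = P.pcomp_closed[OF B(1) xy A(7)] and v' = P.pcomp_closed[OF B(2) xz A(6), unfolded B(3)]
      have deg: "?d + ?f + ?e = ?d + ?e + ?f" by simp
      note v = v'[unfolded deg] and lp = label_set_plug[OF B(1)]
      \<comment> \<open>\<open>e\<close> and \<open>f\<close> are degrees in the desuspension, so
        each is an internal degree plus the degree of an \<epsilon>. In the expanded product, the
        internal degrees give the sign of the axiom in \<open>P\<close>, the degrees of the two
        \<epsilon> give the sign in \<open>pcomp_exponent_parallel\<close>, and the mixed terms are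
        the Koszul signs of the definition.\<close>
      have ef: "e * f = (?e + (int (card T) - 1)) * (?f + (int (card R) - 1))" by (simp add: algebra_simps)
      have "even (pcomp_exponent S s T + pcomp_exponent (plug S s T) r R +
        pcomp_exponent S r R + pcomp_exponent (plug S r R) s T + (int (card T) - 1) * (int (card R) - 1))"
        by (rule pcomp_exponent_parallel[OF A(1-4)])
      then have "ksign (pcomp_exponent (plug S s T) r R + (?d + ?e) * (int (card R) - 1) +
           (pcomp_exponent S s T + ?d * (int (card T) - 1) + ?e * ?f)) =
          (ksign (e * f + (pcomp_exponent (plug S r R) s T + (?d + ?f) * (int (card T) - 1) +
           (pcomp_exponent S r R + ?d * (int (card R) - 1)))) :: 'a)"
        unfolding ef distrib_left distrib_right
        by (intro ksign_cong) (simp only: even_add mult.commute[of ?f]; argo)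
      then show ?thesis
        unfolding desusp_degree_plug[OF A(1)] desusp_degree_plug[OF A(2)] desusp_degree_plug[OF B(1)] B(3) deg
        by (simp only: P.pcomp_smult_left[OF B(1) xy A(7)] P.pcomp_smult_left[OF B(2) xz A(6), unfolded B(3) deg]
            P.ksign_smult[OF lp v[unfolded add.assoc]] parallel_assoc[OF A] add.assoc)
    qed
  qed
qed

lemma operad_iso_desuspension:
  assumes "operad_iso P Q F"
  shows "operad_iso (desuspension P) (desuspension Q) (\<lambda>S d. F S (desusp_degree S d))"
proof -
  note iso = assms[unfolded operad_iso_iff]
  have hom: "operad_hom P Q F" and P: "graded_operad P" and Q: "graded_operad Q" using iso by simp_all
  interpret P: pre_operad P using P by (rule graded_operad_pre_operad)
  note F = operad_homD[OF hom]
  have sm: "F S d (k \<odot>\<^bsub>comp_module P S d\<^esub> x) = k \<odot>\<^bsub>comp_module Q S d\<^esub> F S d x"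
    if "label_set S" "x \<in> carrier (comp_module P S d)" for S d k x
    using linear_mapsD(3)[OF F(1)[OF that(1)] that(2)] .
  have "operad_hom (desuspension P) (desuspension Q) (\<lambda>S d. F S (desusp_degree S d))"
    by (rule operad_homI)
      (simp_all only: desuspension_simps desusp_degree_plug card_image F sm label_set_image label_set_plug
        P.relabel_closed P.pcomp_closed, simp add: F)
  then show ?thesis
    using iso graded_operad_desuspension[OF P] graded_operad_desuspension[OF Q]
    by (simp add: operad_iso_iff desuspension_simps)
qed

section \<open>Ideals of operads\<close>

context pre_operad
begin

lemma operad_ideal_carrier: "operad_ideal P (\<lambda>S d. carrier (comp_module P S d))"
  unfolding operad_ideal_def
  by (auto intro: module.carrier_is_submodule[OF comp_module_module] relabel_closed pcomp_closed)

lemma operad_ideal_ideal_gen: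
  assumes G: "\<And>T e x. (T, e, x) \<in> G \<Longrightarrow> x \<in> carrier (comp_module P T e)"
  shows "operad_ideal P (ideal_gen P G)"
proof -
  define Q where "Q I \<longleftrightarrow> operad_ideal P I \<and> (\<forall>(T,e,x)\<in>G. x \<in> I T e)" for I
  have gen: "x \<in> ideal_gen P G S d \<longleftrightarrow> (\<forall>I. Q I \<longrightarrow> x \<in> I S d)" for x S d
    by (auto simp: ideal_gen_def Q_def)
  have Q: "operad_ideal P I" if "Q I" for I using that by (simp add: Q_def)
  \<comment> \<open>The whole operad is an ideal that contains the generators. It ensures that the
    defining intersection is over a non-empty family and lies in the carrier.\<close>
  have "Q (\<lambda>S d. carrier (comp_module P S d))" using operad_ideal_carrier G by (auto simp: Q_def)
  then have c: "x \<in> carrier (comp_module P S d)" if "x \<in> ideal_gen P G S d" for x S d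
    using that unfolding gen by fastforce
  have "submodule (ideal_gen P G S d) base_ring (comp_module P S d)" if S: "label_set S" for S d
  proof -
    interpret M: module base_ring "comp_module P S d" using S by (rule comp_module_module)
    have sub: "submodule (I S d) base_ring (comp_module P S d)" if "Q I" for I
      using that operad_idealD(1)[OF Q S] by simp
    show ?thesis
    proof (rule M.submoduleI)
      show "ideal_gen P G S d \<subseteq> carrier (comp_module P S d)" using c by auto
      show "\<zero>\<^bsub>comp_module P S d\<^esub> \<in> ideal_gen P G S d"
        unfolding gen using subgroup.one_closed[OF submodule.axioms(1)[OF sub]] by simp
    qed (auto simp: gen intro: M.submoduleE(3,4,5)[OF sub, simplified] sub)
  qed
  moreover have "relabel P \<sigma> S d x \<in> ideal_gen P G (\<sigma> ` S) d"
    if "label_set S" "inj_on \<sigma> S" "x \<in> ideal_gen P G S d" for \<sigma> S d x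
    using that(3) operad_idealD(2)[OF Q that(1,2)] unfolding gen by simp
  moreover have "pcomp P S s T d e x y \<in> ideal_gen P G (plug S s T) (d + e)"
    if "composable S s T" "x \<in> ideal_gen P G S d" "y \<in> carrier (comp_module P T e)" for S s T d e x y
    using that(2) operad_idealD(3)[OF Q that(1) _ that(3)] unfolding gen by simp
  moreover have "pcomp P S s T d e x y \<in> ideal_gen P G (plug S s T) (d + e)"
    if "composable S s T" "x \<in> carrier (comp_module P S d)" "y \<in> ideal_gen P G T e" for S s T d e x y
    using that(3) operad_idealD(4)[OF Q that(1,2)] unfolding gen by simp
  ultimately show ?thesis by (simp add: operad_ideal_def)
qed

lemma ideal_gen_generator: "(T, e, x) \<in> G \<Longrightarrow> x \<in> ideal_gen P G T e"
  by (auto simp: ideal_gen_def)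

lemma ideal_gen_least:
  "operad_ideal P I \<Longrightarrow> (\<And>T e x. (T, e, x) \<in> G \<Longrightarrow> x \<in> I T e) \<Longrightarrow> ideal_gen P G S d \<subseteq> I S d"
  unfolding ideal_gen_def by (rule Inter_lower) auto

text \<open>By linearity, zero is preserved by relabelling and absorbs under composition. Apart from
  bounding the generated ideals from above, this provides the ideal of coboundaries.\<close>

lemma operad_ideal_kernel:
  assumes "operad_hom P N g" "pre_operad N"
  shows "operad_ideal P (\<lambda>S d. {x \<in> carrier (comp_module P S d). g S d x = \<zero>\<^bsub>comp_module N S d\<^esub>})"
proof -
  interpret N: pre_operad N by fact
  note g = operad_homD[OF assms(1)]
  have "submodule {x \<in> carrier (comp_module P S d). g S d x = \<zero>\<^bsub>comp_module N S d\<^esub>} base_ring (comp_module P S d)"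
    if S: "label_set S" for S d
  proof -
    interpret M: module base_ring "comp_module P S d" using S by (rule comp_module_module)
    interpret K: module base_ring "comp_module N S d" using S by (rule N.comp_module_module)
    note l = linear_mapsD[OF g(1)[OF S]] linear_maps_zero[OF g(1)[OF S] M.module_axioms K.module_axioms]
      linear_maps_uminus[OF g(1)[OF S] M.module_axioms K.module_axioms]
    show ?thesis
      by (rule M.submoduleI) (auto simp: l K.smult_r_null)
  qed
  moreover have "relabel N \<sigma> S d \<zero>\<^bsub>comp_module N S d\<^esub> = \<zero>\<^bsub>comp_module N (\<sigma> ` S) d\<^esub>"
    if "label_set S" "inj_on \<sigma> S" for \<sigma> S d
    using that by (intro linear_maps_zero N.relabel_linear N.comp_module_module label_set_image)
  moreover have "pcomp N S s T d e \<zero>\<^bsub>comp_module N S d\<^esub> y = \<zero>\<^bsub>comp_module N (plug S s T) (d + e)\<^esub>"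
    if "composable S s T" "y \<in> carrier (comp_module N T e)" for S s T d e y
    using linear_maps_zero[OF N.pcomp_linear_left[OF that]] that(1) composableD
      N.comp_module_module label_set_plug by metis
  moreover have "pcomp N S s T d e x \<zero>\<^bsub>comp_module N T e\<^esub> = \<zero>\<^bsub>comp_module N (plug S s T) (d + e)\<^esub>"
    if "composable S s T" "x \<in> carrier (comp_module N S d)" for S s T d e x
    using linear_maps_zero[OF N.pcomp_linear_right[OF that]] that(1) composableD
      N.comp_module_module label_set_plug by metis
  ultimately show ?thesis
    unfolding operad_ideal_def
    by (simp add: g composableD(1,2) relabel_closed pcomp_closed)
qed

end


section \<open>The operad of vectors of sum zero\<close>

text \<open>The metabelian operad is identified with the following operad: a left-normed bracket
  \<open>[a\<^sub>1, [a\<^sub>2, \<dots>, [b, c]]]\<close> corresponds to the vector \<open>c - b\<close>.\<close>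

definition vec_operad :: "('k::{comm_ring,comm_monoid_mult}, nat \<Rightarrow> 'k) gr_operad" where
  "vec_operad =
     \<lparr>comp_module = (\<lambda>S d.
        \<lparr>carrier = {v. (\<forall>a. a \<notin> S \<longrightarrow> v a = 0) \<and> (d \<noteq> 0 \<longrightarrow> (\<forall>a. v a = 0)) \<and>
            (2 \<le> card S \<longrightarrow> sum v S = 0)},
         monoid.mult = undefined, one = undefined, ring.zero = (\<lambda>_. 0),
         add = (\<lambda>v w a. v a + w a), smult = (\<lambda>k v a. k * v a)\<rparr>),
      relabel = (\<lambda>\<sigma> S d v b. \<Sum>a\<in>S. if \<sigma> a = b then v a else 0),
      pcomp = (\<lambda>S s T d e v w a. if a \<in> T then v s * w a
        else if a \<in> S - {s} then v a * sum w T else 0),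
      op_unit = (\<lambda>s a. if a = s then 1 else 0)\<rparr>"

lemma vec_carrier:
  "v \<in> carrier (comp_module vec_operad S d) \<longleftrightarrow>
     (\<forall>a. a \<notin> S \<longrightarrow> v a = 0) \<and> (d \<noteq> 0 \<longrightarrow> (\<forall>a. v a = 0)) \<and> (2 \<le> card S \<longrightarrow> sum v S = 0)"
  by (simp add: vec_operad_def)

lemma vec_simps [simp]:
  "\<zero>\<^bsub>comp_module vec_operad S d\<^esub> = (\<lambda>_. 0)"
  "v \<oplus>\<^bsub>comp_module vec_operad S d\<^esub> w = (\<lambda>a. v a + w a)"
  "k \<odot>\<^bsub>comp_module vec_operad S d\<^esub> v = (\<lambda>a. k * v a)"
  "pcomp vec_operad S s T d e v w = (\<lambda>a. if a \<in> T then v s * w a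
        else if a \<in> S - {s} then v a * sum w T else 0)"
  "op_unit vec_operad s = (\<lambda>a. if a = s then 1 else 0)"
  by (simp_all add: vec_operad_def)

lemma vec_relabel:
  assumes "finite S" "inj_on \<sigma> S"
  shows "a \<in> S \<Longrightarrow> relabel vec_operad \<sigma> S d v (\<sigma> a) = v a"
    and "b \<notin> \<sigma> ` S \<Longrightarrow> relabel vec_operad \<sigma> S d v b = 0"
proof -
  assume a: "a \<in> S"
  have "(\<Sum>a'\<in>S. if \<sigma> a' = \<sigma> a then v a' else 0) = (\<Sum>a'\<in>S. if a' = a then v a' else 0)"
    using a assms(2) by (intro sum.cong) (auto simp: inj_on_def)
  then show "relabel vec_operad \<sigma> S d v (\<sigma> a) = v a"
    using a assms(1) by (simp add: vec_operad_def)
next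
  show "b \<notin> \<sigma> ` S \<Longrightarrow> relabel vec_operad \<sigma> S d v b = 0"
    by (auto simp: vec_operad_def intro!: sum.neutral)
qed

lemma vec_relabel_eqI:
  assumes "finite S" "inj_on \<sigma> S" "\<And>a. a \<in> S \<Longrightarrow> f (\<sigma> a) = v a" "\<And>b. b \<notin> \<sigma> ` S \<Longrightarrow> f b = 0"
  shows "relabel vec_operad \<sigma> S d v = f"
proof
  fix b
  show "relabel vec_operad \<sigma> S d v b = f b"
    using vec_relabel[OF assms(1,2)] assms(3,4) by (cases "b \<in> \<sigma> ` S") auto
qed

lemma vec_module: "module base_ring (comp_module vec_operad S d)"
proof (rule moduleI[OF cring_base_ring])
  show "abelian_group (comp_module (vec_operad :: ('k::{comm_ring,comm_monoid_mult}, _) gr_operad) S d)"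
  proof (rule abelian_groupI)
    fix v :: "nat \<Rightarrow> 'k" assume "v \<in> carrier (comp_module vec_operad S d)"
    then show "\<exists>w\<in>carrier (comp_module vec_operad S d).
      w \<oplus>\<^bsub>comp_module vec_operad S d\<^esub> v = \<zero>\<^bsub>comp_module vec_operad S d\<^esub>"
      by (intro bexI[of _ "\<lambda>a. - v a"]) (auto simp: vec_carrier sum_negf)
  qed (auto simp: vec_carrier sum.distrib algebra_simps)
qed (auto simp: vec_carrier sum.distrib algebra_simps simp flip: sum_distrib_left)

text \<open>The coordinates in \<open>T\<close> sum to \<open>v s\<close> times the sum of
  \<open>w\<close>, and the others to the rest of the sum of \<open>v\<close> times the sum of
  \<open>w\<close>. Hence a composite has sum zero as soon as one factor has.\<close>

lemma sum_vec_pcomp: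
  fixes v w :: "nat \<Rightarrow> 'k::{comm_ring,comm_monoid_mult}"
  assumes "composable S s T"
  shows "sum (pcomp vec_operad S s T d e v w) (plug S s T) = sum v S * sum w T"
proof -
  note c = composableD[OF assms]
  have "sum (pcomp vec_operad S s T d e v w) (plug S s T)
    = sum (pcomp vec_operad S s T d e v w) (S - {s}) + sum (pcomp vec_operad S s T d e v w) T"
    unfolding plug_def using c by (intro sum.union_disjoint) auto
  also have "\<dots> = (\<Sum>a\<in>S - {s}. v a * sum w T) + (\<Sum>a\<in>T. v s * w a)"
    using c(7) by (intro arg_cong2[of _ _ _ _ "(+)"] sum.cong) auto
  also have "\<dots> = (sum v (S - {s}) + v s) * sum w T"
    by (simp add: distrib_right flip: sum_distrib_left sum_distrib_right)
  also have "sum v (S - {s}) + v s = sum v S"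
    using sum.remove[OF c(3,5), of v] by (simp add: add.commute)
  finally show ?thesis .
qed

lemma card_plug_ge_2:
  assumes "composable S s T" "2 \<le> card (plug S s T)"
  shows "2 \<le> card S \<or> 2 \<le> card T"
  using card_plug[OF assms(1)] assms(2) by linarith

lemma graded_operad_vec_operad:
  "graded_operad (vec_operad :: ('k::{comm_ring,comm_monoid_mult}, _) gr_operad)"
proof (rule graded_operad.intro)
  let ?V = "vec_operad :: ('k, _) gr_operad"
  fix S T R :: "nat set" and s t r :: nat and d e f :: int and \<sigma> \<tau> :: "nat \<Rightarrow> nat"
    and x y z :: "nat \<Rightarrow> 'k"
  show "module base_ring (comp_module ?V S d)" by (rule vec_module)
  show "relabel ?V \<sigma> S d \<in> linear_maps (comp_module ?V S d) (comp_module ?V (\<sigma> ` S) d)"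
    if A: "label_set S" "inj_on \<sigma> S"
  proof -
    have fin: "finite S" using A(1) by (simp add: label_set_def)
    note r = vec_relabel[OF fin A(2)]
    show ?thesis
    proof (rule linear_mapsI)
      fix x y :: "nat \<Rightarrow> 'k" and k
      assume x: "x \<in> carrier (comp_module ?V S d)"
      have "sum (relabel ?V \<sigma> S d x) (\<sigma> ` S) = sum x S"
        by (subst sum.reindex[OF A(2)]) (simp add: r)
      moreover have "relabel ?V \<sigma> S d x b = 0" if "d \<noteq> 0" for b
        using x that by (cases "b \<in> \<sigma> ` S") (auto simp: vec_carrier r)
      ultimately show "relabel ?V \<sigma> S d x \<in> carrier (comp_module ?V (\<sigma> ` S) d)"
        using x by (simp add: vec_carrier card_image[OF A(2)] r(2))
      show "relabel ?V \<sigma> S d (x \<oplus>\<^bsub>comp_module ?V S d\<^esub> y) =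
        relabel ?V \<sigma> S d x \<oplus>\<^bsub>comp_module ?V (\<sigma> ` S) d\<^esub> relabel ?V \<sigma> S d y"
        by (rule vec_relabel_eqI[OF fin A(2)]) (simp_all add: r)
      show "relabel ?V \<sigma> S d (k \<odot>\<^bsub>comp_module ?V S d\<^esub> x) =
        k \<odot>\<^bsub>comp_module ?V (\<sigma> ` S) d\<^esub> relabel ?V \<sigma> S d x"
        by (rule vec_relabel_eqI[OF fin A(2)]) (simp_all add: r)
    qed
  qed
  show "relabel ?V \<sigma> S d x = relabel ?V \<tau> S d x" if "\<And>s. s \<in> S \<Longrightarrow> \<sigma> s = \<tau> s"
    using that by (auto simp: vec_operad_def intro!: ext sum.cong)
  show "relabel ?V id S d x = x" if "label_set S" "x \<in> carrier (comp_module ?V S d)"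
    using that by (intro vec_relabel_eqI) (auto simp: label_set_def vec_carrier)
  show "relabel ?V (\<tau> \<circ> \<sigma>) S d x = relabel ?V \<tau> (\<sigma> ` S) d (relabel ?V \<sigma> S d x)"
    if "label_set S" "inj_on \<sigma> S" "inj_on \<tau> (\<sigma> ` S)"
    using that by (intro vec_relabel_eqI) (simp_all add: label_set_def comp_inj_on vec_relabel image_comp)
  have closed: "pcomp ?V S s T d e x y \<in> carrier (comp_module ?V (plug S s T) (d + e))"
    if A: "composable S s T" "x \<in> carrier (comp_module ?V S d)" "y \<in> carrier (comp_module ?V T e)" for x y
  proof -
    have "sum (pcomp ?V S s T d e x y) (plug S s T) = 0" if "2 \<le> card (plug S s T)"
      using sum_vec_pcomp[OF A(1), of d e x y] card_plug_ge_2[OF A(1) that] A(2,3)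
      by (auto simp: vec_carrier)
    then show ?thesis using A by (auto simp: vec_carrier plug_def)
  qed
  show "(\<lambda>x. pcomp ?V S s T d e x y) \<in> linear_maps (comp_module ?V S d) (comp_module ?V (plug S s T) (d + e))"
    if "composable S s T" "y \<in> carrier (comp_module ?V T e)"
    by (rule linear_mapsI) (auto intro!: closed[OF that(1) _ that(2)] ext simp: algebra_simps simp del: vec_simps(4), auto simp: algebra_simps)
  show "(\<lambda>y. pcomp ?V S s T d e x y) \<in> linear_maps (comp_module ?V T e) (comp_module ?V (plug S s T) (d + e))"
    if "composable S s T" "x \<in> carrier (comp_module ?V S d)"
    by (rule linear_mapsI) (auto intro!: closed[OF that] ext simp: algebra_simps simp del: vec_simps(4),
      auto simp: algebra_simps sum.distrib simp flip: sum_distrib_left)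
  show "relabel ?V (\<lambda>a. if a \<in> T then \<tau> a else \<sigma> a) (plug S s T) (d + e) (pcomp ?V S s T d e x y) =
       pcomp ?V (\<sigma> ` S) (\<sigma> s) (\<tau> ` T) d e (relabel ?V \<sigma> S d x) (relabel ?V \<tau> T e y)"
    if A: "composable S s T" "inj_on \<sigma> S" "inj_on \<tau> T" "composable (\<sigma> ` S) (\<sigma> s) (\<tau> ` T)"
  proof (rule vec_relabel_eqI)
    note c = composableD[OF A(1)] and c' = composableD[OF A(4)]
    note r = vec_relabel[OF c(3) A(2)] and r' = vec_relabel[OF c(4) A(3)] and p = plug_relabel[OF A]
    show "finite (plug S s T)" using c by (simp add: plug_def)
    show "inj_on (\<lambda>a. if a \<in> T then \<tau> a else \<sigma> a) (plug S s T)" by (rule p(1))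
    have sum: "sum (relabel ?V \<tau> T e y) (\<tau> ` T) = sum y T"
      by (subst sum.reindex[OF A(3)]) (simp add: r')
    fix a
    assume a: "a \<in> plug S s T"
    show "pcomp ?V (\<sigma> ` S) (\<sigma> s) (\<tau> ` T) d e (relabel ?V \<sigma> S d x) (relabel ?V \<tau> T e y)
        (if a \<in> T then \<tau> a else \<sigma> a) = pcomp ?V S s T d e x y a"
    proof (cases "a \<in> T")
      case False
      then have "a \<in> S" "a \<noteq> s" using a by (auto simp: plug_def)
      then have "\<sigma> a \<noteq> \<sigma> s" using A(2) c(5) by (auto dest: inj_onD)
      then have "\<sigma> a \<notin> \<tau> ` T" using c'(7) \<open>a \<in> S\<close> by auto
      then show ?thesis using False \<open>a \<in> S\<close> \<open>a \<noteq> s\<close> \<open>\<sigma> a \<noteq> \<sigma> s\<close> by (simp add: r sum)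
    qed (simp add: r r' c)
  next
    fix b assume "b \<notin> (\<lambda>a. if a \<in> T then \<tau> a else \<sigma> a) ` plug S s T"
    then show "pcomp ?V (\<sigma> ` S) (\<sigma> s) (\<tau> ` T) d e (relabel ?V \<sigma> S d x) (relabel ?V \<tau> T e y) b = 0"
      unfolding plug_relabel(2)[OF A] by (auto simp: plug_def)
  qed
  show "op_unit ?V s \<in> carrier (comp_module ?V {s} 0)" by (simp add: vec_carrier)
  show "relabel ?V \<sigma> {s} 0 (op_unit ?V s) = op_unit ?V (\<sigma> s)"
    by (rule vec_relabel_eqI) auto
  show "pcomp ?V {s} s T 0 e (op_unit ?V s) y = y" if "y \<in> carrier (comp_module ?V T e)"
    using that by (auto simp: vec_carrier)
  show "pcomp ?V S s {t} d 0 x (op_unit ?V t) = relabel ?V (id(s := t)) S d x"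
    if A: "composable S s {t}"
    by (rule vec_relabel_eqI[symmetric])
      (use A composable_unit_right[OF A] in \<open>auto simp: composable_def label_set_def plug_def\<close>)
  show "pcomp ?V (plug S s T) t R (d + e) f (pcomp ?V S s T d e x y) z =
       pcomp ?V S s (plug T t R) d (e + f) x (pcomp ?V T t R e f y z)"
    if A: "composable S s T" "composable T t R" "(S - {s}) \<inter> R = {}"
  proof -
    note c = composableD[OF A(1)] and c' = composableD[OF A(2)]
    \<comment> \<open>On \<open>S - {s}\<close> the right hand side multiplies by the coordinate sum
      of the composite of \<open>y\<close> and \<open>z\<close>, the left hand side by the two sums
      in turn; these agree by multiplicativity.\<close>
    show ?thesis
      using c(5,7) c'(5,7) A(3) sum_vec_pcomp[OF A(2), of e f y z]
      by (auto simp: plug_def fun_eq_iff algebra_simps)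
  qed
  show "pcomp ?V (plug S s T) r R (d + e) f (pcomp ?V S s T d e x y) z =
       ksign (e * f) \<odot>\<^bsub>comp_module ?V (plug (plug S s T) r R) (d + e + f)\<^esub>
       pcomp ?V (plug S r R) s T (d + f) e (pcomp ?V S r R d f x z) y"
    if A: "composable S s T" "composable S r R" "s \<noteq> r" "T \<inter> R = {}"
      "y \<in> carrier (comp_module ?V T e)" "z \<in> carrier (comp_module ?V R f)"
  proof -
    note c = composableD[OF A(1)] and c' = composableD[OF A(2)]
    have s: "s \<notin> R" "r \<notin> T" using c c' A(3) by auto
    have "pcomp ?V (plug S s T) r R (d + e) f (pcomp ?V S s T d e x y) z =
       pcomp ?V (plug S r R) s T (d + f) e (pcomp ?V S r R d f x z) y"
      using c(5,7) c'(5,7) A(3,4) s by (auto simp: plug_def fun_eq_iff algebra_simps)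
    \<comment> \<open>If both degrees are non-zero, \<open>y\<close> and \<open>z\<close> vanish;
      otherwise the exponent \<open>e * f\<close> is 0.\<close>
    moreover have "ksign (e * f) * (pcomp ?V (plug S r R) s T (d + f) e (pcomp ?V S r R d f x z) y a) =
      pcomp ?V (plug S r R) s T (d + f) e (pcomp ?V S r R d f x z) y a" for a
    proof (cases "e = 0 \<or> f = 0")
      case False
      then show ?thesis using A(5,6) by (simp add: vec_carrier)
    qed auto
    ultimately show ?thesis by (simp del: vec_simps(4))
  qed
qed

section \<open>Free modules\<close>

lemma lookup_scale [simp]: "Poly_Mapping.lookup (scale k p) x = k * Poly_Mapping.lookup p x"
  by (simp add: scale_def Poly_Mapping.map.rep_eq when_def)

lemma lookup_basis: "Poly_Mapping.lookup (basis x) y = (if x = y then 1 else 0)"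
  by (simp add: basis_def lookup_single when_def)

lemma keys_basis: "Poly_Mapping.keys (basis x) \<subseteq> {x}"
  by (simp add: basis_def)

lemma keys_scale: "Poly_Mapping.keys (scale k p) \<subseteq> Poly_Mapping.keys p"
  by (auto simp: in_keys_iff)

lemma keys_plus: "Poly_Mapping.keys p \<subseteq> A \<Longrightarrow> Poly_Mapping.keys q \<subseteq> A \<Longrightarrow> Poly_Mapping.keys (p + q) \<subseteq> A"
  using Poly_Mapping.keys_add[of p q] by auto

lemma keys_sum_subset:
  "(\<And>i. i \<in> I \<Longrightarrow> Poly_Mapping.keys (f i) \<subseteq> A) \<Longrightarrow> Poly_Mapping.keys (\<Sum>i\<in>I. f i) \<subseteq> A"
proof (induction I rule: infinite_finite_induct)
  case (insert i I)
  then show ?case by (simp add: keys_plus)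
qed auto

lemma scale_simps [simp]:
  "scale 0 p = 0" "scale k 0 = 0" "scale 1 p = p" "scale k (scale l p) = scale (k * l) p"
  "scale (- 1) p = - p"
  by (rule poly_mapping_eqI; simp add: mult.assoc)+

lemma scale_add: "scale k (p + q) = scale k p + scale k q" "scale (k + l) p = scale k p + scale l p"
  by (rule poly_mapping_eqI; simp add: lookup_add algebra_simps)+

lemma scale_diff: "scale k (p - q) = scale k p - scale k q"
  by (rule poly_mapping_eqI) (simp add: lookup_minus right_diff_distrib)

lemma scale_sum: "scale k (\<Sum>i\<in>I. f i) = (\<Sum>i\<in>I. scale k (f i))"
  by (rule poly_mapping_eqI) (simp add: lookup_sum sum_distrib_left)

lemma poly_mapping_eq_sum_basis:
  "p = (\<Sum>x\<in>Poly_Mapping.keys p. scale (Poly_Mapping.lookup p x) (basis x))"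
proof (rule poly_mapping_eqI)
  fix y
  have "(\<Sum>x\<in>Poly_Mapping.keys p. Poly_Mapping.lookup p x * (if x = y then 1 else 0)) = Poly_Mapping.lookup p y"
    by (cases "y \<in> Poly_Mapping.keys p") (simp_all add: if_distrib[of "(*) _"] in_keys_iff cong: if_cong)
  then show "Poly_Mapping.lookup p y =
      Poly_Mapping.lookup (\<Sum>x\<in>Poly_Mapping.keys p. scale (Poly_Mapping.lookup p x) (basis x)) y"
    by (simp add: lookup_sum lookup_basis)
qed

lemma free_module_induct [consumes 1, case_names zero add basis]:
  assumes "Poly_Mapping.keys p \<subseteq> X"
    and "P 0"
    and "\<And>p q. P p \<Longrightarrow> P q \<Longrightarrow> P (p + q)"
    and "\<And>x k. x \<in> X \<Longrightarrow> P (scale k (basis x))"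
  shows "P p"
proof -
  have "P (\<Sum>x\<in>A. scale (Poly_Mapping.lookup p x) (basis x))" if "A \<subseteq> X" "finite A" for A
    using that(2,1) by (induction A rule: finite_induct) (simp_all add: assms(2-4))
  then show ?thesis by (subst poly_mapping_eq_sum_basis) (simp add: assms(1))
qed

lemma free_module_simps [simp]:
  "carrier (free_module X) = {p. Poly_Mapping.keys p \<subseteq> X}"
  "\<zero>\<^bsub>free_module X\<^esub> = 0" "p \<oplus>\<^bsub>free_module X\<^esub> q = p + q" "k \<odot>\<^bsub>free_module X\<^esub> p = scale k p"
  by (simp_all add: free_module_def)

lemma free_module_module: "module base_ring (free_module X)"
proof (rule moduleI[OF cring_base_ring])
  show "abelian_group (free_module X)"
  proof (rule abelian_groupI)
    show "\<exists>q\<in>carrier (free_module X). q \<oplus>\<^bsub>free_module X\<^esub> p = \<zero>\<^bsub>free_module X\<^esub>"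
      if "p \<in> carrier (free_module X)" for p
      using that by (intro bexI[of _ "- p"]) (auto simp: in_keys_iff)
  qed (auto simp: keys_plus algebra_simps intro: subsetD[OF keys_plus])
qed (auto simp: scale_add dest: subsetD[OF keys_scale])

lemma lin_ext_superset:
  assumes "finite A" "Poly_Mapping.keys p \<subseteq> A"
  shows "lin_ext g p = (\<Sum>x\<in>A. scale (Poly_Mapping.lookup p x) (g x))"
  unfolding lin_ext_def using assms by (intro sum.mono_neutral_left) (auto simp: in_keys_iff)

lemma lin_ext_add: "lin_ext g (p + q) = lin_ext g p + lin_ext g q"
proof -
  let ?A = "Poly_Mapping.keys p \<union> Poly_Mapping.keys q"
  have "Poly_Mapping.keys (p + q) \<subseteq> ?A" by (rule Poly_Mapping.keys_add)
  then show ?thesis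
    by (simp add: lin_ext_superset[of ?A] lookup_add scale_add sum.distrib)
qed

lemma lin_ext_scale: "lin_ext g (scale k p) = scale k (lin_ext g p)"
  using keys_scale[of k p] by (simp add: lin_ext_superset[of "Poly_Mapping.keys p"] scale_sum)

lemma lin_ext_0 [simp]: "lin_ext g 0 = 0"
  by (simp add: lin_ext_def)

lemma lin_ext_basis [simp]: "lin_ext g (basis x) = g x"
  by (subst lin_ext_superset[OF _ keys_basis]) (simp_all add: lookup_basis)

lemma lin_ext_uminus: "lin_ext g (- p) = - lin_ext g p"
  using lin_ext_scale[of g "- 1" p] by simp

lemma lin_ext_diff: "lin_ext g (p - q) = lin_ext g p - lin_ext g q"
  using lin_ext_add[of g p "- q"] by (simp add: lin_ext_uminus)

lemma lin_ext_sum: "lin_ext g (\<Sum>i\<in>I. f i) = (\<Sum>i\<in>I. lin_ext g (f i))"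
  by (induction I rule: infinite_finite_induct) (simp_all add: lin_ext_add)

lemma keys_lin_ext:
  "(\<And>x. x \<in> Poly_Mapping.keys p \<Longrightarrow> Poly_Mapping.keys (g x) \<subseteq> Y) \<Longrightarrow> Poly_Mapping.keys (lin_ext g p) \<subseteq> Y"
  unfolding lin_ext_def by (rule keys_sum_subset) (rule order_trans[OF keys_scale])

lemma lookup_lin_ext:
  "Poly_Mapping.lookup (lin_ext g p) y =
   (\<Sum>x\<in>Poly_Mapping.keys p. Poly_Mapping.lookup p x * Poly_Mapping.lookup (g x) y)"
  by (simp add: lin_ext_def lookup_sum)

text \<open>This form exhibits linearity in the first argument, the next one linearity in the
  second.\<close>

lemma bilin_ext_eq_lin_ext: "bilin_ext g p q = lin_ext (\<lambda>x. lin_ext (g x) q) p"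
  by (simp add: bilin_ext_def lin_ext_def scale_sum)

lemma bilin_ext_eq_lin_ext': "bilin_ext g p q = lin_ext (\<lambda>y. lin_ext (\<lambda>x. g x y) p) q"
  unfolding bilin_ext_def lin_ext_def scale_sum by (subst sum.swap) (simp add: mult.commute)

lemma lin_ext_linear:
  fixes g :: "'x \<Rightarrow> 'y \<Rightarrow>\<^sub>0 'k::{comm_ring,comm_monoid_mult}"
  assumes "\<And>x. x \<in> X \<Longrightarrow> Poly_Mapping.keys (g x) \<subseteq> Y"
  shows "lin_ext g \<in> linear_maps (free_module X) (free_module Y)"
proof (rule linear_mapsI)
  fix p :: "'x \<Rightarrow>\<^sub>0 'k" assume "p \<in> carrier (free_module X)"
  then have "Poly_Mapping.keys p \<subseteq> X" by simp
  then have "Poly_Mapping.keys (lin_ext g p) \<subseteq> Y"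
    by (intro keys_lin_ext assms) (rule subsetD)
  then show "lin_ext g p \<in> carrier (free_module Y)" by simp
qed (simp_all add: lin_ext_add lin_ext_scale)


section \<open>The operad of binary trees\<close>

lemma leaves_map: "leaves (map_ltree \<sigma> t) = map \<sigma> (leaves t)"
  by (induction t) auto

lemma leaves_ne [simp]: "leaves t \<noteq> []"
  by (induction t) auto

lemma graft_id: "s \<notin> set (leaves t) \<Longrightarrow> graft s t u = t"
  by (induction t) auto

lemma set_leaves_graft:
  "set (leaves (graft s t u)) = (set (leaves t) - {s}) \<union> (if s \<in> set (leaves t) then set (leaves u) else {})"
  by (induction t) auto

lemma distinct_leaves_graft:
  "distinct (leaves t) \<Longrightarrow> distinct (leaves u) \<Longrightarrow> (set (leaves t) - {s}) \<inter> set (leaves u) = {} \<Longrightarrow>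
   distinct (leaves (graft s t u))"
proof (induction t)
  case (Br t1 t2)
  then have "distinct (leaves (graft s t1 u))" "distinct (leaves (graft s t2 u))" by auto
  moreover have "s \<notin> set (leaves t1) \<or> s \<notin> set (leaves t2)" using Br.prems(1) by auto
  ultimately show ?case using Br.prems by (auto simp: set_leaves_graft split: if_splits)
qed auto

lemma graft_ltrees:
  "t \<in> ltrees S \<Longrightarrow> u \<in> ltrees T \<Longrightarrow> composable S s T \<Longrightarrow> graft s t u \<in> ltrees (plug S s T)"
  using distinct_leaves_graft[of t u s] set_leaves_graft[of s t u]
  by (auto simp: ltrees_def composable_def plug_def)

lemma map_ltree_ltrees: "t \<in> ltrees S \<Longrightarrow> inj_on \<sigma> S \<Longrightarrow> map_ltree \<sigma> t \<in> ltrees (\<sigma> ` S)"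
  by (auto simp: ltrees_def leaves_map distinct_map)

lemma Mag_simps:
  "comp_module Mag S d = free_module (if d = 0 then ltrees S else {})"
  "relabel Mag \<sigma> S d = lin_ext (\<lambda>t. basis (map_ltree \<sigma> t))"
  "pcomp Mag S s T d e = bilin_ext (\<lambda>t u. basis (graft s t u))"
  "op_unit Mag s = basis (Leaf s)"
  by (simp_all add: Mag_def)

lemma pre_operad_Mag: "pre_operad (Mag :: ('k::{comm_ring,comm_monoid_mult}, _) gr_operad)"
proof (rule pre_operad.intro)
  let ?M = "Mag :: ('k, _) gr_operad"
  fix S T s d e \<sigma> and x y :: "nat ltree \<Rightarrow>\<^sub>0 'k"
  show "module base_ring (comp_module ?M S d)" by (simp add: Mag_simps free_module_module)
  show "relabel ?M \<sigma> S d \<in> linear_maps (comp_module ?M S d) (comp_module ?M (\<sigma> ` S) d)"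
    if "inj_on \<sigma> S"
    unfolding Mag_simps using map_ltree_ltrees[OF _ that] by (intro lin_ext_linear) (auto simp: basis_def split: if_splits)
  have b: "Poly_Mapping.keys (basis (graft s t u) :: _ \<Rightarrow>\<^sub>0 'k) \<subseteq> (if d + e = 0 then ltrees (plug S s T) else {})"
    if "composable S s T" "t \<in> (if d = 0 then ltrees S else {})" "u \<in> (if e = 0 then ltrees T else {})" for t u
    using that graft_ltrees by (auto simp: basis_def split: if_splits)
  show "(\<lambda>x. pcomp ?M S s T d e x y) \<in> linear_maps (comp_module ?M S d) (comp_module ?M (plug S s T) (d + e))"
    if "composable S s T" "y \<in> carrier (comp_module ?M T e)"
    unfolding Mag_simps bilin_ext_eq_lin_ext
    using that by (intro lin_ext_linear keys_lin_ext b) (auto simp: Mag_simps split: if_splits)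
  show "(\<lambda>y. pcomp ?M S s T d e x y) \<in> linear_maps (comp_module ?M T e) (comp_module ?M (plug S s T) (d + e))"
    if "composable S s T" "x \<in> carrier (comp_module ?M S d)"
    unfolding Mag_simps bilin_ext_eq_lin_ext'
    using that by (intro lin_ext_linear keys_lin_ext b) (auto simp: Mag_simps split: if_splits)
  show "op_unit ?M s \<in> carrier (comp_module ?M {s} 0)"
    using keys_basis[of "Leaf s"] by (auto simp: Mag_simps ltrees_def)
qed

text \<open>The counterpart of \<open>lin_ext\<close> for maps into \<open>vec_operad\<close>, whose
  elements are plain functions and not finitely supported maps.\<close>

definition eval_with :: "('x \<Rightarrow> nat \<Rightarrow> 'k) \<Rightarrow> ('x \<Rightarrow>\<^sub>0 'k::{comm_ring,comm_monoid_mult}) \<Rightarrow> nat \<Rightarrow> 'k" where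
  "eval_with f p a = (\<Sum>x\<in>Poly_Mapping.keys p. Poly_Mapping.lookup p x * f x a)"

lemma eval_with_superset:
  assumes "finite A" "Poly_Mapping.keys p \<subseteq> A"
  shows "eval_with f p a = (\<Sum>x\<in>A. Poly_Mapping.lookup p x * f x a)"
  unfolding eval_with_def using assms by (intro sum.mono_neutral_left) (auto simp: in_keys_iff)

lemma eval_with_add: "eval_with f (p + q) a = eval_with f p a + eval_with f q a"
proof -
  let ?A = "Poly_Mapping.keys p \<union> Poly_Mapping.keys q"
  have "Poly_Mapping.keys (p + q) \<subseteq> ?A" by (rule Poly_Mapping.keys_add)
  then show ?thesis
    by (simp add: eval_with_superset[of ?A] lookup_add distrib_right sum.distrib)
qed

lemma eval_with_scale: "eval_with f (scale k p) a = k * eval_with f p a"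
  using keys_scale[of k p]
  by (simp add: eval_with_superset[of "Poly_Mapping.keys p"] sum_distrib_left mult.assoc)

lemma eval_with_0 [simp]: "eval_with f 0 a = 0"
  by (simp add: eval_with_def)

lemma eval_with_basis [simp]: "eval_with f (basis x) a = f x a"
  by (subst eval_with_superset[OF _ keys_basis]) (simp_all add: lookup_basis)

lemma eval_with_diff: "eval_with f (p - q) a = eval_with f p a - eval_with f q a"
  using eval_with_add[of f p "- q" a] eval_with_scale[of f "- 1" q a] by simp

lemma eval_with_sum: "eval_with f (\<Sum>i\<in>I. p i) a = (\<Sum>i\<in>I. eval_with f (p i) a)"
  by (induction I rule: infinite_finite_induct) (simp_all add: eval_with_add)

lemma eval_with_lin_ext:
  "eval_with f (lin_ext g p) a = (\<Sum>x\<in>Poly_Mapping.keys p. Poly_Mapping.lookup p x * eval_with f (g x) a)"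
  by (simp add: lin_ext_def eval_with_sum eval_with_scale)

section \<open>The vector of a binary tree\<close>

text \<open>The coordinate sum of the vector of the tree (\<open>sum_tree_vec\<close>) in closed
  form: brackets have sum zero.\<close>

primrec tree_aug :: "'l ltree \<Rightarrow> 'k::{comm_ring,comm_monoid_mult}" where
  "tree_aug (Leaf a) = 1"
| "tree_aug (Br t u) = 0"

text \<open>The bracket goes to \<open>e_2 - e_1\<close>, and the second clause is what composition
  in \<open>vec_operad\<close> makes of it: each subtree enters with the coordinate sum of the other
  as a factor. If both subtrees are brackets, the result is 0, which is the metabelian
  identity.\<close>

primrec tree_vec :: "nat ltree \<Rightarrow> nat \<Rightarrow> 'k::{comm_ring,comm_monoid_mult}" where
  "tree_vec (Leaf b) a = (if a = b then 1 else 0)"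
| "tree_vec (Br t u) a = tree_aug t * tree_vec u a - tree_aug u * tree_vec t a"

lemma tree_vec_eq_0: "a \<notin> set (leaves t) \<Longrightarrow> tree_vec t a = 0"
  by (induction t) auto

lemma sum_tree_vec:
  "finite S \<Longrightarrow> set (leaves t) \<subseteq> S \<Longrightarrow> sum (tree_vec t) S = tree_aug t"
  by (induction t) (auto simp: sum_subtractf mult.commute simp flip: sum_distrib_left)

lemma tree_vec_map:
  "inj_on \<sigma> S \<Longrightarrow> set (leaves t) \<subseteq> S \<Longrightarrow> a \<in> S \<Longrightarrow> tree_vec (map_ltree \<sigma> t) (\<sigma> a) = tree_vec t a"
  "tree_aug (map_ltree \<sigma> t) = tree_aug t"
proof -
  have *: "tree_aug (map_ltree \<sigma> t) = (tree_aug t :: 'k::{comm_ring,comm_monoid_mult})" for t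
    by (cases t) auto
  then show "tree_aug (map_ltree \<sigma> t) = tree_aug t" .
  show "inj_on \<sigma> S \<Longrightarrow> set (leaves t) \<subseteq> S \<Longrightarrow> a \<in> S \<Longrightarrow> tree_vec (map_ltree \<sigma> t) (\<sigma> a) = tree_vec t a"
    by (induction t) (auto simp: * inj_on_eq_iff)
qed

lemma tree_aug_graft: "s \<in> set (leaves t) \<Longrightarrow> tree_aug (graft s t u) = tree_aug t * tree_aug u"
  by (cases t) auto

text \<open>The formula is the composition of \<open>vec_operad\<close>. As the leaves are distinct,
  \<open>s\<close> occurs in just one of the two subtrees, where the induction hypothesis applies;
  the other one is unchanged and has no coordinates at \<open>s\<close> or at the leaves of
  \<open>u\<close>.\<close>

lemma tree_vec_graft:
  assumes "distinct (leaves t)" "s \<in> set (leaves t)" "(set (leaves t) - {s}) \<inter> set (leaves u) = {}"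
  shows "tree_vec (graft s t u) a = ((if a \<in> set (leaves u) then tree_vec t s * tree_vec u a
    else if a = s then 0 else tree_vec t a * tree_aug u) :: 'k::{comm_ring,comm_monoid_mult})"
  using assms
proof (induction t)
  case (Leaf b)
  then show ?case by (auto simp: tree_vec_eq_0)
next
  case (Br t1 t2)
  consider (1) "s \<in> set (leaves t1)" "s \<notin> set (leaves t2)" | (2) "s \<in> set (leaves t2)" "s \<notin> set (leaves t1)"
    using Br.prems by auto
  then show ?case
  proof cases
    case 1
    then have "a \<in> set (leaves u) \<Longrightarrow> tree_vec t2 a = (0 :: 'k)" "tree_vec t2 s = (0 :: 'k)"
      using Br.prems by (auto intro: tree_vec_eq_0)
    then show ?thesis using 1 Br.prems Br.IH(1)
      by (auto simp: graft_id tree_aug_graft algebra_simps Int_Un_distrib2 Un_Diff)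
  next
    case 2
    then have "a \<in> set (leaves u) \<Longrightarrow> tree_vec t1 a = (0 :: 'k)" "tree_vec t1 s = (0 :: 'k)"
      using Br.prems by (auto intro: tree_vec_eq_0)
    then show ?thesis using 2 Br.prems Br.IH(2)
      by (auto simp: graft_id tree_aug_graft algebra_simps Int_Un_distrib2 Un_Diff)
  qed
qed

lemma tree_aug_ltrees: "t \<in> ltrees S \<Longrightarrow> 2 \<le> card S \<Longrightarrow> tree_aug t = 0"
  by (cases t) (auto simp: ltrees_def)

lemma Mag_vec_hom: "operad_hom (Mag :: ('k::{comm_ring,comm_monoid_mult}, _) gr_operad) vec_operad
  (\<lambda>S d. eval_with tree_vec)"
proof (rule operad_homI)
  let ?M = "Mag :: ('k, _) gr_operad"
  fix S T s d e \<sigma> and x y :: "nat ltree \<Rightarrow>\<^sub>0 'k"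
  have sum: "sum (eval_with tree_vec y) T = (\<Sum>t\<in>Poly_Mapping.keys y. Poly_Mapping.lookup y t * tree_aug t)"
    if "y \<in> carrier (comp_module ?M T e)" for y T e
    unfolding eval_with_def using that
    by (subst sum.swap) (auto intro!: sum.cong simp: Mag_simps ltrees_def sum_tree_vec simp flip: sum_distrib_left split: if_splits)
  have supp: "eval_with tree_vec y a = 0" if "y \<in> carrier (comp_module ?M T e)" "a \<notin> T" for y T e a
    unfolding eval_with_def using that
    by (intro sum.neutral) (auto simp: Mag_simps ltrees_def tree_vec_eq_0 split: if_splits)
  show "eval_with tree_vec \<in> linear_maps (comp_module ?M S d) (comp_module vec_operad S d)"
  proof (rule linear_mapsI)
    fix x assume x: "x \<in> carrier (comp_module ?M S d)"
    have "(\<Sum>t\<in>Poly_Mapping.keys x. Poly_Mapping.lookup x t * tree_aug t) = 0" if "2 \<le> card S"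
      using x that by (intro sum.neutral) (auto simp: Mag_simps tree_aug_ltrees split: if_splits)
    then show "eval_with tree_vec x \<in> carrier (comp_module vec_operad S d)"
      using x sum[OF x] supp[OF x] by (auto simp: vec_carrier Mag_simps split: if_splits)
  qed (simp_all add: Mag_simps fun_eq_iff eval_with_add eval_with_scale)
  show "eval_with tree_vec (relabel ?M \<sigma> S d x) = relabel vec_operad \<sigma> S d (eval_with tree_vec x)"
    if "x \<in> carrier (comp_module ?M S d)" "label_set S" "inj_on \<sigma> S"
  proof (rule vec_relabel_eqI[symmetric])
    show "eval_with tree_vec (relabel ?M \<sigma> S d x) (\<sigma> a) = eval_with tree_vec x a" if "a \<in> S" for a
      unfolding Mag_simps eval_with_lin_ext eval_with_basis unfolding eval_with_def
      using \<open>x \<in> _\<close> \<open>inj_on \<sigma> S\<close> that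
      by (intro sum.cong) (auto simp: Mag_simps ltrees_def tree_vec_map split: if_splits)
    show "eval_with tree_vec (relabel ?M \<sigma> S d x) b = 0" if "b \<notin> \<sigma> ` S" for b
      using supp[OF pre_operad.relabel_closed[OF pre_operad_Mag]] \<open>x \<in> _\<close> \<open>inj_on \<sigma> S\<close> \<open>label_set S\<close> that by blast
  qed (use that in \<open>auto simp: label_set_def\<close>)
  show "eval_with tree_vec (pcomp ?M S s T d e x y) =
      pcomp vec_operad S s T d e (eval_with tree_vec x) (eval_with tree_vec y)"
    if x: "x \<in> carrier (comp_module ?M S d)" and y: "y \<in> carrier (comp_module ?M T e)"
      and c: "composable S s T"
  proof
    fix a
    have "eval_with tree_vec (pcomp ?M S s T d e x y) a =
      (\<Sum>t\<in>Poly_Mapping.keys x. \<Sum>u\<in>Poly_Mapping.keys y. Poly_Mapping.lookup x t * Poly_Mapping.lookup y u *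
        (if a \<in> T then tree_vec t s * tree_vec u a else if a \<in> S - {s} then tree_vec t a * tree_aug u else 0))"
      unfolding Mag_simps bilin_ext_eq_lin_ext eval_with_lin_ext sum_distrib_left eval_with_basis
    proof (intro sum.cong refl)
      fix t u assume "t \<in> Poly_Mapping.keys x" "u \<in> Poly_Mapping.keys y"
      then have tu: "t \<in> ltrees S" "u \<in> ltrees T" using x y by (auto simp: Mag_simps split: if_splits)
      have "tree_vec (graft s t u) a = (if a \<in> set (leaves u) then tree_vec t s * tree_vec u a
        else if a = s then 0 else tree_vec t a * (tree_aug u :: 'k))"
        using tu composableD[OF c] by (intro tree_vec_graft) (auto simp: ltrees_def)
      then show "Poly_Mapping.lookup x t * (Poly_Mapping.lookup y u * tree_vec (graft s t u) a) =
        Poly_Mapping.lookup x t * Poly_Mapping.lookup y u *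
        (if a \<in> T then tree_vec t s * tree_vec u a else if a \<in> S - {s} then tree_vec t a * tree_aug u else 0)"
        using tu by (auto simp: ltrees_def mult.assoc tree_vec_eq_0)
    qed
    also have "\<dots> = pcomp vec_operad S s T d e (eval_with tree_vec x) (eval_with tree_vec y) a"
    proof -
      have "eval_with tree_vec x a * sum (eval_with tree_vec y) T =
        (\<Sum>t\<in>Poly_Mapping.keys x. \<Sum>u\<in>Poly_Mapping.keys y. Poly_Mapping.lookup x t * Poly_Mapping.lookup y u *
          (tree_vec t a * tree_aug u))"
        unfolding sum[OF y] unfolding eval_with_def sum_product by (simp add: ac_simps)
      moreover have "eval_with tree_vec x s * eval_with tree_vec y a =
        (\<Sum>t\<in>Poly_Mapping.keys x. \<Sum>u\<in>Poly_Mapping.keys y. Poly_Mapping.lookup x t * Poly_Mapping.lookup y u *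
          (tree_vec t s * tree_vec u a))"
        unfolding eval_with_def sum_product by (simp add: ac_simps)
      ultimately show ?thesis
        by (cases "a \<in> T"; cases "a \<in> S - {s}";
          simp only: vec_simps if_True if_False mult_zero_right sum.neutral_const)
    qed
    finally show "eval_with tree_vec (pcomp ?M S s T d e x y) a =
      pcomp vec_operad S s T d e (eval_with tree_vec x) (eval_with tree_vec y) a" .
  qed
  show "eval_with tree_vec (op_unit ?M s) = op_unit vec_operad s"
    by (simp add: Mag_simps fun_eq_iff)
qed

lemma tree_basis_carrier: "t \<in> ltrees S \<Longrightarrow> basis t \<in> carrier (comp_module Mag S 0)"
  using keys_basis[of t] by (auto simp: Mag_simps basis_def)

section \<open>Normal forms in the metabelian operad\<close>

text \<open>\<open>K\<close> stands for the elements of \<open>Mag\<close> that become zero in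
  \<open>MetabLie\<close>, so that the two successive quotients are treated as one. By
  \<open>ker\<close> it lies in the kernel of the evaluation; the aim of the locale is the reverse
  inclusion, \<open>kernel_subset\<close>.\<close>

locale metabelian_ideal =
  fixes K :: "nat set \<Rightarrow> int \<Rightarrow> (nat ltree \<Rightarrow>\<^sub>0 'k::{comm_ring,comm_monoid_mult}) set"
  assumes ideal: "operad_ideal Mag K"
    and lie: "(T, e, x) \<in> lie_relations \<Longrightarrow> x \<in> K T e"
    and metab: "basis (Br (Br (Leaf 1) (Leaf 2)) (Br (Leaf 3) (Leaf 4))) \<in> K {1,2,3,4} 0"
    and ker: "label_set S \<Longrightarrow> p \<in> K S 0 \<Longrightarrow> eval_with tree_vec p a = 0"
begin

lemma K_submodule:
  assumes "label_set S"
  shows "0 \<in> K S 0" and "p \<in> K S 0 \<Longrightarrow> q \<in> K S 0 \<Longrightarrow> p + q \<in> K S 0"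
    and "p \<in> K S 0 \<Longrightarrow> scale k p \<in> K S 0" and "p \<in> K S 0 \<Longrightarrow> - p \<in> K S 0"
    and "p \<in> K S 0 \<Longrightarrow> q \<in> K S 0 \<Longrightarrow> p - q \<in> K S 0"
proof -
  have sub: "submodule (K S 0) base_ring (comp_module Mag S 0)"
    using operad_idealD(1)[OF ideal assms] .
  have m: "module base_ring (comp_module (Mag :: ('k, _) gr_operad) S 0)"
    using pre_operad.comp_module_module[OF pre_operad_Mag assms] .
  show "0 \<in> K S 0" using subgroup.one_closed[OF submodule.axioms(1)[OF sub]] by (simp add: Mag_simps)
  show add: "p + q \<in> K S 0" if "p \<in> K S 0" "q \<in> K S 0" for p q
    using module.submoduleE(5)[OF m sub that] by (simp add: Mag_simps)
  show sc: "scale k p \<in> K S 0" if "p \<in> K S 0" for p k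
    using module.submoduleE(4)[OF m sub _ that] by (simp add: Mag_simps)
  show u: "- p \<in> K S 0" if "p \<in> K S 0" for p using sc[OF that, of "- 1"] by simp
  show "p - q \<in> K S 0" if "p \<in> K S 0" "q \<in> K S 0" using add[OF that(1) u[OF that(2)]] by simp
qed

lemma K_graft:
  assumes "composable S s T" "p \<in> K S 0" "u \<in> ltrees T"
  shows "lin_ext (\<lambda>t. basis (graft s t u)) p \<in> K (plug S s T) 0"
  using operad_idealD(3)[OF ideal assms(1,2) tree_basis_carrier[OF assms(3)]]
  by (simp add: Mag_simps bilin_ext_eq_lin_ext)

lemma K_relabel:
  assumes "label_set S" "inj_on \<sigma> S" "p \<in> K S 0"
  shows "lin_ext (\<lambda>t. basis (map_ltree \<sigma> t)) p \<in> K (\<sigma> ` S) 0"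
  using operad_idealD(2)[OF ideal assms] by (simp add: Mag_simps)

lemma label_set_leaves [simp]: "label_set (set (leaves t))"
  by (simp add: label_set_def)

lemma ltrees_leaves [simp]: "t \<in> ltrees (set (leaves t)) \<longleftrightarrow> distinct (leaves t)"
  by (simp add: ltrees_def)

text \<open>An ideal is closed under operadic composition, so bracketing with \<open>t\<close> is
  written as plugging \<open>p\<close> into the leaf \<open>b\<close> of
  \<open>Br t (Leaf b)\<close>, where \<open>b\<close> is a fresh letter.\<close>

lemma K_Br_left:
  assumes "p \<in> K S 0" "label_set S" "distinct (leaves t)" "set (leaves t) \<inter> S = {}"
  shows "lin_ext (\<lambda>u. basis (Br t u)) p \<in> K (set (leaves t) \<union> S) 0"
proof -
  obtain b where b: "b \<notin> set (leaves t)" using ex_new_if_finite[of "set (leaves t)"] by auto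
  have c: "composable (insert b (set (leaves t))) b S"
    using assms b by (auto simp: composable_def label_set_def)
  have pl: "plug (insert b (set (leaves t))) b S = set (leaves t) \<union> S"
    using b by (auto simp: plug_def)
  have "Br t (Leaf b) \<in> ltrees (insert b (set (leaves t)))" using assms b by (auto simp: ltrees_def)
  from operad_idealD(4)[OF ideal c tree_basis_carrier[OF this] assms(1)] show ?thesis
    using b by (simp add: Mag_simps bilin_ext_eq_lin_ext pl graft_id)
qed

text \<open>The relation is given on the letters 1 and 2, which may also occur in \<open>t\<close>
  or \<open>u\<close>. So it is first relabelled to letters beyond all leaves, and then the trees
  are grafted one after the other. The Jacobi and the metabelian identity below take the same
  detour.\<close>

lemma K_antisym:
  assumes "distinct (leaves t)" "distinct (leaves u)" "set (leaves t) \<inter> set (leaves u) = {}"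
  shows "basis (Br t u) + basis (Br u t) \<in> K (set (leaves t) \<union> set (leaves u)) 0"
proof -
  obtain N where "\<And>a. a \<in> set (leaves t) \<union> set (leaves u) \<union> set (leaves t) \<union> set (leaves u) \<Longrightarrow> a < N"
    using finite_nat_set_iff_bounded[of "set (leaves t) \<union> set (leaves u) \<union> set (leaves t) \<union> set (leaves u)"] by auto
  then have N: "\<And>i. i + N \<notin> set (leaves t)" "\<And>i. i + N \<notin> set (leaves u)" by fastforce+
  let ?p = "basis (Br (Leaf 1) (Leaf 2)) + basis (Br (Leaf 2) (Leaf 1)) :: nat ltree \<Rightarrow>\<^sub>0 'k"
  have "?p \<in> K {1,2} 0" by (rule lie) (simp add: lie_relations_def)
  from K_relabel[OF _ _ this, of "\<lambda>i. i + N"]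
  have 1: "basis (Br (Leaf (1 + N)) (Leaf (2 + N))) + basis (Br (Leaf (2 + N)) (Leaf (1 + N)))
      \<in> K {1 + N, 2 + N} 0"
    by (simp add: lin_ext_add label_set_def)
  have 2: "composable {1 + N, 2 + N} (1 + N) (set (leaves t))"
    using N[of 2] by (auto simp: composable_def label_set_def)
  from K_graft[OF 2 1, of t] have 3: "basis (Br t (Leaf (2 + N))) + basis (Br (Leaf (2 + N)) t)
      \<in> K (plug {1 + N, 2 + N} (1 + N) (set (leaves t))) 0"
    using assms by (simp add: lin_ext_add)
  have 4: "composable (plug {1 + N, 2 + N} (1 + N) (set (leaves t))) (2 + N) (set (leaves u))"
    using N[of 2] assms(3) by (auto simp: composable_def label_set_def plug_def)
  have "plug (plug {1 + N, 2 + N} (1 + N) (set (leaves t))) (2 + N) (set (leaves u))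
      = set (leaves t) \<union> set (leaves u)"
    using N[of 2] N[of 1] by (auto simp: plug_def)
  with K_graft[OF 4 3, of u] N[of 2] assms show ?thesis
    by (simp add: lin_ext_add graft_id)
qed

lemma K_jacobi:
  assumes "distinct (leaves t @ leaves u @ leaves v)"
  shows "basis (Br t (Br u v)) + basis (Br u (Br v t)) + basis (Br v (Br t u))
    \<in> K (set (leaves t) \<union> set (leaves u) \<union> set (leaves v)) 0"
proof -
  obtain N where "\<And>a. a \<in> set (leaves t) \<union> set (leaves u) \<union> set (leaves v) \<union> set (leaves u) \<Longrightarrow> a < N"
    using finite_nat_set_iff_bounded[of "set (leaves t) \<union> set (leaves u) \<union> set (leaves v) \<union> set (leaves u)"] by auto
  then have N: "\<And>i. i + N \<notin> set (leaves t)" "\<And>i. i + N \<notin> set (leaves u)" "\<And>i. i + N \<notin> set (leaves v)"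
    by fastforce+
  let ?a = "1 + N" and ?b = "2 + N" and ?c = "3 + N"
  let ?p = "\<lambda>a b c. basis (Br a (Br b c)) + basis (Br b (Br c a)) + basis (Br c (Br a b)) :: nat ltree \<Rightarrow>\<^sub>0 'k"
  have "?p (Leaf 1) (Leaf 2) (Leaf 3) \<in> K {1,2,3} 0" by (rule lie) (simp add: lie_relations_def)
  from K_relabel[OF _ _ this, of "\<lambda>i. i + N"]
  have 1: "?p (Leaf ?a) (Leaf ?b) (Leaf ?c) \<in> K {?a, ?b, ?c} 0"
    by (simp add: lin_ext_add label_set_def)
  let ?S1 = "plug {?a, ?b, ?c} ?a (set (leaves t))"
  have 2: "composable {?a, ?b, ?c} ?a (set (leaves t))"
    using N[of 2] N[of 3] by (auto simp: composable_def label_set_def)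
  from K_graft[OF 2 1, of t] have 3: "?p t (Leaf ?b) (Leaf ?c) \<in> K ?S1 0"
    using assms by (simp add: lin_ext_add)
  let ?S2 = "plug ?S1 ?b (set (leaves u))"
  have 4: "composable ?S1 ?b (set (leaves u))"
    using N[of 2] N[of 3] assms by (auto simp: composable_def label_set_def plug_def)
  from K_graft[OF 4 3, of u] have 5: "?p t u (Leaf ?c) \<in> K ?S2 0"
    using assms N[of 2] by (simp add: lin_ext_add graft_id)
  have 6: "composable ?S2 ?c (set (leaves v))"
    using N[of 2] N[of 3] assms by (auto simp: composable_def label_set_def plug_def)
  have "plug ?S2 ?c (set (leaves v)) = set (leaves t) \<union> set (leaves u) \<union> set (leaves v)"
    using N[of 1] N[of 2] N[of 3] by (auto simp: plug_def)
  with K_graft[OF 6 5, of v] N[of 3] assms show ?thesis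
    by (simp add: lin_ext_add graft_id)
qed

lemma K_metab:
  assumes "distinct (leaves t @ leaves u @ leaves v @ leaves w)"
  shows "basis (Br (Br t u) (Br v w))
    \<in> K (set (leaves t) \<union> set (leaves u) \<union> set (leaves v) \<union> set (leaves w)) 0"
proof -
  obtain N where "\<And>a. a \<in> set (leaves t) \<union> set (leaves u) \<union> set (leaves v) \<union> set (leaves w) \<Longrightarrow> a < N"
    using finite_nat_set_iff_bounded[of "set (leaves t) \<union> set (leaves u) \<union> set (leaves v) \<union> set (leaves w)"] by auto
  then have N: "\<And>i. i + N \<notin> set (leaves t)" "\<And>i. i + N \<notin> set (leaves u)" "\<And>i. i + N \<notin> set (leaves v)"
     "\<And>i. i + N \<notin> set (leaves w)"
    by fastforce+
  let ?a = "1 + N" and ?b = "2 + N" and ?c = "3 + N" and ?d = "4 + N"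
  let ?p = "\<lambda>a b c d. basis (Br (Br a b) (Br c d)) :: nat ltree \<Rightarrow>\<^sub>0 'k"
  from K_relabel[OF _ _ metab, of "\<lambda>i. i + N"]
  have 1: "?p (Leaf ?a) (Leaf ?b) (Leaf ?c) (Leaf ?d) \<in> K {?a, ?b, ?c, ?d} 0"
    by (simp add: lin_ext_add label_set_def)
  let ?S1 = "plug {?a, ?b, ?c, ?d} ?a (set (leaves t))"
  have 2: "composable {?a, ?b, ?c, ?d} ?a (set (leaves t))"
    using N[of 2] N[of 3] N[of 4] by (auto simp: composable_def label_set_def)
  from K_graft[OF 2 1, of t] have 3: "?p t (Leaf ?b) (Leaf ?c) (Leaf ?d) \<in> K ?S1 0"
    using assms by (simp add: lin_ext_add)
  let ?S2 = "plug ?S1 ?b (set (leaves u))"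
  have 4: "composable ?S1 ?b (set (leaves u))"
    using N[of 2] N[of 3] N[of 4] assms by (auto simp: composable_def label_set_def plug_def)
  from K_graft[OF 4 3, of u] have 5: "?p t u (Leaf ?c) (Leaf ?d) \<in> K ?S2 0"
    using assms N[of 2] by (simp add: lin_ext_add graft_id)
  let ?S3 = "plug ?S2 ?c (set (leaves v))"
  have 6: "composable ?S2 ?c (set (leaves v))"
    using N[of 2] N[of 3] N[of 4] assms by (auto simp: composable_def label_set_def plug_def)
  from K_graft[OF 6 5, of v] have 7: "?p t u v (Leaf ?d) \<in> K ?S3 0"
    using assms N[of 3] by (simp add: lin_ext_add graft_id)
  have 8: "composable ?S3 ?d (set (leaves w))"
    using N[of 2] N[of 3] N[of 4] assms by (auto simp: composable_def label_set_def plug_def)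
  have "plug ?S3 ?d (set (leaves w)) =
      set (leaves t) \<union> set (leaves u) \<union> set (leaves v) \<union> set (leaves w)"
    using N[of 1] N[of 2] N[of 3] N[of 4] by (auto simp: plug_def)
  with K_graft[OF 8 7, of w] N[of 4] assms show ?thesis
    by (simp add: lin_ext_add graft_id)
qed

section \<open>Left-normed brackets modulo the metabelian relations\<close>

primrec lnf :: "nat list \<Rightarrow> nat \<Rightarrow> nat \<Rightarrow> nat ltree" where
  "lnf [] x y = Br (Leaf x) (Leaf y)"
| "lnf (a # as) x y = Br (Leaf a) (lnf as x y)"

lemma leaves_lnf: "leaves (lnf as x y) = as @ [x, y]"
  by (induction as) auto

lemma lnf_Br: obtains t u where "lnf as x y = Br t u"
  by (cases as) auto

lemma K_Cons:
  assumes "p \<in> K S 0" "label_set S" "a \<notin> S"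
  shows "lin_ext (\<lambda>u. basis (Br (Leaf a) u)) p \<in> K (insert a S) 0"
  using K_Br_left[OF assms(1,2), of "Leaf a"] assms(3) by simp

text \<open>In the Jacobi identity for \<open>a\<close>, \<open>b\<close> and \<open>[t, u]\<close>,
  the term \<open>[[t, u], [a, b]]\<close> vanishes by the metabelian identity, and antisymmetry
  turns the other two into the difference.\<close>

lemma K_swap:
  assumes "distinct (a # b # leaves (Br t u))"
  shows "basis (Br (Leaf a) (Br (Leaf b) (Br t u))) - basis (Br (Leaf b) (Br (Leaf a) (Br t u)))
    \<in> K (insert a (insert b (set (leaves (Br t u))))) 0" (is "_ \<in> K ?S 0")
proof -
  have S: "label_set ?S" by (simp add: label_set_def)
  have 1: "basis (Br (Leaf a) (Br (Leaf b) (Br t u))) + basis (Br (Leaf b) (Br (Br t u) (Leaf a)))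
      + basis (Br (Br t u) (Br (Leaf a) (Leaf b))) \<in> K ?S 0"
    using K_jacobi[of "Leaf a" "Leaf b" "Br t u"] assms by (simp add: insert_commute Un_ac)
  have 2: "basis (Br (Br t u) (Br (Leaf a) (Leaf b))) \<in> K ?S 0"
    using K_metab[of t u "Leaf a" "Leaf b"] assms by (simp add: insert_commute Un_ac)
  have 3: "basis (Br (Leaf b) (Br (Br t u) (Leaf a))) + basis (Br (Leaf b) (Br (Leaf a) (Br t u))) \<in> K ?S 0"
    using K_Cons[OF K_antisym[of "Br t u" "Leaf a"], of b] assms
    by (simp add: lin_ext_add insert_commute label_set_def)
  show ?thesis
    using K_submodule(5)[OF S K_submodule(5)[OF S 1 2] 3] by (simp add: algebra_simps)
qed

text \<open>By \<open>K_swap\<close>, \<open>a\<close> passes the letters of \<open>as\<close> one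
  by one, the nearest first.\<close>

lemma K_lnf_move:
  assumes "distinct (as @ a # bs @ [x, y])"
  shows "basis (lnf (as @ a # bs) x y) - basis (lnf (a # as @ bs) x y)
    \<in> K (set (as @ a # bs @ [x, y])) 0"
  using assms
proof (induction as)
  case Nil
  then show ?case using K_submodule(1)[of "set (a # bs @ [x, y])"] by (simp add: label_set_def)
next
  case (Cons c as)
  have S: "label_set (set ((c # as) @ a # bs @ [x, y]))" by (simp add: label_set_def)
  have 1: "basis (lnf ((c # as) @ a # bs) x y) - basis (lnf (c # a # as @ bs) x y)
      \<in> K (set ((c # as) @ a # bs @ [x, y])) 0"
    using K_Cons[OF Cons.IH, of c] Cons.prems by (simp add: lin_ext_diff label_set_def)
  obtain t u where tu: "lnf (as @ bs) x y = Br t u" by (rule lnf_Br)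
  then have l: "leaves (Br t u) = as @ bs @ [x, y]" using leaves_lnf[of "as @ bs" x y] by simp
  have "basis (lnf (c # a # as @ bs) x y) - basis (lnf (a # c # as @ bs) x y)
      \<in> K (insert c (insert a (set (as @ bs @ [x, y])))) 0"
    using K_swap[of c a t u] Cons.prems unfolding l by (simp add: tu)
  also have "insert c (insert a (set (as @ bs @ [x, y]))) = set ((c # as) @ a # bs @ [x, y])" by auto
  finally have 2: "basis (lnf (c # a # as @ bs) x y) - basis (lnf (a # c # as @ bs) x y)
      \<in> K (set ((c # as) @ a # bs @ [x, y])) 0" .
  show ?case using K_submodule(2)[OF S 1 2] by simp
qed

text \<open>The first letter of one list is brought to the front of the other; the remaining letters
  are compared inside the bracket with it.\<close>

lemma K_lnf_perm:
  assumes "distinct (as @ [x, y])" "distinct (bs @ [x, y])" "set as = set bs"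
  shows "basis (lnf as x y) - basis (lnf bs x y) \<in> K (set (as @ [x, y])) 0"
  using assms
proof (induction as arbitrary: bs)
  case Nil
  then show ?case using K_submodule(1)[of "set [x, y]"] by (simp add: label_set_def)
next
  case (Cons a as)
  obtain b1 b2 where b: "bs = b1 @ a # b2" using Cons.prems(3) by (metis list.set_intros(1) split_list)
  have e: "set as = set (b1 @ b2)" using Cons.prems unfolding b by auto
  have S: "label_set (set ((a # as) @ [x, y]))" by (simp add: label_set_def)
  have "basis (lnf as x y) - basis (lnf (b1 @ b2) x y) \<in> K (set (as @ [x, y])) 0"
    using Cons.prems e unfolding b by (intro Cons.IH) auto
  from K_Cons[OF this, of a] have 1: "basis (lnf (a # as) x y) - basis (lnf (a # b1 @ b2) x y)
      \<in> K (set ((a # as) @ [x, y])) 0"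
    using Cons.prems by (simp add: lin_ext_diff label_set_def)
  have "set (b1 @ a # b2 @ [x, y]) = set ((a # as) @ [x, y])" using Cons.prems(3) unfolding b by auto
  then have 2: "basis (lnf bs x y) - basis (lnf (a # b1 @ b2) x y) \<in> K (set ((a # as) @ [x, y])) 0"
    using K_lnf_move[of b1 a b2 x y] Cons.prems unfolding b by simp
  show ?case using K_submodule(5)[OF S 1 2] by simp
qed

lemma K_lnf_antisym:
  assumes "distinct (as @ [x, y])"
  shows "basis (lnf as x y) + basis (lnf as y x) \<in> K (set (as @ [x, y])) 0"
  using assms
proof (induction as)
  case Nil
  then show ?case using K_antisym[of "Leaf x" "Leaf y"] by (simp add: insert_commute)
next
  case (Cons a as)
  then show ?case using K_Cons[OF Cons.IH, of a] by (simp add: lin_ext_add label_set_def)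
qed

text \<open>The identity starts at the three innermost letters, and \<open>K_Cons\<close> carries it
  outwards through the common letters \<open>as\<close>.\<close>

lemma K_lnf_jacobi:
  assumes "distinct (as @ [x, y, z])"
  shows "basis (lnf (as @ [z]) x y) + basis (lnf (as @ [x]) y z) + basis (lnf (as @ [y]) z x)
    \<in> K (set (as @ [x, y, z])) 0"
  using assms
proof (induction as)
  case Nil
  then show ?case using K_jacobi[of "Leaf z" "Leaf x" "Leaf y"] by (simp add: insert_commute)
next
  case (Cons a as)
  then show ?case using K_Cons[OF Cons.IH, of a] by (simp add: lin_ext_add label_set_def)
qed

text \<open>Outer letters commute modulo \<open>K\<close>, so sorting them is an arbitrary choice.
  The inner letter \<open>m\<close> is fixed and \<open>b\<close> varies, which leaves one normal
  form for each element of \<open>S - {m}\<close>.\<close>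

definition nf :: "nat set \<Rightarrow> nat \<Rightarrow> nat \<Rightarrow> nat ltree" where
  "nf S m b = lnf (sorted_list_of_set (S - {m, b})) m b"

definition spanned :: "nat set \<Rightarrow> nat \<Rightarrow> (nat ltree \<Rightarrow>\<^sub>0 'k) \<Rightarrow> bool" where
  "spanned S m p \<longleftrightarrow> (\<exists>c. p - (\<Sum>b\<in>S - {m}. scale (c b) (basis (nf S m b))) \<in> K S 0)"

lemma spanned_K:
  assumes "label_set S" "p - q \<in> K S 0" "spanned S m q"
  shows "spanned S m p"
proof -
  obtain c where "q - (\<Sum>b\<in>S - {m}. scale (c b) (basis (nf S m b))) \<in> K S 0"
    using assms(3) by (auto simp: spanned_def)
  from K_submodule(2)[OF assms(1) assms(2) this] show ?thesis
    unfolding spanned_def by auto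
qed

lemma spanned_0: "label_set S \<Longrightarrow> spanned S m 0"
  unfolding spanned_def using K_submodule(1) by (intro exI[of _ "\<lambda>_. 0"]) simp

lemma spanned_add:
  assumes "label_set S" "spanned S m p" "spanned S m q"
  shows "spanned S m (p + q)"
proof -
  obtain c d where "p - (\<Sum>b\<in>S - {m}. scale (c b) (basis (nf S m b))) \<in> K S 0"
    "q - (\<Sum>b\<in>S - {m}. scale (d b) (basis (nf S m b))) \<in> K S 0"
    using assms(2,3) by (auto simp: spanned_def)
  from K_submodule(2)[OF assms(1) this] show ?thesis
    unfolding spanned_def
    by (intro exI[of _ "\<lambda>b. c b + d b"]) (simp add: scale_add sum.distrib algebra_simps)
qed

lemma spanned_scale:
  assumes "label_set S" "spanned S m p"
  shows "spanned S m (scale k p)"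
proof -
  obtain c where "p - (\<Sum>b\<in>S - {m}. scale (c b) (basis (nf S m b))) \<in> K S 0"
    using assms(2) by (auto simp: spanned_def)
  from K_submodule(3)[OF assms(1) this, of k] show ?thesis
    unfolding spanned_def scale_diff
    by (intro exI[of _ "\<lambda>b. k * c b"]) (simp add: scale_sum)
qed

lemma spanned_uminus: "label_set S \<Longrightarrow> spanned S m p \<Longrightarrow> spanned S m (- p)"
  using spanned_scale[of S m p "- 1"] by simp

lemma spanned_sum: "label_set S \<Longrightarrow> (\<And>i. i \<in> I \<Longrightarrow> spanned S m (f i)) \<Longrightarrow> spanned S m (\<Sum>i\<in>I. f i)"
  by (induction I rule: infinite_finite_induct) (simp_all add: spanned_0 spanned_add)

lemma spanned_nf:
  assumes "distinct (as @ [m, b])"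
  shows "spanned (set (as @ [m, b])) m (basis (lnf as m b))"
proof -
  let ?S = "set (as @ [m, b])"
  have S: "label_set ?S" by (simp add: label_set_def)
  have "?S - {m, b} = set as" using assms by auto
  then have 1: "basis (lnf as m b) - basis (nf ?S m b) \<in> K ?S 0"
    unfolding nf_def using assms by (intro K_lnf_perm) auto
  have "(\<Sum>b'\<in>?S - {m}. scale (if b' = b then 1 else 0) (basis (nf ?S m b'))) =
      (\<Sum>b'\<in>?S - {m}. if b' = b then basis (nf ?S m b') else (0 :: nat ltree \<Rightarrow>\<^sub>0 'k))"
    by (intro sum.cong) auto
  also have "\<dots> = basis (nf ?S m b)" using assms by (subst sum.delta) auto
  finally show ?thesis using 1 unfolding spanned_def by (intro exI[of _ "\<lambda>b'. if b' = b then 1 else 0"]) simp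
qed

text \<open>If \<open>m\<close> is one of the two inner letters, at most antisymmetry is needed. If
  it is an outer letter, it is moved next to them, and the Jacobi identity replaces
  \<open>[m, [x, y]]\<close> by brackets in which \<open>m\<close> is an inner letter.\<close>

lemma spanned_lnf:
  assumes "distinct (as @ [x, y])" "m \<in> set (as @ [x, y])"
  shows "spanned (set (as @ [x, y])) m (basis (lnf as x y))"
proof -
  have S: "label_set (set (as @ [x, y]))" by (simp add: label_set_def)
  have swapped: "spanned (set (as @ [x, y])) y (basis (lnf as x y))" if "distinct (as @ [x, y])" for as x y
  proof -
    have S: "label_set (set (as @ [x, y]))" by (simp add: label_set_def)
    have e: "set (as @ [y, x]) = set (as @ [x, y])" by auto
    have "spanned (set (as @ [x, y])) y (- basis (lnf as y x))"
      using spanned_uminus[OF S] spanned_nf[of as y x] that unfolding e by auto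
    then show ?thesis using spanned_K[OF S] K_lnf_antisym[OF that] by (metis diff_minus_eq_add)
  qed
  consider "m = x" | "m = y" | "m \<in> set as" using assms(2) by auto
  then show ?thesis
  proof cases
    case 3
    define bs where "bs = remove1 m as"
    have bs: "set bs = set as - {m}" "distinct bs" using assms(1) by (auto simp: bs_def)
    let ?S = "set (as @ [x, y])"
    have eS: "set (bs @ [x, y, m]) = ?S" "set ((bs @ [x]) @ [y, m]) = ?S" "set ((bs @ [y]) @ [m, x]) = ?S"
      using 3 bs by auto
    have d: "distinct (bs @ [x, y, m])" "distinct ((bs @ [x]) @ [y, m])" "distinct ((bs @ [y]) @ [m, x])"
      using assms(1) bs 3 by auto
    have 1: "basis (lnf as x y) - basis (lnf (bs @ [m]) x y) \<in> K ?S 0"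
      using assms(1) bs 3 by (intro K_lnf_perm) auto
    have 2: "basis (lnf (bs @ [m]) x y) + basis (lnf (bs @ [x]) y m) + basis (lnf (bs @ [y]) m x) \<in> K ?S 0"
      using K_lnf_jacobi[OF d(1)] unfolding eS .
    have 3: "spanned ?S m (- (basis (lnf (bs @ [x]) y m) + basis (lnf (bs @ [y]) m x)))"
      using swapped[OF d(2)] spanned_nf[OF d(3)] unfolding eS
      by (intro spanned_uminus[OF S] spanned_add[OF S])
    show ?thesis
      by (rule spanned_K[OF S _ 3]) (use K_submodule(2)[OF S 1 2] in \<open>simp add: algebra_simps\<close>)
  qed (use spanned_nf swapped assms in auto)
qed

text \<open>The normal forms of \<open>u\<close> may be based at a letter \<open>m'\<close> other
  than \<open>m\<close>, for instance if \<open>m = a\<close>. Bracketing them with \<open>a\<close>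
  gives left-normed brackets again, which \<open>spanned_lnf\<close> rewrites in terms of
  \<open>m\<close>.\<close>

lemma spanned_Br_Leaf:
  assumes "distinct (a # leaves u)" "spanned (set (leaves u)) m' (basis u)" "m' \<in> set (leaves u)"
    "m \<in> set (a # leaves u)"
  shows "spanned (set (a # leaves u)) m (basis (Br (Leaf a) u))"
proof -
  let ?T = "set (leaves u)" and ?S = "set (a # leaves u)"
  have S: "label_set ?S" by (simp add: label_set_def)
  obtain c where c: "basis u - (\<Sum>b\<in>?T - {m'}. scale (c b) (basis (nf ?T m' b))) \<in> K ?T 0"
    using assms(2) by (auto simp: spanned_def)
  have "basis (Br (Leaf a) u) - (\<Sum>b\<in>?T - {m'}. scale (c b) (basis (Br (Leaf a) (nf ?T m' b)))) \<in> K ?S 0"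
    using K_Cons[OF c, of a] assms(1) by (simp add: lin_ext_diff lin_ext_sum lin_ext_scale)
  moreover have "spanned ?S m (\<Sum>b\<in>?T - {m'}. scale (c b) (basis (Br (Leaf a) (nf ?T m' b))))"
  proof (intro spanned_sum spanned_scale S)
    fix b assume b: "b \<in> ?T - {m'}"
    have e: "set ((a # sorted_list_of_set (?T - {m', b})) @ [m', b]) = ?S"
      using b assms(3) by auto
    have d: "distinct ((a # sorted_list_of_set (?T - {m', b})) @ [m', b])"
      using b assms(1,3) by auto
    show "spanned ?S m (basis (Br (Leaf a) (nf ?T m' b)))"
      using spanned_lnf[OF d, of m, unfolded e, OF assms(4)] by (simp add: nf_def)
  qed
  ultimately show ?thesis by (rule spanned_K[OF S])
qed

text \<open>A bracket of two brackets vanishes, and antisymmetry moves a leaf to the left, so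
  brackets of a leaf with a smaller tree remain. The base letter varies in the induction, because
  that of the whole tree need not occur in the smaller one.\<close>

lemma spanned_tree:
  assumes "distinct (leaves (Br t u))" "m \<in> set (leaves (Br t u))"
  shows "spanned (set (leaves (Br t u))) m (basis (Br t u))"
  using assms
proof (induction "Br t u" arbitrary: t u m)
  case (Br t u)
  have S: "label_set (set (leaves (Br t u)))" by (rule label_set_leaves)
  have leaf_br: "spanned (set (a # leaves (Br t' u'))) m (basis (Br (Leaf a) (Br t' u')))"
    if "distinct (a # leaves (Br t' u'))" "m \<in> set (a # leaves (Br t' u'))"
      "\<And>m. m \<in> set (leaves (Br t' u')) \<Longrightarrow> spanned (set (leaves (Br t' u'))) m (basis (Br t' u'))" for a t' u'
  proof -
    obtain m' where "m' \<in> set (leaves (Br t' u'))" by (metis leaves_ne ex_in_conv set_empty)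
    then show ?thesis using that by (intro spanned_Br_Leaf)
  qed
  show ?case
  proof (cases t)
    case t: (Leaf a)
    show ?thesis
    proof (cases u)
      case u: (Leaf b)
      show ?thesis using spanned_lnf[of "[]" a b m] Br.prems t u by simp
    next
      case u: (Br u1 u2)
      show ?thesis using leaf_br[of a u1 u2] Br.hyps(2)[OF u] Br.prems t u by simp
    qed
  next
    case t: (Br t1 t2)
    show ?thesis
    proof (cases u)
      case u: (Leaf b)
      have e: "set (leaves (Br t u)) = set (b # leaves (Br t1 t2))" using t u by auto
      have "spanned (set (leaves (Br t u))) m (- basis (Br u t))"
        using leaf_br[of b t1 t2] Br.hyps(1)[OF t] Br.prems t u unfolding e
        by (intro spanned_uminus) (auto simp: label_set_def)
      moreover have "basis (Br t u) - (- basis (Br u t)) \<in> K (set (leaves (Br t u))) 0"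
        using K_antisym[of t u] Br.prems by simp
      ultimately show ?thesis by (rule spanned_K[OF S, rotated])
    next
      case u: (Br u1 u2)
      have "basis (Br t u) - 0 \<in> K (set (leaves (Br t u))) 0"
        using K_metab[of t1 t2 u1 u2] Br.prems t u by (simp add: Un_assoc)
      then show ?thesis using spanned_0[OF S] by (rule spanned_K[OF S])
    qed
  qed
qed

lemma eval_nf:
  assumes "finite S" "m \<in> S" "b \<in> S" "b \<noteq> m"
  shows "tree_vec (nf S m b) a = ((if a = b then 1 else 0) - (if a = m then 1 else 0) :: 'k)"
proof -
  have "tree_vec (lnf as x y) a = ((if a = y then 1 else 0) - (if a = x then 1 else 0) :: 'k)" for as x y
  proof (induction as)
    case (Cons c as)
    obtain t u where "lnf as x y = Br t u" by (rule lnf_Br)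
    then have "tree_aug (lnf as x y) = (0 :: 'k)" by simp
    then show ?case using Cons by simp
  qed simp
  then show ?thesis by (simp add: nf_def)
qed

text \<open>Modulo \<open>K\<close>, \<open>p\<close> is a combination of normal forms based at
  \<open>m\<close>. For \<open>b\<close> other than \<open>m\<close>, the coordinate at
  \<open>b\<close> of their vectors is 1 for \<open>nf S m b\<close> and 0 for the others. As
  elements of \<open>K\<close> evaluate to 0, the coefficients are coordinates of the vector of
  \<open>p\<close>, that is, zero.\<close>

theorem kernel_subset:
  assumes S: "label_set S" and p: "Poly_Mapping.keys p \<subseteq> ltrees S"
    and 0: "\<And>a. eval_with tree_vec p a = 0"
  shows "p \<in> K S 0"
proof -
  have fin: "finite S" using S by (simp add: label_set_def)
  obtain m where m: "m \<in> S" using S by (auto simp: label_set_def)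
  show ?thesis
  proof (cases "S = {m}")
    case True
    \<comment> \<open>On one letter the leaf is the only tree, and its coefficient in
      \<open>p\<close> is the coordinate at \<open>m\<close>.\<close>
    have t: "t = Leaf m" if "t \<in> ltrees S" for t
    proof (cases t)
      case (Br t1 t2)
      obtain a b where "a \<in> set (leaves t1)" "b \<in> set (leaves t2)" by (metis leaves_ne ex_in_conv set_empty)
      moreover from this have "a = m" "b = m" using that Br unfolding ltrees_def True by auto
      ultimately show ?thesis using that Br by (auto simp: ltrees_def)
    qed (use that True in \<open>auto simp: ltrees_def\<close>)
    have "p = scale (Poly_Mapping.lookup p (Leaf m)) (basis (Leaf m))"
    proof (rule poly_mapping_eqI)
      fix t
      show "Poly_Mapping.lookup p t = Poly_Mapping.lookup (scale (Poly_Mapping.lookup p (Leaf m)) (basis (Leaf m))) t"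
        using t[of t] p by (cases "t = Leaf m") (auto simp: lookup_basis in_keys_iff)
    qed
    moreover from this have "eval_with tree_vec p m = Poly_Mapping.lookup p (Leaf m)"
      by (metis eval_with_scale eval_with_basis tree_vec.simps(1) mult.comm_neutral)
    ultimately have "p = 0" using 0 by (metis scale_simps(1))
    then show ?thesis using K_submodule(1)[OF S] by simp
  next
    case False
    have "spanned S m p"
      using p
    proof (induction rule: free_module_induct)
      case (basis t k)
      obtain t1 t2 where t: "t = Br t1 t2" using basis m False by (cases t) (auto simp: ltrees_def)
      have "S = set (leaves (Br t1 t2))" "distinct (leaves (Br t1 t2))" using basis t by (auto simp: ltrees_def)
      then show ?case using spanned_tree[of t1 t2 m] m S t by (intro spanned_scale) auto
    qed (use spanned_0 spanned_add S in auto)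
    then obtain c where c: "p - (\<Sum>b\<in>S - {m}. scale (c b) (basis (nf S m b))) \<in> K S 0"
      by (auto simp: spanned_def)
    have "c b = 0" if b: "b \<in> S - {m}" for b
    proof -
      have "0 = eval_with tree_vec (p - (\<Sum>b\<in>S - {m}. scale (c b) (basis (nf S m b)))) b"
        using ker[OF S c] by simp
      also have "\<dots> = - (\<Sum>b'\<in>S - {m}. c b' * (if b = b' then 1 else 0))"
        using 0 b fin m by (simp add: eval_with_diff eval_with_sum eval_with_scale eval_nf)
      also have "\<dots> = - c b"
        using b fin by (simp add: if_distrib[of "(*) _"] cong: if_cong)
      finally show ?thesis by simp
    qed
    then have "(\<Sum>b\<in>S - {m}. scale (c b) (basis (nf S m b))) = (0 :: nat ltree \<Rightarrow>\<^sub>0 'k)" by simp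
    then show ?thesis using c by simp
  qed
qed

end

section \<open>Identification of the metabelian operad\<close>

lemma (in pre_operad) operad_ideal_preimage:
  assumes hom: "operad_hom P N g" and J: "operad_ideal N J" and N: "pre_operad N"
  shows "operad_ideal P (\<lambda>S d. {x \<in> carrier (comp_module P S d). g S d x \<in> J S d})"
proof -
  interpret N: pre_operad N by fact
  note g = operad_homD[OF hom]
  have "submodule {x \<in> carrier (comp_module P S d). g S d x \<in> J S d} base_ring (comp_module P S d)"
    if S: "label_set S" for S d
  proof -
    interpret M: module base_ring "comp_module P S d" using S by (rule comp_module_module)
    interpret K: module base_ring "comp_module N S d" using S by (rule N.comp_module_module)
    note l = linear_mapsD[OF g(1)[OF S]] linear_maps_zero[OF g(1)[OF S] M.module_axioms K.module_axioms]
      linear_maps_uminus[OF g(1)[OF S] M.module_axioms K.module_axioms]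
    note sub = operad_idealD(1)[OF J S]
    show ?thesis
      by (rule M.submoduleI)
        (auto simp: l subgroup.one_closed[OF submodule.axioms(1)[OF sub], simplified]
          intro: K.submoduleE(3,4,5)[OF sub, simplified])
  qed
  then show ?thesis
    using operad_idealD(2-4)[OF J] unfolding operad_ideal_def
    by (simp add: g composableD(1,2) relabel_closed pcomp_closed)
qed

text \<open>The vectors \<open>e_b - e_m\<close> span the vectors of sum zero: for \<open>b\<close>
  other than \<open>m\<close> the coefficient is the coordinate at \<open>b\<close>, and then the
  coordinate at \<open>m\<close> is right because the sum is zero.\<close>

lemma Mag_vec_surj:
  fixes v :: "nat \<Rightarrow> 'k::{comm_ring,comm_monoid_mult}"
  assumes S: "label_set S" and v: "v \<in> carrier (comp_module vec_operad S d)"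
  shows "v \<in> eval_with tree_vec ` carrier (comp_module Mag S d)"
proof (cases "d = 0")
  case False
  then have "v = eval_with tree_vec 0" using v by (auto simp: vec_carrier)
  then show ?thesis by (auto simp: Mag_simps)
next
  case True
  have fin: "finite S" using S by (simp add: label_set_def)
  obtain m where m: "m \<in> S" using S by (auto simp: label_set_def)
  \<comment> \<open>The tree of \<open>nf S m b\<close>, written out because \<open>nf\<close>
    belongs to a locale that presupposes an ideal.\<close>
  define tr where "tr b = foldr (\<lambda>a t. Br (Leaf a) t) (sorted_list_of_set (S - {m, b})) (Br (Leaf m) (Leaf b))" for b
  have lf: "leaves (foldr (\<lambda>a t. Br (Leaf a) t) as t) = as @ leaves t" for as and t :: "nat ltree"
    by (induction as) auto
  have tr: "tr b \<in> ltrees S" if "b \<in> S - {m}" for b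
    using that m fin by (auto simp: tr_def ltrees_def lf)
  have aug: "tree_aug (foldr (\<lambda>a t. Br (Leaf a) t) as (Br (Leaf m) (Leaf b))) = (0 :: 'k)" for as b
    by (cases as) auto
  have tv: "tree_vec (foldr (\<lambda>a t. Br (Leaf a) t) as (Br (Leaf m) (Leaf b))) a
    = ((if a = b then 1 else 0) - (if a = m then 1 else 0) :: 'k)" for as a b
    by (induction as) (simp_all add: aug)
  show ?thesis
  proof (cases "S = {m}")
    case True
    have "v = eval_with tree_vec (scale (v m) (basis (Leaf m)))"
      using v True by (auto simp: vec_carrier eval_with_scale fun_eq_iff)
    moreover have "scale (v m) (basis (Leaf m)) \<in> carrier (comp_module Mag S d)"
      using True \<open>d = 0\<close> subset_trans[OF keys_scale keys_basis, of "v m" "Leaf m"]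
      by (auto simp: Mag_simps ltrees_def)
    ultimately show ?thesis by blast
  next
    case False
    let ?p = "\<Sum>b\<in>S - {m}. scale (v b) (basis (tr b))"
    have "card {m} < card S" using False m fin by (intro psubset_card_mono) auto
    then have 0: "sum v S = 0" using v by (simp add: vec_carrier)
    have "eval_with tree_vec ?p a = v a" for a
    proof -
      have "eval_with tree_vec ?p a =
         (\<Sum>b\<in>S - {m}. v b * (if a = b then 1 else 0)) - (\<Sum>b\<in>S - {m}. v b * (if a = m then 1 else 0))"
        by (simp only: eval_with_sum eval_with_scale eval_with_basis tr_def tv right_diff_distrib sum_subtractf)
      also have "(\<Sum>b\<in>S - {m}. v b * (if a = b then 1 else 0)) = (if a \<in> S - {m} then v a else 0)"
        using fin by (simp add: if_distrib[of "(*) _"] cong: if_cong)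
      also have "(\<Sum>b\<in>S - {m}. v b * (if a = m then 1 else 0)) = (if a = m then - v m else 0)"
        using sum.remove[OF fin m, of v] 0 by (simp add: eq_neg_iff_add_eq_0 add.commute)
      finally show ?thesis using v by (auto simp: vec_carrier)
    qed
    moreover have "?p \<in> carrier (comp_module Mag S d)"
    proof -
      have "Poly_Mapping.keys (scale (v b) (basis (tr b))) \<subseteq> ltrees S" if "b \<in> S - {m}" for b
        using tr[OF that] by (intro order_trans[OF subset_trans[OF keys_scale keys_basis]]) simp
      then have "Poly_Mapping.keys ?p \<subseteq> ltrees S" by (rule keys_sum_subset)
      then show ?thesis using \<open>d = 0\<close> by (simp add: Mag_simps)
    qed
    ultimately show ?thesis by (intro image_eqI[of _ _ ?p]) auto
  qed
qed

lemma lie_relations_carrier: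
  fixes x :: "nat ltree \<Rightarrow>\<^sub>0 'k::{comm_ring,comm_monoid_mult}"
  assumes "(T, e, x) \<in> lie_relations"
  shows "x \<in> carrier (comp_module Mag T e)"
proof -
  from assms consider "T = {1,2}" "e = 0" "x = basis (Br (Leaf 1) (Leaf 2)) + basis (Br (Leaf 2) (Leaf 1))"
    | "T = {1,2,3}" "e = 0" "x = basis (Br (Leaf 1) (Br (Leaf 2) (Leaf 3)))
                 + basis (Br (Leaf 2) (Br (Leaf 3) (Leaf 1)))
                 + basis (Br (Leaf 3) (Br (Leaf 1) (Leaf 2)))"
    by (auto simp: lie_relations_def)
  then show ?thesis
  proof cases
    case 1
    have "Br (Leaf 1) (Leaf 2) \<in> ltrees {1, 2::nat}" "Br (Leaf 2) (Leaf 1) \<in> ltrees {1, 2::nat}"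
      by (auto simp: ltrees_def)
    from this[THEN tree_basis_carrier, where ?'a = 'k] show ?thesis
      using 1 by (simp add: Mag_simps keys_plus)
  next
    case 2
    have "Br (Leaf 1) (Br (Leaf 2) (Leaf 3)) \<in> ltrees {1, 2, 3::nat}"
      "Br (Leaf 2) (Br (Leaf 3) (Leaf 1)) \<in> ltrees {1, 2, 3::nat}"
      "Br (Leaf 3) (Br (Leaf 1) (Leaf 2)) \<in> ltrees {1, 2, 3::nat}"
      by (auto simp: ltrees_def)
    from this[THEN tree_basis_carrier, where ?'a = 'k] show ?thesis
      using 2 by (simp add: Mag_simps keys_plus)
  qed
qed

lemma lie_relations_vec: "(T, e, x) \<in> lie_relations \<Longrightarrow> eval_with tree_vec x a = 0"
  by (auto simp: lie_relations_def eval_with_add)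

theorem MetabLie_iso_vec_operad:
  obtains h where
    "operad_iso (MetabLie :: ('k::{comm_ring,comm_monoid_mult}, _) gr_operad) vec_operad h"
    "\<And>S t. t \<in> ltrees S \<Longrightarrow> h S 0 (quot_class Lie metab_relations S 0 (lie_monomial t)) = tree_vec t"
proof -
  let ?M = "Mag :: ('k, _) gr_operad" and ?V = "vec_operad :: ('k, _) gr_operad"
  let ?L = "Lie :: ('k, _) gr_operad"
  define I where "I = ideal_gen ?M lie_relations"
  define J where "J = ideal_gen ?L metab_relations"
  interpret V: pre_operad ?V using graded_operad_vec_operad by (rule graded_operad_pre_operad)
  interpret M: operad_with_ideal ?M I
    unfolding I_def using lie_relations_carrier
    by (intro operad_with_ideal.intro operad_with_ideal_axioms.intro pre_operad_Mag
        pre_operad.operad_ideal_ideal_gen)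
  have L: "?L = quot_by ?M I" by (simp add: Lie_def operad_quot_eq_quot_by I_def)
  have I: "I S d \<subseteq> {x \<in> carrier (comp_module ?M S d). eval_with tree_vec x = \<zero>\<^bsub>comp_module ?V S d\<^esub>}" for S d
    unfolding I_def
    by (rule M.ideal_gen_least[OF M.operad_ideal_kernel[OF Mag_vec_hom V.pre_operad_axioms]])
      (use lie_relations_vec lie_relations_carrier in \<open>auto simp: fun_eq_iff\<close>)
  obtain g where g: "operad_hom ?L ?V g"
    "\<And>S d x. label_set S \<Longrightarrow> x \<in> carrier (comp_module ?M S d) \<Longrightarrow> g S d (M.cls S d x) = eval_with tree_vec x"
    using M.induced_hom[OF Mag_vec_hom V.pre_operad_axioms] I unfolding L by blast
  interpret L: pre_operad ?L unfolding L by (rule M.pre_operad_quot)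
  have qc: "quot_class ?M lie_relations S d x = M.cls S d x" for S d x
    by (simp add: quot_class_def I_def)
  have lm: "lie_monomial t = M.cls S 0 (basis t)" if "t \<in> ltrees S" for t S
    using that by (simp add: lie_monomial_def qc ltrees_def)
  have lm_carrier: "lie_monomial t \<in> carrier (comp_module ?L S 0)" if "t \<in> ltrees S" "label_set S" for t S
    using M.quot_carrier[OF that(2), of 0] tree_basis_carrier[OF that(1), where ?'a = 'k]
    unfolding L lm[OF that(1)] by blast
  have t4: "Br (Br (Leaf 1) (Leaf 2)) (Br (Leaf 3) (Leaf 4)) \<in> ltrees {1,2,3,4::nat}" (is "?t4 \<in> _")
    by (auto simp: ltrees_def)
  have S4: "label_set {1,2,3,4}" by (simp add: label_set_def)
  have mr: "x \<in> carrier (comp_module ?L T e)" if "(T, e, x) \<in> metab_relations" for T e x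
    using that lm_carrier[OF t4 S4] by (simp add: metab_relations_def)
  interpret L: operad_with_ideal ?L J
    unfolding J_def using mr
    by (intro operad_with_ideal.intro operad_with_ideal_axioms.intro L.pre_operad_axioms
        L.operad_ideal_ideal_gen)
  have metab_eq: "(MetabLie :: ('k, _) gr_operad) = quot_by ?L J"
    by (simp add: MetabLie_def operad_quot_eq_quot_by J_def)
  have gt: "g S 0 (lie_monomial t) = tree_vec t" if "t \<in> ltrees S" "label_set S" for t S
    using g(2)[OF that(2) tree_basis_carrier[OF that(1)]] by (simp add: lm[OF that(1)] fun_eq_iff)
  have J: "J S d \<subseteq> {x \<in> carrier (comp_module ?L S d). g S d x = \<zero>\<^bsub>comp_module ?V S d\<^esub>}" for S d
    unfolding J_def
  proof (rule L.ideal_gen_least[OF L.operad_ideal_kernel[OF g(1) V.pre_operad_axioms]])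
    fix T e x assume *: "(T, e, x) \<in> (metab_relations :: (_ \<times> _ \<times> (_ \<Rightarrow>\<^sub>0 'k) set) set)"
    then show "x \<in> {x \<in> carrier (comp_module ?L T e). g T e x = \<zero>\<^bsub>comp_module ?V T e\<^esub>}"
      using mr[OF *] gt[OF t4 S4] by (auto simp: metab_relations_def fun_eq_iff)
  qed
  \<comment> \<open>The elements of \<open>Mag\<close> whose class in \<open>Lie\<close> lies in the
    metabelian ideal. Lifting to \<open>Mag\<close> makes all elements explicit combinations of
    trees.\<close>
  let ?K = "\<lambda>S d. {p \<in> carrier (comp_module ?M S d). M.cls S d p \<in> J S d}"
  have K: "metabelian_ideal ?K"
  proof
    show "operad_ideal Mag ?K"
      using M.operad_ideal_preimage[OF _ L.ideal L.pre_operad_axioms] M.class_hom unfolding L by blast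
    show "x \<in> ?K T e" if x: "(T, e, x) \<in> lie_relations" for T e x
    proof -
      have T: "label_set T" using x by (auto simp: lie_relations_def label_set_def)
      interpret A: module_quotient "comp_module ?M T e" "I T e" using T by (rule M.module_quotient)
      interpret B: module_quotient "comp_module ?L T e" "J T e" using T by (rule L.module_quotient)
      have "x \<in> I T e" unfolding I_def using x by (rule M.ideal_gen_generator)
      then have "M.cls T e x = I T e" using A.class_eq_self_iff[OF lie_relations_carrier[OF x]] by simp
      also have "\<dots> = \<zero>\<^bsub>comp_module ?L T e\<^esub>" unfolding L M.quot_comp_module by (simp add: A.quot_zero)
      finally show ?thesis
        using lie_relations_carrier[OF x] subgroup.one_closed[OF B.H.subgroup_axioms] by simp
    qed
    have "lie_monomial ?t4 \<in> J {1,2,3,4} 0"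
      unfolding J_def by (rule L.ideal_gen_generator) (simp add: metab_relations_def)
    then show "basis ?t4 \<in> ?K {1,2,3,4} 0"
      unfolding lm[OF t4] using tree_basis_carrier[OF t4] by blast
    show "eval_with tree_vec p a = 0" if "label_set S" "p \<in> ?K S 0" for S p a
      using that J[of S 0] g(2)[OF that(1), of p 0] by (auto simp: fun_eq_iff)
  qed
  interpret K: metabelian_ideal ?K by (rule K)
  have ker: "g S d x = \<zero>\<^bsub>comp_module ?V S d\<^esub> \<longleftrightarrow> x \<in> J S d"
    if S: "label_set S" and x: "x \<in> carrier (comp_module ?L S d)" for S d x
  proof
    assume 0: "g S d x = \<zero>\<^bsub>comp_module ?V S d\<^esub>"
    obtain p where p: "p \<in> carrier (comp_module ?M S d)" "x = M.cls S d p"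
      using x M.quot_carrier[OF S, of d] unfolding L by auto
    have e: "eval_with tree_vec p a = 0" for a using 0 g(2)[OF S p(1)] p(2) by (simp add: fun_eq_iff)
    show "x \<in> J S d"
    proof (cases "d = 0")
      case True
      have "Poly_Mapping.keys p \<subseteq> ltrees S" using p(1) True by (simp add: Mag_simps)
      from K.kernel_subset[OF S this e] show ?thesis using True p(2) by simp
    next
      case False
      have "p = 0" using p(1) False by (simp add: Mag_simps)
      interpret A: module_quotient "comp_module ?M S d" "I S d" using S by (rule M.module_quotient)
      interpret B: module_quotient "comp_module ?L S d" "J S d" using S by (rule L.module_quotient)
      have z: "\<zero>\<^bsub>comp_module ?M S d\<^esub> = 0" by (simp add: Mag_simps)
      have "M.cls S d 0 = \<zero>\<^bsub>comp_module ?L S d\<^esub>"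
        using A.class_eq_self_iff[OF A.M.zero_closed] subgroup.one_closed[OF A.H.subgroup_axioms]
        unfolding L M.quot_comp_module A.quot_zero by (simp add: z)
      then show ?thesis using p(2) \<open>p = 0\<close> subgroup.one_closed[OF B.H.subgroup_axioms] by simp
    qed
  qed (use J[of S d] in blast)
  have surj: "carrier (comp_module ?V S d) \<subseteq> g S d ` carrier (comp_module ?L S d)" if S: "label_set S" for S d
  proof
    fix v assume "v \<in> carrier (comp_module ?V S d)"
    then obtain p where p: "p \<in> carrier (comp_module ?M S d)" "v = eval_with tree_vec p"
      using Mag_vec_surj[OF S, of v d] by auto
    have "M.cls S d p \<in> carrier (comp_module ?L S d)" using M.quot_carrier[OF S, of d] p(1) unfolding L by blast
    then show "v \<in> g S d ` carrier (comp_module ?L S d)" using g(2)[OF S p(1)] p(2) by (metis imageI)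
  qed
  obtain h where h: "operad_iso (quot_by ?L J) ?V h"
    "\<And>S d x. label_set S \<Longrightarrow> x \<in> carrier (comp_module ?L S d) \<Longrightarrow> h S d (L.cls S d x) = g S d x"
    using L.quot_by_iso[OF g(1) graded_operad_vec_operad ker surj] by blast
  have qc': "quot_class ?L metab_relations S d x = L.cls S d x" for S d x
    by (simp add: quot_class_def J_def)
  show ?thesis
  proof (rule that[of h])
    show "operad_iso MetabLie ?V h" using h(1) unfolding metab_eq .
    show "h S 0 (quot_class Lie metab_relations S 0 (lie_monomial t)) = tree_vec t" if "t \<in> ltrees S" for S t
    proof -
      have S: "label_set S" using that by (auto simp: ltrees_def label_set_def)
      show ?thesis unfolding qc' using h(2)[OF S lm_carrier[OF that S]] gt[OF that S] by simp
    qed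
  qed
qed

section \<open>Cochains of finite posets\<close>

definition del :: "nat \<Rightarrow> 'x list \<Rightarrow> 'x list" where
  "del i xs = take i xs @ drop (Suc i) xs"

lemma length_del: "i < length xs \<Longrightarrow> length (del i xs) = length xs - 1"
  by (simp add: del_def)

lemma map_del: "map f (del i xs) = del i (map f xs)"
  by (simp add: del_def take_map drop_map)

lemma set_del_subset: "set (del i xs) \<subseteq> set xs"
  using set_take_subset set_drop_subset by (fastforce simp: del_def)

lemma del_Suc_Cons [simp]: "del (Suc i) (x # xs) = x # del i xs" "del 0 (x # xs) = xs"
  by (simp_all add: del_def)

text \<open>One of the simplicial identities, responsible for the cancellation in the square of the
  coboundary.\<close>

lemma del_del: "j < i \<Longrightarrow> del j (del i xs) = del (i - 1) (del j xs)"
proof (induction xs arbitrary: i j)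
  case (Cons x xs)
  show ?case
  proof (cases j)
    case 0
    then show ?thesis using Cons.prems by (cases i) auto
  next
    case (Suc j')
    define i' where "i' = i - 2"
    have i: "i = Suc (Suc i')" "j' < Suc i'"
      using Cons.prems Suc by (simp_all add: i'_def)
    then show ?thesis using Suc Cons.IH[of j' "Suc i'"] by simp
  qed
qed (simp add: del_def)

lemma hd_del: "0 < i \<Longrightarrow> i < length xs \<Longrightarrow> hd (del i xs) = hd xs"
  by (cases xs; cases i) auto

lemma last_del: "Suc i < length xs \<Longrightarrow> last (del i xs) = last xs"
  by (simp add: del_def)

lemma sorted_wrt_del: "sorted_wrt P xs \<Longrightarrow> sorted_wrt P (del i xs)"
proof (induction xs arbitrary: i)
  case (Cons x xs)
  show ?case
  proof (cases i)
    case (Suc j)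
    then show ?thesis using Cons set_del_subset[of j xs] by auto
  qed (use Cons in auto)
qed (simp add: del_def)

lemma insert_eq_iff:
  assumes "i < length xs"
  shows "take i xs @ y # drop i xs = ys \<longleftrightarrow> i < length ys \<and> y = ys ! i \<and> xs = del i ys"
proof
  assume e: "take i xs @ y # drop i xs = ys"
  then have "length ys = Suc (length xs)" using assms by auto
  moreover have "ys ! i = y" using assms e by (metis length_take less_imp_le min.absorb2 nth_append_length)
  moreover have "del i ys = xs" unfolding e[symmetric] del_def using assms by simp
  ultimately show "i < length ys \<and> y = ys ! i \<and> xs = del i ys" using assms by simp
next
  assume "i < length ys \<and> y = ys ! i \<and> xs = del i ys"
  then show "take i xs @ y # drop i xs = ys"
    by (simp add: del_def id_take_nth_drop[symmetric])
qed

text \<open>Chains and coboundaries involve only the strict order. These axioms hold for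
  \<open>NS S\<close> and are inherited by its intervals, so that the same lemmas serve for all
  posets in the definition of the composition.\<close>

locale finite_gorder =
  fixes L :: "'x gorder"
  assumes finite_carrier: "finite (carrier L)"
    and less_trans: "x \<in> carrier L \<Longrightarrow> y \<in> carrier L \<Longrightarrow> z \<in> carrier L \<Longrightarrow>
      x \<sqsubset>\<^bsub>L\<^esub> y \<Longrightarrow> y \<sqsubset>\<^bsub>L\<^esub> z \<Longrightarrow> x \<sqsubset>\<^bsub>L\<^esub> z"
    and less_irrefl: "\<not> x \<sqsubset>\<^bsub>L\<^esub> x"
begin

lemma finite_chains: "finite (chains L n)"
  by (rule finite_subset[OF _ finite_lists_length_eq[OF finite_carrier, of "nat (n + 1)"]])
    (auto simp: chains_def)

lemma chains_distinct: "xs \<in> chains L n \<Longrightarrow> distinct xs"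
  unfolding chains_def using less_irrefl
  by (auto simp: sorted_wrt_iff_nth_less distinct_conv_nth) (metis linorder_neqE_nat)

lemma del_chain:
  assumes "ys \<in> chains L n" "1 \<le> i" "Suc i < length ys"
  shows "del i ys \<in> chains L (n - 1)"
proof -
  have "del i ys \<noteq> []" using assms length_del[of i ys] by auto
  then show ?thesis
    using assms set_del_subset[of i ys] length_del[of i ys] sorted_wrt_del[of "lless L" ys i]
    by (auto simp: chains_def hd_del last_del)
qed

lemma insert_chain:
  assumes "xs \<in> chains L n" "1 \<le> i" "i < length xs" "y \<in> carrier L"
    "xs ! (i - 1) \<sqsubset>\<^bsub>L\<^esub> y" "y \<sqsubset>\<^bsub>L\<^esub> xs ! i"
  shows "take i xs @ y # drop i xs \<in> chains L (n + 1)"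
proof -
  have s: "sorted_wrt (lless L) xs" and c: "set xs \<subseteq> carrier L" using assms(1) by (auto simp: chains_def)
  have m: "xs ! k \<in> carrier L" if "k < length xs" for k using c nth_mem[OF that] by auto
  have 1: "a \<sqsubset>\<^bsub>L\<^esub> y" if a: "a \<in> set (take i xs)" for a
  proof -
    obtain j where "j < length (take i xs)" "take i xs ! j = a"
      using a unfolding in_set_conv_nth by (elim exE conjE)
    then have j: "j < i" "a = xs ! j" by auto
    show ?thesis
    proof (cases "j = i - 1")
      case False
      then have "xs ! j \<sqsubset>\<^bsub>L\<^esub> xs ! (i - 1)" using s j assms(3) by (simp add: sorted_wrt_iff_nth_less)
      then show ?thesis using less_trans[OF m[of j] m[of "i - 1"] assms(4)] assms j by simp
    qed (use j assms in auto)
  qed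
  have 2: "y \<sqsubset>\<^bsub>L\<^esub> a" if a: "a \<in> set (drop i xs)" for a
  proof -
    obtain j where "j < length (drop i xs)" "drop i xs ! j = a"
      using a unfolding in_set_conv_nth by (elim exE conjE)
    then have j: "i + j < length xs" "a = xs ! (i + j)" by auto
    show ?thesis
    proof (cases "j = 0")
      case False
      then have "xs ! i \<sqsubset>\<^bsub>L\<^esub> xs ! (i + j)" using s j by (simp add: sorted_wrt_iff_nth_less)
      then show ?thesis using less_trans[OF assms(4) m[of i] m[of "i + j"]] assms j by simp
    qed (use j assms in auto)
  qed
  have 3: "sorted_wrt (lless L) (take i xs @ drop i xs)" using s by simp
  have "sorted_wrt (lless L) (take i xs @ y # drop i xs)"
    using 1 2 3 by (auto simp only: sorted_wrt_append sorted_wrt.simps set_simps)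
  moreover have "set (take i xs @ y # drop i xs) \<subseteq> carrier L"
    using c assms(4) set_take_subset[of i xs] set_drop_subset[of i xs] by auto
  ultimately show ?thesis
    using assms by (auto simp: chains_def hd_append)
qed

lemma coboundary_keys:
  assumes "Poly_Mapping.keys z \<subseteq> chains L n"
  shows "Poly_Mapping.keys (coboundary L z) \<subseteq> chains L (n + 1)"
  unfolding coboundary_def
proof (intro keys_lin_ext keys_sum_subset order_trans[OF keys_scale])
  fix xs i y assume "xs \<in> Poly_Mapping.keys z" "i \<in> {1..<length xs}"
    "y \<in> {y \<in> carrier L. xs ! (i - 1) \<sqsubset>\<^bsub>L\<^esub> y \<and> y \<sqsubset>\<^bsub>L\<^esub> xs ! i}"
  then have "take i xs @ y # drop i xs \<in> chains L (n + 1)"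
    using assms by (intro insert_chain) auto
  then show "Poly_Mapping.keys (basis (take i xs @ y # drop i xs)) \<subseteq> chains L (n + 1)"
    by (intro order_trans[OF keys_basis]) simp
qed

text \<open>Seen from the result, \<open>ys\<close> arises from \<open>xs\<close> by insertion at
  \<open>i\<close> exactly if \<open>xs\<close> is \<open>ys\<close> without its entry
  \<open>i\<close>. So the coefficients of a coboundary are alternating sums over deletions of inner
  entries, which is how coboundaries are computed later.\<close>

lemma lookup_coboundary:
  fixes z :: "'x list \<Rightarrow>\<^sub>0 'k::{comm_ring,comm_monoid_mult}"
  assumes z: "Poly_Mapping.keys z \<subseteq> chains L n" and ys: "ys \<in> chains L m"
  shows "Poly_Mapping.lookup (coboundary L z) ys =
    (\<Sum>i = 1..<length ys - 1. ksign (int i) * Poly_Mapping.lookup z (del i ys))"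
proof (cases "m = n + 1")
  case False
  have "ys \<notin> chains L (n + 1)" using ys False by (auto simp: chains_def)
  then have "Poly_Mapping.lookup (coboundary L z) ys = 0"
    using coboundary_keys[OF z] by (auto simp: in_keys_iff)
  moreover have "Poly_Mapping.lookup z (del i ys) = 0" if "i \<in> {1..<length ys - 1}" for i
  proof -
    have "del i ys \<notin> chains L n" using that ys False length_del[of i ys] by (auto simp: chains_def)
    then show ?thesis using z by (auto simp: in_keys_iff)
  qed
  ultimately show ?thesis by simp
next
  case True
  have len: "length xs = length ys - 1" if "xs \<in> Poly_Mapping.keys z" for xs
    using that z ys True by (force simp: chains_def)
  have ins: "(\<Sum>y | y \<in> carrier L \<and> xs ! (i - 1) \<sqsubset>\<^bsub>L\<^esub> y \<and> y \<sqsubset>\<^bsub>L\<^esub> xs ! i.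
      if take i xs @ y # drop i xs = ys then 1 else 0 :: 'k) = (if xs = del i ys then 1 else 0)"
    if xs: "xs \<in> Poly_Mapping.keys z" and i: "i \<in> {1..<length xs}" for xs i
  proof -
    let ?Y = "{y. y \<in> carrier L \<and> xs ! (i - 1) \<sqsubset>\<^bsub>L\<^esub> y \<and> y \<sqsubset>\<^bsub>L\<^esub> xs ! i}"
    have l: "Suc i < length ys" using len[OF xs] i by auto
    have "take i xs @ y # drop i xs = ys \<longleftrightarrow> y = ys ! i \<and> xs = del i ys" for y
      using insert_eq_iff[of i xs y ys] i l by auto
    then have "(\<Sum>y\<in>?Y. if take i xs @ y # drop i xs = ys then 1 else 0 :: 'k) =
      (\<Sum>y\<in>?Y. if y = ys ! i then (if xs = del i ys then 1 else 0) else 0)"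
      by (intro sum.cong) auto
    also have "\<dots> = (if ys ! i \<in> ?Y then (if xs = del i ys then 1 else 0) else 0)"
      by (rule sum.delta) (use finite_carrier in auto)
    also have "\<dots> = (if xs = del i ys then 1 else 0)"
    proof -
      have "ys ! i \<in> ?Y" if "xs = del i ys"
      proof -
        have "xs ! (i - 1) = ys ! (i - 1)" "xs ! i = ys ! Suc i"
          using that i l by (auto simp: del_def nth_append)
        then show ?thesis using ys i l by (auto simp: chains_def sorted_wrt_iff_nth_less)
      qed
      then show ?thesis by auto
    qed
    finally show ?thesis .
  qed
  have "Poly_Mapping.lookup (coboundary L z) ys = (\<Sum>xs\<in>Poly_Mapping.keys z. Poly_Mapping.lookup z xs *
      (\<Sum>i = 1..<length xs. ksign (int i) *
        (\<Sum>y | y \<in> carrier L \<and> xs ! (i - 1) \<sqsubset>\<^bsub>L\<^esub> y \<and> y \<sqsubset>\<^bsub>L\<^esub> xs ! i.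
          if take i xs @ y # drop i xs = ys then 1 else 0)))"
    by (simp add: coboundary_def lookup_lin_ext lookup_sum lookup_basis)
  also have "\<dots> = (\<Sum>xs\<in>Poly_Mapping.keys z. \<Sum>i = 1..<length ys - 1.
      ksign (int i) * (if xs = del i ys then Poly_Mapping.lookup z xs else 0))"
    using len ins by (intro sum.cong refl) (auto simp: sum_distrib_left mult.commute intro!: sum.cong)
  also have "\<dots> = (\<Sum>i = 1..<length ys - 1. ksign (int i) *
      (\<Sum>xs\<in>Poly_Mapping.keys z. if xs = del i ys then Poly_Mapping.lookup z xs else 0))"
    unfolding sum_distrib_left by (rule sum.swap)
  also have "\<dots> = (\<Sum>i = 1..<length ys - 1. ksign (int i) * Poly_Mapping.lookup z (del i ys))"
    by (intro sum.cong refl arg_cong2[of _ _ _ _ "(*)"]) (simp add: sum.delta in_keys_iff)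
  finally show ?thesis .
qed

lemma coboundary_coboundary:
  fixes z :: "'x list \<Rightarrow>\<^sub>0 'k::{comm_ring,comm_monoid_mult}"
  assumes z: "Poly_Mapping.keys z \<subseteq> chains L n"
  shows "coboundary L (coboundary L z) = 0"
proof (rule poly_mapping_eqI)
  fix ys
  note dz = coboundary_keys[OF z]
  show "Poly_Mapping.lookup (coboundary L (coboundary L z)) ys = Poly_Mapping.lookup 0 ys"
  proof (cases "ys \<in> chains L (n + 1 + 1)")
    case False
    then show ?thesis using coboundary_keys[OF dz] by (auto simp: in_keys_iff)
  next
    case True
    define N where "N = length ys - 2"
    let ?f = "\<lambda>(i, j). ksign (int i) * (ksign (int j) * Poly_Mapping.lookup z (del j (del i ys))) :: 'k"
    \<comment> \<open>The pairs of deletions are split according to whether the second position is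
      smaller than the first. By \<open>del_del\<close> the two halves correspond to each other, and
      the sign is reversed because one index shifts by 1.\<close>
    let ?A = "{(i, j). 1 \<le> j \<and> j < i \<and> i \<le> N}" and ?B = "{(i, j). 1 \<le> i \<and> i \<le> j \<and> j < N}"
    have fin: "finite ?A" "finite ?B"
      by (rule finite_subset[of _ "{..N} \<times> {..N}"]; auto)+
    have "Poly_Mapping.lookup (coboundary L (coboundary L z)) ys =
      (\<Sum>i = 1..<length ys - 1. ksign (int i) * Poly_Mapping.lookup (coboundary L z) (del i ys))"
      by (rule lookup_coboundary[OF dz True])
    also have "\<dots> = (\<Sum>i = 1..<length ys - 1. \<Sum>j = 1..<length ys - 2. ?f (i, j))"
    proof (intro sum.cong refl)
      fix i assume i: "i \<in> {1..<length ys - 1}"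
      then have "del i ys \<in> chains L (n + 1 + 1 - 1)" using True by (intro del_chain) auto
      moreover have "length (del i ys) - 1 = length ys - 2" using i by (subst length_del) auto
      ultimately show "ksign (int i) * Poly_Mapping.lookup (coboundary L z) (del i ys) =
        (\<Sum>j = 1..<length ys - 2. ?f (i, j))"
        by (simp add: lookup_coboundary[OF z] sum_distrib_left)
    qed
    also have "\<dots> = (\<Sum>p\<in>{1..<length ys - 1} \<times> {1..<length ys - 2}. ?f p)"
      by (simp add: sum.cartesian_product)
    also have "{1..<length ys - 1} \<times> {1..<length ys - 2} = ?A \<union> ?B"
      by (auto simp: N_def)
    also have "(\<Sum>p\<in>?A \<union> ?B. ?f p) = (\<Sum>p\<in>?A. ?f p) + (\<Sum>p\<in>?B. ?f p)"
      using fin by (intro sum.union_disjoint) auto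
    also have "(\<Sum>p\<in>?A. ?f p) = (\<Sum>p\<in>?B. - ?f p)"
    proof (rule sum.reindex_bij_witness[of _ "\<lambda>(i, j). (Suc j, i)" "\<lambda>(i, j). (j, i - 1)"])
      fix p assume p: "p \<in> ?A"
      obtain i j where ij: "p = (i, j)" by force
      have "ksign (int (i - 1)) = - (ksign (int i) :: 'k)"
        using p unfolding ij by (cases i) (auto simp: ksign_def)
      then show "- ?f (case p of (i, j) \<Rightarrow> (j, i - 1)) = ?f p"
        using p unfolding ij by (simp add: del_del ac_simps)
    qed (auto simp: N_def)
    finally show ?thesis by (simp add: sum_negf)
  qed
qed

lemma cocycles_simps [simp]:
  "carrier (cocycles L n) = {p. Poly_Mapping.keys p \<subseteq> chains L n \<and> coboundary L p = 0}"
  "\<zero>\<^bsub>cocycles L n\<^esub> = 0" "p \<oplus>\<^bsub>cocycles L n\<^esub> q = p + q" "k \<odot>\<^bsub>cocycles L n\<^esub> p = scale k p"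
  by (simp_all add: cocycles_def cochains_def)

lemma coboundary_simps:
  "coboundary L 0 = 0" "coboundary L (p + q) = coboundary L p + coboundary L q"
  "coboundary L (scale k p) = scale k (coboundary L p)" "coboundary L (p - q) = coboundary L p - coboundary L q"
  "coboundary L (- p) = - coboundary L p"
  by (simp_all add: coboundary_def lin_ext_add lin_ext_scale lin_ext_diff lin_ext_uminus)

lemma cocycles_module: "module base_ring (cocycles L n)"
proof (rule moduleI[OF cring_base_ring])
  show "abelian_group (cocycles L n)"
  proof (rule abelian_groupI)
    show "\<exists>q\<in>carrier (cocycles L n). q \<oplus>\<^bsub>cocycles L n\<^esub> p = \<zero>\<^bsub>cocycles L n\<^esub>"
      if "p \<in> carrier (cocycles L n)" for p
      using that by (intro bexI[of _ "- p"]) (auto simp: in_keys_iff coboundary_simps)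
  qed (auto simp: keys_plus coboundary_simps algebra_simps dest: subsetD[OF Poly_Mapping.keys_add])
qed (auto simp: scale_add coboundary_simps dest: subsetD[OF keys_scale])

text \<open>A chain of \<open>L\<close> occurs in the pullback of a single chain, namely its image,
  so the pullback just reads \<open>x\<close> at the image.\<close>

lemma lookup_pullback:
  "Poly_Mapping.lookup (pullback L f x) xs =
    (if xs \<in> chains L (int (length xs) - 1) then Poly_Mapping.lookup x (map f xs) else 0)"
proof -
  have "Poly_Mapping.lookup (pullback L f x) xs = (\<Sum>ys\<in>Poly_Mapping.keys x. Poly_Mapping.lookup x ys *
      (\<Sum>xs' | xs' \<in> chains L (int (length ys) - 1) \<and> map f xs' = ys. if xs' = xs then 1 else 0))"
    by (simp add: pullback_def lookup_lin_ext lookup_sum lookup_basis)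
  also have "\<dots> = (\<Sum>ys\<in>Poly_Mapping.keys x. if ys = map f xs then
      (if xs \<in> chains L (int (length xs) - 1) then Poly_Mapping.lookup x ys else 0) else 0)"
    using finite_chains by (intro sum.cong refl) (auto simp: sum.delta)
  also have "\<dots> = (if xs \<in> chains L (int (length xs) - 1) then Poly_Mapping.lookup x (map f xs) else 0)"
    by (simp add: sum.delta in_keys_iff)
  finally show ?thesis .
qed

end

section \<open>Non-singleton boolean posets\<close>

text \<open>A partition with at most one block of cardinality at least 2 is determined by this block,
  or by the empty set if it is the discrete partition.\<close>

definition part :: "nat set \<Rightarrow> nat set \<Rightarrow> nat set set" where
  "part S X = insert X ((\<lambda>a. {a}) ` (S - X)) - {{}}"

text \<open>The sets that code partitions. The empty set codes the discrete partition; one-element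
  sets are excluded, since they would code it a second time.\<close>

definition non_singletons :: "nat set \<Rightarrow> nat set set" where
  "non_singletons S = {X. X \<subseteq> S \<and> card X \<noteq> 1}"

text \<open>The code of the one-block partition. If \<open>S\<close> has one element, this partition
  is also the discrete one, so its code is empty.\<close>

definition top_set :: "nat set \<Rightarrow> nat set" where
  "top_set S = (if card S = 1 then {} else S)"

lemma part_eq: "part S X = (if X = {} then {} else {X}) \<union> (\<lambda>a. {a}) ` (S - X)"
  by (auto simp: part_def)

lemma finite_non_singletons: "finite S \<Longrightarrow> finite (non_singletons S)"
  by (rule finite_subset[of _ "Pow S"]) (auto simp: non_singletons_def)

lemma top_set_in: "top_set S \<in> non_singletons S" "{} \<in> non_singletons S"
  by (auto simp: top_set_def non_singletons_def)

lemma top_set_upper: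
  assumes "X \<in> non_singletons S"
  shows "X \<subseteq> top_set S"
proof (cases "card S = 1")
  case True
  then obtain s where "S = {s}" by (auto simp: card_1_singleton_iff)
  then show ?thesis using assms True
    by (auto simp: top_set_def non_singletons_def subset_singleton_iff)
qed (use assms in \<open>auto simp: top_set_def non_singletons_def\<close>)

lemma partition_part: "X \<subseteq> S \<Longrightarrow> partition_on S (part S X)"
  by (auto simp: partition_on_def part_def disjoint_def)

lemma NS_carrier:
  assumes "finite S"
  shows "carrier (NS S) = part S ` non_singletons S"
proof (intro equalityI subsetI)
  fix \<alpha> assume "\<alpha> \<in> carrier (NS S)"
  then have p: "partition_on S \<alpha>" and c: "card {B\<in>\<alpha>. 2 \<le> card B} \<le> 1" by (auto simp: NS_def)
  have fin: "finite \<alpha>" using p assms by (rule finite_elements[rotated])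
  have fB: "finite B" "B \<noteq> {}" "B \<subseteq> S" if "B \<in> \<alpha>" for B
    using that p assms finite_subset[of B S] by (auto simp: partition_on_def)
  have single: "\<exists>a\<in>S. B = {a}" if "B \<in> \<alpha>" "\<not> 2 \<le> card B" for B
  proof -
    have "card B = 1" using fB[OF that(1)] that(2) by (metis One_nat_def Suc_1 card_0_eq less_2_cases not_le)
    then show ?thesis using fB(3)[OF that(1)] by (auto simp: card_1_singleton_iff)
  qed
  have dis: "B = C" if "B \<in> \<alpha>" "C \<in> \<alpha>" "a \<in> B" "a \<in> C" for B C a
    using p that by (auto simp: partition_on_def disjoint_def)
  have un: "\<Union>\<alpha> = S" using p by (simp add: partition_on_def)
  \<comment> \<open>\<open>X\<close> is the block with at least two elements if there is one, and
    empty otherwise.\<close>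
  obtain X where X: "X \<in> non_singletons S" "X \<noteq> {} \<Longrightarrow> X \<in> \<alpha>" "\<And>B. B \<in> \<alpha> \<Longrightarrow> 2 \<le> card B \<Longrightarrow> B = X"
  proof (cases "{B\<in>\<alpha>. 2 \<le> card B} = {}")
    case True
    then show ?thesis using that[of "{}"] by (auto simp: non_singletons_def)
  next
    case False
    then have "card {B\<in>\<alpha>. 2 \<le> card B} \<noteq> 0" using fin by simp
    then have "card {B\<in>\<alpha>. 2 \<le> card B} = 1" using c by linarith
    then obtain X where X: "{B\<in>\<alpha>. 2 \<le> card B} = {X}" by (auto simp: card_1_singleton_iff)
    then have "X \<in> \<alpha>" "2 \<le> card X" by auto
    show ?thesis
    proof (rule that[of X])
      show "X \<in> non_singletons S"
        using fB(3)[OF \<open>X \<in> \<alpha>\<close>] \<open>2 \<le> card X\<close> by (simp add: non_singletons_def)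
      show "B = X" if "B \<in> \<alpha>" "2 \<le> card B" for B using X that by blast
    qed (use \<open>X \<in> \<alpha>\<close> in simp)
  qed
  have "\<alpha> = part S X"
  proof (intro equalityI subsetI)
    fix B assume B: "B \<in> \<alpha>"
    show "B \<in> part S X"
    proof (cases "B = X")
      case False
      then obtain a where a: "a \<in> S" "B = {a}" using single[OF B] X(3)[OF B] by blast
      have "a \<notin> X" using dis[OF B X(2), of a] a False by auto
      then show ?thesis using a by (auto simp: part_def)
    qed (use fB(2)[OF B] in \<open>auto simp: part_def\<close>)
  next
    fix B assume B: "B \<in> part S X"
    show "B \<in> \<alpha>"
    proof (cases "B = X")
      case False
      then obtain a where a: "a \<in> S" "a \<notin> X" "B = {a}" using B by (auto simp: part_def)
      then obtain C where C: "C \<in> \<alpha>" "a \<in> C" using un by auto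
      then have "C \<noteq> X" using a by auto
      then show ?thesis using single[OF C(1)] X(3)[OF C(1)] C a by auto
    qed (use B X(2) in \<open>auto simp: part_def\<close>)
  qed
  then show "\<alpha> \<in> part S ` non_singletons S" using X(1) by blast
next
  fix \<alpha> assume "\<alpha> \<in> part S ` non_singletons S"
  then obtain X where X: "X \<subseteq> S" "\<alpha> = part S X" by (auto simp: non_singletons_def)
  have "{B\<in>\<alpha>. 2 \<le> card B} \<subseteq> {X}" unfolding X(2) part_def by auto
  then have "card {B\<in>\<alpha>. 2 \<le> card B} \<le> card {X}" by (intro card_mono) auto
  then show "\<alpha> \<in> carrier (NS S)" using partition_part[OF X(1)] X(2) by (simp add: NS_def)
qed

text \<open>A non-empty \<open>Y\<close> has at least two elements and does not fit into a singleton
  block, so it must lie in \<open>X\<close>. Hence the finer partition has the smaller code, and the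
  order of \<open>NS\<close> becomes reverse inclusion.\<close>

lemma refines_part:
  assumes "finite S" "X \<in> non_singletons S" "Y \<in> non_singletons S"
  shows "refines S (part S Y) (part S X) \<longleftrightarrow> Y \<subseteq> X"
proof
  assume r: "refines S (part S Y) (part S X)"
  show "Y \<subseteq> X"
  proof (cases "Y = {}")
    case False
    then have "Y \<in> part S Y" by (simp add: part_def)
    then obtain Z where Z: "Z \<in> part S X" "Y \<subseteq> Z" using r by (auto simp: refines_def)
    have "finite Y" using assms(1,3) finite_subset by (auto simp: non_singletons_def)
    then have "\<not> Y \<subseteq> {a}" for a
      using False assms(3) by (auto simp: non_singletons_def subset_singleton_iff)
    then have "Z = X" using Z by (auto simp: part_def)
    then show ?thesis using Z by simp
  qed simp
next
  assume "Y \<subseteq> X"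
  have "\<exists>W\<in>part S X. Z \<subseteq> W" if Z: "Z \<in> part S Y" for Z
  proof (cases "Z \<subseteq> X")
    case True
    then have "X \<in> part S X" using Z by (auto simp: part_def)
    then show ?thesis using True by blast
  next
    case False
    then have "Z \<in> part S X" using Z \<open>Y \<subseteq> X\<close> by (auto simp: part_def)
    then show ?thesis by blast
  qed
  then show "refines S (part S Y) (part S X)"
    using assms(2,3) partition_part[of X S] partition_part[of Y S]
    by (simp add: refines_def non_singletons_def)
qed

lemma NS_less [simp]: "\<alpha> \<sqsubset>\<^bsub>NS S\<^esub> \<beta> \<longleftrightarrow> refines S \<beta> \<alpha> \<and> \<alpha> \<noteq> \<beta>"
  by (simp add: lless_def NS_def)

lemma part_inj:
  assumes "finite S"
  shows "inj_on (part S) (non_singletons S)"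
proof (rule inj_onI)
  fix X Y assume XY: "X \<in> non_singletons S" "Y \<in> non_singletons S" "part S X = part S Y"
  then have "X \<subseteq> S" by (simp add: non_singletons_def)
  then have "refines S (part S X) (part S X)" by (intro refines_refl partition_part)
  then show "X = Y"
    using refines_part[OF assms XY(1,2)] refines_part[OF assms XY(2,1)] XY(3) by auto
qed

lemma NS_less_part:
  "finite S \<Longrightarrow> X \<in> non_singletons S \<Longrightarrow> Y \<in> non_singletons S \<Longrightarrow>
   part S X \<sqsubset>\<^bsub>NS S\<^esub> part S Y \<longleftrightarrow> Y \<subset> X"
  using part_inj[of S] by (auto simp: refines_part dest: inj_onD)

lemma finite_gorder_NS_sub:
  assumes "finite S" "C \<subseteq> carrier (NS S)"
  shows "finite_gorder ((NS S)\<lparr>carrier := C\<rparr>)"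
proof
  have "finite (carrier (NS S))" using assms(1) by (simp add: NS_carrier finite_non_singletons)
  then show "finite (carrier ((NS S)\<lparr>carrier := C\<rparr>))" using assms(2) finite_subset by auto
  have l: "x \<sqsubset>\<^bsub>(NS S)\<lparr>carrier := C\<rparr>\<^esub> y \<longleftrightarrow> refines S y x \<and> x \<noteq> y" for x y
    by (simp add: lless_def NS_def)
  show "x \<sqsubset>\<^bsub>(NS S)\<lparr>carrier := C\<rparr>\<^esub> z"
    if "x \<sqsubset>\<^bsub>(NS S)\<lparr>carrier := C\<rparr>\<^esub> y" "y \<sqsubset>\<^bsub>(NS S)\<lparr>carrier := C\<rparr>\<^esub> z" for x y z
    using that refines_trans[of S z y x] refines_asym[of S x y] unfolding l by auto
  show "\<not> x \<sqsubset>\<^bsub>(NS S)\<lparr>carrier := C\<rparr>\<^esub> x" for x unfolding l by simp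
qed

lemma finite_gorder_NS: "finite S \<Longrightarrow> finite_gorder (NS S)"
  using finite_gorder_NS_sub[of S "carrier (NS S)"] by simp

section \<open>Chains of partitions as decreasing chains of sets\<close>

definition set_chains :: "nat set set \<Rightarrow> nat set \<Rightarrow> nat set \<Rightarrow> int \<Rightarrow> nat set list set" where
  "set_chains \<X> A B n = {cs. cs \<noteq> [] \<and> int (length cs) = n + 1 \<and> set cs \<subseteq> \<X> \<and>
     sorted_wrt (\<supset>) cs \<and> hd cs = A \<and> last cs = B}"

text \<open>Stated for any family of codes with a largest and a smallest member, to cover the whole
  poset as well as the intervals below and above \<pi>.\<close>

lemma chains_eq_set_chains:
  assumes P: "finite P" and X: "\<X> \<subseteq> non_singletons P" and c: "carrier L = part P ` \<X>"
    and less: "\<And>\<alpha> \<beta>. \<alpha> \<sqsubset>\<^bsub>L\<^esub> \<beta> \<longleftrightarrow> \<alpha> \<sqsubset>\<^bsub>NS P\<^esub> \<beta>"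
    and AB: "A \<in> \<X>" "B \<in> \<X>" "\<And>X. X \<in> \<X> \<Longrightarrow> B \<subseteq> X \<and> X \<subseteq> A"
  shows "chains L n = map (part P) ` set_chains \<X> A B n"
proof -
  have l: "part P X \<sqsubset>\<^bsub>L\<^esub> part P Y \<longleftrightarrow> Y \<subset> X" if "X \<in> \<X>" "Y \<in> \<X>" for X Y
    unfolding less using that X by (intro NS_less_part[OF P]) auto
  have main: "map (part P) cs \<in> chains L n \<longleftrightarrow> cs \<in> set_chains \<X> A B n" if cs: "set cs \<subseteq> \<X>" for cs
  proof (cases "cs = []")
    case False
    then have h: "hd cs \<in> \<X>" "last cs \<in> \<X>" using cs by auto
    have m: "cs ! i \<in> \<X>" if "i < length cs" for i using cs nth_mem[OF that] by auto
    have "sorted_wrt (lless L) (map (part P) cs) \<longleftrightarrow> sorted_wrt (\<supset>) cs"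
    proof -
      have "part P (cs ! i) \<sqsubset>\<^bsub>L\<^esub> part P (cs ! j) \<longleftrightarrow> cs ! j \<subset> cs ! i" if "i < j" "j < length cs" for i j
        using that by (intro l m) auto
      then show ?thesis by (auto simp: sorted_wrt_map sorted_wrt_iff_nth_less)
    qed
    moreover have "(\<forall>y\<in>carrier L. \<not> y \<sqsubset>\<^bsub>L\<^esub> part P (hd cs)) \<longleftrightarrow> hd cs = A"
    proof -
      have "(\<forall>y\<in>carrier L. \<not> y \<sqsubset>\<^bsub>L\<^esub> part P (hd cs)) \<longleftrightarrow> (\<forall>X\<in>\<X>. \<not> hd cs \<subset> X)"
        unfolding c using l[OF _ h(1)] by simp
      also have "\<dots> \<longleftrightarrow> hd cs = A" using AB(1) AB(3)[OF h(1)] AB(3) by fastforce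
      finally show ?thesis .
    qed
    moreover have "(\<forall>y\<in>carrier L. \<not> part P (last cs) \<sqsubset>\<^bsub>L\<^esub> y) \<longleftrightarrow> last cs = B"
    proof -
      have "(\<forall>y\<in>carrier L. \<not> part P (last cs) \<sqsubset>\<^bsub>L\<^esub> y) \<longleftrightarrow> (\<forall>X\<in>\<X>. \<not> X \<subset> last cs)"
        unfolding c using l[OF h(2)] by simp
      also have "\<dots> \<longleftrightarrow> last cs = B" using AB(2) AB(3)[OF h(2)] AB(3) by fastforce
      finally show ?thesis .
    qed
    ultimately show ?thesis
      using False cs image_mono[OF cs, of "part P"]
      by (simp add: chains_def set_chains_def hd_map last_map c)
  qed (simp add: chains_def set_chains_def)
  show ?thesis
  proof (intro equalityI subsetI)
    fix xs assume xs: "xs \<in> chains L n"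
    then have "set xs \<subseteq> part P ` \<X>" by (simp add: chains_def c)
    then have "\<forall>x\<in>set xs. \<exists>X. X \<in> \<X> \<and> part P X = x" by fastforce
    then obtain f where f: "\<forall>x\<in>set xs. f x \<in> \<X> \<and> part P (f x) = x" by (auto dest!: bchoice)
    have e: "set (map f xs) \<subseteq> \<X>" "map (part P) (map f xs) = xs"
      using f by (auto simp: map_idI)
    have "map f xs \<in> set_chains \<X> A B n" using main[OF e(1)] xs unfolding e(2) by simp
    then have "map (part P) (map f xs) \<in> map (part P) ` set_chains \<X> A B n" by (rule imageI)
    then show "xs \<in> map (part P) ` set_chains \<X> A B n" by (simp only: e(2))
  next
    fix xs assume "xs \<in> map (part P) ` set_chains \<X> A B n"
    then obtain cs where cs: "cs \<in> set_chains \<X> A B n" "xs = map (part P) cs" by blast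
    then have "set cs \<subseteq> \<X>" by (simp add: set_chains_def)
    then show "xs \<in> chains L n" using main cs by simp
  qed
qed

definition schains :: "nat set \<Rightarrow> int \<Rightarrow> nat set list set" where
  "schains S n = set_chains (non_singletons S) (top_set S) {} n"

lemma chains_NS:
  assumes "finite S"
  shows "chains (NS S) n = map (part S) ` schains S n"
  unfolding schains_def
proof (rule chains_eq_set_chains[OF assms subset_refl NS_carrier[OF assms]])
  show "{} \<subseteq> X \<and> X \<subseteq> top_set S" if "X \<in> non_singletons S" for X
    using top_set_upper[OF that] by simp
qed (rule refl top_set_in)+

lemma map_part_inj:
  "finite S \<Longrightarrow> set cs \<subseteq> non_singletons S \<Longrightarrow> set cs' \<subseteq> non_singletons S \<Longrightarrow>
   map (part S) cs = map (part S) cs' \<Longrightarrow> cs = cs'"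
  by (rule map_inj_on[OF _ inj_on_subset[OF part_inj]]) auto

lemma schains_subset: "cs \<in> schains S n \<Longrightarrow> set cs \<subseteq> non_singletons S"
  by (simp add: schains_def set_chains_def)

lemma map_part_chains: "finite S \<Longrightarrow> cs \<in> schains S n \<Longrightarrow> map (part S) cs \<in> chains (NS S) n"
  by (simp add: chains_NS)

lemma sorted_supset_distinct: "sorted_wrt (\<supset>) (cs :: nat set list) \<Longrightarrow> distinct cs"
  by (induction cs) auto

section \<open>The intervals below and above the partition \<pi> of a composition\<close>

abbreviation (input) below_sets :: "nat set \<Rightarrow> nat \<Rightarrow> nat set \<Rightarrow> nat set set" where
  "below_sets S s T \<equiv> {X \<in> non_singletons (plug S s T). top_set T \<subseteq> X}"

abbreviation (input) above_sets :: "nat set \<Rightarrow> nat \<Rightarrow> nat set \<Rightarrow> nat set set" where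
  "above_sets S s T \<equiv> {X \<in> non_singletons (plug S s T). X \<subseteq> top_set T}"

text \<open>The map \<phi> on codes. The case \<open>X = top_set T\<close> is separate because a big
  block \<open>T\<close> shrinks to the singleton \<open>{s}\<close>, so that the induced partition
  is discrete and has the empty code.\<close>

definition induced_set :: "nat set \<Rightarrow> nat \<Rightarrow> nat set \<Rightarrow> nat set \<Rightarrow> nat set" where
  "induced_set S s T X = (if X = top_set T then {} else {a\<in>S. plug_block s T a \<subseteq> X})"

context
  fixes S :: "nat set" and s :: nat and T :: "nat set"
  assumes comp: "composable S s T"
begin

lemma finite_plug: "finite (plug S s T)" "finite S" "finite T" "s \<in> S"
  using composableD[OF comp] by (auto simp: plug_def)

text \<open>If \<open>T\<close> has one element, \<pi> is discrete, its code is empty, and plugging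
  in \<open>T\<close> only renames \<open>s\<close>; otherwise \<pi> has the big block
  \<open>T\<close>. Most facts about composition are proved separately in these two cases.\<close>

lemma card_T_cases:
  obtains (one) t where "T = {t}" "top_set T = {}" "t \<notin> S - {s}" | (two) "2 \<le> card T" "top_set T = T"
proof (cases "card T = 1")
  case True
  then show ?thesis using one composableD[OF comp] by (auto simp: card_1_singleton_iff top_set_def)
next
  case False
  have "card T \<noteq> 0" using composableD[OF comp] by simp
  then show ?thesis using two False by (simp add: top_set_def)
qed

lemma top_set_T: "top_set T \<in> non_singletons (plug S s T)"
  using top_set_in[of T] by (auto simp: non_singletons_def plug_def)

lemma plug_part_eq: "plug_part S s T = part (plug S s T) (top_set T)"
proof -
  note c = composableD[OF comp]
  have S: "S = insert s (S - {s})" using c by auto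
  have "plug_part S s T = insert T ((\<lambda>a. {a}) ` (S - {s}))"
    unfolding plug_part_def by (subst S, subst image_insert) (auto simp: plug_block_def)
  also have "\<dots> = part (plug S s T) (top_set T)"
  proof (cases rule: card_T_cases)
    case (one t)
    then show ?thesis using c by (auto simp: part_def plug_def)
  next
    case two
    then show ?thesis using c by (auto simp: part_def plug_def)
  qed
  finally show ?thesis .
qed

lemma NS_below_carrier: "carrier (NS_below S s T) = part (plug S s T) ` (below_sets S s T)"
proof -
  have le: "\<alpha> \<sqsubseteq>\<^bsub>NS (plug S s T)\<^esub> \<beta> \<longleftrightarrow> refines (plug S s T) \<beta> \<alpha>" for \<alpha> \<beta> by (simp add: NS_def)
  show ?thesis
    using refines_part[OF finite_plug(1) _ top_set_T]
    by (auto simp: NS_below_def plug_part_eq le NS_carrier[OF finite_plug(1)])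
qed

lemma NS_above_carrier: "carrier (NS_above S s T) = part (plug S s T) ` (above_sets S s T)"
proof -
  have le: "\<alpha> \<sqsubseteq>\<^bsub>NS (plug S s T)\<^esub> \<beta> \<longleftrightarrow> refines (plug S s T) \<beta> \<alpha>" for \<alpha> \<beta> by (simp add: NS_def)
  show ?thesis
    using refines_part[OF finite_plug(1) top_set_T]
    by (auto simp: NS_above_def plug_part_eq le NS_carrier[OF finite_plug(1)])
qed

lemma chains_NS_below:
  "chains (NS_below S s T) n =
   map (part (plug S s T)) ` set_chains (below_sets S s T) (top_set (plug S s T)) (top_set T) n"
proof (rule chains_eq_set_chains[OF finite_plug(1) _ NS_below_carrier])
  show "\<alpha> \<sqsubset>\<^bsub>NS_below S s T\<^esub> \<beta> \<longleftrightarrow> \<alpha> \<sqsubset>\<^bsub>NS (plug S s T)\<^esub> \<beta>" for \<alpha> \<beta>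
    by (simp add: NS_below_def lless_def NS_def)
  show "top_set (plug S s T) \<in> below_sets S s T"
    using top_set_in(1) top_set_upper[OF top_set_T] by simp
  show "top_set T \<in> below_sets S s T" using top_set_T by simp
  show "top_set T \<subseteq> X \<and> X \<subseteq> top_set (plug S s T)" if "X \<in> below_sets S s T" for X
    using that top_set_upper by simp
qed simp

lemma chains_NS_above:
  "chains (NS_above S s T) n =
   map (part (plug S s T)) ` set_chains (above_sets S s T) (top_set T) {} n"
proof (rule chains_eq_set_chains[OF finite_plug(1) _ NS_above_carrier])
  show "\<alpha> \<sqsubset>\<^bsub>NS_above S s T\<^esub> \<beta> \<longleftrightarrow> \<alpha> \<sqsubset>\<^bsub>NS (plug S s T)\<^esub> \<beta>" for \<alpha> \<beta>
    by (simp add: NS_above_def lless_def NS_def)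
  show "top_set T \<in> above_sets S s T" using top_set_T by simp
  show "{} \<in> above_sets S s T" using top_set_in(2) by simp
qed auto

lemma finite_gorder_below: "finite_gorder (NS_below S s T)"
  unfolding NS_below_def by (rule finite_gorder_NS_sub[OF finite_plug(1)]) auto

lemma finite_gorder_above: "finite_gorder (NS_above S s T)"
  unfolding NS_above_def by (rule finite_gorder_NS_sub[OF finite_plug(1)]) auto

text \<open>A letter lost between \<open>X\<close> and \<open>Y\<close> is lost between the induced
  sets as well; if \<open>T = {t}\<close>, the letter \<open>t\<close> has to be read as
  \<open>s\<close>.\<close>

lemma ind_strict:
  assumes "Y \<subset> X" "top_set T \<subseteq> Y" "X \<subseteq> plug S s T"
  shows "induced_set S s T Y \<subset> induced_set S s T X"
proof (cases rule: card_T_cases)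
  case (one t)
  obtain b where "b \<in> X" "b \<notin> Y" using assms by auto
  then have "(if b = t then s else b) \<in> {a\<in>S. plug_block s T a \<subseteq> X}"
    "(if b = t then s else b) \<notin> {a\<in>S. plug_block s T a \<subseteq> Y}"
    using one assms(3) finite_plug(4) by (auto simp: plug_block_def plug_def)
  moreover have "{a\<in>S. plug_block s T a \<subseteq> Y} \<subseteq> {a\<in>S. plug_block s T a \<subseteq> X}" using assms(1) by auto
  ultimately show ?thesis using assms by (auto simp: induced_set_def)
next
  case two
  obtain b where b: "b \<in> X" "b \<notin> Y" using assms by auto
  then have "b \<in> S - {s}" using two assms by (auto simp: plug_def)
  then have "b \<in> {a\<in>S. plug_block s T a \<subseteq> X}" "b \<notin> {a\<in>S. plug_block s T a \<subseteq> Y}"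
    using b by (auto simp: plug_block_def)
  moreover have "{a\<in>S. plug_block s T a \<subseteq> Y} \<subseteq> {a\<in>S. plug_block s T a \<subseteq> X}" using assms(1) by auto
  ultimately show ?thesis using assms by (auto simp: induced_set_def)
qed

text \<open>A set beyond \<open>top_set T\<close> has a letter \<open>b\<close> outside it, which
  gives one element. A second one is \<open>s\<close> if \<open>T\<close> has several elements;
  otherwise it comes from another letter of \<open>X\<close>, which is not a singleton.\<close>

lemma ind_non_singleton:
  assumes "X \<in> (below_sets S s T)"
  shows "induced_set S s T X \<in> non_singletons S"
proof (cases "X = top_set T")
  case False
  then obtain b where b: "b \<in> X" "b \<notin> top_set T" using assms by auto
  have P: "X \<subseteq> plug S s T" "card X \<noteq> 1" "top_set T \<subseteq> X" using assms by (auto simp: non_singletons_def)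
  have "\<exists>x y. x \<in> induced_set S s T X \<and> y \<in> induced_set S s T X \<and> x \<noteq> y"
  proof (cases rule: card_T_cases)
    case (one t)
    have "X \<noteq> {b}" using P(2) by auto
    then obtain b' where b': "b' \<in> X" "b' \<noteq> b" using b by blast
    have "(if b = t then s else b) \<in> induced_set S s T X" "(if b' = t then s else b') \<in> induced_set S s T X"
      using b b' P one False finite_plug(4) by (auto simp: induced_set_def plug_def plug_block_def)
    moreover have "(if b = t then s else b) \<noteq> (if b' = t then s else b')"
      using b b' P one composableD[OF comp] by (auto simp: plug_def)
    ultimately show ?thesis by blast
  next
    case two
    then have "b \<in> S - {s}" using b P by (auto simp: plug_def)
    then have "b \<in> induced_set S s T X" "s \<in> induced_set S s T X" "b \<noteq> s"
      using b P two False finite_plug(4) by (auto simp: induced_set_def plug_block_def)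
    then show ?thesis by blast
  qed
  then have "card (induced_set S s T X) \<noteq> 1" by (metis card_1_singletonE singletonD)
  then show ?thesis by (auto simp: non_singletons_def induced_set_def)
qed (simp add: induced_set_def top_set_in)

lemma ind_top: "induced_set S s T (top_set (plug S s T)) = top_set S"
proof (cases "plug S s T = T")
  case True
  have "S = {s}" using True composableD[OF comp] by (auto simp: plug_def)
  then show ?thesis using True by (simp add: induced_set_def top_set_def)
next
  case False
  then obtain b where b: "b \<in> S" "b \<noteq> s" "b \<notin> T" by (auto simp: plug_def)
  have "2 \<le> card S" using b finite_plug card_mono[of S "{b, s}"] by auto
  obtain t where t: "t \<in> T" using composableD[OF comp] by auto
  have "2 \<le> card (plug S s T)"
  proof -
    have "b \<noteq> t" "{b, t} \<subseteq> plug S s T" using b t by (auto simp: plug_def)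
    then show ?thesis using card_mono[OF finite_plug(1) \<open>{b, t} \<subseteq> plug S s T\<close>] by simp
  qed
  then have "top_set (plug S s T) = plug S s T" "top_set S = S"
    using \<open>2 \<le> card S\<close> by (auto simp: top_set_def)
  moreover have "plug S s T \<noteq> top_set T" using False b by (auto simp: top_set_def plug_def)
  ultimately show ?thesis by (auto simp: induced_set_def plug_block_def plug_def)
qed

lemma induced_part_eq:
  assumes "X \<in> (below_sets S s T)"
  shows "induced_part S s T (part (plug S s T) X) = part S (induced_set S s T X)"
proof -
  note c = composableD[OF comp]
  let ?\<rho> = "\<lambda>X. {a\<in>S. plug_block s T a \<subseteq> X}"
  have X: "X \<subseteq> plug S s T" "card X \<noteq> 1" "top_set T \<subseteq> X" using assms by (auto simp: non_singletons_def)
  show ?thesis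
  proof (cases rule: card_T_cases)
    case (one t)
    have sing: "?\<rho> {b} = {if b = t then s else b}" if "b \<in> plug S s T" for b
      using that one c by (auto simp: plug_block_def plug_def)
    have r: "?\<rho> X = induced_set S s T X" using one by (auto simp: induced_set_def plug_block_def)
    have ne: "?\<rho> X \<noteq> {}" if "X \<noteq> {}"
      using that ind_strict[of "{}" X] X one unfolding r by auto
    have "?\<rho> ` (\<lambda>a. {a}) ` (plug S s T - X) = (\<lambda>a. {a}) ` (S - ?\<rho> X)"
    proof -
      have "?\<rho> ` (\<lambda>a. {a}) ` (plug S s T - X) = (\<lambda>b. {if b = t then s else b}) ` (plug S s T - X)"
        unfolding image_image using sing by (intro image_cong) auto
      also have "\<dots> = (\<lambda>a. {a}) ` (\<lambda>b. if b = t then s else b) ` (plug S s T - X)"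
        by (simp only: image_image)
      also have "(\<lambda>b. if b = t then s else b) ` (plug S s T - X) = S - ?\<rho> X"
        using one c by (auto simp: plug_def plug_block_def image_iff)
      finally show ?thesis .
    qed
    then have "induced_part S s T (part (plug S s T) X) =
        (if X = {} then {} else {?\<rho> X}) \<union> (\<lambda>a. {a}) ` (S - ?\<rho> X)"
      unfolding induced_part_def part_eq image_Un by simp
    moreover have "X = {} \<longleftrightarrow> ?\<rho> X = {}" using ne one unfolding r by (auto simp: induced_set_def)
    ultimately show ?thesis unfolding part_eq r by simp
  next
    case two
    have T: "T \<subseteq> X" using X two by simp
    have sing: "?\<rho> {b} = {b}" if "b \<in> plug S s T - X" for b
    proof -
      have "\<not> T \<subseteq> {b}" using that T c by auto
      then show ?thesis using that T c by (auto simp: plug_block_def plug_def)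
    qed
    have rs: "s \<in> ?\<rho> X" using T c by (simp add: plug_block_def)
    have h: "?\<rho> ` (\<lambda>a. {a}) ` (plug S s T - X) = (\<lambda>a. {a}) ` (plug S s T - X)"
      unfolding image_image using sing by (intro image_cong) auto
    have "plug S s T - X = S - ?\<rho> X" using T c by (auto simp: plug_def plug_block_def)
    then have sg: "?\<rho> ` (\<lambda>a. {a}) ` (plug S s T - X) = (\<lambda>a. {a}) ` (S - ?\<rho> X)"
      using h by metis
    have "X \<noteq> {}" using T c(6) by auto
    then have e2: "induced_part S s T (part (plug S s T) X) = insert (?\<rho> X) ((\<lambda>a. {a}) ` (S - ?\<rho> X))"
      unfolding induced_part_def part_eq image_Un sg by simp
    show ?thesis
    proof (cases "X = T")
      case True
      \<comment> \<open>The exceptional case of \<open>induced_set\<close>: the block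
        \<open>{s}\<close> is among the singletons of the discrete partition.\<close>
      have "?\<rho> X = {s}" using True c by (auto simp: plug_block_def)
      moreover have "induced_set S s T X = {}" using True two by (simp add: induced_set_def)
      ultimately show ?thesis unfolding e2 unfolding part_eq using c(5) by auto
    next
      case False
      then have "?\<rho> X = induced_set S s T X" using two by (simp add: induced_set_def)
      then show ?thesis unfolding e2 unfolding part_eq using rs by auto
    qed
  qed
qed

lemma restrict_part_eq:
  assumes "X \<in> (above_sets S s T)"
  shows "restrict_part T (part (plug S s T) X) = part T X"
proof -
  note c = composableD[OF comp]
  have X: "X \<subseteq> T" using assms top_set_upper[OF top_set_in(1), of T] by (auto simp: top_set_def split: if_splits)
  have "(\<lambda>Y. Y \<inter> T) ` part (plug S s T) X - {{}} = part T X"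
    using X by (auto simp: part_def plug_def image_iff)
  then show ?thesis by (simp add: restrict_part_def)
qed

end

section \<open>Vanishing of the cohomology below the top degree\<close>

text \<open>A chain \<open>S = X\<^sub>0 \<supset> X\<^sub>1 \<supset> \<dots> \<supset> X\<^sub>n = {}\<close> is a sequence of blocks \<open>W\<^sub>i = X\<^sub>i\<^sub>-\<^sub>1 - X\<^sub>i\<close>.  Reading from the
  left, look for the first block that either is not a singleton (respectively, not of cardinality 2
  for the last block), or is a singleton \<open>{a}\<close> with \<open>a\<close> smaller than all elements of the next block.
  In the first case the chain is matched with the chain obtained by splitting off the minimum of
  this block, in the second case with the chain obtained by joining the two blocks.  A chain
  without such a block is critical.  The matching is acyclic because the set of inversions
  decreases along gradient paths.\<close>

fun is_down :: "nat set list \<Rightarrow> bool" where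
  "is_down [X, Y] = (3 \<le> card X)"
| "is_down (X # Y # Z # r) =
     (2 \<le> card (X - Y) \<or> \<not> Min (X - Y) < Min (Y - Z) \<and> is_down (Y # Z # r))"
| "is_down _ = False"

text \<open>The names tell the place in a matched pair: a chain with \<open>is_down\<close> is the
  shorter member, and \<open>up\<close> inserts a set; a chain with \<open>is_up\<close> is the
  longer member, and \<open>down\<close> removes a set.\<close>

fun is_up :: "nat set list \<Rightarrow> bool" where
  "is_up (X # Y # Z # r) =
     (card (X - Y) = 1 \<and> (Min (X - Y) < Min (Y - Z) \<or> is_up (Y # Z # r)))"
| "is_up _ = False"

fun up :: "nat set list \<Rightarrow> nat set list" where
  "up [X, Y] = [X, X - {Min X}, Y]"
| "up (X # Y # Z # r) =
     (if 2 \<le> card (X - Y) then X # (X - {Min (X - Y)}) # Y # Z # r else X # up (Y # Z # r))"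
| "up xs = xs"

fun down :: "nat set list \<Rightarrow> nat set list" where
  "down (X # Y # Z # r) = (if Min (X - Y) < Min (Y - Z) then X # Z # r else X # down (Y # Z # r))"
| "down xs = xs"

text \<open>The position in \<open>up cs\<close> of the inserted set. Deleting it gives back
  \<open>cs\<close>, so it also determines the sign of \<open>cs\<close> in the coboundary at
  \<open>up cs\<close>.\<close>

fun down_pos :: "nat set list \<Rightarrow> nat" where
  "down_pos (X # Y # Z # r) = (if 2 \<le> card (X - Y) then 1 else Suc (down_pos (Y # Z # r)))"
| "down_pos xs = 1"

text \<open>The chains of codes in a form suited to induction. As the sets grow to the left, the
  condition \<open>2 \<le> card X\<close> at the end keeps all earlier sets from being singletons
  too (\<open>dchain_iff\<close>).\<close>

fun dchain :: "nat set list \<Rightarrow> bool" where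
  "dchain [X, Y] = (Y = {} \<and> finite X \<and> 2 \<le> card X)"
| "dchain (X # Y # Z # r) = (finite X \<and> Y \<subset> X \<and> dchain (Y # Z # r))"
| "dchain _ = False"

lemma dchain_hd: "dchain cs \<Longrightarrow> finite (hd cs) \<and> 2 \<le> card (hd cs) \<and> 2 \<le> length cs"
proof (induction cs rule: dchain.induct)
  case (2 X Y Z r)
  then show ?case using psubset_card_mono[of X Y] by auto
qed auto

lemma dchain_tl: "dchain (X # Y # Z # r) \<Longrightarrow> dchain (Y # Z # r)"
  by simp

lemma dchain_psubset: "dchain (X # Y # r) \<Longrightarrow> finite X \<and> finite Y \<and> Y \<subset> X"
  using finite_subset by (cases r) auto

lemma dchain_subset: "dchain cs \<Longrightarrow> A \<in> set cs \<Longrightarrow> A \<subseteq> hd cs"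
  by (induction cs rule: dchain.induct) auto

lemma dchain_iff:
  "dchain cs \<longleftrightarrow> cs \<noteq> [] \<and> hd cs \<noteq> {} \<and> (\<forall>A\<in>set cs. finite A \<and> card A \<noteq> 1) \<and>
     sorted_wrt (\<supset>) cs \<and> last cs = {}"
proof (induction cs rule: dchain.induct)
  case (1 X Y)
  have "2 \<le> card X \<longleftrightarrow> X \<noteq> {} \<and> card X \<noteq> 1" if "finite X"
    using card_0_eq[OF that] by linarith
  then show ?case by auto
next
  case (2 X Y Z r)
  show ?case
  proof
    assume d: "dchain (X # Y # Z # r)"
    then have IH: "Y \<noteq> {} \<and> (\<forall>A\<in>set (Y # Z # r). finite A \<and> card A \<noteq> 1) \<and>
      sorted_wrt (\<supset>) (Y # Z # r) \<and> last (Y # Z # r) = {}" using 2 by simp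
    have "card X \<noteq> 1" using dchain_hd[OF d] by simp
    moreover have "A \<subset> X" if "A \<in> set (Y # Z # r)" for A
      using dchain_subset[of "Y # Z # r" A] that d by auto
    ultimately show "X # Y # Z # r \<noteq> [] \<and> hd (X # Y # Z # r) \<noteq> {} \<and>
      (\<forall>A\<in>set (X # Y # Z # r). finite A \<and> card A \<noteq> 1) \<and>
      sorted_wrt (\<supset>) (X # Y # Z # r) \<and> last (X # Y # Z # r) = {}"
      using IH d by auto
  next
    assume "X # Y # Z # r \<noteq> [] \<and> hd (X # Y # Z # r) \<noteq> {} \<and>
      (\<forall>A\<in>set (X # Y # Z # r). finite A \<and> card A \<noteq> 1) \<and>
      sorted_wrt (\<supset>) (X # Y # Z # r) \<and> last (X # Y # Z # r) = {}"
    then show "dchain (X # Y # Z # r)" using 2 by auto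
  qed
qed auto

lemma schains_dchain:
  assumes "finite S" "2 \<le> card S"
  shows "cs \<in> schains S n \<longleftrightarrow> dchain cs \<and> hd cs = S \<and> int (length cs) = n + 1"
proof -
  have ne: "S \<noteq> {}" using assms by auto
  have top: "top_set S = S" using assms by (auto simp: top_set_def)
  have "set cs \<subseteq> non_singletons S \<longleftrightarrow> (\<forall>A\<in>set cs. finite A \<and> card A \<noteq> 1)"
    if cs: "cs \<noteq> []" "sorted_wrt (\<supset>) cs" "hd cs = S"
  proof -
    have "cs = S # tl cs" using cs by (metis list.collapse)
    moreover have "\<forall>A\<in>set (tl cs). A \<subset> S" using cs by (cases cs) auto
    ultimately have "\<forall>A\<in>set cs. A \<subseteq> S" by (metis psubset_imp_subset set_ConsD subset_refl)
    moreover have "\<forall>A\<in>set cs. finite A" using calculation finite_subset[OF _ assms(1)] by blast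
    ultimately show ?thesis by (auto simp: non_singletons_def)
  qed
  then show ?thesis
    unfolding schains_def set_chains_def dchain_iff top using ne by auto
qed

lemma dchain_length: "dchain cs \<Longrightarrow> length cs \<le> card (hd cs)"
proof (induction cs rule: dchain.induct)
  case (2 X Y Z r)
  then show ?case using psubset_card_mono[of X Y] by auto
qed auto

text \<open>The successive differences of the chain are an ordered partition of its first set, and
  these are its inversions: \<open>x\<close> lies in an earlier block than the smaller
  \<open>y\<close>.\<close>

definition inversions :: "nat set list \<Rightarrow> (nat \<times> nat) set" where
  "inversions cs = {(x, y). x \<in> hd cs \<and> y \<in> hd cs \<and> y < x \<and> (\<exists>A\<in>set cs. x \<notin> A \<and> y \<in> A)}"

lemma finite_inversions: "finite (hd cs) \<Longrightarrow> finite (inversions cs)"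
  by (rule finite_subset[of _ "hd cs \<times> hd cs"]) (auto simp: inversions_def)

lemma inversions_Cons:
  assumes "\<And>A. A \<in> set (Y # r) \<Longrightarrow> A \<subseteq> Y" "Y \<subseteq> X"
  shows "inversions (X # Y # r) = {(x, y). x \<in> X - Y \<and> y \<in> Y \<and> y < x} \<union> inversions (Y # r)"
proof (intro equalityI subsetI)
  fix p assume p: "p \<in> inversions (X # Y # r)"
  then obtain x y A where xy: "p = (x, y)" "x \<in> X" "y \<in> X" "y < x" "A \<in> set (X # Y # r)" "x \<notin> A" "y \<in> A"
    by (auto simp: inversions_def)
  then have A: "A \<in> set (Y # r)" by auto
  then have "y \<in> Y" using assms(1) xy by blast
  then show "p \<in> {(x, y). x \<in> X - Y \<and> y \<in> Y \<and> y < x} \<union> inversions (Y # r)"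
    using xy A unfolding inversions_def by auto
next
  fix p assume "p \<in> {(x, y). x \<in> X - Y \<and> y \<in> Y \<and> y < x} \<union> inversions (Y # r)"
  then show "p \<in> inversions (X # Y # r)" using assms(2) unfolding inversions_def by auto
qed

lemma inversions_dchain_Cons:
  assumes "dchain (Y # r)" "Y \<subset> X"
  shows "inversions (X # Y # r) = {(x, y). x \<in> X - Y \<and> y \<in> Y \<and> y < x} \<union> inversions (Y # r)"
  using dchain_subset[OF assms(1)] assms(2) by (intro inversions_Cons) auto

lemma inversions_mono: "set cs \<subseteq> set cs' \<Longrightarrow> hd cs = hd cs' \<Longrightarrow> inversions cs \<subseteq> inversions cs'"
  by (auto simp: inversions_def)

lemma Min_remove_Min:
  assumes "finite W" "2 \<le> card W"
  shows "W - {Min W} \<noteq> {}" "Min W < Min (W - {Min W})" "Min W \<in> W"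
proof -
  have W: "W \<noteq> {}" using assms by auto
  show m: "Min W \<in> W" using assms W by simp
  have "card (W - {Min W}) = card W - 1" using m assms by simp
  then have "card (W - {Min W}) \<noteq> 0" using assms by simp
  then show ne: "W - {Min W} \<noteq> {}" by (metis card.empty)
  have "Min (W - {Min W}) \<in> W - {Min W}" using ne assms(1) by (intro Min_in) auto
  then show "Min W < Min (W - {Min W})" using assms(1) by (auto simp: order_less_le)
qed

text \<open>The first block may shrink under \<open>up\<close>, but it keeps its minimum. So its
  comparison with a block to the left, on which the recursion depends, has the same outcome before
  and after.\<close>

lemma up_hd:
  assumes "dchain (X # Y # r)" "is_down (X # Y # r)"
  obtains Z' r' where "up (X # Y # r) = X # Z' # r'" "Min (X - Z') = Min (X - Y)" "r' \<noteq> []"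
proof (cases r)
  case Nil
  have "Min X \<in> X" using assms Nil by (intro Min_in) auto
  then have "X - (X - {Min X}) = {Min X}" by auto
  then show ?thesis using that[of "X - {Min X}" "[Y]"] assms Nil by simp
next
  case (Cons Z r2)
  show ?thesis
  proof (cases "2 \<le> card (X - Y)")
    case True
    have "Min (X - Y) \<in> X - Y" using True assms Cons by (intro Min_remove_Min) auto
    then have "X - (X - {Min (X - Y)}) = {Min (X - Y)}" by auto
    then show ?thesis using that[of "X - {Min (X - Y)}" "Y # r"] Cons True by simp
  next
    case False
    have "up (Z # r2) \<noteq> []" by (cases "Z # r2" rule: up.cases) auto
    then have "up (Y # Z # r2) \<noteq> []" by (cases r2) auto
    moreover have "hd (up (Y # Z # r2)) = Y \<and> tl (up (Y # Z # r2)) \<noteq> []"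
      using \<open>up (Z # r2) \<noteq> []\<close> by (cases r2) auto
    ultimately have "up (X # Y # r) = X # Y # tl (up (Y # Z # r2))" using Cons False by (cases "up (Y # Z # r2)") auto
    then show ?thesis using that[of Y "tl (up (Y # Z # r2))"] \<open>_ \<and> _\<close> by simp
  qed
qed

lemma not_ge_2_card_1: "dchain (X # Y # r) \<Longrightarrow> \<not> 2 \<le> card (X - Y) \<Longrightarrow> \<exists>a. X - Y = {a} \<and> a \<in> X \<and> a \<notin> Y"
proof -
  assume d: "dchain (X # Y # r)" and c: "\<not> 2 \<le> card (X - Y)"
  have "finite (X - Y)" "X - Y \<noteq> {}" using dchain_psubset[OF d] by auto
  then have "card (X - Y) = 1" using c card_0_eq[of "X - Y"] by linarith
  then obtain a where "X - Y = {a}" by (auto simp: card_1_singleton_iff)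
  then show ?thesis by auto
qed

text \<open>The inserted set separates the minimum \<open>m\<close> of a block from the rest of the
  block. Since \<open>m\<close> comes first, this creates no inversion, and all other sets are
  unchanged.\<close>

lemma up_props:
  assumes "dchain cs" "is_down cs"
  shows "dchain (up cs) \<and> hd (up cs) = hd cs \<and> is_up (up cs) \<and> down (up cs) = cs \<and>
    length (up cs) = Suc (length cs) \<and> del (down_pos cs) (up cs) = cs \<and>
    1 \<le> down_pos cs \<and> Suc (down_pos cs) < length (up cs) \<and> inversions (up cs) = inversions cs"
  using assms
proof (induction cs rule: up.induct)
  case (1 X Y)
  then have X: "Y = {}" "finite X" "3 \<le> card X" by auto
  note m = Min_remove_Min[OF X(2)]
  have c: "card (X - {Min X}) = card X - 1" using m X by simp
  have e: "X - (X - {Min X}) = {Min X}" using m X by auto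
  have "inversions [X, X - {Min X}, {}] = inversions [X, {}]"
    using X Min_le[OF X(2)] by (auto simp: inversions_def not_le[symmetric])
  then show ?case using X m c e by (auto simp: del_def)
next
  case (2 X Y Z r)
  show ?case
  proof (cases "2 \<le> card (X - Y)")
    case True
    define m where "m = Min (X - Y)"
    have X: "finite X" "Y \<subset> X" "dchain (Y # Z # r)" using 2 by auto
    note M = Min_remove_Min[of "X - Y", OF _ True, folded m_def]
    have m: "m \<in> X" "m \<notin> Y" "X - Y - {m} \<noteq> {}" "m < Min (X - Y - {m})" using M X by auto
    have e: "X - (X - {m}) = {m}" "X - {m} - Y = X - Y - {m}" using m by auto
    have "inversions (X # (X - {m}) # Y # Z # r) = inversions (X # Y # Z # r)"
    proof
      show "inversions (X # (X - {m}) # Y # Z # r) \<subseteq> inversions (X # Y # Z # r)"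
      proof
        fix p assume "p \<in> inversions (X # (X - {m}) # Y # Z # r)"
        then obtain x y A where p: "p = (x, y)" "x \<in> X" "y \<in> X" "y < x"
          "A \<in> set (X # (X - {m}) # Y # Z # r)" "x \<notin> A" "y \<in> A" by (auto simp: inversions_def)
        have "\<exists>A\<in>set (X # Y # Z # r). x \<notin> A \<and> y \<in> A"
        proof (cases "A = X - {m}")
          case True
          \<comment> \<open>An inversion detected by the inserted set has \<open>x = m\<close>. Then
            \<open>y < m\<close> cannot lie in the block of \<open>m\<close>, so it lies in
            \<open>Y\<close>, and \<open>Y\<close> detects the inversion as well.\<close>
          then have "x = m" "y \<noteq> m" using p by auto
          then have "y \<in> Y" using p(3,4) Min_le[of "X - Y" y] X(1) unfolding m_def by fastforce
          then show ?thesis using m \<open>x = m\<close> by auto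
        qed (use p in auto)
        then show "p \<in> inversions (X # Y # Z # r)" using p by (auto simp: inversions_def)
      qed
    qed (rule inversions_mono; auto)
    moreover have "up (X # Y # Z # r) = X # (X - {m}) # Y # Z # r" using True by (simp add: m_def)
    moreover have "down_pos (X # Y # Z # r) = 1" using True by simp
    moreover have "dchain (X # (X - {m}) # Y # Z # r)" using X m by auto
    ultimately show ?thesis using e m by (simp add: del_def)
  next
    case False
    have d: "dchain (Y # Z # r)" "is_down (Y # Z # r)" "\<not> Min (X - Y) < Min (Y - Z)" "Y \<subset> X" "finite X"
      using 2 False by auto
    obtain a where a: "X - Y = {a}" using not_ge_2_card_1[OF 2(2) False] by blast
    obtain Z' r' where u: "up (Y # Z # r) = Y # Z' # r'" "Min (Y - Z') = Min (Y - Z)" "r' \<noteq> []"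
      using up_hd[OF d(1,2)] .
    note IH = 2(1)[OF False d(1,2), unfolded u(1)]
    have "dchain (X # Y # Z' # r')" using IH d by simp
    moreover have "inversions (X # Y # Z' # r') = inversions (X # Y # Z # r)"
      using IH inversions_dchain_Cons[OF d(1,4)] inversions_dchain_Cons[of Y "Z' # r'" X] d(4) by simp
    ultimately show ?thesis using IH False u d(3) a by (simp add: u(1))
  qed
qed auto

lemma down_hd:
  assumes "dchain (X # Y # Z # r)" "is_up (X # Y # Z # r)"
  obtains Z' r' where "down (X # Y # Z # r) = X # Z' # r'" "Min (X - Z') = Min (X - Y)"
proof (cases "Min (X - Y) < Min (Y - Z)")
  case True
  have f: "finite X" "finite Y" "Y \<subset> X" "Z \<subset> Y"
    using dchain_psubset[OF assms(1)] dchain_psubset[OF dchain_tl[OF assms(1)]] by auto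
  have "X - Z = (X - Y) \<union> (Y - Z)" using f by auto
  then have "Min (X - Z) = min (Min (X - Y)) (Min (Y - Z))" using f by (auto intro: Min_Un)
  then show ?thesis using True that[of Z r] by simp
next
  case False
  have "is_up (Y # Z # r)" using assms(2) False by simp
  then have "hd (down (Y # Z # r)) = Y \<and> down (Y # Z # r) \<noteq> []" by (cases r) auto
  then have "down (X # Y # Z # r) = X # Y # tl (down (Y # Z # r))" using False
    by (cases "down (Y # Z # r)") auto
  then show ?thesis using that[of Y] by simp
qed

text \<open>Joining \<open>{a}\<close> to the next block, all of whose elements are larger, gives a
  block with minimum \<open>a\<close>, from which \<open>up\<close> splits off \<open>a\<close>
  again.\<close>

lemma down_props:
  assumes "dchain cs" "is_up cs"
  shows "dchain (down cs) \<and> hd (down cs) = hd cs \<and> is_down (down cs) \<and> up (down cs) = cs \<and>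
    Suc (length (down cs)) = length cs"
  using assms
proof (induction cs rule: is_up.induct)
  case (1 X Y Z r)
  have d: "dchain (Y # Z # r)" "card (X - Y) = 1" "finite X" "finite Y" "Y \<subset> X" "Z \<subset> Y"
    using 1 dchain_psubset[OF 1(2)] dchain_psubset[OF dchain_tl[OF 1(2)]] by auto
  then obtain a where a: "X - Y = {a}" by (auto simp: card_1_singleton_iff)
  have aX: "a \<in> X" "a \<notin> Y" using a by auto
  show ?case
  proof (cases "Min (X - Y) < Min (Y - Z)")
    case True
    have XZ: "X - Z = insert a (Y - Z)" using a d by auto
    have m: "Min (X - Z) = a" using True d a unfolding XZ by (subst Min_insert) auto
    have Y: "X - {a} = Y" using a d by auto
    have c: "2 \<le> card (X - Z)"
    proof -
      define W where "W = Y - Z"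
      have "W \<noteq> {}" "finite W" "a \<notin> W" using d aX by (auto simp: W_def)
      then have "card (insert a W) = Suc (card W)" "card W \<noteq> 0" by simp_all
      then show ?thesis unfolding XZ W_def by linarith
    qed
    have ZX: "Z \<subset> X" using d by auto
    show ?thesis
    proof (cases r)
      case Nil
      have "Z = {}" "2 \<le> card Y" using d(1) Nil by auto
      moreover have "card X = Suc (card Y)" using d Y aX by (metis card_Suc_Diff1)
      ultimately show ?thesis using Nil True d m Y by auto
    next
      case (Cons Z2 r2)
      then show ?thesis using True d m Y c ZX by auto
    qed
  next
    case False
    have u: "is_up (Y # Z # r)" using 1(3) False by simp
    note IH = 1(1)[OF d(1) u]
    obtain Z2 r2 where r: "r = Z2 # r2 \<or> r = []" by (cases r) auto
    have "r \<noteq> []" using u by (cases r) auto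
    then obtain Z2 r2 where r: "r = Z2 # r2" by (cases r) auto
    obtain Z' r' where dn: "down (Y # Z # r) = Y # Z' # r'" "Min (Y - Z') = Min (Y - Z)"
      using down_hd[of Y Z Z2 r2] d(1) u unfolding r by blast
    have "dchain (X # Y # Z' # r')" using IH d unfolding dn(1) by simp
    moreover have "down (X # Y # Z # r) = X # Y # Z' # r'"
      using False dn(1) by (simp del: Min_gr_iff)
    ultimately show ?thesis using IH False d dn(2) unfolding dn(1) by (simp del: Min_gr_iff)
  qed
qed auto

lemma inversions_del_subset:
  assumes "0 < i" "i < length cs"
  shows "inversions (del i cs) \<subseteq> inversions cs"
  using set_del_subset[of i cs] hd_del[OF assms] by (intro inversions_mono)

text \<open>The acyclicity of the matching. Deleting a set joins two blocks and can only lose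
  inversions. If the set is not the inserted one and the result can be enlarged again, then there is
  an inversion between the two joined blocks, and it is lost.\<close>

lemma inversions_decrease:
  assumes "dchain cs" "is_down cs" "1 \<le> j" "Suc j < length (up cs)" "j \<noteq> down_pos cs"
    "is_down (del j (up cs))"
  shows "inversions (del j (up cs)) \<subset> inversions cs"
  using assms
proof (induction cs arbitrary: j rule: up.induct)
  case (1 X Y)
  then show ?case by simp
next
  case (2 X Y Z r)
  note props = up_props[OF 2(2,3)]
  have sub: "inversions (del j (up (X # Y # Z # r))) \<subseteq> inversions (X # Y # Z # r)"
    using inversions_del_subset[of j "up (X # Y # Z # r)"] 2(4,5) props by simp
  show ?case
  proof (cases "2 \<le> card (X - Y)")
    case True
    define m where "m = Min (X - Y)"
    have X: "finite X" "Y \<subset> X" "dchain (Y # Z # r)" using 2 by auto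
    note M = Min_remove_Min[of "X - Y", OF _ True, folded m_def]
    have m: "m \<in> X" "m \<notin> Y" "X - Y - {m} \<noteq> {}" "m < Min (X - Y - {m})" using M X by auto
    have e: "X - (X - {m}) = {m}" "X - {m} - Y = X - Y - {m}" using m by auto
    have u: "up (X # Y # Z # r) = X # (X - {m}) # Y # Z # r" using True by (simp add: m_def)
    have "j \<noteq> 1" using 2(6) True by simp
    then obtain k where k: "j = Suc (Suc k)" using 2(4) by (cases j; cases "j - 1") auto
    show ?thesis
    proof (cases k)
      case 0
      have del: "del j (up (X # Y # Z # r)) = X # (X - {m}) # Z # r" using k 0 u by (simp add: del_def)
      \<comment> \<open>The shortened chain starts with the block \<open>{m}\<close> and has
        \<open>is_down\<close>, so the minimum \<open>y\<close> of the joined block is below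
        \<open>m\<close>. That \<open>y\<close> comes from the second of the joined blocks, and each
        \<open>x\<close> of the first forms an inversion with it.\<close>
      have nm: "\<not> m < Min (X - {m} - Z)" using 2(7) unfolding del by (simp add: e)
      have fne: "finite (X - {m} - Z)" "X - {m} - Z \<noteq> {}"
        using m X dchain_psubset[OF X(3)] by auto
      define y where "y = Min (X - {m} - Z)"
      have y: "y \<in> X - {m} - Z" unfolding y_def using fne by (rule Min_in)
      have "y < m" using nm y unfolding y_def by (metis DiffD1 DiffD2 insertI1 linorder_neqE_nat)
      then have yY: "y \<in> Y" using y Min_le[of "X - Y" y] X(1) unfolding m_def by fastforce
      obtain x where x: "x \<in> X" "x \<notin> Y" "x \<noteq> m" using m(3) by auto
      have "m \<le> x" unfolding m_def using x X(1) by (intro Min_le) auto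
      then have "y < x" using \<open>y < m\<close> by simp
      then have "(x, y) \<in> inversions (X # Y # Z # r)" using x y yY by (auto simp: inversions_def)
      moreover have "(x, y) \<notin> inversions (X # (X - {m}) # Z # r)"
      proof -
        have "y \<notin> A" if "A \<in> set (Z # r)" for A
        proof -
          have "A \<subseteq> Z"
          proof (cases r)
            case (Cons Z2 r2)
            then show ?thesis using dchain_subset[of "Z # r" A] X(3) that by simp
          qed (use that in simp)
          then show ?thesis using y by auto
        qed
        then show ?thesis using x y by (auto simp: inversions_def)
      qed
      ultimately show ?thesis using sub unfolding del by blast
    next
      case (Suc k')
      have "del j (up (X # Y # Z # r)) = X # (X - {m}) # Y # del k' (Z # r)" using k Suc u by simp
      then show ?thesis using 2(7) m e by simp
    qed
  next
    case False
    have d: "dchain (Y # Z # r)" "is_down (Y # Z # r)" "\<not> Min (X - Y) < Min (Y - Z)" "Y \<subset> X" "finite X"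
      using 2 False by auto
    obtain a where a: "X - Y = {a}" "a \<in> X" "a \<notin> Y" using not_ge_2_card_1[OF 2(2) False] by blast
    obtain Z' r' where u: "up (Y # Z # r) = Y # Z' # r'" "Min (Y - Z') = Min (Y - Z)" "r' \<noteq> []"
      using up_hd[OF d(1,2)] .
    have up: "up (X # Y # Z # r) = X # Y # Z' # r'" using False u by simp
    note props' = up_props[OF d(1,2), unfolded u(1)]
    have Z': "Z' \<subset> Y" "finite Y" using dchain_psubset[of Y Z' r'] props' by auto
    obtain j' where j': "j = Suc j'" using 2(4) by (cases j) auto
    show ?thesis
    proof (cases j')
      case 0
      have del: "del j (up (X # Y # Z # r)) = X # Z' # r'" using up j' 0 by (simp add: del_def)
      \<comment> \<open>The block \<open>{a}\<close> is joined to the next one. Since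
        \<open>a\<close> is not below the minimum of that block, there is an element
        \<open>y\<close> below \<open>a\<close> in it, and the inversion of \<open>a\<close> and
        \<open>y\<close> is lost.\<close>
      define y where "y = Min (Y - Z')"
      have y: "y \<in> Y - Z'" unfolding y_def using Z' by (intro Min_in) auto
      have "\<not> a < y" using d(3) a(1) u(2) unfolding y_def by simp
      then have "y < a" using y a by (metis DiffD1 linorder_neqE_nat)
      then have "(a, y) \<in> inversions (X # Y # Z # r)" using a y d(4) by (auto simp: inversions_def)
      moreover have "(a, y) \<notin> inversions (X # Z' # r')"
      proof -
        obtain Z2 r2 where r2: "r' = Z2 # r2" using u(3) by (cases r') auto
        have "dchain (Y # Z' # Z2 # r2)" using props' r2 by simp
        then have "dchain (Z' # Z2 # r2) " by simp
        then have "A \<subseteq> Z'" if "A \<in> set (Z' # r')" for A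
          using dchain_subset[of "Z' # Z2 # r2" A] that r2 by auto
        then show ?thesis using a y by (auto simp: inversions_def)
      qed
      ultimately show ?thesis using sub unfolding del by blast
    next
      case (Suc k)
      have len: "Suc j' < length (up (Y # Z # r))" using 2(5) unfolding up u(1) j' by simp
      have del: "del j (up (X # Y # Z # r)) = X # del j' (up (Y # Z # r))" using up j' u by simp
      have dl: "length (del j' (up (Y # Z # r))) \<ge> 2"
        using length_del[of j' "up (Y # Z # r)"] len Suc by simp
      have dh: "hd (del j' (up (Y # Z # r))) = Y" using hd_del[of j' "up (Y # Z # r)"] len Suc u by simp
      obtain W r2 where W: "del j' (up (Y # Z # r)) = Y # W # r2"
      proof (cases "del j' (up (Y # Z # r))")
        case (Cons Y' r1)
        then show ?thesis using dl dh that by (cases r1) auto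
      qed (use dl in simp)
      have "is_down (Y # W # r2)" using 2(7) False unfolding del W by simp
      moreover have "j' \<noteq> down_pos (Y # Z # r)" using 2(6) False j' by simp
      ultimately have IH: "inversions (Y # W # r2) \<subset> inversions (Y # Z # r)"
        using 2(1)[OF False d(1,2), of j'] Suc len unfolding W by simp
      have "A \<subseteq> Y" if A: "A \<in> set (Y # W # r2)" for A
      proof -
        have "A \<in> set (Y # Z' # r')"
          using set_del_subset[of j' "up (Y # Z # r)", unfolded W] A unfolding u(1) by (rule subsetD)
        then show ?thesis using dchain_subset[of "Y # Z' # r'" A] props' by simp
      qed
      then have 1: "inversions (X # Y # W # r2) = {(x, y). x \<in> X - Y \<and> y \<in> Y \<and> y < x} \<union> inversions (Y # W # r2)"
        using d(4) by (intro inversions_Cons) auto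
      have 2: "{(x, y). x \<in> X - Y \<and> y \<in> Y \<and> y < x} \<inter> inversions (Y # Z # r) = {}"
        by (auto simp: inversions_def)
      have "R \<union> I' \<subset> R \<union> I" if "I' \<subset> I" "R \<inter> I = {}" for R I I' :: "(nat \<times> nat) set"
        using that by blast
      from this[OF IH 2] show ?thesis
        unfolding del W 1 inversions_dchain_Cons[OF d(1,4)] .
    qed
  qed
qed auto

text \<open>All blocks of a critical chain are singletons except the last one, which has two
  elements. By \<open>dchain_length\<close> such a chain is as long as possible.\<close>

lemma critical_length:
  "dchain cs \<Longrightarrow> \<not> is_down cs \<Longrightarrow> \<not> is_up cs \<Longrightarrow> length cs = card (hd cs)"
proof (induction cs rule: dchain.induct)
  case (2 X Y Z r)
  then have nd: "\<not> 2 \<le> card (X - Y)" by simp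
  obtain a where a: "X - Y = {a}" using not_ge_2_card_1[OF 2(2) nd] by blast
  then have c: "card (X - Y) = 1" by simp
  have "\<not> is_up (Y # Z # r)" "\<not> Min (X - Y) < Min (Y - Z)" using 2(4) c by auto
  then have "\<not> is_down (Y # Z # r)" using 2(3) by auto
  then have "length (Y # Z # r) = card Y" using 2(1)[OF dchain_tl[OF 2(2)]] \<open>\<not> is_up (Y # Z # r)\<close> by simp
  moreover have "X = insert a Y" "a \<notin> Y" "finite Y" using a dchain_psubset[OF 2(2)] by auto
  ultimately show ?case by simp
qed auto

subsection \<open>Elimination of the matched chains\<close>

lemma del_schains:
  assumes "cs \<in> schains S n" "1 \<le> i" "Suc i < length cs"
  shows "del i cs \<in> schains S (n - 1)"
  using assms set_del_subset[of i cs] length_del[of i cs] hd_del[of i cs] last_del[of i cs]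
    sorted_wrt_del[of "(\<supset>)" cs i] length_del[of i cs]
  by (auto simp: schains_def set_chains_def)

lemma lookup_coboundary_schains:
  fixes z :: "nat set set list \<Rightarrow>\<^sub>0 'k::{comm_ring,comm_monoid_mult}"
  assumes fin: "finite S" and "Poly_Mapping.keys z \<subseteq> chains (NS S) n" "cs \<in> schains S m"
  shows "Poly_Mapping.lookup (coboundary (NS S) z) (map (part S) cs) =
    (\<Sum>i = 1..<length cs - 1. ksign (int i) * Poly_Mapping.lookup z (map (part S) (del i cs)))"
  using finite_gorder.lookup_coboundary[OF finite_gorder_NS[OF fin] assms(2) map_part_chains[OF fin assms(3)]]
  by (simp add: map_del)

context
  fixes S :: "nat set"
  assumes fin: "finite S" and two: "2 \<le> card S"
begin

lemmas sd = schains_dchain[OF fin two]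

lemma finite_schains: "finite (schains S n)"
proof (rule finite_imageD)
  show "finite (map (part S) ` schains S n)"
    using finite_gorder.finite_chains[OF finite_gorder_NS[OF fin], of n] by (simp add: chains_NS[OF fin])
  show "inj_on (map (part S)) (schains S n)"
    using map_part_inj[OF fin] schains_subset by (auto intro!: inj_onI)
qed

lemma map_part_eq_iff:
  "cs \<in> schains S n \<Longrightarrow> cs' \<in> schains S m \<Longrightarrow> map (part S) cs = map (part S) cs' \<longleftrightarrow> cs = cs'"
  using map_part_inj[OF fin] schains_subset by blast

lemma up_schains:
  assumes "cs \<in> schains S n" "is_down cs"
  shows "up cs \<in> schains S (n + 1)"
  using assms up_props[of cs] by (auto simp: sd)

definition rank :: "nat set list \<Rightarrow> nat" where
  "rank cs = card (inversions cs)"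

lemma rank_up: "dchain cs \<Longrightarrow> is_down cs \<Longrightarrow> rank (up cs) = rank cs"
  using up_props by (simp add: rank_def)

lemma rank_decrease:
  assumes "dchain cs" "is_down cs" "1 \<le> j" "Suc j < length (up cs)" "j \<noteq> down_pos cs"
    "is_down (del j (up cs))"
  shows "rank (del j (up cs)) < rank cs"
  unfolding rank_def using assms dchain_hd[OF assms(1)]
  by (intro psubset_card_mono finite_inversions inversions_decrease) auto

text \<open>Induction on the rank. The value of \<open>z\<close> at a longer chain of rank
  \<open>k\<close> is cancelled by the coboundary of its partner. By \<open>rank_decrease\<close>,
  among the chains with \<open>is_up\<close> this coboundary otherwise affects only those of larger
  rank, so earlier cancellations are preserved.\<close>

lemma eliminate_up:
  fixes z :: "nat set set list \<Rightarrow>\<^sub>0 'k::{comm_ring,comm_monoid_mult}"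
  shows "\<exists>w. Poly_Mapping.keys w \<subseteq> chains (NS S) (n - 1) \<and>
    (\<forall>cs\<in>schains S n. is_up cs \<longrightarrow> rank cs < k \<longrightarrow>
      Poly_Mapping.lookup (z - coboundary (NS S) w) (map (part S) cs) = 0)"
proof (induction k)
  case 0
  then show ?case by (intro exI[of _ 0]) simp
next
  case (Suc k)
  interpret finite_gorder "NS S" by (rule finite_gorder_NS[OF fin])
  obtain w where w: "Poly_Mapping.keys w \<subseteq> chains (NS S) (n - 1)"
    "\<And>cs. cs \<in> schains S n \<Longrightarrow> is_up cs \<Longrightarrow> rank cs < k \<Longrightarrow>
      Poly_Mapping.lookup (z - coboundary (NS S) w) (map (part S) cs) = 0" using Suc by blast
  define z' where "z' = z - coboundary (NS S) w"
  define D where "D = {d \<in> schains S (n - 1). is_down d \<and> rank d = k}"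
  have D: "finite D" using finite_schains[of "n - 1"] by (simp add: D_def)
  \<comment> \<open>The factor \<open>ksign (int (down_pos d))\<close> is the sign with which
    \<open>d\<close> enters the coboundary at \<open>up d\<close>; the two signs multiply to
    1.\<close>
  define c where "c d = ksign (int (down_pos d)) * Poly_Mapping.lookup z' (map (part S) (up d))" for d
  define v where "v = (\<Sum>d\<in>D. scale (c d) (basis (map (part S) d)))"
  have v_keys: "Poly_Mapping.keys v \<subseteq> chains (NS S) (n - 1)"
    unfolding v_def
  proof (rule keys_sum_subset)
    fix d assume "d \<in> D"
    then have "map (part S) d \<in> chains (NS S) (n - 1)" using map_part_chains[OF fin] by (simp add: D_def)
    then show "Poly_Mapping.keys (scale (c d) (basis (map (part S) d))) \<subseteq> chains (NS S) (n - 1)"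
      by (intro order_trans[OF keys_scale] order_trans[OF keys_basis]) simp
  qed
  have v: "Poly_Mapping.lookup v (map (part S) e) = (if e \<in> D then c e else 0)"
    if e: "e \<in> schains S (n - 1)" for e
  proof -
    have "Poly_Mapping.lookup v (map (part S) e) = (\<Sum>d\<in>D. if d = e then c d else 0)"
      unfolding v_def lookup_sum lookup_scale lookup_basis
      using map_part_eq_iff[OF _ e] by (intro sum.cong) (auto simp: D_def)
    then show ?thesis using D by simp
  qed
  have wv: "Poly_Mapping.keys (w + v) \<subseteq> chains (NS S) (n - 1)" using w(1) v_keys by (rule keys_plus)
  have "Poly_Mapping.lookup (z - coboundary (NS S) (w + v)) (map (part S) cs) = 0"
    if cs: "cs \<in> schains S n" "is_up cs" "rank cs < Suc k" for cs
  proof -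
    have dn: "dchain (down cs)" "is_down (down cs)" "up (down cs) = cs"
      using down_props[OF _ cs(2)] cs(1) by (auto simp: sd)
    note up = up_props[OF dn(1,2), unfolded dn(3)]
    have len: "down_pos (down cs) \<in> {1..<length cs - 1}" using up by auto
    have "Poly_Mapping.lookup (coboundary (NS S) v) (map (part S) cs) =
        (\<Sum>i = 1..<length cs - 1. ksign (int i) * Poly_Mapping.lookup v (map (part S) (del i cs)))"
      by (rule lookup_coboundary_schains[OF fin v_keys cs(1)])
    also have "\<dots> = (\<Sum>i = 1..<length cs - 1. if i = down_pos (down cs) then
        (if rank cs = k then Poly_Mapping.lookup z' (map (part S) cs) else 0) else 0)"
    proof (intro sum.cong refl)
      fix i assume i: "i \<in> {1..<length cs - 1}"
      have i': "1 \<le> i" "Suc i < length cs" using i by auto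
      have e: "del i cs \<in> schains S (n - 1)" using cs(1) i' by (intro del_schains) auto
      show "ksign (int i) * Poly_Mapping.lookup v (map (part S) (del i cs)) =
        (if i = down_pos (down cs) then
          (if rank cs = k then Poly_Mapping.lookup z' (map (part S) cs) else 0) else 0)"
      proof (cases "i = down_pos (down cs)")
        case True
        then have d: "del i cs = down cs" using up by simp
        have "down cs \<in> D \<longleftrightarrow> rank cs = k"
          using e dn rank_up[OF dn(1,2)] unfolding d by (simp add: D_def)
        then show ?thesis using v[OF e] True unfolding d by (simp add: c_def dn(3))
      next
        case False
        have "del i cs \<notin> D"
        proof
          assume "del i cs \<in> D"
          then have "is_down (del i cs)" "rank (del i cs) = k" by (auto simp: D_def)
          then show False
            using rank_decrease[OF dn(1,2), of i] i' False cs(3) rank_up[OF dn(1,2)] unfolding dn(3) by simp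
        qed
        then show ?thesis using False v[OF e] by simp
      qed
    qed
    also have "\<dots> = (if rank cs = k then Poly_Mapping.lookup z' (map (part S) cs) else 0)"
      using len by (simp add: sum.delta)
    finally have "Poly_Mapping.lookup (z - coboundary (NS S) (w + v)) (map (part S) cs) =
      Poly_Mapping.lookup z' (map (part S) cs) -
      (if rank cs = k then Poly_Mapping.lookup z' (map (part S) cs) else 0)"
      by (simp add: coboundary_simps lookup_minus lookup_add z'_def algebra_simps)
    then show ?thesis using w(2)[OF cs(1,2)] cs(3) by (auto simp: z'_def)
  qed
  then show ?case using wv by blast
qed

text \<open>Evaluate the cocycle condition at \<open>up cs\<close>. Besides \<open>cs\<close> itself
  the sum contains chains with \<open>is_up\<close>, where \<open>z\<close> vanishes, and chains
  with \<open>is_down\<close> of smaller rank. Critical chains cannot occur: they have maximal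
  length, whereas the terms are shorter than \<open>up cs\<close>.\<close>

lemma no_down:
  fixes z :: "nat set set list \<Rightarrow>\<^sub>0 'k::{comm_ring,comm_monoid_mult}"
  assumes z: "Poly_Mapping.keys z \<subseteq> chains (NS S) n" and dz: "coboundary (NS S) z = 0"
    and up0: "\<And>cs. cs \<in> schains S n \<Longrightarrow> is_up cs \<Longrightarrow> Poly_Mapping.lookup z (map (part S) cs) = 0"
    and cs: "cs \<in> schains S n" "is_down cs"
  shows "Poly_Mapping.lookup z (map (part S) cs) = 0"
  using cs
proof (induction "rank cs" arbitrary: cs rule: less_induct)
  case less
  have d: "dchain cs" "hd cs = S" using less.prems by (auto simp: sd)
  note up = up_props[OF d(1) less.prems(2)]
  have u: "up cs \<in> schains S (n + 1)" by (rule up_schains[OF less.prems])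
  have "0 = (\<Sum>i = 1..<length (up cs) - 1. ksign (int i) * Poly_Mapping.lookup z (map (part S) (del i (up cs))))"
    using lookup_coboundary_schains[OF fin z u] dz by simp
  also have "\<dots> = (\<Sum>i = 1..<length (up cs) - 1. if i = down_pos cs then
      ksign (int i) * Poly_Mapping.lookup z (map (part S) cs) else 0)"
  proof (intro sum.cong refl)
    fix i assume i: "i \<in> {1..<length (up cs) - 1}"
    show "ksign (int i) * Poly_Mapping.lookup z (map (part S) (del i (up cs))) =
      (if i = down_pos cs then ksign (int i) * Poly_Mapping.lookup z (map (part S) cs) else 0)"
    proof (cases "i = down_pos cs")
      case False
      have i': "1 \<le> i" "Suc i < length (up cs)" using i by auto
      have e: "del i (up cs) \<in> schains S n" using del_schains[OF u i'] by simp
      have "Poly_Mapping.lookup z (map (part S) (del i (up cs))) = 0"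
      proof (cases "is_up (del i (up cs))")
        case False
        show ?thesis
        proof (cases "is_down (del i (up cs))")
          case True
          then show ?thesis
            using less.hyps[OF rank_decrease[OF d(1) less.prems(2) i']] e \<open>i \<noteq> down_pos cs\<close> by simp
        next
          case nd: False
          have "dchain (del i (up cs))" "hd (del i (up cs)) = S" using e by (auto simp: sd)
          then have "length (del i (up cs)) = card S" using critical_length False nd by metis
          moreover have "length (up cs) \<le> card S" using dchain_length[of "up cs"] up d(2) by simp
          ultimately show ?thesis using length_del[of i "up cs"] i by auto
        qed
      qed (use up0[OF e] in simp)
      then show ?thesis using False by simp
    qed (use up in simp)
  qed
  also have "\<dots> = ksign (int (down_pos cs)) * Poly_Mapping.lookup z (map (part S) cs)"
    using up by (simp add: sum.delta)
  finally show ?case using ksign_eq_0_iff by metis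
qed

theorem cohomologous_to_critical:
  fixes z :: "nat set set list \<Rightarrow>\<^sub>0 'k::{comm_ring,comm_monoid_mult}"
  assumes z: "Poly_Mapping.keys z \<subseteq> chains (NS S) n" and dz: "coboundary (NS S) z = 0"
  obtains w where "Poly_Mapping.keys w \<subseteq> chains (NS S) (n - 1)"
    "\<And>cs. cs \<in> schains S n \<Longrightarrow> Poly_Mapping.lookup (z - coboundary (NS S) w) (map (part S) cs) \<noteq> 0 \<Longrightarrow>
      \<not> is_up cs \<and> \<not> is_down cs"
proof -
  interpret finite_gorder "NS S" by (rule finite_gorder_NS[OF fin])
  \<comment> \<open>A bound above all ranks, so that every chain with \<open>is_up\<close> is
    eliminated; the inserted 0 makes the maximum meaningful if there are no chains.\<close>
  define k where "k = Suc (Max (insert 0 (rank ` schains S n)))"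
  have k: "rank cs < k" if "cs \<in> schains S n" for cs
    unfolding k_def using that finite_schains[of n] by (simp add: less_Suc_eq_le)
  obtain w where w: "Poly_Mapping.keys w \<subseteq> chains (NS S) (n - 1)"
    "\<And>cs. cs \<in> schains S n \<Longrightarrow> is_up cs \<Longrightarrow> rank cs < k \<Longrightarrow>
      Poly_Mapping.lookup (z - coboundary (NS S) w) (map (part S) cs) = 0"
    using eliminate_up[of n k z] by blast
  have dw: "Poly_Mapping.keys (coboundary (NS S) w) \<subseteq> chains (NS S) n"
    using coboundary_keys[OF w(1)] by simp
  have "Poly_Mapping.keys (z + scale (- 1) (coboundary (NS S) w)) \<subseteq> chains (NS S) n"
    by (rule keys_plus[OF z order_trans[OF keys_scale dw]])
  then have keys: "Poly_Mapping.keys (z - coboundary (NS S) w) \<subseteq> chains (NS S) n" by simp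
  have d0: "coboundary (NS S) (z - coboundary (NS S) w) = 0"
    using dz coboundary_coboundary[OF w(1)] by (simp add: coboundary_simps)
  show ?thesis
  proof (rule that[OF w(1)], intro conjI)
    fix cs assume cs: "cs \<in> schains S n"
      and ne: "Poly_Mapping.lookup (z - coboundary (NS S) w) (map (part S) cs) \<noteq> 0"
    show "\<not> is_up cs" using w(2)[OF cs _ k[OF cs]] ne by blast
    show "\<not> is_down cs" using no_down[OF keys d0 w(2) cs] k ne by blast
  qed
qed

end

section \<open>The operad of cocycles\<close>

lemma nth_del:
  "j < i \<Longrightarrow> i < length xs \<Longrightarrow> del i xs ! j = xs ! j"
  "i \<le> j \<Longrightarrow> Suc j < length xs \<Longrightarrow> del i xs ! j = xs ! Suc j"
  by (simp_all add: del_def nth_append min_def)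

text \<open>A chain without repetition passes through \<pi> at most once, so it can be cut there in
  only one way. The entry \<pi> belongs to both parts, hence \<open>take (Suc k)\<close> and
  \<open>drop k\<close>.\<close>

lemma lookup_concat_chains:
  fixes p q :: "'x list \<Rightarrow>\<^sub>0 'k::{comm_ring,comm_monoid_mult}"
  assumes p: "\<And>xs. xs \<in> Poly_Mapping.keys p \<Longrightarrow> xs \<noteq> [] \<and> last xs = \<pi>"
    and q: "\<And>ys. ys \<in> Poly_Mapping.keys q \<Longrightarrow> ys \<noteq> [] \<and> hd ys = \<pi>"
  shows "distinct c \<Longrightarrow> k < length c \<Longrightarrow> c ! k = \<pi> \<Longrightarrow> Poly_Mapping.lookup (concat_chains p q) c =
      Poly_Mapping.lookup p (take (Suc k) c) * Poly_Mapping.lookup q (drop k c)"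
    and "\<pi> \<notin> set c \<Longrightarrow> Poly_Mapping.lookup (concat_chains p q) c = 0"
proof -
  have sum: "Poly_Mapping.lookup (concat_chains p q) c =
    (\<Sum>xs\<in>Poly_Mapping.keys p. \<Sum>ys\<in>Poly_Mapping.keys q.
      Poly_Mapping.lookup p xs * Poly_Mapping.lookup q ys * (if xs @ tl ys = c then 1 else 0))" for c
    by (simp add: concat_chains_def bilin_ext_def lookup_sum lookup_basis)
  {
    assume "\<pi> \<notin> set c"
    then have "xs @ tl ys \<noteq> c" if "xs \<in> Poly_Mapping.keys p" for xs ys
      using p[OF that] by (metis Un_iff last_in_set set_append)
    then show "Poly_Mapping.lookup (concat_chains p q) c = 0"
      unfolding sum by (intro sum.neutral ballI) simp
  }
  assume c: "distinct c" "k < length c" "c ! k = \<pi>"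
  have iff: "xs @ tl ys = c \<longleftrightarrow> xs = take (Suc k) c \<and> ys = drop k c"
    if "xs \<in> Poly_Mapping.keys p" "ys \<in> Poly_Mapping.keys q" for xs ys
  proof
    assume e: "xs @ tl ys = c"
    have xs: "xs \<noteq> []" "last xs = \<pi>" and ys: "ys \<noteq> []" "hd ys = \<pi>" using p q that by auto
    have "c ! (length xs - 1) = \<pi>" "length xs - 1 < length c"
    proof -
      show "length xs - 1 < length c" using xs unfolding e[symmetric] by (cases xs) auto
      show "c ! (length xs - 1) = \<pi>"
        using xs unfolding e[symmetric] by (simp add: nth_append last_conv_nth)
    qed
    then have k: "length xs - 1 = k" using c nth_eq_iff_index_eq by metis
    have "xs = butlast xs @ [\<pi>]" "ys = \<pi> # tl ys" using xs ys by (metis append_butlast_last_id, metis list.collapse)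
    moreover have "length (butlast xs) = k" using k by simp
    moreover have "Suc k = length xs" using k xs by (cases xs) auto
    ultimately show "xs = take (Suc k) c \<and> ys = drop k c"
      unfolding e[symmetric] by (metis append.assoc append_Cons append_Nil append_eq_conv_conj)
  next
    assume "xs = take (Suc k) c \<and> ys = drop k c"
    moreover have "tl (drop k c) = drop (Suc k) c" by (simp add: drop_Suc tl_drop)
    ultimately show "xs @ tl ys = c" by (metis append_take_drop_id)
  qed
  have "Poly_Mapping.lookup (concat_chains p q) c =
    (\<Sum>xs\<in>Poly_Mapping.keys p. \<Sum>ys\<in>Poly_Mapping.keys q. if xs = take (Suc k) c then
      (if ys = drop k c then Poly_Mapping.lookup p xs * Poly_Mapping.lookup q ys else 0) else 0)"
    unfolding sum using iff by (intro sum.cong refl) simp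
  also have "\<dots> = (\<Sum>xs\<in>Poly_Mapping.keys p. if xs = take (Suc k) c then
      (\<Sum>ys\<in>Poly_Mapping.keys q. if ys = drop k c then Poly_Mapping.lookup p xs * Poly_Mapping.lookup q ys else 0) else 0)"
    by (intro sum.cong refl) simp
  also have "\<dots> = Poly_Mapping.lookup p (take (Suc k) c) * Poly_Mapping.lookup q (drop k c)"
    by (simp add: sum.delta in_keys_iff)
  finally show "Poly_Mapping.lookup (concat_chains p q) c =
      Poly_Mapping.lookup p (take (Suc k) c) * Poly_Mapping.lookup q (drop k c)" .
qed

lemma set_chainsD:
  assumes "cs \<in> set_chains \<X> A B n"
  shows "cs \<noteq> []" "int (length cs) = n + 1" "set cs \<subseteq> \<X>" "sorted_wrt (\<supset>) cs" "hd cs = A" "last cs = B"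
  using assms by (auto simp: set_chains_def)

lemma sorted_supset_last:
  "sorted_wrt (\<supset>) cs \<Longrightarrow> X \<in> set cs \<Longrightarrow> last cs \<subseteq> (X :: nat set)"
  by (induction cs) auto

lemma sorted_supset_hd:
  "sorted_wrt (\<supset>) cs \<Longrightarrow> X \<in> set cs \<Longrightarrow> (X :: nat set) \<subseteq> hd cs"
  by (cases cs) auto

lemma sorted_supset_append:
  assumes "sorted_wrt (\<supset>) a" "sorted_wrt (\<supset>) (b :: nat set list)" "a \<noteq> []" "b \<noteq> []" "last a = hd b"
  shows "sorted_wrt (\<supset>) (a @ tl b)"
proof -
  have "y \<subset> x" if "x \<in> set a" "y \<in> set (tl b)" for x y
  proof -
    have "y \<subset> hd b" using assms(2,4) that(2) by (cases b) auto
    then show ?thesis using sorted_supset_last[OF assms(1) that(1)] assms(5) by auto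
  qed
  moreover have "sorted_wrt (\<supset>) (tl b)" using assms(2) by (cases b) auto
  ultimately show ?thesis using assms(1) by (auto simp: sorted_wrt_append)
qed

context
  fixes S :: "nat set" and s :: nat and T :: "nat set"
  assumes comp: "composable S s T"
begin

lemmas fin = finite_plug[OF comp]

lemma schains_split:
  assumes cs: "cs \<in> schains (plug S s T) n" and k: "k < length cs" "cs ! k = top_set T"
  shows "take (Suc k) cs \<in> set_chains (below_sets S s T) (top_set (plug S s T)) (top_set T) (int k)"
    and "drop k cs \<in> set_chains (above_sets S s T) (top_set T) {} (n - int k)"
proof -
  note c = set_chainsD[OF cs[unfolded schains_def]]
  have s: "sorted_wrt (\<supset>) (take (Suc k) cs)" "sorted_wrt (\<supset>) (drop k cs)"
    using c(4) by (simp_all add: sorted_wrt_take sorted_wrt_drop)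
  have l: "last (take (Suc k) cs) = top_set T" "hd (drop k cs) = top_set T"
    using k by (simp_all add: take_Suc_conv_app_nth hd_drop_conv_nth)
  have "hd (take (Suc k) cs) = hd cs" "last (drop k cs) = last cs" using k by (cases cs; simp)+
  moreover have "set (take (Suc k) cs) \<subseteq> below_sets S s T"
    using sorted_supset_last[OF s(1)] l(1) c(3) set_take_subset[of "Suc k" cs] by auto
  moreover have "set (drop k cs) \<subseteq> above_sets S s T"
    using sorted_supset_hd[OF s(2)] l(2) c(3) set_drop_subset[of k cs] by auto
  ultimately show "take (Suc k) cs \<in> set_chains (below_sets S s T) (top_set (plug S s T)) (top_set T) (int k)"
    "drop k cs \<in> set_chains (above_sets S s T) (top_set T) {} (n - int k)"
    using c k s l by (simp_all add: set_chains_def of_nat_diff)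
qed

lemma schains_join:
  assumes a: "a \<in> set_chains (below_sets S s T) (top_set (plug S s T)) (top_set T) p"
    and b: "b \<in> set_chains (above_sets S s T) (top_set T) {} q"
  shows "a @ tl b \<in> schains (plug S s T) (p + q)"
proof -
  note A = set_chainsD[OF a] and B = set_chainsD[OF b]
  have "set (tl b) \<subseteq> set b" by (cases b) auto
  then have "set (a @ tl b) \<subseteq> non_singletons (plug S s T)" using A(3) B(3) by auto
  moreover have "last (a @ tl b) = {}" using A B by (cases b) (auto simp: last_append)
  moreover have "int (length (a @ tl b)) = p + q + 1" using A B by (cases b) auto
  ultimately show ?thesis
    using A B sorted_supset_append[OF A(4) B(4)] by (simp add: schains_def set_chains_def)
qed

lemma map_induced_set_schains:
  assumes a: "a \<in> set_chains (below_sets S s T) (top_set (plug S s T)) (top_set T) p"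
  shows "map (induced_set S s T) a \<in> schains S p"
proof -
  note A = set_chainsD[OF a]
  have "induced_set S s T X \<in> non_singletons S" if "X \<in> set a" for X
    using A(3) that by (intro ind_non_singleton[OF comp]) auto
  moreover have "sorted_wrt (\<supset>) (map (induced_set S s T) a)"
    unfolding sorted_wrt_map
  proof (rule sorted_wrt_mono_rel[OF _ A(4)])
    fix X Y assume "X \<in> set a" "Y \<in> set a" "Y \<subset> X"
    then show "induced_set S s T Y \<subset> induced_set S s T X"
      using A(3) by (intro ind_strict[OF comp]) (auto simp: non_singletons_def)
  qed
  moreover have "last (map (induced_set S s T) a) = {}"
    using A by (simp add: last_map induced_set_def)
  ultimately show ?thesis
    using A ind_top[OF comp] by (auto simp: schains_def set_chains_def hd_map)
qed

lemma above_schains: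
  assumes b: "b \<in> set_chains (above_sets S s T) (top_set T) {} q"
  shows "b \<in> schains T q"
proof -
  have "above_sets S s T \<subseteq> non_singletons T"
    using top_set_in(1)[of T] by (auto simp: non_singletons_def)
  then show ?thesis using b by (auto simp: schains_def set_chains_def)
qed

lemma map_induced_part:
  "set a \<subseteq> below_sets S s T \<Longrightarrow>
   map (induced_part S s T) (map (part (plug S s T)) a) = map (part S) (map (induced_set S s T) a)"
  using induced_part_eq[OF comp] by auto

lemma map_restrict_part:
  "set b \<subseteq> above_sets S s T \<Longrightarrow>
   map (restrict_part T) (map (part (plug S s T)) b) = map (part T) b"
  using restrict_part_eq[OF comp] by auto

lemma lookup_pullback_below:
  "Poly_Mapping.lookup (pullback (NS_below S s T) (induced_part S s T) x) xs =
    (if xs \<in> chains (NS_below S s T) (int (length xs) - 1)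
     then Poly_Mapping.lookup x (map (induced_part S s T) xs) else 0)"
  by (rule finite_gorder.lookup_pullback[OF finite_gorder_below[OF comp]])

lemma lookup_pullback_above:
  "Poly_Mapping.lookup (pullback (NS_above S s T) (restrict_part T) x) xs =
    (if xs \<in> chains (NS_above S s T) (int (length xs) - 1)
     then Poly_Mapping.lookup x (map (restrict_part T) xs) else 0)"
  by (rule finite_gorder.lookup_pullback[OF finite_gorder_above[OF comp]])

lemma keys_pullback_below:
  assumes "xs \<in> Poly_Mapping.keys (pullback (NS_below S s T) (induced_part S s T) x)"
  obtains a where "a \<in> set_chains (below_sets S s T) (top_set (plug S s T)) (top_set T) (int (length xs) - 1)"
    "xs = map (part (plug S s T)) a" "map (induced_part S s T) xs \<in> Poly_Mapping.keys x"
proof -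
  have "xs \<in> chains (NS_below S s T) (int (length xs) - 1)" "map (induced_part S s T) xs \<in> Poly_Mapping.keys x"
    using assms lookup_pullback_below[of x xs] by (auto simp: in_keys_iff split: if_splits)
  then show ?thesis using that unfolding chains_NS_below[OF comp] by blast
qed

lemma keys_pullback_above:
  assumes "xs \<in> Poly_Mapping.keys (pullback (NS_above S s T) (restrict_part T) x)"
  obtains b where "b \<in> set_chains (above_sets S s T) (top_set T) {} (int (length xs) - 1)"
    "xs = map (part (plug S s T)) b" "map (restrict_part T) xs \<in> Poly_Mapping.keys x"
proof -
  have "xs \<in> chains (NS_above S s T) (int (length xs) - 1)" "map (restrict_part T) xs \<in> Poly_Mapping.keys x"
    using assms lookup_pullback_above[of x xs] by (auto simp: in_keys_iff split: if_splits)
  then show ?thesis using that unfolding chains_NS_above[OF comp] by blast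
qed

lemma keys_NS_pcomp:
  fixes x y :: "nat set set list \<Rightarrow>\<^sub>0 'k::{comm_ring,comm_monoid_mult}"
  assumes x: "Poly_Mapping.keys x \<subseteq> chains (NS S) d" and y: "Poly_Mapping.keys y \<subseteq> chains (NS T) e"
  shows "Poly_Mapping.keys (NS_pcomp S s T x y) \<subseteq> chains (NS (plug S s T)) (d + e)"
  unfolding NS_pcomp_def concat_chains_def bilin_ext_eq_lin_ext
proof (intro keys_lin_ext order_trans[OF keys_basis])
  fix xs ys assume xs: "xs \<in> Poly_Mapping.keys (pullback (NS_below S s T) (induced_part S s T) x)"
    and ys: "ys \<in> Poly_Mapping.keys (pullback (NS_above S s T) (restrict_part T) y)"
  obtain a where a: "a \<in> set_chains (below_sets S s T) (top_set (plug S s T)) (top_set T) (int (length xs) - 1)"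
    "xs = map (part (plug S s T)) a" "map (induced_part S s T) xs \<in> Poly_Mapping.keys x"
    using keys_pullback_below[OF xs] .
  obtain b where b: "b \<in> set_chains (above_sets S s T) (top_set T) {} (int (length ys) - 1)"
    "ys = map (part (plug S s T)) b" "map (restrict_part T) ys \<in> Poly_Mapping.keys y"
    using keys_pullback_above[OF ys] .
  have "int (length xs) - 1 = d" "int (length ys) - 1 = e"
    using a(3) b(3) x y by (force simp: chains_def)+
  then have "a @ tl b \<in> schains (plug S s T) (d + e)" using schains_join[OF a(1) b(1)] by simp
  from map_part_chains[OF fin(1) this] show "{xs @ tl ys} \<subseteq> chains (NS (plug S s T)) (d + e)"
    by (simp add: a(2) b(2) map_tl)
qed

text \<open>The composition in terms of coefficients at chains of sets: the chain is cut at the code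
  of \<pi>, and both halves are read as chains of \<open>S\<close> and \<open>T\<close>. Later
  computations with composites rest on this formula.\<close>

lemma lookup_NS_pcomp:
  fixes x y :: "nat set set list \<Rightarrow>\<^sub>0 'k::{comm_ring,comm_monoid_mult}"
  assumes cs: "cs \<in> schains (plug S s T) n"
  shows "k < length cs \<Longrightarrow> cs ! k = top_set T \<Longrightarrow>
      Poly_Mapping.lookup (NS_pcomp S s T x y) (map (part (plug S s T)) cs) =
      Poly_Mapping.lookup x (map (part S) (map (induced_set S s T) (take (Suc k) cs))) *
      Poly_Mapping.lookup y (map (part T) (drop k cs))"
    and "top_set T \<notin> set cs \<Longrightarrow>
      Poly_Mapping.lookup (NS_pcomp S s T x y) (map (part (plug S s T)) cs) = 0"
proof -
  let ?p = "part (plug S s T)"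
  let ?P = "pullback (NS_below S s T) (induced_part S s T) x"
  let ?Q = "pullback (NS_above S s T) (restrict_part T) y"
  have P: "xs \<noteq> [] \<and> last xs = ?p (top_set T)" if xs: "xs \<in> Poly_Mapping.keys ?P" for xs
  proof -
    obtain a where a: "a \<in> set_chains (below_sets S s T) (top_set (plug S s T)) (top_set T) (int (length xs) - 1)"
      "xs = map ?p a" using keys_pullback_below[OF xs] by blast
    then show ?thesis using set_chainsD(1,6)[OF a(1)] by (simp add: last_map)
  qed
  have Q: "ys \<noteq> [] \<and> hd ys = ?p (top_set T)" if ys: "ys \<in> Poly_Mapping.keys ?Q" for ys
  proof -
    obtain b where b: "b \<in> set_chains (above_sets S s T) (top_set T) {} (int (length ys) - 1)"
      "ys = map ?p b" using keys_pullback_above[OF ys] by blast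
    then show ?thesis using set_chainsD(1,5)[OF b(1)] by (simp add: hd_map)
  qed
  note L = lookup_concat_chains[OF P Q]
  have sub: "set cs \<subseteq> non_singletons (plug S s T)" using cs by (rule schains_subset)
  {
    assume "top_set T \<notin> set cs"
    then have "?p (top_set T) \<notin> set (map ?p cs)"
      using inj_onD[OF part_inj[OF fin(1)] _ top_set_T[OF comp]] sub by auto
    then show "Poly_Mapping.lookup (NS_pcomp S s T x y) (map ?p cs) = 0"
      unfolding NS_pcomp_def by (intro L(2))
  }
  assume k: "k < length cs" "cs ! k = top_set T"
  note sp = schains_split[OF cs k]
  have "distinct (map ?p cs)"
    using chains_NS[OF fin(1), of n] cs finite_gorder.chains_distinct[OF finite_gorder_NS[OF fin(1)]] by blast
  then have "Poly_Mapping.lookup (concat_chains ?P ?Q) (map ?p cs) =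
    Poly_Mapping.lookup ?P (take (Suc k) (map ?p cs)) * Poly_Mapping.lookup ?Q (drop k (map ?p cs))"
    using k by (intro L(1)) auto
  then have "Poly_Mapping.lookup (NS_pcomp S s T x y) (map ?p cs) =
    Poly_Mapping.lookup ?P (map ?p (take (Suc k) cs)) * Poly_Mapping.lookup ?Q (map ?p (drop k cs))"
    unfolding NS_pcomp_def take_map drop_map .
  also have "Poly_Mapping.lookup ?P (map ?p (take (Suc k) cs)) =
      Poly_Mapping.lookup x (map (part S) (map (induced_set S s T) (take (Suc k) cs)))"
  proof -
    have "map ?p (take (Suc k) cs) \<in> chains (NS_below S s T) (int (length (map ?p (take (Suc k) cs))) - 1)"
      unfolding chains_NS_below[OF comp] using sp(1) k(1) by (intro imageI) simp
    then show ?thesis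
      unfolding lookup_pullback_below by (simp only: if_True map_induced_part[OF set_chainsD(3)[OF sp(1)]])
  qed
  also have "Poly_Mapping.lookup ?Q (map ?p (drop k cs)) = Poly_Mapping.lookup y (map (part T) (drop k cs))"
  proof -
    have "int (length (map ?p (drop k cs))) - 1 = n - int k"
      using k(1) set_chainsD(2)[OF sp(2)] by simp
    then have "map ?p (drop k cs) \<in> chains (NS_above S s T) (int (length (map ?p (drop k cs))) - 1)"
      unfolding chains_NS_above[OF comp] using sp(2) by (intro imageI) simp
    then show ?thesis
      unfolding lookup_pullback_above by (simp only: if_True map_restrict_part[OF set_chainsD(3)[OF sp(2)]])
  qed
  finally show "Poly_Mapping.lookup (NS_pcomp S s T x y) (map ?p cs) =
      Poly_Mapping.lookup x (map (part S) (map (induced_set S s T) (take (Suc k) cs))) *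
      Poly_Mapping.lookup y (map (part T) (drop k cs))" .
qed

lemma take_drop_del:
  "i < k \<Longrightarrow> take k (del i xs) = del i (take (Suc k) xs)"
  "i < k \<Longrightarrow> k < length xs \<Longrightarrow> drop (k - Suc 0) (del i xs) = drop k xs"
  "k < i \<Longrightarrow> take (Suc k) (del i xs) = take (Suc k) xs"
  "k < i \<Longrightarrow> i < length xs \<Longrightarrow> drop k (del i xs) = del (i - k) (drop k xs)"
  by (auto simp: del_def drop_take min_def take_Suc_conv_app_nth Suc_diff_le)

text \<open>The Leibniz rule at a chain with \<pi> at position \<open>k\<close>: deletions before
  \<open>k\<close> yield the coboundary of \<open>x\<close>, those after \<open>k\<close> the
  coboundary of \<open>y\<close>, and without \<pi> the composite vanishes on the chain.\<close>

lemma NS_pcomp_cocycle: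
  fixes x y :: "nat set set list \<Rightarrow>\<^sub>0 'k::{comm_ring,comm_monoid_mult}"
  assumes x: "x \<in> carrier (cocycles (NS S) d)" and y: "y \<in> carrier (cocycles (NS T) e)"
  shows "NS_pcomp S s T x y \<in> carrier (cocycles (NS (plug S s T)) (d + e))"
proof -
  interpret PS: finite_gorder "NS S" by (rule finite_gorder_NS[OF fin(2)])
  interpret PT: finite_gorder "NS T" by (rule finite_gorder_NS[OF fin(3)])
  interpret PP: finite_gorder "NS (plug S s T)" by (rule finite_gorder_NS[OF fin(1)])
  let ?w = "NS_pcomp S s T x y" and ?p = "part (plug S s T)"
  have xk: "Poly_Mapping.keys x \<subseteq> chains (NS S) d" "coboundary (NS S) x = 0"
    and yk: "Poly_Mapping.keys y \<subseteq> chains (NS T) e" "coboundary (NS T) y = 0" using x y by auto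
  note wk = keys_NS_pcomp[OF xk(1) yk(1)]
  have "coboundary (NS (plug S s T)) ?w = 0"
  proof (rule poly_mapping_eqI)
    fix xs
    show "Poly_Mapping.lookup (coboundary (NS (plug S s T)) ?w) xs = Poly_Mapping.lookup 0 xs"
    proof (cases "xs \<in> chains (NS (plug S s T)) (d + e + 1)")
      case False
      then show ?thesis using PP.coboundary_keys[OF wk] by (auto simp: in_keys_iff)
    next
      case True
      then obtain cs where cs: "cs \<in> schains (plug S s T) (d + e + 1)" "xs = map ?p cs"
        by (auto simp: chains_NS[OF fin(1)])
      let ?f = "\<lambda>i. ksign (int i) * Poly_Mapping.lookup ?w (map ?p (del i cs))"
      have dels: "del i cs \<in> schains (plug S s T) (d + e)" if "i \<in> {1..<length cs - 1}" for i
        using del_schains[OF cs(1), of i] that by auto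
      have eq: "Poly_Mapping.lookup (coboundary (NS (plug S s T)) ?w) xs = (\<Sum>i = 1..<length cs - 1. ?f i)"
        unfolding cs(2) by (rule lookup_coboundary_schains[OF fin(1) wk cs(1)])
      show ?thesis
      proof (cases "top_set T \<in> set cs")
        case False
        have "?f i = 0" if "i \<in> {1..<length cs - 1}" for i
        proof -
          have "top_set T \<notin> set (del i cs)" using False set_del_subset[of i cs] by auto
          from lookup_NS_pcomp(2)[OF dels[OF that] this, of x y] show ?thesis by simp
        qed
        then show ?thesis unfolding eq by simp
      next
        case True
        then obtain k where k: "k < length cs" "cs ! k = top_set T" by (auto simp: in_set_conv_nth)
        note sp = schains_split[OF cs(1) k]
        define F where "F = map (induced_set S s T) (take (Suc k) cs)"
        define G where "G = drop k cs"
        have F: "F \<in> schains S (int k)" unfolding F_def by (rule map_induced_set_schains[OF sp(1)])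
        have G: "G \<in> schains T (d + e + 1 - int k)" unfolding G_def by (rule above_schains[OF sp(2)])
        have lF: "length F - 1 = k" and lG: "length G - 1 = length cs - 1 - k"
          using k(1) by (auto simp: F_def G_def)
        have dist: "distinct cs" using cs(1) by (auto simp: schains_def set_chains_def intro: sorted_supset_distinct)
        let ?x = "\<lambda>c. Poly_Mapping.lookup x (map (part S) c)" and ?y = "\<lambda>c. Poly_Mapping.lookup y (map (part T) c)"
        have f: "?f i = (if i < k then ksign (int i) * ?x (del i F) * ?y G else 0) +
            (if k < i then ksign (int i) * (?x F * ?y (del (i - k) G)) else 0)"
          if i: "i \<in> {1..<length cs - 1}" for i
        proof (rule linorder_cases[of i k])
          assume ik: "i < k"
          have "i \<le> k - 1" "Suc (k - 1) = k" using ik by auto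
          \<comment> \<open>A deletion to the left moves \<pi> to position
            \<open>k - 1\<close>.\<close>
          then have "k - 1 < length (del i cs)" "del i cs ! (k - 1) = top_set T"
            using ik k by (simp_all add: length_del nth_del)
          from lookup_NS_pcomp(1)[OF dels[OF i] this, of x y] show ?thesis
            using ik k by (simp add: take_drop_del F_def G_def map_del mult.assoc)
        next
          assume ik: "i = k"
          have "top_set T \<notin> set (del i cs)"
          proof -
            have "cs = take k cs @ cs ! k # drop (Suc k) cs" using k(1) by (rule id_take_nth_drop)
            then have "distinct (take k cs @ cs ! k # drop (Suc k) cs)" using dist by simp
            then show ?thesis unfolding ik del_def k(2)[symmetric] by simp
          qed
          from lookup_NS_pcomp(2)[OF dels[OF i] this, of x y] show ?thesis using ik by simp
        next
          assume ik: "k < i"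
          have "k < length (del i cs)" "del i cs ! k = top_set T"
            using i ik k by (simp_all add: length_del nth_del)
          from lookup_NS_pcomp(1)[OF dels[OF i] this, of x y] show ?thesis
            using ik i by (simp add: take_drop_del F_def G_def)
        qed
        have "(\<Sum>i = 1..<length cs - 1. if i < k then ksign (int i) * ?x (del i F) * ?y G else 0) =
            (\<Sum>i = 1..<length F - 1. ksign (int i) * ?x (del i F) * ?y G)"
          unfolding lF using k(1) by (intro sum.mono_neutral_cong_right) auto
        also have "\<dots> = 0"
          using lookup_coboundary_schains[OF fin(2) xk(1) F] xk(2) by (simp flip: sum_distrib_right)
        finally have 1: "(\<Sum>i = 1..<length cs - 1. if i < k then ksign (int i) * ?x (del i F) * ?y G else 0) = 0" .
        have "(\<Sum>i = 1..<length cs - 1. if k < i then ksign (int i) * (?x F * ?y (del (i - k) G)) else 0) =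
            (\<Sum>i = Suc k..<length cs - 1. ksign (int i) * (?x F * ?y (del (i - k) G)))"
          by (intro sum.mono_neutral_cong_right) auto
        also have "\<dots> = (\<Sum>j = 1..<length cs - 1 - k. ksign (int k) * ?x F * (ksign (int j) * ?y (del j G)))"
        proof (rule sum.reindex_bij_witness[of _ "\<lambda>j. j + k" "\<lambda>i. i - k"])
          fix i assume "i \<in> {Suc k..<length cs - 1}"
          then have "ksign (int i) = (ksign (int k) * ksign (int (i - k)) :: 'k)"
            by (auto simp: ksign_mult of_nat_diff)
          then show "ksign (int k) * ?x F * (ksign (int (i - k)) * ?y (del (i - k) G)) =
              ksign (int i) * (?x F * ?y (del (i - k) G))"
            by (simp only: ac_simps)
        qed auto
        also have "\<dots> = 0"
          using lookup_coboundary_schains[OF fin(3) yk(1) G] yk(2) unfolding lG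
          by (simp flip: sum_distrib_left)
        finally have 2: "(\<Sum>i = 1..<length cs - 1. if k < i then ksign (int i) * (?x F * ?y (del (i - k) G)) else 0) = 0" .
        have "(\<Sum>i = 1..<length cs - 1. ?f i) = 0"
          using f 1 2 by (simp add: sum.distrib)
        then show ?thesis unfolding eq by simp
      qed
    qed
  qed
  then show ?thesis using wk by simp
qed

end

section \<open>Relabelling of cochains\<close>

lemma part_image:
  assumes "inj_on \<sigma> S" "X \<subseteq> S"
  shows "(`) \<sigma> ` part S X = part (\<sigma> ` S) (\<sigma> ` X)"
proof -
  have "\<sigma> ` S - \<sigma> ` X = \<sigma> ` (S - X)"
    using inj_on_image_set_diff[OF assms(1), of S X] assms(2) by auto
  then show ?thesis by (simp add: part_eq image_Un image_image)
qed

lemma schains_map: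
  assumes "inj_on \<sigma> S" "cs \<in> schains S n"
  shows "map ((`) \<sigma>) cs \<in> schains (\<sigma> ` S) n"
proof -
  note cs = set_chainsD[OF assms(2)[unfolded schains_def]]
  have sub: "X \<subseteq> S" if "X \<in> set cs" for X using that cs(3) by (auto simp: non_singletons_def)
  have "set (map ((`) \<sigma>) cs) \<subseteq> non_singletons (\<sigma> ` S)"
  proof
    fix Y assume "Y \<in> set (map ((`) \<sigma>) cs)"
    then obtain X where X: "X \<in> set cs" "Y = \<sigma> ` X" by auto
    then show "Y \<in> non_singletons (\<sigma> ` S)"
      using cs(3) sub[OF X(1)] inj_on_subset[OF assms(1) sub[OF X(1)]]
      by (auto simp: non_singletons_def card_image)
  qed
  moreover have "sorted_wrt (\<supset>) (map ((`) \<sigma>) cs)"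
    unfolding sorted_wrt_map
  proof (rule sorted_wrt_mono_rel[OF _ cs(4)])
    fix X Y assume "X \<in> set cs" "Y \<in> set cs" "X \<supset> Y"
    then show "\<sigma> ` X \<supset> \<sigma> ` Y"
      using inj_on_image_eq_iff[OF assms(1) sub sub, of X Y] by blast
  qed
  moreover have "\<sigma> ` top_set S = top_set (\<sigma> ` S)"
    using card_image[OF assms(1)] by (simp add: top_set_def)
  ultimately show ?thesis
    using cs by (simp add: schains_def set_chains_def hd_map last_map)
qed

lemma schains_image_obtain:
  assumes "inj_on \<sigma> S" "cs' \<in> schains (\<sigma> ` S) n"
  obtains cs where "cs \<in> schains S n" "cs' = map ((`) \<sigma>) cs"
proof
  let ?t = "the_inv_into S \<sigma>"
  show "map ((`) ?t) cs' \<in> schains S n"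
    using schains_map[OF inj_on_the_inv_into[OF assms(1)] assms(2)] assms(1)
    by (simp add: the_inv_into_onto)
  have "\<sigma> ` ?t ` X = X" if "X \<in> set cs'" for X
  proof -
    have "X \<subseteq> \<sigma> ` S" using schains_subset[OF assms(2)] that by (auto simp: non_singletons_def)
    then have "\<sigma> (?t y) = y" if "y \<in> X" for y using that f_the_inv_into_f[OF assms(1)] by auto
    then show ?thesis by (simp add: image_image)
  qed
  then show "cs' = map ((`) \<sigma>) (map ((`) ?t) cs')" by (simp add: map_idI)
qed

abbreviation (input) relabel_cochain where
  "relabel_cochain \<sigma> \<equiv> lin_ext (\<lambda>xs. basis (map ((`) ((`) \<sigma>)) xs))"

context
  fixes S :: "nat set" and \<sigma> :: "nat \<Rightarrow> nat"
  assumes fin: "finite S" and inj: "inj_on \<sigma> S"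
begin

lemma map_image_part:
  assumes "cs \<in> schains S n"
  shows "map ((`) ((`) \<sigma>)) (map (part S) cs) = map (part (\<sigma> ` S)) (map ((`) \<sigma>) cs)"
  using schains_subset[OF assms] by (auto simp: non_singletons_def intro!: part_image[OF inj])

lemma map_image_inj:
  assumes "cs \<in> schains S n" "cs' \<in> schains S m"
  shows "map (part (\<sigma> ` S)) (map ((`) \<sigma>) cs) = map (part (\<sigma> ` S)) (map ((`) \<sigma>) cs')
    \<longleftrightarrow> map (part S) cs = map (part S) cs'"
proof
  assume "map (part (\<sigma> ` S)) (map ((`) \<sigma>) cs) = map (part (\<sigma> ` S)) (map ((`) \<sigma>) cs')"
  then have "map ((`) \<sigma>) cs = map ((`) \<sigma>) cs'"
    using map_part_inj[of "\<sigma> ` S" "map ((`) \<sigma>) cs" "map ((`) \<sigma>) cs'"] fin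
      schains_subset[OF schains_map[OF inj assms(1)]] schains_subset[OF schains_map[OF inj assms(2)]]
    by blast
  moreover have "inj_on ((`) \<sigma>) (set cs \<union> set cs')"
    using schains_subset[OF assms(1)] schains_subset[OF assms(2)]
    by (intro inj_on_subset[OF inj_on_image_Pow[OF inj]]) (auto simp: non_singletons_def)
  ultimately have "cs = cs'" by (simp add: inj_on_map_eq_map)
  then show "map (part S) cs = map (part S) cs'" by simp
next
  assume "map (part S) cs = map (part S) cs'"
  then show "map (part (\<sigma> ` S)) (map ((`) \<sigma>) cs) = map (part (\<sigma> ` S)) (map ((`) \<sigma>) cs')"
    unfolding map_image_part[OF assms(1), symmetric] map_image_part[OF assms(2), symmetric] by simp
qed

lemma lookup_relabel_cochain:
  fixes z :: "nat set set list \<Rightarrow>\<^sub>0 'k::{comm_ring,comm_monoid_mult}"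
  assumes z: "Poly_Mapping.keys z \<subseteq> chains (NS S) n" and cs: "cs \<in> schains S m"
  shows "Poly_Mapping.lookup (relabel_cochain \<sigma> z) (map (part (\<sigma> ` S)) (map ((`) \<sigma>) cs)) =
    Poly_Mapping.lookup z (map (part S) cs)"
  using z
proof (induction z rule: free_module_induct)
  case (basis x k)
  then obtain cs' where cs': "cs' \<in> schains S n" "x = map (part S) cs'"
    using chains_NS[OF fin] by auto
  show ?case
    unfolding lin_ext_scale lin_ext_basis lookup_scale lookup_basis cs'(2) map_image_part[OF cs'(1)]
      map_image_inj[OF cs'(1) cs] ..
qed (simp_all add: lin_ext_add lookup_add)

lemma keys_relabel_cochain:
  fixes z :: "nat set set list \<Rightarrow>\<^sub>0 'k::{comm_ring,comm_monoid_mult}"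
  assumes z: "Poly_Mapping.keys z \<subseteq> chains (NS S) n"
  shows "Poly_Mapping.keys (relabel_cochain \<sigma> z) \<subseteq> chains (NS (\<sigma> ` S)) n"
proof (rule keys_lin_ext)
  fix x assume "x \<in> Poly_Mapping.keys z"
  then obtain cs where cs: "cs \<in> schains S n" "x = map (part S) cs"
    using z chains_NS[OF fin] by auto
  show "Poly_Mapping.keys (basis (map ((`) ((`) \<sigma>)) x)) \<subseteq> chains (NS (\<sigma> ` S)) n"
    using keys_basis map_part_chains[OF _ schains_map[OF inj cs(1)]] fin
    unfolding cs(2) map_image_part[OF cs(1)] by fastforce
qed

lemma relabel_cocycle:
  fixes z :: "nat set set list \<Rightarrow>\<^sub>0 'k::{comm_ring,comm_monoid_mult}"
  assumes z: "z \<in> carrier (cocycles (NS S) n)"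
  shows "relabel_cochain \<sigma> z \<in> carrier (cocycles (NS (\<sigma> ` S)) n)"
proof -
  interpret A: finite_gorder "NS S" using fin by (rule finite_gorder_NS)
  interpret B: finite_gorder "NS (\<sigma> ` S)" using fin by (intro finite_gorder_NS) simp
  have z': "Poly_Mapping.keys z \<subseteq> chains (NS S) n" "coboundary (NS S) z = 0" using z by simp_all
  note k = keys_relabel_cochain[OF z'(1)]
  have "Poly_Mapping.lookup (coboundary (NS (\<sigma> ` S)) (relabel_cochain \<sigma> z)) ys = 0" for ys
  proof (cases "ys \<in> chains (NS (\<sigma> ` S)) (n + 1)")
    case True
    then obtain cs' where cs': "cs' \<in> schains (\<sigma> ` S) (n + 1)" "ys = map (part (\<sigma> ` S)) cs'"
      using chains_NS[of "\<sigma> ` S"] fin by auto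
    obtain cs where cs: "cs \<in> schains S (n + 1)" "cs' = map ((`) \<sigma>) cs"
      using schains_image_obtain[OF inj cs'(1)] .
    have "Poly_Mapping.lookup (coboundary (NS (\<sigma> ` S)) (relabel_cochain \<sigma> z)) ys =
      (\<Sum>i = 1..<length cs - 1. ksign (int i) *
         Poly_Mapping.lookup (relabel_cochain \<sigma> z) (map (part (\<sigma> ` S)) (map ((`) \<sigma>) (del i cs))))"
      using lookup_coboundary_schains[OF _ k cs'(1)] fin
      by (simp add: cs'(2) cs(2) map_del)
    also have "\<dots> = (\<Sum>i = 1..<length cs - 1. ksign (int i) * Poly_Mapping.lookup z (map (part S) (del i cs)))"
    proof (rule sum.cong[OF refl])
      fix i assume "i \<in> {1..<length cs - 1}"
      then have "1 \<le> i" "Suc i < length cs" by auto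
      then have "del i cs \<in> schains S n" using del_schains[OF cs(1), of i] by simp
      then show "ksign (int i) * Poly_Mapping.lookup (relabel_cochain \<sigma> z) (map (part (\<sigma> ` S)) (map ((`) \<sigma>) (del i cs)))
        = ksign (int i) * Poly_Mapping.lookup z (map (part S) (del i cs))"
        using lookup_relabel_cochain[OF z'(1)] by simp
    qed
    also have "\<dots> = Poly_Mapping.lookup (coboundary (NS S) z) (map (part S) cs)"
      using lookup_coboundary_schains[OF fin z'(1) cs(1)] by simp
    finally show ?thesis using z'(2) by simp
  next
    case False
    then show ?thesis using B.coboundary_keys[OF k] by (auto simp: in_keys_iff)
  qed
  then show ?thesis using k by (auto intro: poly_mapping_eqI)
qed

end

text \<open>These are the operations by which \<open>hNS\<close> acts on representatives, so that
  \<open>hNS\<close> is literally a \<open>quot_by\<close>.\<close>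

definition cocycle_operad ::
  "('k::{comm_ring,comm_monoid_mult}, nat set set list \<Rightarrow>\<^sub>0 'k) gr_operad" where
  "cocycle_operad =
     \<lparr>comp_module = (\<lambda>S d. cocycles (NS S) d), relabel = (\<lambda>\<sigma> S d. relabel_cochain \<sigma>),
      pcomp = (\<lambda>S s T d e. NS_pcomp S s T), op_unit = (\<lambda>s. basis [{{s}}])\<rparr>"

lemma cocycle_operad_simps [simp]:
  "comp_module cocycle_operad S d = cocycles (NS S) d"
  "relabel cocycle_operad \<sigma> S d = relabel_cochain \<sigma>"
  "pcomp cocycle_operad S s T d e = NS_pcomp S s T"
  "op_unit cocycle_operad s = basis [{{s}}]"
  by (simp_all add: cocycle_operad_def)

lemma hNS_eq_quot_by: "hNS = quot_by cocycle_operad (\<lambda>S. coboundaries (NS S))"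
  by (simp add: hNS_def quot_by_def cohomology_def coh_class_def cocycle_operad_def)

lemma bilin_ext_linear:
  "bilin_ext g (p + p') q = bilin_ext g p q + bilin_ext g p' q"
  "bilin_ext g (scale k p) q = scale k (bilin_ext g p q)"
  "bilin_ext g p (q + q') = bilin_ext g p q + bilin_ext g p q'"
  "bilin_ext g p (scale k q) = scale k (bilin_ext g p q)"
proof -
  show "bilin_ext g (p + p') q = bilin_ext g p q + bilin_ext g p' q"
    "bilin_ext g (scale k p) q = scale k (bilin_ext g p q)"
    by (simp_all only: bilin_ext_eq_lin_ext lin_ext_add lin_ext_scale)
  show "bilin_ext g p (q + q') = bilin_ext g p q + bilin_ext g p q'"
    "bilin_ext g p (scale k q) = scale k (bilin_ext g p q)"
    by (simp_all only: bilin_ext_eq_lin_ext' lin_ext_add lin_ext_scale)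
qed

lemma NS_pcomp_linear:
  "NS_pcomp S s T (x + x') y = NS_pcomp S s T x y + NS_pcomp S s T x' y"
  "NS_pcomp S s T (scale k x) y = scale k (NS_pcomp S s T x y)"
  "NS_pcomp S s T x (y + y') = NS_pcomp S s T x y + NS_pcomp S s T x y'"
  "NS_pcomp S s T x (scale k y) = scale k (NS_pcomp S s T x y)"
  by (simp_all only: NS_pcomp_def concat_chains_def pullback_def lin_ext_add lin_ext_scale bilin_ext_linear)

lemma schains_singleton: "schains {s} n = (if n = 0 then {[{}]} else {})"
proof -
  have "non_singletons {s} = {{}}" by (auto simp: non_singletons_def subset_singleton_iff)
  then have "cs = [{}]" if "cs \<in> schains {s} n" for cs
  proof (cases cs)
    case (Cons a cs')
    then show ?thesis using that \<open>non_singletons {s} = {{}}\<close>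
      by (cases cs') (auto simp: schains_def set_chains_def)
  qed (use that in \<open>auto simp: schains_def set_chains_def\<close>)
  moreover have "[{}] \<in> schains {s} n \<longleftrightarrow> n = 0"
    by (auto simp: schains_def set_chains_def top_set_def non_singletons_def)
  ultimately show ?thesis by auto
qed

lemma chains_singleton: "chains (NS {s}) n = (if n = 0 then {[{{s}}]} else {})"
proof -
  have "part {s} {} = {{s}}" by (auto simp: part_def)
  then show ?thesis using chains_NS[of "{s}" n] by (auto simp: schains_singleton)
qed

lemma cocycles_ops:
  "p \<oplus>\<^bsub>cocycles L n\<^esub> q = p + q" "k \<odot>\<^bsub>cocycles L n\<^esub> p = scale k p"
  by (simp_all add: cocycles_def cochains_def)

lemma pre_operad_cocycle_operad:
  "pre_operad (cocycle_operad :: ('k::{comm_ring,comm_monoid_mult}, _) gr_operad)"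
proof (rule pre_operad.intro)
  fix S s T and d e :: int and \<sigma> :: "nat \<Rightarrow> nat" and x y :: "nat set set list \<Rightarrow>\<^sub>0 'k"
  show "module base_ring (comp_module (cocycle_operad :: ('k, _) gr_operad) S d)" if "label_set S"
    unfolding cocycle_operad_simps
    by (rule finite_gorder.cocycles_module[OF finite_gorder_NS]) (use that in \<open>simp add: label_set_def\<close>)
  show "relabel cocycle_operad \<sigma> S d \<in> linear_maps (comp_module (cocycle_operad :: ('k, _) gr_operad) S d)
      (comp_module cocycle_operad (\<sigma> ` S) d)" if "label_set S" "inj_on \<sigma> S"
    using relabel_cocycle[OF _ that(2)] that(1) unfolding cocycle_operad_simps
    by (intro linear_mapsI)
      (auto simp: label_set_def lin_ext_add lin_ext_scale cocycles_ops)
  show "(\<lambda>x. pcomp cocycle_operad S s T d e x y) \<in> linear_maps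
      (comp_module (cocycle_operad :: ('k, _) gr_operad) S d) (comp_module cocycle_operad (plug S s T) (d + e))"
    if "composable S s T" "y \<in> carrier (comp_module cocycle_operad T e)"
    using NS_pcomp_cocycle[OF that(1) _ that(2)[unfolded cocycle_operad_simps]]
    unfolding cocycle_operad_simps
    by (intro linear_mapsI) (simp_all only: cocycles_ops NS_pcomp_linear)
  show "(\<lambda>y. pcomp cocycle_operad S s T d e x y) \<in> linear_maps
      (comp_module (cocycle_operad :: ('k, _) gr_operad) T e) (comp_module cocycle_operad (plug S s T) (d + e))"
    if "composable S s T" "x \<in> carrier (comp_module cocycle_operad S d)"
    using NS_pcomp_cocycle[OF that(1) that(2)[unfolded cocycle_operad_simps]]
    unfolding cocycle_operad_simps
    by (intro linear_mapsI) (simp_all only: cocycles_ops NS_pcomp_linear)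
next
  fix s
  interpret finite_gorder "NS {s}" by (rule finite_gorder_NS) simp
  have k: "Poly_Mapping.keys (basis [{{s}}] :: _ \<Rightarrow>\<^sub>0 'k) \<subseteq> chains (NS {s}) 0"
    using keys_basis by (fastforce simp: chains_singleton)
  have "Poly_Mapping.keys (coboundary (NS {s}) (basis [{{s}}] :: _ \<Rightarrow>\<^sub>0 'k)) \<subseteq> {}"
    using coboundary_keys[OF k] by (simp add: chains_singleton)
  then show "op_unit (cocycle_operad :: ('k, _) gr_operad) s \<in> carrier (comp_module cocycle_operad {s} 0)"
    using k by simp
qed

section \<open>Signed sums over words\<close>

definition words :: "nat set \<Rightarrow> nat \<Rightarrow> nat list set" where
  "words S v = {l. distinct l \<and> set l = S \<and> last l = v}"

text \<open>Letters are removed from the left until two remain, which go together because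
  \<open>{last l}\<close> is not an admissible set. A word of one letter gives
  \<open>[{}]\<close>.\<close>

definition word_chain :: "nat list \<Rightarrow> nat set list" where
  "word_chain l = map (\<lambda>j. set (drop j l)) [0..<length l - 1] @ [{}]"

lemma finite_words: "finite S \<Longrightarrow> finite (words S v)"
  by (rule finite_subset[OF _ finite_subset_distinct[of S]]) (auto simp: words_def)

lemma words_empty: "S \<noteq> {} \<Longrightarrow> v \<notin> S \<Longrightarrow> words S v = {}"
  by (auto simp: words_def)

lemma words_length: "l \<in> words S v \<Longrightarrow> length l = card S"
  by (auto simp: words_def distinct_card)

lemma words_singleton: "words {s} s = {[s]}"
proof -
  have "l = [s]" if "distinct l" "set l = {s}" for l
  proof -
    have "length l = 1" using that distinct_card[of l] by simp
    then show ?thesis using that by (cases l) auto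
  qed
  then show ?thesis by (auto simp: words_def)
qed

lemma words_map:
  assumes inj: "inj_on \<sigma> S" and S: "S \<noteq> {}" "v \<in> S"
  shows "bij_betw (map \<sigma>) (words S v) (words (\<sigma> ` S) (\<sigma> v))"
proof (rule bij_betw_byWitness[where f' = "map (the_inv_into S \<sigma>)"])
  show "\<forall>l\<in>words S v. map (the_inv_into S \<sigma>) (map \<sigma> l) = l"
    by (intro ballI, unfold map_map, rule map_idI) (auto simp: words_def intro!: the_inv_into_f_f[OF inj])
  show "\<forall>l\<in>words (\<sigma> ` S) (\<sigma> v). map \<sigma> (map (the_inv_into S \<sigma>) l) = l"
    by (intro ballI, unfold map_map, rule map_idI) (auto simp: words_def intro!: f_the_inv_into_f[OF inj])
  show "map \<sigma> ` words S v \<subseteq> words (\<sigma> ` S) (\<sigma> v)"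
    using S inj by (auto simp: words_def distinct_map last_map)
  have "l \<noteq> []" if "set l = \<sigma> ` S" for l using that S by auto
  then show "map (the_inv_into S \<sigma>) ` words (\<sigma> ` S) (\<sigma> v) \<subseteq> words S v"
    using S by (auto simp: words_def distinct_map inj_on_the_inv_into inj last_map the_inv_into_f_f[OF inj]
        simp flip: image_image)
qed

lemma word_chain_length [simp]: "l \<noteq> [] \<Longrightarrow> length (word_chain l) = length l"
  by (simp add: word_chain_def)

lemma word_chain_nth:
  "j < length l - 1 \<Longrightarrow> word_chain l ! j = set (drop j l)"
  "j = length l - 1 \<Longrightarrow> word_chain l ! j = {}"
  by (simp_all add: word_chain_def nth_append)

lemma word_chain_eqI:
  assumes "l \<noteq> []" "length cs = length l" "\<And>j. j < length l - 1 \<Longrightarrow> cs ! j = set (drop j l)"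
    "cs ! (length l - 1) = {}"
  shows "cs = word_chain l"
proof (rule nth_equalityI)
  fix j assume "j < length cs"
  then show "cs ! j = word_chain l ! j"
    using assms by (cases "j < length l - 1") (auto simp: word_chain_nth not_less dest: le_antisym)
qed (use assms in simp)

lemma set_drop_psubset:
  assumes "distinct l" "j < k" "j < length l"
  shows "set (drop k l) \<subset> set (drop j l)"
proof -
  have "l ! j \<in> set (drop j l)" using assms(3) by (metis Cons_nth_drop_Suc list.set_intros(1))
  moreover have "l ! j \<notin> set (drop k l)"
    using assms by (auto simp: in_set_conv_nth nth_eq_iff_index_eq)
  moreover have "set (drop k l) \<subseteq> set (drop j l)" using assms(2) by (intro set_drop_subset_set_drop) simp
  ultimately show ?thesis by blast
qed

lemma word_chain_schains:
  assumes "distinct l" "set l = S" "l \<noteq> []"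
  shows "word_chain l \<in> schains S (int (card S) - 1)"
proof -
  have n: "card S = length l" using assms distinct_card by fastforce
  have "set (word_chain l) \<subseteq> non_singletons S"
  proof
    fix X assume "X \<in> set (word_chain l)"
    then consider "X = {}" | j where "j < length l - 1" "X = set (drop j l)"
      by (auto simp: word_chain_def)
    then show "X \<in> non_singletons S"
    proof cases
      case 2
      have "card X = length l - j" using 2 assms(1) by (simp add: distinct_card)
      then show ?thesis using 2 assms(2) set_drop_subset[of j l] by (auto simp: non_singletons_def)
    qed (simp add: top_set_in)
  qed
  moreover have "sorted_wrt (\<supset>) (word_chain l)"
    unfolding sorted_wrt_iff_nth_less
  proof (intro allI impI)
    fix i j assume ij: "i < j" "j < length (word_chain l)"
    then have i: "i < length l - 1" using assms(3) by auto
    show "word_chain l ! j \<subset> word_chain l ! i"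
    proof (cases "j = length l - 1")
      case False
      then have "j < length l - 1" using ij assms(3) by auto
      then show ?thesis using set_drop_psubset[OF assms(1) ij(1)] i by (simp add: word_chain_nth)
    qed (use i in \<open>auto simp: word_chain_nth\<close>)
  qed
  moreover have "hd (word_chain l) = top_set S"
    using assms n length_greater_0_conv[of l] by (cases "length l = 1") (auto simp: hd_conv_nth word_chain_def top_set_def nth_append not_less le_Suc_eq)
  ultimately show ?thesis
    using assms(3) n by (auto simp: schains_def set_chains_def word_chain_def)
qed

lemma word_chain_map:
  assumes "l \<noteq> []"
  shows "map ((`) \<sigma>) (word_chain l) = word_chain (map \<sigma> l)"
  by (simp add: word_chain_def drop_map)

definition word_sum ::
  "nat set \<Rightarrow> (nat set set list \<Rightarrow>\<^sub>0 'k::{comm_ring,comm_monoid_mult}) \<Rightarrow> nat \<Rightarrow> 'k" where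
  "word_sum S z v = (\<Sum>l\<in>words S v. ksign (invs l) * Poly_Mapping.lookup z (map (part S) (word_chain l)))"

lemma word_sum_linear:
  "word_sum S (x + y) v = word_sum S x v + word_sum S y v"
  "word_sum S (scale k x) v = k * word_sum S x v"
  by (simp_all add: word_sum_def lookup_add distrib_left sum.distrib sum_distrib_left mult.left_commute)

lemma word_sum_0 [simp]: "word_sum S 0 v = 0"
  by (simp add: word_sum_def)

lemma word_sum_diff: "word_sum S (x - y) v = word_sum S x v - word_sum S y v"
  using word_sum_linear(1)[of S "x - y" y v] by (simp add: eq_diff_eq)

lemma word_sum_outside: "label_set S \<Longrightarrow> v \<notin> S \<Longrightarrow> word_sum S z v = 0"
  by (simp add: word_sum_def words_empty label_set_def)

lemma word_sum_degree:
  assumes "label_set S" "Poly_Mapping.keys z \<subseteq> chains (NS S) d" "d \<noteq> int (card S) - 1"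
  shows "word_sum S z v = 0"
  unfolding word_sum_def
proof (rule sum.neutral, rule ballI)
  fix l assume "l \<in> words S v"
  then have "l \<noteq> []" "length l = card S" using assms(1) words_length[of l S v] by (auto simp: words_def label_set_def)
  then have "map (part S) (word_chain l) \<notin> chains (NS S) d"
    using assms(3) by (auto simp: Defs.chains_def)
  then have "map (part S) (word_chain l) \<notin> Poly_Mapping.keys z" using assms(2) by blast
  then show "ksign (invs l) * Poly_Mapping.lookup z (map (part S) (word_chain l)) = 0"
    by (simp add: in_keys_iff)
qed

lemma word_sum_relabel:
  fixes z :: "nat set set list \<Rightarrow>\<^sub>0 'k::{comm_ring,comm_monoid_mult}"
  assumes S: "label_set S" and inj: "inj_on \<sigma> S" and v: "v \<in> S"
    and z: "Poly_Mapping.keys z \<subseteq> chains (NS S) d"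
  shows "word_sum (\<sigma> ` S) (relabel_cochain \<sigma> z) (\<sigma> v) = ksign (relabel_exponent \<sigma> S) * word_sum S z v"
proof -
  have fin: "finite S" "S \<noteq> {}" using S by (auto simp: label_set_def)
  have "word_sum (\<sigma> ` S) (relabel_cochain \<sigma> z) (\<sigma> v) = (\<Sum>l\<in>words S v. ksign (invs (map \<sigma> l)) *
      Poly_Mapping.lookup (relabel_cochain \<sigma> z) (map (part (\<sigma> ` S)) (word_chain (map \<sigma> l))))"
    unfolding word_sum_def by (rule sum.reindex_bij_betw[OF words_map[OF inj fin(2) v], symmetric])
  also have "\<dots> = (\<Sum>l\<in>words S v. ksign (relabel_exponent \<sigma> S) *
      (ksign (invs l) * Poly_Mapping.lookup z (map (part S) (word_chain l))))"
  proof (rule sum.cong[OF refl])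
    fix l assume "l \<in> words S v"
    then have l: "distinct l" "set l = S" "l \<noteq> []" using fin by (auto simp: words_def)
    have "ksign (invs (map \<sigma> l)) = (ksign (relabel_exponent \<sigma> S + invs l) :: 'k)"
      using invs_map[OF l(1), of \<sigma>] inj l(2) by (intro ksign_cong) (simp add: add_ac)
    then show "ksign (invs (map \<sigma> l)) *
      Poly_Mapping.lookup (relabel_cochain \<sigma> z) (map (part (\<sigma> ` S)) (word_chain (map \<sigma> l))) =
      ksign (relabel_exponent \<sigma> S) * (ksign (invs l) * Poly_Mapping.lookup z (map (part S) (word_chain l)))"
      using lookup_relabel_cochain[OF fin(1) inj z word_chain_schains[OF l]] l
      by (simp add: word_chain_map ksign_mult mult.assoc[symmetric])
  qed
  finally show ?thesis by (simp add: word_sum_def sum_distrib_left)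
qed

text \<open>\<open>P\<close> selects one element of each orbit of the involution and excludes fixed
  points. This makes the cancellation valid even where 2 is a zero divisor and a sum equal to its
  negative need not vanish.\<close>

lemma sum_sign_reversing:
  fixes g :: "'x \<Rightarrow> 'b::ab_group_add"
  assumes "finite A" "\<And>x. x \<in> A \<Longrightarrow> f x \<in> A" "\<And>x. x \<in> A \<Longrightarrow> f (f x) = x"
    and "\<And>x. x \<in> A \<Longrightarrow> P (f x) \<longleftrightarrow> \<not> P x" "\<And>x. x \<in> A \<Longrightarrow> g (f x) = - g x"
  shows "sum g A = 0"
proof -
  have "sum g {x\<in>A. \<not> P x} = (\<Sum>x\<in>{x\<in>A. P x}. g (f x))"
    by (rule sum.reindex_bij_witness[of _ f f]) (use assms in auto)
  also have "\<dots> = - sum g {x\<in>A. P x}" using assms(5) by (simp add: sum_negf)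
  finally show ?thesis
    using sum.union_disjoint[of "{x\<in>A. P x}" "{x\<in>A. \<not> P x}" g] assms(1)
    by (simp add: Collect_disj_eq[symmetric] Int_def conj_disj_distribL[symmetric])
qed

definition swap :: "nat \<Rightarrow> nat list \<Rightarrow> nat list" where
  "swap k l = take k l @ [l ! Suc k, l ! k] @ drop (k + 2) l"

text \<open>Exchanging the letters at \<open>k\<close> and \<open>Suc k\<close> affects only the set
  of letters from \<open>Suc k\<close> on. If these are the last two letters, that place of the
  chain holds the empty set anyway, and the chain stays the same.\<close>

lemma swap_props:
  assumes "Suc k < length l" "distinct l"
  shows "swap k (swap k l) = l" "distinct (swap k l)" "set (swap k l) = set l"
    "length (swap k l) = length l" "ksign (invs (swap k l)) = - ksign (invs l)"
    "swap k l ! k = l ! Suc k" "swap k l ! Suc k = l ! k"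
    "k + 2 < length l \<Longrightarrow> last (swap k l) = last l"
    "j \<noteq> Suc k \<Longrightarrow> word_chain (swap k l) ! j = word_chain l ! j"
    "Suc (Suc k) = length l \<Longrightarrow> word_chain (swap k l) = word_chain l"
proof -
  define xs ys a b where xs_ys_a_b_def: "xs = take k l" "ys = drop (k + 2) l" "a = l ! k" "b = l ! Suc k"
  have l: "l = xs @ [a, b] @ ys"
    using assms(1) by (simp add: Cons_nth_drop_Suc id_take_nth_drop xs_ys_a_b_def)
  have k: "length xs = k" using assms(1) by (simp add: xs_ys_a_b_def)
  have s: "swap k l = xs @ [b, a] @ ys" by (simp add: swap_def xs_ys_a_b_def)
  show "swap k (swap k l) = l" unfolding s by (simp add: swap_def k[symmetric] l nth_append)
  show "distinct (swap k l)" "set (swap k l) = set l" "length (swap k l) = length l"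
    using assms(2) unfolding s unfolding l by auto
  show "ksign (invs (swap k l)) = - ksign (invs l)"
    using invs_swap[of xs "[a]" "[b]" ys] assms(2) unfolding s unfolding l by (auto simp: ksign_def)
  show "swap k l ! k = l ! Suc k" "swap k l ! Suc k = l ! k"
    unfolding s unfolding l k[symmetric] by (simp_all add: nth_append)
  show "last (swap k l) = last l" if "k + 2 < length l"
  proof -
    have "ys \<noteq> []" using that by (simp add: xs_ys_a_b_def)
    then show ?thesis unfolding s unfolding l by simp
  qed
  have d: "set (drop j (swap k l)) = set (drop j l)" if "j \<noteq> Suc k" for j
  proof (cases "j \<le> k")
    case False
    then have "j = k + 2 + (j - (k + 2))" using that by arith
    then obtain i where "j = k + 2 + i" ..
    then show ?thesis unfolding s unfolding l k[symmetric] by simp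
  qed (unfold s, unfold l k[symmetric], auto)
  have len: "length (swap k l) = length l" unfolding s unfolding l by simp
  show w: "word_chain (swap k l) ! j = word_chain l ! j" if "j \<noteq> Suc k" for j
    using d[OF that] len unfolding word_chain_def
    by (cases "j < length l - 1") (auto simp: nth_append)
  show "word_chain (swap k l) = word_chain l" if "Suc (Suc k) = length l"
  proof (rule nth_equalityI)
    fix j assume "j < length (word_chain (swap k l))"
    show "word_chain (swap k l) ! j = word_chain l ! j"
      using w[of j] len that by (cases "j = Suc k") (auto simp: word_chain_nth(2))
  qed (use len assms in \<open>simp add: word_chain_def\<close>)
qed

text \<open>The two words that differ in the order of the last two letters have the same chain and opposite signs.\<close>

lemma sum_word_sum:
  assumes S: "finite S" "2 \<le> card S"
  shows "sum (word_sum S z) S = 0"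
proof -
  \<comment> \<open>\<open>?k\<close> is the position of the last letter but one.\<close>
  let ?W = "{l. distinct l \<and> set l = S}" and ?k = "card S - 2"
  let ?g = "\<lambda>l. ksign (invs l) * Poly_Mapping.lookup z (map (part S) (word_chain l))"
  have fin: "finite ?W" using finite_subset_distinct[OF S(1)] by (rule finite_subset[rotated]) auto
  have ne: "S \<noteq> {}" using S by auto
  have "sum (word_sum S z) S = sum ?g (\<Union>v\<in>S. words S v)"
    unfolding word_sum_def by (subst sum.UNION_disjoint) (use S finite_words in \<open>auto simp: words_def\<close>)
  also have "(\<Union>v\<in>S. words S v) = ?W"
  proof (intro equalityI subsetI)
    fix l assume "l \<in> ?W"
    then have l: "distinct l" "set l = S" by auto
    then have "last l \<in> S" using ne last_in_set[of l] by auto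
    then show "l \<in> (\<Union>v\<in>S. words S v)" using l by (auto simp: words_def)
  qed (auto simp: words_def)
  also have "sum ?g ?W = 0"
  proof (rule sum_sign_reversing[where f = "swap ?k" and P = "\<lambda>l. l ! ?k < l ! Suc ?k"])
    fix l assume "l \<in> ?W"
    then have l: "distinct l" "set l = S" "length l = card S" by (auto simp: distinct_card)
    then have k: "Suc ?k < length l" "Suc (Suc ?k) = length l" using S(2) by auto
    note p = swap_props[OF k(1) l(1)]
    show "swap ?k l \<in> ?W" "swap ?k (swap ?k l) = l" using p l by auto
    have "l ! ?k \<noteq> l ! Suc ?k" using k(1) l(1) by (simp add: nth_eq_iff_index_eq)
    then show "swap ?k l ! ?k < swap ?k l ! Suc ?k \<longleftrightarrow> \<not> l ! ?k < l ! Suc ?k"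
      unfolding p(6,7) by auto
    show "?g (swap ?k l) = - ?g l" unfolding p(5) p(10)[OF k(2)] by simp
  qed (fact fin)
  finally show ?thesis .
qed

text \<open>The coboundary deletes the set at some position \<open>i\<close> of the chain of a word,
  and this is the only set that changes when the letters at \<open>i - 1\<close> and
  \<open>i\<close> are exchanged; so the two words cancel. Because \<open>i < card S - 1\<close>,
  the last letter stays, and both words belong to the same coordinate.\<close>

lemma word_sum_coboundary:
  assumes S: "label_set S" and w: "Poly_Mapping.keys w \<subseteq> chains (NS S) n"
  shows "word_sum S (coboundary (NS S) w) v = 0"
proof -
  have fin: "finite S" "S \<noteq> {}" using S by (auto simp: label_set_def)
  let ?g = "\<lambda>i l. ksign (invs l) * (ksign (int i) * Poly_Mapping.lookup w (map (part S) (del i (word_chain l))))"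
  have "word_sum S (coboundary (NS S) w) v = (\<Sum>l\<in>words S v. \<Sum>i = 1..<card S - 1. ?g i l)"
    unfolding word_sum_def
  proof (rule sum.cong[OF refl])
    fix l assume "l \<in> words S v"
    then have l: "distinct l" "set l = S" "l \<noteq> []" "length l = card S" using fin by (auto simp: words_def distinct_card)
    show "ksign (invs l) * Poly_Mapping.lookup (coboundary (NS S) w) (map (part S) (word_chain l)) =
      (\<Sum>i = 1..<card S - 1. ?g i l)"
      using lookup_coboundary_schains[OF fin(1) w word_chain_schains[OF l(1-3)]] l(3,4)
      by (simp add: sum_distrib_left)
  qed
  also have "\<dots> = (\<Sum>i = 1..<card S - 1. \<Sum>l\<in>words S v. ?g i l)" by (rule sum.swap)
  also have "\<dots> = 0"
  proof (rule sum.neutral, rule ballI)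
    fix i assume i: "i \<in> {1..<card S - 1}"
    define k where "k = i - 1"
    have ik: "i = Suc k" using i by (auto simp: k_def)
    show "(\<Sum>l\<in>words S v. ?g i l) = 0"
    proof (rule sum_sign_reversing[where f = "swap k" and P = "\<lambda>l. l ! k < l ! Suc k"])
      fix l assume "l \<in> words S v"
      then have l: "distinct l" "set l = S" "length l = card S" "last l = v" by (auto simp: words_def distinct_card)
      then have k: "Suc k < length l" "k + 2 < length l" using i ik by auto
      note p = swap_props[OF k(1) l(1)]
      show "swap k l \<in> words S v" "swap k (swap k l) = l" using p l k(2) by (auto simp: words_def)
      have "l ! k \<noteq> l ! Suc k" using k(1) l(1) by (simp add: nth_eq_iff_index_eq)
      then show "swap k l ! k < swap k l ! Suc k \<longleftrightarrow> \<not> l ! k < l ! Suc k"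
        unfolding p(6,7) by auto
      have "del i (word_chain (swap k l)) = del i (word_chain l)"
      proof -
        have ne: "l \<noteq> []" "swap k l \<noteq> []" using k p(4) by auto
        have "take i (word_chain (swap k l)) = take i (word_chain l)"
          "drop (Suc i) (word_chain (swap k l)) = drop (Suc i) (word_chain l)"
          by (rule nth_equalityI; use ik p(4,9) ne in simp)+
        then show ?thesis by (simp add: del_def)
      qed
      then show "?g i (swap k l) = - ?g i l" unfolding p(5) by simp
    qed (use finite_words[OF fin(1)] in simp)
  qed
  finally show ?thesis .
qed

text \<open>The composite vanishes on chains that avoid \<open>T\<close>, so only words that end in
  a word of \<open>T\<close> count. The first half of such a chain belongs to the word of
  \<open>S\<close> with \<open>s\<close> put last, whence the exponent
  \<open>(|S| - 1)(|T| - 1)\<close>, and the second half to the word of \<open>T\<close>.\<close>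

lemma word_sum_pcomp_two:
  fixes x y :: "nat set set list \<Rightarrow>\<^sub>0 'k::{comm_ring,comm_monoid_mult}"
  assumes comp: "composable S s T" and T: "2 \<le> card T"
  shows "word_sum (plug S s T) (NS_pcomp S s T x y) v =
    ksign (pcomp_exponent S s T + (int (card S) - 1) * (int (card T) - 1)) *
    (if v \<in> T then word_sum S x s * word_sum T y v else 0)"
proof -
  define P k where "P = plug S s T" and "k = card S - 1"
  let ?sg = "pcomp_exponent S s T + (int (card S) - 1) * (int (card T) - 1)"
  let ?z = "NS_pcomp S s T x y"
  let ?g = "\<lambda>l. ksign (invs l) * Poly_Mapping.lookup ?z (map (part P) (word_chain l)) :: 'k"
  note c = composableD[OF comp]
  have top: "top_set T = T" using T by (simp add: top_set_def)
  have "0 < card S" using c by (auto simp: card_gt_0_iff)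
  then have k: "Suc k = card S" by (simp add: k_def)
  have n: "card P = k + card T" using card_plug[OF comp] k unfolding P_def by linarith
  have P: "P = (S - {s}) \<union> T" by (simp add: P_def plug_def)
  have finP: "finite P" using c P by simp
  \<comment> \<open>If the final letters do not form \<open>T\<close>, the chain avoids
    \<open>T\<close>: by cardinality, \<open>T\<close> could only stand at position
    \<open>k\<close>.\<close>
  have zero: "?g l = 0" if l: "distinct l" "set l = P" "set (drop k l) \<noteq> T" for l
  proof -
    have len: "length l = card P" using l by (metis distinct_card)
    then have ne: "l \<noteq> []" using n T by auto
    have "T \<notin> set (word_chain l)"
    proof
      assume "T \<in> set (word_chain l)"
      then have "T \<in> (\<lambda>j. set (drop j l)) ` {0..<length l - 1}"
        using c(6) unfolding word_chain_def by simp
      then obtain j where j: "j < length l - 1" "T = set (drop j l)"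
        unfolding image_iff by auto
      have "card T = length l - j" using j l(1) by (simp add: distinct_card)
      then have "j = k" using n len j(1) by arith
      then show False using j l(3) by simp
    qed
    then show ?thesis
      using lookup_NS_pcomp(2)[OF comp, of "word_chain l" _ x y] word_chain_schains[OF l(1,2) ne] top
      unfolding P_def by simp
  qed
  have trm: "?g (l1 @ l2) = ksign ?sg *
      ((ksign (invs (l1 @ [s])) * Poly_Mapping.lookup x (map (part S) (word_chain (l1 @ [s])))) *
       (ksign (invs l2) * Poly_Mapping.lookup y (map (part T) (word_chain l2))))"
    if l1: "distinct l1" "set l1 = S - {s}" and l2: "distinct l2" "set l2 = T" for l1 l2
  proof -
    let ?l = "l1 @ l2"
    have l: "distinct ?l" "set ?l = P" "?l \<noteq> []" using l1 l2 c P by auto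
    have len1: "length l1 = k" using l1 c distinct_card[OF l1(1)] by (simp add: k_def)
    have len2: "length l2 = card T" using distinct_card[OF l2(1)] l2(2) by simp
    have kk: "k < length (word_chain ?l)" "word_chain ?l ! k = T"
      using l(3) len1 len2 T l2 by (auto simp: word_chain_nth)
    have 1: "map (induced_set S s T) (take (Suc k) (word_chain ?l)) = word_chain (l1 @ [s])"
    proof (rule word_chain_eqI)
      show len: "length (map (induced_set S s T) (take (Suc k) (word_chain ?l))) = length (l1 @ [s])"
        using kk(1) len1 by simp
      fix j assume "j < length (l1 @ [s]) - 1"
      then have j: "j < k" using len1 by simp
      have X: "word_chain ?l ! j = set (drop j l1) \<union> T"
        using j len1 len2 T l2 by (subst word_chain_nth) auto
      have sub: "set (drop j l1) \<subseteq> S - {s}" using set_drop_subset[of j l1] l1 by simp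
      have "l1 ! j \<in> set (drop j l1)" using j len1 by (metis Cons_nth_drop_Suc list.set_intros(1))
      then have "set (drop j l1) \<union> T \<noteq> T" using sub c(7) by auto
      then have "induced_set S s T (set (drop j l1) \<union> T) = set (drop j l1) \<union> {s}"
        using sub c(5,7) by (auto simp: induced_set_def top plug_block_def)
      then show "map (induced_set S s T) (take (Suc k) (word_chain ?l)) ! j = set (drop j (l1 @ [s]))"
        using j kk(1) len1 X by simp
    next
      show "map (induced_set S s T) (take (Suc k) (word_chain ?l)) ! (length (l1 @ [s]) - 1) = {}"
        using kk len1 by (simp add: induced_set_def top)
    qed simp
    have 2: "drop k (word_chain ?l) = word_chain l2"
    proof (rule word_chain_eqI)
      show "length (drop k (word_chain ?l)) = length l2" using l(3) len1 by simp
      fix j assume j: "j < length l2 - 1"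
      then show "drop k (word_chain ?l) ! j = set (drop j l2)"
        using l(3) len1 by (simp add: word_chain_nth)
    next
      show "drop k (word_chain ?l) ! (length l2 - 1) = {}"
        using l(3) len1 len2 T by (auto simp: word_chain_nth(2))
    qed (use l2 c in auto)
    have "ksign (invs ?l) = (ksign (?sg + invs (l1 @ [s]) + invs l2) :: 'k)"
      using pcomp_exponent_invs[OF l1 c(5) l2 c(7)] by (intro ksign_cong) presburger
    then show ?thesis
      using lookup_NS_pcomp(1)[OF comp word_chain_schains[OF l, unfolded P_def], of k x y] kk
      unfolding 1 2 top P_def by (simp add: ksign_mult[symmetric] mult_ac)
  qed
  show ?thesis
  proof (cases "v \<in> T")
    case True
    \<comment> \<open>Words of \<open>S\<close> that end in \<open>s\<close> correspond to words of
      \<open>S - {s}\<close>; this is why the coordinate of \<open>x\<close> at \<open>s\<close>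
      appears.\<close>
    have sp: "butlast l' @ [s] = l' \<and> distinct (butlast l') \<and> set (butlast l') = S - {s}" if "l' \<in> words S s" for l'
    proof -
      have l': "distinct l'" "set l' = S" "last l' = s" "l' \<noteq> []" using that c(1) by (auto simp: words_def label_set_def)
      then have e: "butlast l' @ [s] = l'" using append_butlast_last_id by metis
      have "distinct (butlast l' @ [s])" "set (butlast l' @ [s]) = S" unfolding e using l' by simp_all
      then have "distinct (butlast l') \<and> set (butlast l') = S - {s}" by auto
      with e show ?thesis by simp
    qed
    have "word_sum P ?z v = (\<Sum>l\<in>{l\<in>words P v. set (drop k l) = T}. ?g l)"
      unfolding word_sum_def
      by (rule sum.mono_neutral_right) (use finite_words[OF finP] zero in \<open>auto simp: words_def\<close>)
    also have "\<dots> = (\<Sum>(l',l2)\<in>words S s \<times> words T v. ?g (butlast l' @ l2))"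
    proof (rule sum.reindex_bij_witness[where j = "\<lambda>l. (take k l @ [s], drop k l)" and i = "\<lambda>(l',l2). butlast l' @ l2"])
      fix l assume "l \<in> {l\<in>words P v. set (drop k l) = T}"
      then have l: "distinct l" "set l = P" "last l = v" "set (drop k l) = T" by (auto simp: words_def)
      have len: "length l = card P" using l by (metis distinct_card)
      have "set (take k l) \<union> set (drop k l) = P" "set (take k l) \<inter> set (drop k l) = {}"
        using l(1,2) by (simp_all flip: set_append add: set_take_disj_set_drop_if_distinct)
      then have tk: "set (take k l) = S - {s}" using l(4) P c(7) by auto
      have "last (drop k l) = v" using l(3) len n T by (simp add: last_drop)
      then show "(take k l @ [s], drop k l) \<in> words S s \<times> words T v"
        using l tk c(5) by (auto simp: words_def)
    next
      fix p assume p: "p \<in> words S s \<times> words T v"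
      obtain l' l2 where [simp]: "p = (l', l2)" by (cases p)
      have l': "l' \<in> words S s" and l2: "distinct l2" "set l2 = T" "last l2 = v" using p by (auto simp: words_def)
      note q = sp[OF l']
      have len: "length (butlast l') = k" using distinct_card[of "butlast l'"] q c by (simp add: k_def)
      have ne: "l2 \<noteq> []" using l2 c by auto
      show "(case p of (l', l2) \<Rightarrow> butlast l' @ l2) \<in> {l\<in>words P v. set (drop k l) = T}"
        using q l2 len ne c(7) P by (auto simp: words_def)
      show "(take k (case p of (l', l2) \<Rightarrow> butlast l' @ l2) @ [s], drop k (case p of (l', l2) \<Rightarrow> butlast l' @ l2)) = p"
        using q len by simp
    qed auto
    also have "\<dots> = (\<Sum>(l',l2)\<in>words S s \<times> words T v. ksign ?sg *
      ((ksign (invs l') * Poly_Mapping.lookup x (map (part S) (word_chain l'))) *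
       (ksign (invs l2) * Poly_Mapping.lookup y (map (part T) (word_chain l2)))))"
    proof (rule sum.cong[OF refl], clarify)
      fix l' l2 assume "l' \<in> words S s" and l2: "l2 \<in> words T v"
      note q = sp[OF this(1)]
      show "?g (butlast l' @ l2) = ksign ?sg *
        ((ksign (invs l') * Poly_Mapping.lookup x (map (part S) (word_chain l'))) *
         (ksign (invs l2) * Poly_Mapping.lookup y (map (part T) (word_chain l2))))"
        using trm[of "butlast l'" l2] q l2 by (simp add: words_def)
    qed
    also have "\<dots> = ksign ?sg * (\<Sum>(l',l2)\<in>words S s \<times> words T v.
      (ksign (invs l') * Poly_Mapping.lookup x (map (part S) (word_chain l'))) *
       (ksign (invs l2) * Poly_Mapping.lookup y (map (part T) (word_chain l2))))"
      by (simp only: sum_distrib_left case_prod_unfold)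
    also have "\<dots> = ksign ?sg * (word_sum S x s * word_sum T y v)"
      unfolding word_sum_def sum_product sum.cartesian_product ..
    finally show ?thesis using True by (simp add: P_def)
  next
    case False
    have "word_sum P ?z v = 0"
      unfolding word_sum_def
    proof (rule sum.neutral, rule ballI)
      fix l assume "l \<in> words P v"
      then have l: "distinct l" "set l = P" "last l = v" by (auto simp: words_def)
      have len: "length l = card P" using l by (metis distinct_card)
      have "last (drop k l) = v" "drop k l \<noteq> []" using l(3) len n T by (auto simp: last_drop)
      then have "v \<in> set (drop k l)" using last_in_set by blast
      then show "?g l = 0" using False by (intro zero l(1,2)) auto
    qed
    then show ?thesis using False by (simp add: P_def)
  qed
qed

text \<open>For a one-element set the partition \<pi> is discrete and ends every chain. So, up to
  sign, the composite is \<open>x\<close> with \<open>s\<close> renamed to \<open>t\<close>,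
  multiplied by the scalar that \<open>y\<close> amounts to.\<close>

lemma word_sum_pcomp_one:
  fixes x y :: "nat set set list \<Rightarrow>\<^sub>0 'k::{comm_ring,comm_monoid_mult}"
  assumes comp: "composable S s {t}" and v: "v \<in> S"
  shows "word_sum (plug S s {t}) (NS_pcomp S s {t} x y) ((id(s := t)) v) =
    ksign (pcomp_exponent S s {t}) * (word_sum S x v * word_sum {t} y t)"
proof -
  define \<sigma> where "\<sigma> = id(s := t)"
  define P where "P = plug S s {t}"
  note c = composableD[OF comp]
  have \<sigma>: "inj_on \<sigma> S" "\<sigma> ` S = P"
    using composable_unit_right[OF comp] by (simp_all add: \<sigma>_def P_def)
  have ne: "S \<noteq> {}" using v by auto
  have top: "top_set {t} = {}" by (simp add: top_set_def)
  have y: "word_sum {t} y t = Poly_Mapping.lookup y (map (part {t}) [{}])"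
    by (simp add: word_sum_def words_singleton word_chain_def)
  have "word_sum P (NS_pcomp S s {t} x y) (\<sigma> v) = (\<Sum>l\<in>words S v. ksign (invs (map \<sigma> l)) *
      Poly_Mapping.lookup (NS_pcomp S s {t} x y) (map (part P) (word_chain (map \<sigma> l))))"
    unfolding word_sum_def \<sigma>(2)[symmetric]
    by (rule sum.reindex_bij_betw[OF words_map[OF \<sigma>(1) ne v], symmetric])
  also have "\<dots> = (\<Sum>l\<in>words S v. ksign (pcomp_exponent S s {t}) *
      ((ksign (invs l) * Poly_Mapping.lookup x (map (part S) (word_chain l))) * word_sum {t} y t))"
  proof (rule sum.cong[OF refl])
    fix l assume "l \<in> words S v"
    then have l: "distinct l" "set l = S" "l \<noteq> []" using ne by (auto simp: words_def)
    let ?l = "map \<sigma> l" and ?k = "length l - 1"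
    have l': "distinct ?l" "set ?l = P" "?l \<noteq> []" using l \<sigma> by (auto simp: distinct_map)
    have len: "length (word_chain ?l) = length l" using l'(3) by simp
    have k: "?k < length (word_chain ?l)" "word_chain ?l ! ?k = top_set {t}"
      using l l' len by (simp_all add: word_chain_nth top)
    have 1: "map (induced_set S s {t}) (take (Suc ?k) (word_chain ?l)) = word_chain l"
    proof (rule word_chain_eqI)
      show "length (map (induced_set S s {t}) (take (Suc ?k) (word_chain ?l))) = length l"
        using l len by simp
      show "map (induced_set S s {t}) (take (Suc ?k) (word_chain ?l)) ! (length l - 1) = {}"
        using k l by (simp add: induced_set_def)
      fix j assume j: "j < length l - 1"
      have sub: "set (drop j l) \<subseteq> S" using set_drop_subset[of j l] l by simp
      have X: "word_chain ?l ! j = \<sigma> ` set (drop j l)"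
        using j by (simp add: word_chain_nth drop_map)
      have "\<sigma> ` set (drop j l) \<noteq> {}" using j by auto
      moreover have "(plug_block s {t} a \<subseteq> \<sigma> ` set (drop j l)) = (a \<in> set (drop j l))" if "a \<in> S" for a
      proof -
        have "plug_block s {t} a = {\<sigma> a}" by (simp add: plug_block_def \<sigma>_def)
        then show ?thesis using inj_on_image_mem_iff[OF \<sigma>(1) that sub] by simp
      qed
      ultimately have "induced_set S s {t} (\<sigma> ` set (drop j l)) = set (drop j l)"
        using sub by (auto simp: induced_set_def top)
      then show "map (induced_set S s {t}) (take (Suc ?k) (word_chain ?l)) ! j = set (drop j l)"
        using j len X by simp
    qed (fact l(3))
    have 2: "drop ?k (word_chain ?l) = [{}]"
      using l by (simp add: word_chain_def)
    have "ksign (invs ?l) = (ksign (pcomp_exponent S s {t} + invs l) :: 'k)"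
      using invs_map[OF l(1), of \<sigma>] \<sigma>(1) l(2) pcomp_exponent_unit_right[OF comp]
      by (intro ksign_cong) (auto simp flip: \<sigma>_def)
    then show "ksign (invs ?l) * Poly_Mapping.lookup (NS_pcomp S s {t} x y) (map (part P) (word_chain ?l)) =
      ksign (pcomp_exponent S s {t}) *
      ((ksign (invs l) * Poly_Mapping.lookup x (map (part S) (word_chain l))) * word_sum {t} y t)"
      using lookup_NS_pcomp(1)[OF comp word_chain_schains[OF l', unfolded P_def], of ?k x y] k
      unfolding 1 2 top P_def y by (simp add: ksign_mult[symmetric] mult_ac)
  qed
  finally show ?thesis
    by (simp add: word_sum_def[of S] sum_distrib_left sum_distrib_right P_def \<sigma>_def)
qed

text \<open>If \<open>T\<close> has several elements, the coordinates of the right hand side outside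
  \<open>T\<close> are multiples of the coordinate sum of \<open>y\<close>, which is zero by
  \<open>sum_word_sum\<close>.\<close>

lemma word_sum_pcomp:
  fixes x y :: "nat set set list \<Rightarrow>\<^sub>0 'k::{comm_ring,comm_monoid_mult}"
  assumes comp: "composable S s T"
  shows "word_sum (plug S s T) (NS_pcomp S s T x y) v =
    ksign (pcomp_exponent S s T + (int (card S) - 1) * (int (card T) - 1)) *
    pcomp vec_operad S s T 0 0 (word_sum S x) (word_sum T y) v"
proof -
  note c = composableD[OF comp]
  show ?thesis
  proof (rule card_T_cases[OF comp])
    assume T: "2 \<le> card T"
    then show ?thesis using word_sum_pcomp_two[OF comp T, of x y v] sum_word_sum[OF c(4) T, of y] by auto
  next
    fix t assume T: "T = {t}" and t: "t \<notin> S - {s}"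
    have comp': "composable S s {t}" using comp T by simp
    consider "v = t" | "v \<noteq> t" "v \<in> S - {s}" | "v \<notin> plug S s T" by (auto simp: plug_def T)
    then show ?thesis
    proof cases
      case 1
      then show ?thesis using word_sum_pcomp_one[OF comp' c(5), of x y] by (simp add: T)
    next
      case 2
      then show ?thesis using word_sum_pcomp_one[OF comp', of v x y] by (simp add: T)
    next
      case 3
      then show ?thesis using word_sum_outside[OF label_set_plug[OF comp], of v] by (auto simp: plug_def)
    qed
  qed
qed

section \<open>The homomorphism from cocycles to vectors\<close>

text \<open>Word sums compose with an extra sign of exponent \<open>m n\<close>, where
  \<open>m = |S| - 1\<close> and \<open>n = |T| - 1\<close>. By \<open>choose_two_add\<close> this
  bilinear term is absorbed by the sign of exponent \<open>m choose 2\<close>.\<close>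

definition word_hom ::
  "nat set \<Rightarrow> int \<Rightarrow> (nat set set list \<Rightarrow>\<^sub>0 'k::{comm_ring,comm_monoid_mult}) \<Rightarrow> nat \<Rightarrow> 'k" where
  "word_hom S d z v = ksign (int ((card S - 1) choose 2)) * word_sum S z v"

lemma choose_two_add: "(m + n) choose 2 = (m choose 2) + (n choose 2) + m * n"
proof (induction m)
  case (Suc m)
  have "Suc k choose 2 = (k choose 2) + k" for k by (simp add: numeral_2_eq_2)
  then show ?case using Suc by simp
qed simp

lemma word_hom_carrier:
  fixes z :: "nat set set list \<Rightarrow>\<^sub>0 'k::{comm_ring,comm_monoid_mult}"
  assumes S: "label_set S" and z: "Poly_Mapping.keys z \<subseteq> chains (NS S) d"
  shows "word_hom S d z \<in> carrier (comp_module (desuspension vec_operad) S d)"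
  using word_sum_outside[OF S, of _ z] word_sum_degree[OF S z] sum_word_sum[of S z] S
  by (auto simp: desuspension_simps vec_carrier word_hom_def label_set_def simp flip: sum_distrib_left)

lemma word_hom_operad_hom:
  "operad_hom cocycle_operad (desuspension (vec_operad :: ('k::{comm_ring,comm_monoid_mult}, _) gr_operad)) word_hom"
proof (rule operad_homI)
  fix S d assume S: "label_set S"
  show "word_hom S d \<in> linear_maps (comp_module (cocycle_operad :: ('k, _) gr_operad) S d)
      (comp_module (desuspension vec_operad) S d)"
    unfolding cocycle_operad_simps
  proof (rule linear_mapsI)
    fix x :: "nat set set list \<Rightarrow>\<^sub>0 'k"
    assume "x \<in> carrier (cocycles (NS S) d)"
    then have "Poly_Mapping.keys x \<subseteq> chains (NS S) d" by (auto simp: cocycles_def cochains_def)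
    then show "word_hom S d x \<in> carrier (comp_module (desuspension vec_operad) S d)"
      by (rule word_hom_carrier[OF S])
  qed (simp_all add: cocycles_ops desuspension_simps word_hom_def word_sum_linear fun_eq_iff distrib_left
      mult.left_commute)
next
  fix \<sigma> :: "nat \<Rightarrow> nat" and S d and x :: "nat set set list \<Rightarrow>\<^sub>0 'k"
  assume x: "x \<in> carrier (comp_module cocycle_operad S d)" and S: "label_set S" and inj: "inj_on \<sigma> S"
  have k: "Poly_Mapping.keys x \<subseteq> chains (NS S) d" using x by (auto simp: cocycles_def cochains_def)
  have fin: "finite S" using S by (simp add: label_set_def)
  let ?f = "\<lambda>b. ksign (relabel_exponent \<sigma> S) * word_hom (\<sigma> ` S) d (relabel_cochain \<sigma> x) b"
  have "relabel vec_operad \<sigma> S (desusp_degree S d) (word_hom S d x) = ?f"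
  proof (rule vec_relabel_eqI[OF fin inj])
    show "?f (\<sigma> a) = word_hom S d x a" if "a \<in> S" for a
    proof -
      have "?f (\<sigma> a) = ksign (relabel_exponent \<sigma> S) * (ksign (int ((card S - 1) choose 2)) *
          (ksign (relabel_exponent \<sigma> S) * word_sum S x a))"
        by (simp only: word_hom_def word_sum_relabel[OF S inj that k] card_image[OF inj])
      also have "\<dots> = ksign (int ((card S - 1) choose 2)) * (ksign (relabel_exponent \<sigma> S) *
          (ksign (relabel_exponent \<sigma> S) * word_sum S x a))"
        by (rule mult.left_commute)
      finally show ?thesis by (simp add: word_hom_def)
    qed
    show "?f b = 0" if "b \<notin> \<sigma> ` S" for b
      by (simp add: word_hom_def word_sum_outside[OF label_set_image[OF S] that])
  qed
  then show "word_hom (\<sigma> ` S) d (relabel cocycle_operad \<sigma> S d x) =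
      relabel (desuspension vec_operad) \<sigma> S d (word_hom S d x)"
    by (simp add: desuspension_simps)
next
  fix S s T d e and x y :: "nat set set list \<Rightarrow>\<^sub>0 'k"
  assume x: "x \<in> carrier (comp_module cocycle_operad S d)" and y: "y \<in> carrier (comp_module cocycle_operad T e)"
    and comp: "composable S s T"
  have k: "Poly_Mapping.keys x \<subseteq> chains (NS S) d" using x by (auto simp: cocycles_def cochains_def)
  note c = composableD[OF comp]
  obtain m n where mn: "card S = Suc m" "card T = Suc n"
    using c by (metis card_gt_0_iff empty_iff gr0_implies_Suc)
  have P: "card (plug S s T) = Suc (m + n)" using card_plug[OF comp] mn by simp
  let ?p = "pcomp_exponent S s T"
  \<comment> \<open>In internal degree 0 the Koszul term of the desuspension vanishes, and the
    binomial coefficients account for \<open>m n\<close>.\<close>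
  have sg: "ksign (int ((m + n) choose 2)) * ksign (?p + int m * int n) =
    (ksign (?p + desusp_degree S d * int n) * (ksign (int (m choose 2)) * ksign (int (n choose 2))) :: 'k)"
    if "desusp_degree S d = 0"
    unfolding ksign_mult that choose_two_add by (intro ksign_cong) simp
  have "word_hom (plug S s T) (d + e) (NS_pcomp S s T x y) v =
     ksign (?p + desusp_degree S d * (int (card T) - 1)) *
     pcomp vec_operad S s T (desusp_degree S d) (desusp_degree T e) (word_hom S d x) (word_hom T e y) v" for v
  proof (cases "desusp_degree S d = 0")
    case True
    have "word_hom (plug S s T) (d + e) (NS_pcomp S s T x y) v =
      (ksign (int ((m + n) choose 2)) * ksign (?p + int m * int n)) *
      pcomp vec_operad S s T 0 0 (word_sum S x) (word_sum T y) v"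
      unfolding word_hom_def word_sum_pcomp[OF comp] P by (simp add: mn mult.assoc)
    also have "\<dots> = ksign (?p + desusp_degree S d * int n) *
      pcomp vec_operad S s T 0 0 (word_hom S d x) (word_hom T e y) v"
    proof -
      have "(\<Sum>v\<in>T. ksign (int (n choose 2)) * word_sum T y v) =
          ksign (int (n choose 2)) * sum (word_sum T y) T"
        by (simp only: sum_distrib_left)
      then show ?thesis
        unfolding sg[OF True] word_hom_def by (simp add: mn) (simp add: mult_ac)
    qed
    finally show ?thesis by (simp add: mn)
  next
    case False
    \<comment> \<open>The chains of words all have degree \<open>card S - 1\<close>, so in any other
      degree both sides vanish.\<close>
    then have "word_sum S x = (\<lambda>_. 0)" using word_sum_degree[OF c(1) k] by auto
    then show ?thesis
      unfolding word_hom_def word_sum_pcomp[OF comp] by simp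
  qed
  then show "word_hom (plug S s T) (d + e) (pcomp cocycle_operad S s T d e x y) =
      pcomp (desuspension vec_operad) S s T d e (word_hom S d x) (word_hom T e y)"
    unfolding cocycle_operad_simps desuspension_simps vec_simps(3) by (intro ext)
next
  fix s
  have "part {s} {} = {{s}}" by (auto simp: part_def)
  then have "word_sum {s} (basis [{{s}}] :: _ \<Rightarrow>\<^sub>0 'k) v = (if v = s then 1 else 0)" for v
    by (cases "v = s") (simp_all add: word_sum_outside, simp add: word_sum_def words_singleton word_chain_def lookup_basis)
  then show "word_hom {s} 0 (op_unit cocycle_operad s) = op_unit (desuspension (vec_operad :: ('k, _) gr_operad)) s"
    by (auto simp: word_hom_def desuspension_simps fun_eq_iff numeral_2_eq_2)
qed

section \<open>Kernel and image of the word homomorphism\<close>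

lemma word_chain_Cons: "word_chain (a # b # r) = set (a # b # r) # word_chain (b # r)"
  by (simp add: word_chain_def map_upt_Suc del: upt_Suc)

lemma word_chain_single [simp]: "word_chain [a] = [{}]"
  by (simp add: word_chain_def)

text \<open>The chain records the word except for the order of its last two letters, which the last
  letter settles.\<close>

lemma word_chain_inj:
  assumes "distinct l" "distinct l'" "l \<noteq> []" "l' \<noteq> []" "last l = last l'" "word_chain l = word_chain l'"
  shows "l = l'"
  using assms
proof (induction l arbitrary: l')
  case (Cons a r)
  have len: "length l' = length (a # r)"
    using word_chain_length[OF Cons.prems(3)] word_chain_length[OF Cons.prems(4)] Cons.prems(6) by simp
  show ?case
  proof (cases r)
    case Nil
    then show ?thesis using len Cons.prems(5) by (cases l') auto
  next
    case r: (Cons b s)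
    then obtain a' b' s' where l': "l' = a' # b' # s'"
      using len by (cases l'; cases "tl l'") auto
    have "word_chain r = word_chain (b' # s')" "set (a # b # s) = set (a' # b' # s')"
      using Cons.prems(6) by (auto simp: l' r word_chain_Cons)
    moreover from this have "r = b' # s'"
      using Cons.prems r by (intro Cons.IH) (auto simp: l')
    ultimately show ?thesis using Cons.prems(1,2) by (auto simp: l' r)
  qed
qed simp

text \<open>With as many sets as \<open>hd cs\<close> has elements, each step removes a single
  letter, except the last one, which removes two. These two may be put in either order.\<close>

lemma full_chain_word:
  "dchain cs \<Longrightarrow> length cs = card (hd cs) \<Longrightarrow> \<exists>l. distinct l \<and> set l = hd cs \<and> l \<noteq> [] \<and> cs = word_chain l"
proof (induction cs rule: dchain.induct)
  case (1 X Y)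
  then have "card X = 2" by simp
  then obtain a b where "X = {a, b}" "a \<noteq> b" by (auto simp: card_2_iff)
  then show ?case using 1 by (intro exI[of _ "[a, b]"]) (auto simp: word_chain_Cons)
next
  case (2 X Y Z r)
  then have d: "dchain (Y # Z # r)" "finite X" "Y \<subset> X" by auto
  have "length (Y # Z # r) \<le> card Y" using dchain_length[OF d(1)] by simp
  moreover have "card Y < card X" using d by (intro psubset_card_mono)
  moreover have "Suc (length (Y # Z # r)) = card X" using 2(3) by simp
  ultimately have c: "length (Y # Z # r) = card Y" "card X = Suc (card Y)" by linarith+
  obtain l where l: "distinct l" "set l = Y" "l \<noteq> []" "Y # Z # r = word_chain l"
    using 2(1)[OF d(1)] c(1) by auto
  have "card (X - Y) = 1" using c(2) d card_Diff_subset[of Y X] by (simp add: finite_subset psubset_imp_subset)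
  then obtain a where a: "X - Y = {a}" by (auto simp: card_1_singleton_iff)
  have X: "X = insert a Y" "a \<notin> Y" using a d(3) by auto
  obtain b s where [simp]: "l = b # s" using l(3) by (cases l) auto
  show ?case
    using l X by (intro exI[of _ "a # l"]) (auto simp: word_chain_Cons)
qed simp_all

text \<open>In a critical chain each single letter exceeds the minimum of the next block. If the
  smaller of the last two letters comes first, the word decreases up to its last letter; if it
  stands last, it is the minimum of all letters.\<close>

lemma critical_word:
  "distinct l \<Longrightarrow> 2 \<le> length l \<Longrightarrow> \<not> is_up (word_chain l) \<Longrightarrow> \<not> is_down (word_chain l) \<Longrightarrow>
   sorted_wrt (>) (butlast l) \<or> last l = Min (set l)"
proof (induction l)
  case (Cons a t)
  show ?case
  proof (cases "length t = 1")
    case True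
    then show ?thesis by (cases t) auto
  next
    case False
    then have "2 \<le> length t" using Cons.prems(2) by auto
    then obtain b c r where t: "t = b # c # r" by (cases t; cases "tl t") auto
    \<comment> \<open>The third set of the chain of \<open>a # t\<close>: it is empty if
      \<open>t\<close> has just two letters, since singletons are skipped.\<close>
    define Z where "Z = (if r = [] then {} else set (c # r))"
    obtain q where q: "word_chain t = set t # Z # q"
      by (cases r) (auto simp: t word_chain_Cons Z_def)
    have wc: "word_chain (a # t) = set (a # t) # set t # Z # q" by (simp add: q[symmetric], simp add: t word_chain_Cons)
    have d: "set (a # t) - set t = {a}" using Cons.prems(1) by auto
    have nlt: "\<not> a < Min (set t - Z)" "\<not> is_up (word_chain t)"
      using Cons.prems(3) unfolding wc q by (simp_all add: d[simplified])
    have "\<not> is_down (word_chain t)"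
      using Cons.prems(4) nlt unfolding wc q by (simp add: d[simplified])
    then have IH: "sorted_wrt (>) (butlast t) \<or> last t = Min (set t)"
      using Cons.IH Cons.prems(1) nlt(2) \<open>2 \<le> length t\<close> by simp
    show ?thesis
    proof (cases "last t = Min (set t)")
      case True
      have "Min (set t) \<le> Min (set t - Z)"
      proof (rule Min_antimono)
        show "set t - Z \<noteq> {}" using Cons.prems(1) by (auto simp: t Z_def)
      qed auto
      then have "Min (set t) \<le> a" using nlt by simp
      then show ?thesis using True by (simp add: t min_def)
    next
      case False
      then have s: "sorted_wrt (>) (butlast t)" using IH by simp
      have "b < a"
      proof (cases "r = []")
        case True
        then show ?thesis using nlt(1) False Cons.prems(1) by (auto simp: t Z_def min_def split: if_splits)
      next
        case r: False
        then have "set t - Z = {b}" using Cons.prems(1) by (auto simp: t Z_def)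
        then show ?thesis using nlt(1) Cons.prems(1) by (auto simp: t)
      qed
      moreover have "x < b" if "x \<in> set (butlast (c # r))" for x using s that by (simp add: t)
      ultimately show ?thesis using s by (fastforce simp: t)
    qed
  qed
qed simp

lemma sorted_words_eq:
  assumes "l \<in> words S v" "l' \<in> words S v" "S \<noteq> {}" "sorted_wrt (>) (butlast l)" "sorted_wrt (>) (butlast l')"
  shows "l = l'"
proof -
  have *: "m = butlast m @ [v] \<and> set (butlast m) = S - {v}" if "m \<in> words S v" for m
  proof -
    have m: "distinct m" "set m = S" "last m = v" "m \<noteq> []" using that assms(3) by (auto simp: words_def)
    then have e: "butlast m @ [v] = m" using append_butlast_last_id by metis
    have "distinct (butlast m @ [v])" "set (butlast m @ [v]) = S" unfolding e using m by simp_all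
    then have "set (butlast m) = S - {v}" by auto
    then show ?thesis using e by simp
  qed
  have "rev (butlast l) = rev (butlast l')"
    using *[OF assms(1)] *[OF assms(2)] assms(4,5)
    by (intro strict_sorted_equal) (simp_all add: sorted_wrt_rev)
  then show ?thesis using *[OF assms(1)] *[OF assms(2)] by (metis rev_rev_ident)
qed

lemma word_hom_eq_0_iff:
  "label_set S \<Longrightarrow> word_hom S d z = (\<lambda>_. 0) \<longleftrightarrow> (\<forall>v\<in>S. word_sum S z v = 0)"
  by (auto simp: word_hom_def fun_eq_iff ksign_eq_0_iff) (metis word_sum_outside)

text \<open>One direction is \<open>word_sum_coboundary\<close>. For the other, subtract a
  coboundary so that only critical chains remain. A critical chain with non-zero value would give
  the only term of some word sum, which then could not vanish.\<close>

lemma word_hom_kernel: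
  fixes z :: "nat set set list \<Rightarrow>\<^sub>0 'k::{comm_ring,comm_monoid_mult}"
  assumes S: "label_set S" and z: "z \<in> carrier (cocycles (NS S) d)"
  shows "word_hom S d z = (\<lambda>_. 0) \<longleftrightarrow> z \<in> coboundaries (NS S) d"
proof
  assume "z \<in> coboundaries (NS S) d"
  then obtain w where "Poly_Mapping.keys w \<subseteq> chains (NS S) (d - 1)" "z = coboundary (NS S) w"
    by (auto simp: coboundaries_def cochains_def)
  then show "word_hom S d z = (\<lambda>_. 0)"
    by (simp add: word_hom_eq_0_iff[OF S] word_sum_coboundary[OF S])
next
  assume "word_hom S d z = (\<lambda>_. 0)"
  then have ws: "\<And>v. v \<in> S \<Longrightarrow> word_sum S z v = 0" by (simp add: word_hom_eq_0_iff[OF S])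
  have fin: "finite S" "S \<noteq> {}" using S by (auto simp: label_set_def)
  interpret finite_gorder "NS S" using fin(1) by (rule finite_gorder_NS)
  have k: "Poly_Mapping.keys z \<subseteq> chains (NS S) d" and dz: "coboundary (NS S) z = 0" using z by auto
  have "card S > 0" using fin by (simp add: card_gt_0_iff)
  then consider "card S = 1" | "2 \<le> card S" by linarith
  then obtain w where w: "Poly_Mapping.keys w \<subseteq> chains (NS S) (d - 1)" "z - coboundary (NS S) w = 0"
  proof cases
    case 1
    then obtain s where s: "S = {s}" by (auto simp: card_1_singleton_iff)
    have "part {s} {} = {{s}}" by (auto simp: part_def)
    then have "Poly_Mapping.lookup z [{{s}}] = 0"
      using ws[of s] by (simp add: s word_sum_def words_singleton)
    then have "[{{s}}] \<notin> Poly_Mapping.keys z" by (simp add: in_keys_iff)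
    moreover have "Poly_Mapping.keys z \<subseteq> {[{{s}}]}"
      using k by (auto simp: s chains_singleton split: if_splits)
    ultimately have "Poly_Mapping.keys z = {}" by blast
    then show ?thesis using that[of 0] by (simp add: coboundary_simps)
  next
    case 2
    obtain w where w: "Poly_Mapping.keys w \<subseteq> chains (NS S) (d - 1)" and
      crit: "\<And>cs. cs \<in> schains S d \<Longrightarrow> Poly_Mapping.lookup (z - coboundary (NS S) w) (map (part S) cs) \<noteq> 0 \<Longrightarrow>
        \<not> is_up cs \<and> \<not> is_down cs"
      using cohomologous_to_critical[OF fin(1) 2 k dz] by blast
    define y where "y = z - coboundary (NS S) w"
    have ws': "word_sum S y v = 0" if "v \<in> S" for v
      using ws[OF that] word_sum_coboundary[OF S w] by (simp add: y_def word_sum_diff)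
    have ky: "Poly_Mapping.keys y \<subseteq> chains (NS S) d"
      using keys_diff[of z "coboundary (NS S) w"] k coboundary_keys[OF w] by (auto simp: y_def)
    note sd = schains_dchain[OF fin(1) 2]
    have "Poly_Mapping.lookup y xs = 0" for xs
    proof (rule ccontr)
      assume nz: "Poly_Mapping.lookup y xs \<noteq> 0"
      then have "xs \<in> chains (NS S) d" using ky by (auto simp: in_keys_iff)
      then obtain cs where cs: "cs \<in> schains S d" "xs = map (part S) cs" using chains_NS[OF fin(1)] by auto
      have cr: "\<not> is_up cs" "\<not> is_down cs" using crit[OF cs(1)] nz by (simp_all add: cs(2) y_def)
      have dc: "dchain cs" "hd cs = S" "int (length cs) = d + 1" using sd cs(1) by auto
      have len: "length cs = card S" using critical_length[OF dc(1) cr(2,1)] dc(2) by simp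
      obtain l0 where l0: "distinct l0" "set l0 = S" "l0 \<noteq> []" "cs = word_chain l0"
        using full_chain_word[OF dc(1)] len dc(2) by auto
      have len0: "length l0 = card S" using l0 by (metis distinct_card)
      \<comment> \<open>Of the two words of this chain, one does not end in \<open>Min S\<close>; by
        \<open>critical_word\<close> it decreases up to its last letter.\<close>
      obtain l where l: "distinct l" "set l = S" "cs = word_chain l" "last l \<noteq> Min S"
      proof (cases "last l0 = Min S")
        case True
        define k where "k = card S - 2"
        have kk: "Suc k < length l0" "Suc (Suc k) = length l0" using len0 2 by (auto simp: k_def)
        note p = swap_props[OF kk(1) l0(1)]
        have ne: "swap k l0 \<noteq> []" using p(4) kk by auto
        have "last (swap k l0) = swap k l0 ! Suc k" using p(4) kk(2) ne by (metis diff_Suc_1 last_conv_nth)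
        also have "\<dots> = l0 ! k" by (rule p(7))
        also have "\<dots> \<noteq> l0 ! Suc k" using l0(1) kk(1) by (simp add: nth_eq_iff_index_eq)
        also have "l0 ! Suc k = Min S" using True l0(3) kk(2) by (metis diff_Suc_1 last_conv_nth)
        finally have "last (swap k l0) \<noteq> Min S" .
        then show ?thesis using that[of "swap k l0"] p(2,3) p(10)[OF kk(2)] l0 by simp
      next
        case False
        then show ?thesis using that[of l0] l0 by simp
      qed
      have lw: "l \<in> words S (last l)" using l by (simp add: words_def)
      \<comment> \<open>Every word with this last letter on which \<open>y\<close> is non-zero
        decreases up to the last letter, and there is just one such word.\<close>
      have so: "sorted_wrt (>) (butlast l')"
        if "l' \<in> words S (last l)" "Poly_Mapping.lookup y (map (part S) (word_chain l')) \<noteq> 0" for l'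
      proof -
        have l': "distinct l'" "set l' = S" "last l' = last l" "l' \<noteq> []" using that(1) fin by (auto simp: words_def)
        have "word_chain l' \<in> schains S d"
          using word_chain_schains[OF l'(1,2,4)] dc(3) len by simp
        then have "\<not> is_up (word_chain l')" "\<not> is_down (word_chain l')"
          using crit that(2) by (simp_all add: y_def)
        then show ?thesis
          using critical_word[OF l'(1)] l' l(4) 2 words_length[OF that(1)] by auto
      qed
      have nzl: "Poly_Mapping.lookup y (map (part S) (word_chain l)) \<noteq> 0" using nz cs(2) l(3) by simp
      have "word_sum S y (last l) =
        (\<Sum>l'\<in>{l}. ksign (invs l') * Poly_Mapping.lookup y (map (part S) (word_chain l')))"
        unfolding word_sum_def
      proof (rule sum.mono_neutral_right[OF finite_words[OF fin(1)]])
        show "\<forall>l'\<in>words S (last l) - {l}. ksign (invs l') * Poly_Mapping.lookup y (map (part S) (word_chain l')) = 0"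
          using so so[OF lw nzl] sorted_words_eq[OF _ lw fin(2)] by (auto simp: ksign_eq_0_iff)
      qed (use lw in auto)
      moreover have "last l \<in> S" using l(2) fin(2) last_in_set[of l] by auto
      ultimately show False using ws' nzl by (simp add: ksign_eq_0_iff)
    qed
    then have "y = 0" by (intro poly_mapping_eqI) simp
    then show ?thesis using that[OF w] by (simp add: y_def)
  qed
  then show "z \<in> coboundaries (NS S) d"
    by (auto simp: coboundaries_def cochains_def intro!: image_eqI[of _ _ w])
qed

text \<open>The chain determines the word up to the order of the last letters \<open>m\<close> and
  \<open>a\<close>, so it contributes only to these two coordinates. The one at \<open>m\<close> is
  excluded here, as it follows from the vanishing of the coordinate sum.\<close>

lemma word_sum_basis:
  assumes S: "finite S" "2 \<le> card S" and l: "distinct l" "set l = S" "l = r @ [m, a]" and v: "v \<noteq> m"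
  shows "word_sum S (basis (map (part S) (word_chain l))) v =
    (if v = a then ksign (invs l) else (0 :: 'k::{comm_ring,comm_monoid_mult}))"
proof -
  have ne: "l \<noteq> []" using l by simp
  have eq: "map (part S) (word_chain l) = map (part S) (word_chain l') \<longleftrightarrow> l' = l \<and> v = a"
    if "l' \<in> words S v" for l'
  proof
    have l': "distinct l'" "set l' = S" "last l' = v" "l' \<noteq> []" using that S by (auto simp: words_def)
    have len: "length l' = length l" using l l' by (metis distinct_card)
    assume "map (part S) (word_chain l) = map (part S) (word_chain l')"
    then have e: "word_chain l = word_chain l'"
      using map_part_eq_iff[OF S word_chain_schains[OF l(1,2) ne] word_chain_schains[OF l'(1,2,4)]] by simp
    let ?k = "length r"
    have k: "?k < length l - 1" "Suc (Suc ?k) = length l" using l by simp_all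
    have "set (drop ?k l') = set (drop ?k l)"
      using e k len by (simp flip: word_chain_nth(1))
    moreover have "last (drop ?k l') = v" "drop ?k l' \<noteq> []" using l'(3) len k by (auto simp: last_drop)
    ultimately have "v \<in> {m, a}" using last_in_set[of "drop ?k l'"] by (simp add: l(3))
    then have "v = a" using v by simp
    then have "last l = last l'" using l'(3) l(3) by simp
    then show "l' = l \<and> v = a"
      using word_chain_inj[OF l(1) l'(1) ne l'(4) _ e] \<open>v = a\<close> by simp
  qed auto
  have "word_sum S (basis (map (part S) (word_chain l))) v = (\<Sum>l'\<in>words S v. if l' = l \<and> v = a then ksign (invs l) else (0::'k))"
    unfolding word_sum_def by (rule sum.cong) (auto simp: lookup_basis eq)
  also have "\<dots> = (if v = a then ksign (invs l) else 0)"
    using finite_words[OF S(1), of v] l by (auto simp: words_def)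
  finally show ?thesis .
qed

text \<open>There are no longer chains that could occur in the coboundary.\<close>

lemma top_cochain_cocycle:
  assumes S: "finite S" "2 \<le> card S" and z: "Poly_Mapping.keys z \<subseteq> chains (NS S) (int (card S) - 1)"
  shows "z \<in> carrier (cocycles (NS S) (int (card S) - 1))"
proof -
  interpret finite_gorder "NS S" using S(1) by (rule finite_gorder_NS)
  have "schains S (int (card S) - 1 + 1) = {}"
    using schains_dchain[OF S] dchain_length by fastforce
  then have "Poly_Mapping.keys (coboundary (NS S) z) \<subseteq> {}"
    using coboundary_keys[OF z] chains_NS[OF S(1)] by simp
  then show ?thesis using z by simp
qed

lemma word_hom_surj:
  fixes v :: "nat \<Rightarrow> 'k::{comm_ring,comm_monoid_mult}"
  assumes S: "label_set S" and v: "v \<in> carrier (comp_module (desuspension vec_operad) S d)"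
  shows "v \<in> word_hom S d ` carrier (cocycles (NS S) d)"
proof -
  have fin: "finite S" "S \<noteq> {}" using S by (auto simp: label_set_def)
  interpret finite_gorder "NS S" using fin(1) by (rule finite_gorder_NS)
  have vS: "\<And>a. a \<notin> S \<Longrightarrow> v a = 0" and v0: "\<And>a. desusp_degree S d \<noteq> 0 \<Longrightarrow> v a = 0"
    and v2: "2 \<le> card S \<Longrightarrow> sum v S = 0"
    using v by (auto simp: desuspension_simps vec_carrier)
  let ?c = "ksign (int ((card S - 1) choose 2)) :: 'k"
  have "card S > 0" using fin by (simp add: card_gt_0_iff)
  then consider "desusp_degree S d \<noteq> 0" | "desusp_degree S d = 0" "card S = 1"
    | "desusp_degree S d = 0" "2 \<le> card S" by linarith
  then obtain z where "z \<in> carrier (cocycles (NS S) d)" "\<And>a. a \<in> S \<Longrightarrow> word_sum S z a = ?c * v a"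
  proof cases
    case 1
    then show ?thesis using that[of 0] v0 by (simp add: coboundary_simps)
  next
    case 2
    then obtain s where s: "S = {s}" by (auto simp: card_1_singleton_iff)
    have d: "d = 0" using 2 by simp
    have p: "part {s} {} = {{s}}" by (auto simp: part_def)
    interpret pre_operad "cocycle_operad :: ('k, _) gr_operad" by (rule pre_operad_cocycle_operad)
    have "scale (?c * v s) (basis [{{s}}]) \<in> carrier (cocycles (NS S) d)"
      using smult_closed[of "{s}" "basis [{{s}}]" 0 "?c * v s"] op_unit_closed[of s]
      by (simp add: s d cocycles_ops)
    then show ?thesis
      by (rule that) (simp add: s word_sum_linear, simp add: word_sum_def words_singleton p lookup_basis)
  next
    case 3
    define m where "m = Min S"
    have m: "m \<in> S" using fin by (simp add: m_def)
    have d: "d = int (card S) - 1" using 3 by simp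
    have "\<exists>l. distinct l \<and> set l = S \<and> (\<exists>r. l = r @ [m, a])" if "a \<in> S - {m}" for a
    proof -
      obtain r where "distinct r" "set r = S - {m, a}" using obtain_word[of "S - {m, a}"] fin by auto
      then show ?thesis using that m by (intro exI[of _ "r @ [m, a]"]) auto
    qed
    then have "\<forall>a\<in>S - {m}. \<exists>l. distinct l \<and> set l = S \<and> (\<exists>r. l = r @ [m, a])" by blast
    from bchoice[OF this] obtain l
      where l: "\<And>a. a \<in> S - {m} \<Longrightarrow> distinct (l a) \<and> set (l a) = S \<and> (\<exists>r. l a = r @ [m, a])" by blast
    \<comment> \<open>Apart from the coordinate at \<open>m\<close>, the chain of \<open>l a\<close>
      contributes only to the one at \<open>a\<close>, namely the sign of \<open>l a\<close>. So
      these coordinates can be prescribed one by one; the factor \<open>?c\<close> undoes the sign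
      in \<open>word_hom\<close>.\<close>
    define z where "z = (\<Sum>a\<in>S - {m}. scale (?c * v a * ksign (invs (l a))) (basis (map (part S) (word_chain (l a)))))"
    have ws: "word_sum S (\<Sum>a\<in>A. scale (f a) (g a)) b = (\<Sum>a\<in>A. f a * word_sum S (g a) b)" if "finite A"
      for A f g b using that by (induction A) (simp_all add: word_sum_linear)
    have "Poly_Mapping.keys z \<subseteq> chains (NS S) d"
      unfolding z_def
    proof (rule keys_sum_subset)
      fix a assume a: "a \<in> S - {m}"
      note la = l[OF a]
      have "map (part S) (word_chain (l a)) \<in> chains (NS S) d"
        unfolding d using la by (intro map_part_chains[OF fin(1)] word_chain_schains) auto
      then show "Poly_Mapping.keys (scale (?c * v a * ksign (invs (l a))) (basis (map (part S) (word_chain (l a)))))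
        \<subseteq> chains (NS S) d"
        using keys_scale keys_basis by fastforce
    qed
    then have "z \<in> carrier (cocycles (NS S) d)" unfolding d by (rule top_cochain_cocycle[OF fin(1) 3(2)])
    moreover have nm: "word_sum S z b = ?c * v b" if b: "b \<in> S - {m}" for b
    proof -
      have "word_sum S z b = (\<Sum>a\<in>S - {m}. ?c * v a * ksign (invs (l a)) *
          word_sum S (basis (map (part S) (word_chain (l a)))) b)"
        unfolding z_def using fin by (intro ws) simp
      also have "\<dots> = (\<Sum>a\<in>S - {m}. if b = a then ?c * v a else 0)"
      proof (rule sum.cong[OF refl])
        fix a assume "a \<in> S - {m}"
        from l[OF this] obtain r where r: "distinct (l a)" "set (l a) = S" "l a = r @ [m, a]" by blast
        have "word_sum S (basis (map (part S) (word_chain (l a)))) b = (if b = a then ksign (invs (l a)) else (0 :: 'k))"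
          by (rule word_sum_basis[OF fin(1) 3(2) r]) (use b in simp)
        then show "?c * v a * ksign (invs (l a)) * word_sum S (basis (map (part S) (word_chain (l a)))) b =
          (if b = a then ?c * v a else 0)"
          by (simp add: mult.assoc)
      qed
      finally show ?thesis using b fin by (simp add: sum.delta)
    qed
    \<comment> \<open>On both sides the coordinate at \<open>m\<close> is determined by the others,
      because the coordinate sums vanish.\<close>
    moreover have "word_sum S z m = ?c * v m"
    proof -
      have "word_sum S z m + sum (word_sum S z) (S - {m}) = 0"
        using sum_word_sum[OF fin(1) 3(2), of z] sum.remove[OF fin(1) m, of "word_sum S z"] by simp
      moreover have "sum (word_sum S z) (S - {m}) = ?c * sum v (S - {m})"
        using nm by (simp add: sum_distrib_left)
      moreover have "v m + sum v (S - {m}) = 0" using v2[OF 3(2)] sum.remove[OF fin(1) m, of v] by simp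
      then have "sum v (S - {m}) = - v m" by (simp only: add_eq_0_iff)
      ultimately show ?thesis by simp
    qed
    ultimately show ?thesis using that by blast
  qed note z = this
  have "word_hom S d z = v"
  proof
    fix a show "word_hom S d z a = v a"
      using z(2)[of a] vS[of a] by (cases "a \<in> S") (simp_all add: word_hom_def word_sum_outside[OF S])
  qed
  then show ?thesis using z(1) by blast
qed

section \<open>The isomorphism\<close>

text \<open>\<open>operad_ideal\<close> speaks of label sets only, and it is there that the
  coboundaries are known to be the kernel of \<open>word_hom\<close>.\<close>

lemma operad_ideal_cong:
  assumes "operad_ideal P I" "\<And>S d. label_set S \<Longrightarrow> J S d = I S d"
  shows "operad_ideal P J"
  using assms(1) unfolding operad_ideal_def
  by (auto simp: assms(2) label_set_image label_set_plug composableD(1,2))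

text \<open>As the kernel of \<open>word_hom\<close> the coboundaries form an ideal automatically,
  without computing any composite of a cocycle with a coboundary.\<close>

lemma operad_ideal_coboundaries:
  "operad_ideal (cocycle_operad :: ('k::{comm_ring,comm_monoid_mult}, _) gr_operad) (\<lambda>S. coboundaries (NS S))"
proof (rule operad_ideal_cong)
  interpret pre_operad "cocycle_operad :: ('k, _) gr_operad" by (rule pre_operad_cocycle_operad)
  show "operad_ideal (cocycle_operad :: ('k, _) gr_operad)
    (\<lambda>S d. {x \<in> carrier (comp_module cocycle_operad S d).
      word_hom S d x = \<zero>\<^bsub>comp_module (desuspension vec_operad) S d\<^esub>})"
    by (rule operad_ideal_kernel[OF word_hom_operad_hom])
      (intro graded_operad_pre_operad graded_operad_desuspension graded_operad_vec_operad)
next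
  fix S :: "nat set" and d assume S: "label_set S"
  then interpret finite_gorder "NS S" by (intro finite_gorder_NS) (simp add: label_set_def)
  have "coboundaries (NS S) d \<subseteq> (carrier (cocycles (NS S) d) :: (_ \<Rightarrow>\<^sub>0 'k) set)"
  proof
    fix x :: "_ \<Rightarrow>\<^sub>0 'k" assume "x \<in> coboundaries (NS S) d"
    then obtain w where "Poly_Mapping.keys w \<subseteq> chains (NS S) (d - 1)" "x = coboundary (NS S) w"
      by (auto simp: coboundaries_def cochains_def)
    then show "x \<in> carrier (cocycles (NS S) d)"
      using coboundary_keys[of w "d - 1"] coboundary_coboundary[of w "d - 1"] by simp
  qed
  then show "coboundaries (NS S) d = {x \<in> carrier (comp_module (cocycle_operad :: ('k, _) gr_operad) S d).
      word_hom S d x = \<zero>\<^bsub>comp_module (desuspension vec_operad) S d\<^esub>}"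
    unfolding desuspension_simps vec_simps cocycle_operad_simps
    using word_hom_kernel[OF S, where ?'k = 'k] by blast
qed

theorem hNS_iso_vec_operad:
  obtains h where "operad_iso (hNS :: ('k::{comm_ring,comm_monoid_mult}, _) gr_operad) (desuspension vec_operad) h"
    "\<And>S d z. label_set S \<Longrightarrow> z \<in> carrier (cocycles (NS S) d) \<Longrightarrow> h S d (coh_class (NS S) d z) = word_hom S d z"
proof -
  interpret operad_with_ideal "cocycle_operad :: ('k, _) gr_operad" "\<lambda>S. coboundaries (NS S)"
    using operad_ideal_coboundaries pre_operad_cocycle_operad
    by (intro operad_with_ideal.intro operad_with_ideal_axioms.intro)
  show ?thesis
  proof (rule quot_by_iso[OF word_hom_operad_hom])
    show "graded_operad (desuspension (vec_operad :: ('k, _) gr_operad))"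
      by (intro graded_operad_desuspension graded_operad_vec_operad)
    fix S :: "nat set" and d assume S: "label_set S"
    show "carrier (comp_module (desuspension (vec_operad :: ('k, _) gr_operad)) S d)
        \<subseteq> word_hom S d ` carrier (comp_module cocycle_operad S d)"
      using word_hom_surj[OF S] by auto
    show "word_hom S d x = \<zero>\<^bsub>comp_module (desuspension vec_operad) S d\<^esub> \<longleftrightarrow> x \<in> coboundaries (NS S) d"
      if "x \<in> carrier (comp_module cocycle_operad S d)" for x :: "_ \<Rightarrow>\<^sub>0 'k"
      using word_hom_kernel[OF S, of x d] that by (simp add: desuspension_simps)
  next
    fix h
    assume "operad_iso (quot_by cocycle_operad (\<lambda>S. coboundaries (NS S))) (desuspension (vec_operad :: ('k, _) gr_operad)) h"
      and "\<And>S d x. label_set S \<Longrightarrow> x \<in> carrier (comp_module cocycle_operad S d) \<Longrightarrow>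
        h S d (coboundaries (NS S) d +>\<^bsub>comp_module cocycle_operad S d\<^esub> x) = word_hom S d x"
    then show ?thesis by (intro that[of h]) (simp_all add: hNS_eq_quot_by coh_class_def)
  qed
qed

text \<open>The generator is the chain of the words 12 and 21, whose signs are 1 and -1, so its
  vector is \<open>e_2 - e_1\<close>, like that of the bracket. As \<open>1 choose 2\<close> is 0,
  \<open>word_hom\<close> adds no sign.\<close>

lemma hNS_generator_cocycle:
  "(basis [{{1,2}}, {{1},{2}}] :: _ \<Rightarrow>\<^sub>0 'k::{comm_ring,comm_monoid_mult}) \<in> carrier (cocycles (NS {1,2}) 1)" (is ?A)
  and word_hom_hNS_generator:
  "word_hom {1,2} 1 (basis [{{1,2}}, {{1},{2}}]) = (tree_vec (Br (Leaf 1) (Leaf 2)) :: nat \<Rightarrow> 'k)" (is ?B)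
proof -
  let ?S = "{1,2} :: nat set"
  have S: "finite ?S" "2 \<le> card ?S" "card ?S = 2" "label_set ?S" by (auto simp: label_set_def)
  have "part ?S ?S = {{1,2}}" "part ?S {} = {{1},{2}}" by (auto simp: part_def)
  then have ch: "map (part ?S) (word_chain [1,2]) = [{{1,2}}, {{1},{2}}]"
    by (simp add: word_chain_Cons)
  have "[{{1,2}}, {{1},{2}}] \<in> chains (NS ?S) (int (card ?S) - 1)"
    unfolding ch[symmetric] by (intro map_part_chains[OF S(1)] word_chain_schains) auto
  then have k: "Poly_Mapping.keys (basis [{{1,2}}, {{1},{2}}] :: _ \<Rightarrow>\<^sub>0 'k) \<subseteq> chains (NS ?S) (int (card ?S) - 1)"
    using keys_basis by fastforce
  show ?A using top_cochain_cocycle[OF S(1,2) k] S(3) by simp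
  have 1: "word_sum ?S (basis [{{1,2}}, {{1},{2}}]) v = (if v = 2 then 1 else (0::'k))" if "v \<noteq> 1" for v
    using word_sum_basis[OF S(1,2), of "[1,2]" "[]" 1 2 v, where ?'k = 'k] that unfolding ch by simp
  have 2: "word_sum ?S (basis [{{1,2}}, {{1},{2}}]) 1 = (- 1 :: 'k)"
    using sum_word_sum[OF S(1,2), of "basis [{{1,2}}, {{1},{2}}] :: _ \<Rightarrow>\<^sub>0 'k"] 1[of 2]
    by (simp add: eq_neg_iff_add_eq_0)
  show ?B
  proof
    fix v show "word_hom ?S 1 (basis [{{1,2}}, {{1},{2}}]) v = (tree_vec (Br (Leaf 1) (Leaf 2)) v :: 'k)"
      using 1[of v] 2 by (cases "v = 1") (simp_all add: word_hom_def numeral_2_eq_2)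
  qed
qed

section \<open>Uniqueness and conclusion\<close>

text \<open>The vectors on which \<open>f\<close> and \<open>g\<close> agree are closed under all
  operations. They contain the bracket, hence the vectors of all trees, and these span the
  components.\<close>

lemma vec_desuspension_hom_unique:
  fixes f g :: "nat set \<Rightarrow> int \<Rightarrow> (nat \<Rightarrow> 'k::{comm_ring,comm_monoid_mult}) \<Rightarrow> 'b"
  assumes f: "operad_hom (desuspension vec_operad) N f" and g: "operad_hom (desuspension vec_operad) N g"
    and N: "pre_operad N"
    and gen: "f {1,2} 1 (tree_vec (Br (Leaf 1) (Leaf 2))) = g {1,2} 1 (tree_vec (Br (Leaf 1) (Leaf 2)))"
    and S: "label_set S" and v: "v \<in> carrier (comp_module (desuspension vec_operad) S d)"
  shows "f S d v = g S d v"
proof -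
  interpret N: pre_operad N by fact
  \<comment> \<open>The desuspended operad lives in degree \<open>card S - 1\<close> only, so
    agreement is stated there, for vectors of the original operad.\<close>
  define A where "A S v \<longleftrightarrow> v \<in> carrier (comp_module vec_operad S 0) \<and>
    f S (int (card S) - 1) v = g S (int (card S) - 1) v" for S v
  have top: "comp_module (desuspension (vec_operad :: ('k, _) gr_operad)) S (int (card S) - 1) =
      comp_module vec_operad S 0" for S
    by (simp add: desuspension_simps)
  interpret V: graded_operad "vec_operad :: ('k, _) gr_operad" by (rule graded_operad_vec_operad)
  interpret V: pre_operad "vec_operad :: ('k, _) gr_operad"
    by (rule graded_operad_pre_operad[OF graded_operad_vec_operad])
  note lin = linear_mapsD[OF operad_homD(1)[OF f]] linear_mapsD[OF operad_homD(1)[OF g]]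
  have A_add: "A S (\<lambda>a. v a + w a)" if "label_set S" "A S v" "A S w" for S v w
    using that lin(2,5)[OF that(1), of v "int (card S) - 1" w]
      abelian_monoid.a_closed[of "comp_module vec_operad S 0" v w] V.comp_module_module[OF that(1), of 0]
    by (auto simp: A_def top module_def abelian_group_def)
  have A_scale: "A S (\<lambda>a. k * v a)" if "label_set S" "A S v" for S v k
    using that lin(3,6)[OF that(1), of v "int (card S) - 1" k] V.smult_closed[OF that(1), of v 0 k]
    by (auto simp: A_def top)
  \<comment> \<open>Scaling by a sign once more removes it; this reduces the signed operations of
    the desuspension to those of \<open>vec_operad\<close>.\<close>
  have A_sign: "A S v" if "label_set S" "A S (\<lambda>a. ksign n * v a)" for S v n
    using A_scale[OF that, of "ksign n"] by simp
  have A_relabel: "A (\<sigma> ` S) (relabel vec_operad \<sigma> S 0 v)" if "label_set S" "inj_on \<sigma> S" "A S v" for \<sigma> S v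
  proof (rule A_sign[OF label_set_image[OF that(1)], where n = "relabel_exponent \<sigma> S"])
    have x: "v \<in> carrier (comp_module (desuspension vec_operad) S (int (card S) - 1))"
      using that(3) by (simp add: A_def top)
    have "f (\<sigma> ` S) (int (card S) - 1) (\<lambda>a. ksign (relabel_exponent \<sigma> S) * relabel vec_operad \<sigma> S 0 v a) =
      g (\<sigma> ` S) (int (card S) - 1) (\<lambda>a. ksign (relabel_exponent \<sigma> S) * relabel vec_operad \<sigma> S 0 v a)"
      using operad_homD(2)[OF f x that(1,2)] operad_homD(2)[OF g x that(1,2)] that(3)
      by (simp add: A_def desuspension_simps)
    then show "A (\<sigma> ` S) (\<lambda>a. ksign (relabel_exponent \<sigma> S) * relabel vec_operad \<sigma> S 0 v a)"
      using V.smult_closed[OF label_set_image[OF that(1)] V.relabel_closed[OF that(1,2), of v 0]]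
        that(3) card_image[OF that(2)]
      by (simp add: A_def)
  qed
  have A_pcomp: "A (plug S s T) (pcomp vec_operad S s T 0 0 v w)" if "composable S s T" "A S v" "A T w" for S s T v w
  proof (rule A_sign[OF label_set_plug[OF that(1)], where n = "pcomp_exponent S s T"])
    have x: "v \<in> carrier (comp_module (desuspension vec_operad) S (int (card S) - 1))"
      "w \<in> carrier (comp_module (desuspension vec_operad) T (int (card T) - 1))"
      using that(2,3) by (simp_all add: A_def top)
    let ?u = "\<lambda>a. ksign (pcomp_exponent S s T) * pcomp vec_operad S s T 0 0 v w a"
    have "f (plug S s T) (int (card (plug S s T)) - 1) ?u = g (plug S s T) (int (card (plug S s T)) - 1) ?u"
      using operad_homD(3)[OF f x that(1)] operad_homD(3)[OF g x that(1)] that(2,3)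
      unfolding card_plug[OF that(1)] by (simp add: A_def desuspension_simps)
    then show "A (plug S s T) ?u"
      using V.smult_closed[OF label_set_plug[OF that(1)] V.pcomp_closed[OF that(1), of v 0 w 0]] that(2,3)
      by (simp add: A_def)
  qed
  note mag = operad_homD[OF Mag_vec_hom[where ?'k = 'k]]
  have tv: "tree_vec t = eval_with tree_vec (basis t :: _ \<Rightarrow>\<^sub>0 'k)" for t by (rule ext) simp
  have car: "tree_vec t \<in> carrier (comp_module (vec_operad :: ('k, _) gr_operad) S 0)"
    if "t \<in> ltrees S" "label_set S" for t S
    by (subst tv) (rule mag(5)[OF that(2) tree_basis_carrier[OF that(1)]])
  have tree_pcomp: "tree_vec (graft s t u) = (pcomp vec_operad S s T 0 0 (tree_vec t) (tree_vec u) :: nat \<Rightarrow> 'k)"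
    if "composable S s T" "t \<in> ltrees S" "u \<in> ltrees T" for S s T t u
    using mag(3)[OF tree_basis_carrier[OF that(2)] tree_basis_carrier[OF that(3)] that(1)]
    unfolding tv[symmetric] Mag_simps bilin_ext_eq_lin_ext lin_ext_basis by (simp only: tv[symmetric])
  have tree_relabel: "tree_vec (map_ltree \<sigma> t) = (relabel vec_operad \<sigma> S 0 (tree_vec t) :: nat \<Rightarrow> 'k)"
    if "label_set S" "inj_on \<sigma> S" "t \<in> ltrees S" for \<sigma> S t
    using mag(2)[OF tree_basis_carrier[OF that(3)] that(1,2)]
    unfolding Mag_simps lin_ext_basis by (simp only: tv[symmetric])
  have A_bracket: "A {a,b} (tree_vec (Br (Leaf a) (Leaf b)))" if "a \<noteq> b" for a b
  proof -
    define \<sigma> :: "nat \<Rightarrow> nat" where "\<sigma> i = (if i = 1 then a else b)" for i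
    have l: "label_set {1,2 :: nat}" "inj_on \<sigma> {1,2}" "Br (Leaf 1) (Leaf 2) \<in> ltrees {1,2 :: nat}"
      using that by (auto simp: label_set_def \<sigma>_def ltrees_def)
    have "A {1,2} (tree_vec (Br (Leaf 1) (Leaf 2)))" using gen car[OF l(3,1)] by (simp add: A_def)
    then have "A (\<sigma> ` {1,2}) (tree_vec (map_ltree \<sigma> (Br (Leaf 1) (Leaf 2))))"
      unfolding tree_relabel[OF l] by (rule A_relabel[OF l(1,2)])
    then show ?thesis by (simp add: \<sigma>_def insert_commute)
  qed
  have A_tree: "A (set (leaves t)) (tree_vec t)" if "distinct (leaves t)" for t
    using that
  proof (induction t)
    case (Leaf a)
    show ?case
      using operad_homD(4)[OF f, of a] operad_homD(4)[OF g, of a]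
      by (simp add: A_def desuspension_simps vec_carrier)
  next
    case (Br t u)
    define T U where TU: "T = set (leaves t)" "U = set (leaves u)"
    have t: "t \<in> ltrees T" "u \<in> ltrees U" "T \<inter> U = {}" "finite T" "finite U" "T \<noteq> {}" "U \<noteq> {}"
      using Br.prems by (auto simp: TU ltrees_def)
    have At: "A T (tree_vec t)" "A U (tree_vec u)" using Br by (simp_all add: TU)
    \<comment> \<open>Two fresh letters are chosen: \<open>Br t u\<close> arises from the bracket of
      \<open>a\<close> and \<open>b\<close> by grafting \<open>t\<close> at \<open>a\<close> and
      then \<open>u\<close> at \<open>b\<close>.\<close>
    obtain a where a: "a \<notin> T \<union> U"
      using ex_new_if_finite[OF infinite_UNIV_nat, of "T \<union> U"] t by auto
    obtain b where "b \<notin> insert a (T \<union> U)"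
      using ex_new_if_finite[OF infinite_UNIV_nat, of "insert a (T \<union> U)"] t by auto
    then have ab: "a \<notin> T \<union> U" "b \<notin> T \<union> U" "a \<noteq> b" using a by auto
    let ?b = "Br (Leaf a) (Leaf b) :: nat ltree"
    have 1: "composable {a,b} a T" "?b \<in> ltrees {a,b}" "plug {a,b} a T = insert b T"
      using t ab by (auto simp: composable_def label_set_def ltrees_def plug_def)
    have g1: "graft a ?b t = Br t (Leaf b)" using ab by simp
    have "A (plug {a,b} a T) (tree_vec (graft a ?b t))"
      unfolding tree_pcomp[OF 1(1,2) t(1)] by (rule A_pcomp[OF 1(1) A_bracket[OF ab(3)] At(1)])
    then have A1: "A (insert b T) (tree_vec (Br t (Leaf b)))" unfolding g1 1(3) .
    have 2: "composable (insert b T) b U" "Br t (Leaf b) \<in> ltrees (insert b T)" "plug (insert b T) b U = T \<union> U"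
      using t ab by (auto simp: composable_def label_set_def ltrees_def plug_def)
    have g2: "graft b (Br t (Leaf b)) u = Br t u" using graft_id[of b t u] ab by (simp add: TU)
    have "A (plug (insert b T) b U) (tree_vec (graft b (Br t (Leaf b)) u))"
      unfolding tree_pcomp[OF 2(1,2) t(2)] by (rule A_pcomp[OF 2(1) A1 At(2)])
    then show ?case unfolding g2 2(3) by (simp only: TU leaves.simps set_append)
  qed
  show ?thesis
  proof (cases "d = int (card S) - 1")
    case True
    have "v \<in> eval_with tree_vec ` carrier (comp_module Mag S 0)"
      using v True by (intro Mag_vec_surj[OF S, of v 0]) (simp add: top)
    then obtain p where p: "Poly_Mapping.keys p \<subseteq> ltrees S" "v = eval_with tree_vec p"
      by (auto simp: Mag_simps)
    have zero: "A S (\<lambda>_. 0)"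
    proof -
      have z: "(\<lambda>_. 0) \<in> carrier (comp_module (vec_operad :: ('k, _) gr_operad) S 0)" by (simp add: vec_carrier)
      show ?thesis
        using linear_maps_zero[OF operad_homD(1)[OF f S] _ N.comp_module_module[OF S], of "int (card S) - 1"]
          linear_maps_zero[OF operad_homD(1)[OF g S] _ N.comp_module_module[OF S], of "int (card S) - 1"]
          V.comp_module_module[OF S, of 0] z
        by (simp add: A_def top)
    qed
    have "A S (eval_with tree_vec p)"
      using p(1)
    proof (induction p rule: free_module_induct)
      case zero
      then show ?case using \<open>A S (\<lambda>_. 0)\<close> by (simp add: eval_with_0[abs_def])
    next
      case (add p q)
      then show ?case using A_add[OF S] by (simp add: eval_with_add[abs_def])
    next
      case (basis t k)
      then have "A S (tree_vec t)" using A_tree[of t] by (auto simp: ltrees_def)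
      moreover have "eval_with tree_vec (scale k (basis t)) = (\<lambda>a. k * tree_vec t a)"
        by (rule ext) (simp add: eval_with_scale)
      ultimately show ?case using A_scale[OF S] by simp
    qed
    then show ?thesis using True p(2) by (simp add: A_def)
  next
    case False
    then have "v = \<zero>\<^bsub>comp_module (desuspension vec_operad) S d\<^esub>"
      using v by (auto simp: desuspension_simps vec_carrier fun_eq_iff)
    moreover have "module base_ring (comp_module (desuspension (vec_operad :: ('k, _) gr_operad)) S d)"
      using V.comp_module_module[OF S] by (simp add: desuspension_simps)
    ultimately show ?thesis
      using linear_maps_zero[OF operad_homD(1)[OF f S] _ N.comp_module_module[OF S], of d]
        linear_maps_zero[OF operad_homD(1)[OF g S] _ N.comp_module_module[OF S], of d] by simp
  qed
qed

theorem theorem5p4: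
  shows "\<exists>F. operad_iso
               (desuspension MetabLie :: ('k::{comm_ring,comm_monoid_mult}, _) gr_operad) hNS F \<and>
             F {1,2} 1 metab_bracket = hNS_generator \<and>
             (\<forall>G. operad_iso (desuspension MetabLie) hNS G \<and>
                  G {1,2} 1 metab_bracket = hNS_generator \<longrightarrow>
                  (\<forall>S d. label_set S \<longrightarrow>
                     (\<forall>x\<in>carrier (comp_module
                           (desuspension MetabLie :: ('k, _) gr_operad) S d). G S d x = F S d x)))"
proof -
  let ?M = "desuspension MetabLie :: ('k, _) gr_operad" and ?V = "desuspension vec_operad :: ('k, _) gr_operad"
  obtain h0 where h0: "operad_iso (MetabLie :: ('k, _) gr_operad) vec_operad h0"
    "\<And>S t. t \<in> ltrees S \<Longrightarrow> h0 S 0 (quot_class Lie metab_relations S 0 (lie_monomial t)) = tree_vec t"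
    by (rule MetabLie_iso_vec_operad[where ?'k = 'k]) (rule that)
  \<comment> \<open>The shift moves degree 0 of \<open>MetabLie\<close> to degree
    \<open>card S - 1\<close>; for two letters this is the degree 1 of the generator.\<close>
  define H where "H S d = h0 S (desusp_degree S d)" for S d
  have H: "operad_iso ?M ?V H" using operad_iso_desuspension[OF h0(1)] by (simp add: H_def[abs_def])
  obtain W where W: "operad_iso (hNS :: ('k, _) gr_operad) ?V W"
    "\<And>S d z. label_set S \<Longrightarrow> z \<in> carrier (cocycles (NS S) d) \<Longrightarrow> W S d (coh_class (NS S) d z) = word_hom S d z"
    by (rule hNS_iso_vec_operad[where ?'k = 'k]) (rule that)
  let ?b = "tree_vec (Br (Leaf 1) (Leaf 2)) :: nat \<Rightarrow> 'k"
  have S: "label_set {1,2 :: nat}" by (simp add: label_set_def)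
  have Hb: "H {1,2} 1 metab_bracket = ?b"
    using h0(2)[of "Br (Leaf 1) (Leaf 2)" "{1,2}"] by (simp add: H_def metab_bracket_def ltrees_def)
  have bM: "metab_bracket \<in> carrier (comp_module ?M {1,2} 1)"
  proof -
    have "(basis (Br (Leaf 1) (Leaf 2)) :: _ \<Rightarrow>\<^sub>0 'k) \<in> carrier (comp_module Mag {1,2} 0)"
      by (rule tree_basis_carrier) (auto simp: ltrees_def)
    then show ?thesis
      by (auto simp: desuspension_simps metab_bracket_def lie_monomial_def MetabLie_def Lie_def operad_quot_def
          quot_module_def quot_class_def A_RCOSETS_def')
  qed
  have Wg: "W {1,2} 1 hNS_generator = ?b"
    unfolding hNS_generator_def using W(2)[OF S hNS_generator_cocycle] word_hom_hNS_generator by simp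
  have gN: "hNS_generator \<in> carrier (comp_module (hNS :: ('k, _) gr_operad) {1,2} 1)"
    using hNS_generator_cocycle[where ?'k = 'k]
    by (auto simp: hNS_def hNS_generator_def cohomology_def coh_class_def quot_module_def A_RCOSETS_def')
  define Hi where "Hi S d = the_inv_into (carrier (comp_module ?M S d)) (H S d)" for S d
  define Wi where "Wi S d = the_inv_into (carrier (comp_module (hNS :: ('k, _) gr_operad) S d)) (W S d)" for S d
  have inv: "operad_iso ?V ?M Hi" "operad_iso ?V hNS Wi"
    using operad_iso_sym[OF H] operad_iso_sym[OF W(1)] by (simp_all add: Hi_def[abs_def] Wi_def[abs_def])
  have HiH: "Hi S d (H S d x) = x" if "label_set S" "x \<in> carrier (comp_module ?M S d)" for S d x
  proof -
    have "inj_on (H S d) (carrier (comp_module ?M S d))"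
      using H that(1) by (simp add: operad_iso_iff bij_betw_def)
    then show ?thesis using that(2) by (simp add: Hi_def the_inv_into_f_f)
  qed
  have Wib: "Wi {1,2} 1 ?b = hNS_generator"
  proof -
    have "inj_on (W {1,2} 1) (carrier (comp_module (hNS :: ('k, _) gr_operad) {1,2} 1))"
      using W(1) S by (simp add: operad_iso_iff bij_betw_def)
    then show ?thesis unfolding Wg[symmetric] Wi_def using gN by (rule the_inv_into_f_f)
  qed
  define F where "F S d x = Wi S d (H S d x)" for S d x
  have F: "operad_iso ?M hNS F" using operad_iso_trans[OF H inv(2)] by (simp add: F_def[abs_def])
  have Fb: "F {1,2} 1 metab_bracket = hNS_generator" by (simp only: F_def Hb Wib)
  have uniq: "G S d x = F S d x" if G: "operad_iso ?M hNS G" "G {1,2} 1 metab_bracket = hNS_generator"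
    and x: "label_set S" "x \<in> carrier (comp_module ?M S d)" for G S d x
  proof -
    \<comment> \<open>\<open>F\<close> and \<open>G\<close> are compared after composition with the
      inverse of \<open>H\<close>: then both start from the explicit operad, where uniqueness is
      known.\<close>
    have "G S d (Hi S d (H S d x)) = F S d (Hi S d (H S d x))"
    proof (rule vec_desuspension_hom_unique[where N = hNS])
      show "operad_hom ?V hNS (\<lambda>S d v. G S d (Hi S d v))" "operad_hom ?V hNS (\<lambda>S d v. F S d (Hi S d v))"
        using operad_iso_trans[OF inv(1) G(1)] operad_iso_trans[OF inv(1) F] by (simp_all add: operad_iso_iff)
      show "pre_operad (hNS :: ('k, _) gr_operad)"
        using F by (auto simp: operad_iso_def intro: graded_operad_pre_operad)
      show "G {1,2} 1 (Hi {1,2} 1 ?b) = F {1,2} 1 (Hi {1,2} 1 ?b)"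
        unfolding Hb[symmetric] HiH[OF S bM] G(2) Fb ..
      show "H S d x \<in> carrier (comp_module ?V S d)"
        using H x unfolding operad_iso_def by (auto dest: linear_mapsD(1))
    qed fact
    then show ?thesis using HiH[OF x] by simp
  qed
  show ?thesis
  proof (intro exI[of _ F] conjI allI impI ballI F Fb)
    fix G S d x
    assume "operad_iso ?M hNS G \<and> G {1,2} 1 metab_bracket = hNS_generator" "label_set S"
      "x \<in> carrier (comp_module ?M S d)"
    then show "G S d x = F S d x" by (intro uniq) simp_all
  qed
qed

end
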